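(* Let $\mathcal T\subset\mathbb R$ be a closed finite interval, $k,r,R\in\mathbb N$, and $r_1,\dots,r_R\in\mathbb N$ with $\sum_{\ell=1}^R r_\ell=r$. Let $\mathbf H=[\mathbf H_1^\top,\dots,\mathbf H_R^\top]^\top\in\mathbb R^{r\times k}$ be a fixed block matrix with blocks $\mathbf H_\ell\in\mathbb R^{r_\ell\times k}$. Consider $k$ independent samples of real-valued stochastic processes on $\mathcal T$, where for each $i\in\{1,\dots,k\}$ the $i$th sample is $x_{i1},\dots,x_{in_i}$, $n=\sum_{i=1}^k n_i$, and put $v_{ij}:=x_{ij}-\eta_i$. Assume that for every $i\in\{1,\dots,k\}$: (i) $x_{i1},\dots,x_{in_i}$ are i.i.d. with mean function $\eta_i$ and covariance function $\gamma_i$ and take values in $\mathcal L_2(\mathcal T)$; (ii) $\eta_i\in\mathcal L_2(\mathcal T)$; (iii) the function $\mathcal T\ni t\mapsto\gamma_i(t,t)\in\mathbb R$ is continuous and positive; (iv) there exists $\tau_i>0$ such that $n_i/n\to\tau_i$ as $n\to\infty$; (v) $\mathrm E\big[\big(\int_{\mathcal T}v_{i1}^2(t)\,\mathrm dt\big)^2\big]<\infty$; (vi) for each $j\in\{1,2\}$, $\mathrm E_{\mathrm{out}}\Big[\sup_{t,s\in\mathcal T,\,|t-s|<\delta}|v_{i1}(t)v_{ij}(t)-v_{i1}(s)v_{ij}(s)|\Big]\to0$ as $\delta\to0$. Let $\mathbf z=(\mathbf z_\ell)_{\ell\in\{1,\dots,R\}}\sim GP_r(\mathbf 0_r,\mathbf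 H\boldsymbol\Sigma\mathbf H^\top)$, with $\mathbf z_\ell$ being $\mathbb R^{r_\ell}$-valued. Then the parametric bootstrap statistics satisfy, as $n\to\infty$, $$\big(T_n^{\mathcal P}(\mathbf H_\ell)\big)_{\ell\in\{1,\dots,R\}}\xrightarrow{d^*}\left(\int_{\mathcal T}\mathbf z_\ell^\top(t)\big(\mathbf H_\ell\boldsymbol\Sigma(t,t)\mathbf H_\ell^\top\big)^+\mathbf z_\ell(t)\,\mathrm dt\right)_{\ell\in\{1,\dots,R\}}.$$
   Context: $\mathcal L_2(\mathcal T)$ is the Hilbert space of square-integrable real functions on $\mathcal T$. $\mathrm E_{\mathrm{out}}$ is outer expectation. $\mathbf A^+$ is the Moore–Penrose inverse of $\mathbf A$. $GP(0,\gamma)$ denotes a real centered Gaussian process on $\mathcal T$ with covariance function $\gamma$; $GP_r(\mathbf 0_r,\boldsymbol\Gamma)$ denotes an $r$-dimensional centered Gaussian process on $\mathcal T$, viewed as a random element of $\mathcal L_2^r(\mathcal T)$, with covariance function $\boldsymbol\Gamma:\mathcal T^2\to\mathbb R^{r\times r}$. Define $$\boldsymbol\Sigma(t,s):=\mathrm{diag}\Big(\tfrac1{\tau_1}\gamma_1(t,s),\dots,\tfrac1{\tau_k}\gamma_k(t,s)\Big),$$ $\widehat\eta_i(t):=\frac1{n_i}\sum_{j=1}^{n_i}x_{ij}(t)$ and $\widehat\gamma_i(t,s):=\frac1{n_i-1}\sum_{j=1}^{n_i}(x_{ij}(t)-\widehat\eta_i(t))(x_{ij}(s)-\widehat\eta_i(s))$.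 Parametric bootstrap: conditionally on the data, for each $i$ let $x_{i1}^{\mathcal P},\dots,x_{in_i}^{\mathcal P}\sim GP(0,\widehat\gamma_i)$, all independent (within and across groups). Let $\widehat\eta_i^{\mathcal P}(t):=\frac1{n_i}\sum_{j}x_{ij}^{\mathcal P}(t)$, $\widehat{\boldsymbol\eta}^{\mathcal P}:=(\widehat\eta_1^{\mathcal P},\dots,\widehat\eta_k^{\mathcal P})^\top$, $\widehat\gamma_i^{\mathcal P}(t,s):=\frac1{n_i-1}\sum_j(x_{ij}^{\mathcal P}(t)-\widehat\eta_i^{\mathcal P}(t))(x_{ij}^{\mathcal P}(s)-\widehat\eta_i^{\mathcal P}(s))$, $\widehat{\boldsymbol\Sigma}^{\mathcal P}(t,s):=\mathrm{diag}(\frac n{n_1}\widehat\gamma_1^{\mathcal P}(t,s),\dots,\frac n{n_k}\widehat\gamma_k^{\mathcal P}(t,s))$, and for each $\ell$ (using the same bootstrap sample for all $\ell$) $$T_n^{\mathcal P}(\mathbf H_\ell):=\int_{\mathcal T}n\,(\mathbf H_\ell\widehat{\boldsymbol\eta}^{\mathcal P}(t))^\top\big(\mathbf H_\ell\widehat{\boldsymbol\Sigma}^{\mathcal P}(t,t)\mathbf H_\ell^\top\big)^+\mathbf H_\ell\widehat{\boldsymbol\eta}^{\mathcal P}(t)\,\mathrm dt .$$ $\xrightarrow{d^*}$ denotes conditional convergence in distribution given the data $(x_{i1},x_{i2},\dots)_{i\in\{1,\dots,k\}}$, in probability: every subsequence has a further subsequence along which, for almost every realization of the data, the conditional law given the data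 converges weakly to the law of the limit (equivalently, the bounded Lipschitz distance between the conditional law and the limit law tends to $0$ in outer probability). *)

theory Defs
  imports "HOL-Probability.Probability" "Jordan_Normal_Form.Matrix"
begin

unbundle no vec_syntax
unbundle no inner_syntax

definition is_moore_penrose :: "real mat \<Rightarrow> real mat \<Rightarrow> bool" where
  "is_moore_penrose A X \<longleftrightarrow>
     X \<in> carrier_mat (dim_col A) (dim_row A) \<and>
     A * X * A = A \<and> X * A * X = X \<and>
     (A * X)\<^sup>T = A * X \<and> (X * A)\<^sup>T = X * A"

definition moore_penrose :: "real mat \<Rightarrow> real mat" where
  "moore_penrose A = (THE X. is_moore_penrose A X)"

lemma is_moore_penrose_unique:
  assumes "is_moore_penrose A X" "is_moore_penrose A Y"
  shows "X = Y"
proof -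
  define m n where "m = dim_row A" and "n = dim_col A"
  have A: "A \<in> carrier_mat m n" by (simp add: m_def n_def)
  have X: "X \<in> carrier_mat n m" and Y: "Y \<in> carrier_mat n m"
    using assms by (simp_all add: is_moore_penrose_def m_def n_def)
  note px = assms(1)[unfolded is_moore_penrose_def] and py = assms(2)[unfolded is_moore_penrose_def]
  note [simp] = assoc_mult_mat[of _ m n _ m _ m] assoc_mult_mat[of _ m n _ m _ n]
    assoc_mult_mat[of _ m n _ n _ m] assoc_mult_mat[of _ m n _ n _ n]
    assoc_mult_mat[of _ n m _ m _ m] assoc_mult_mat[of _ n m _ m _ n]
    assoc_mult_mat[of _ n m _ n _ m] assoc_mult_mat[of _ n m _ n _ n]
    assoc_mult_mat[of _ m m _ m _ m] assoc_mult_mat[of _ m m _ m _ n]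
    assoc_mult_mat[of _ m m _ n _ m] assoc_mult_mat[of _ m m _ n _ n]
    assoc_mult_mat[of _ n n _ m _ m] assoc_mult_mat[of _ n n _ m _ n]
    assoc_mult_mat[of _ n n _ n _ m] assoc_mult_mat[of _ n n _ n _ n]
  have AX: "A * X \<in> carrier_mat m m" and AY: "A * Y \<in> carrier_mat m m"
    and XA: "X * A \<in> carrier_mat n n" and YA: "Y * A \<in> carrier_mat n n"
    using A X Y by auto
  have "A * X = (A * Y * A) * X" using py by simp
  also have "\<dots> = (A * Y) * (A * X)" using A X Y by simp
  also have "\<dots> = (A * Y)\<^sup>T * (A * X)\<^sup>T" using px py by simp
  also have "\<dots> = ((A * X) * (A * Y))\<^sup>T" using transpose_mult[OF AX AY] by simp
  also have "(A * X) * (A * Y) = (A * X * A) * Y" using A X Y by simp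
  also have "\<dots> = A * Y" using px by simp
  finally have 1: "A * X = A * Y" using py by simp
  have "X * A = X * (A * Y * A)" using py by simp
  also have "\<dots> = (X * A) * (Y * A)" using A X Y by simp
  also have "\<dots> = (X * A)\<^sup>T * (Y * A)\<^sup>T" using px py by simp
  also have "\<dots> = ((Y * A) * (X * A))\<^sup>T" using transpose_mult[OF YA XA] by simp
  also have "(Y * A) * (X * A) = Y * (A * X * A)" using A X Y by simp
  also have "\<dots> = Y * A" using px by simp
  finally have 2: "X * A = Y * A" using py by simp
  have "X = X * A * X" using px by simp
  also have "\<dots> = Y * A * X" by (simp add: 2)
  also have "\<dots> = Y * (A * X)" using A X Y by simp
  also have "\<dots> = Y * (A * Y)" by (simp add: 1)
  also have "\<dots> = Y * A * Y" using A X Y by simp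
  also have "\<dots> = Y" using py by simp
  finally show ?thesis .
qed

lemma moore_penrose_eqI: "is_moore_penrose A X \<Longrightarrow> moore_penrose A = X"
  unfolding moore_penrose_def by (blast intro: the_equality is_moore_penrose_unique)

definition stack_rows :: "nat \<Rightarrow> nat \<Rightarrow> (nat \<Rightarrow> real mat) \<Rightarrow> real mat" where
  "stack_rows R k Hs = foldr (\<lambda>l A. Hs l @\<^sub>r A) [0..<R] (0\<^sub>m 0 k)"

text \<open>The \<open>l\<close>-th subvector of \<open>u\<close>, when \<open>u\<close> is partitioned into blocks of lengths
  \<open>rr 0, rr 1, \<dots>\<close> (the same partition that \<open>stack_rows\<close> induces on rows).\<close>

definition vec_block :: "(nat \<Rightarrow> nat) \<Rightarrow> nat \<Rightarrow> real vec \<Rightarrow> real vec" where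
  "vec_block rr l u = vec (rr l) (\<lambda>p. u $ ((\<Sum>m<l. rr m) + p))"

abbreviation lborel_on :: "real set \<Rightarrow> real measure" where
  "lborel_on T \<equiv> restrict_space lborel T"

definition L2_on :: "real set \<Rightarrow> (real \<Rightarrow> real) \<Rightarrow> bool" where
  "L2_on T f \<longleftrightarrow> f \<in> borel_measurable (lborel_on T) \<and> integrable (lborel_on T) (\<lambda>t. (f t)\<^sup>2)"

text \<open>A real process with square-integrable paths. Joint measurability makes the process at once a
  family of random variables indexed by \<open>T\<close> and a random element of the space of
  square-integrable functions.\<close>

definition L2_process :: "'w measure \<Rightarrow> real set \<Rightarrow> ('w \<Rightarrow> real \<Rightarrow> real) \<Rightarrow> bool" where
  "L2_process P T X \<longleftrightarrow>
     (\<lambda>(w, t). X w t) \<in> borel_measurable (P \<Otimes>\<^sub>M lborel_on T) \<and>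
     (\<forall>w\<in>space P. L2_on T (X w))"

definition has_mean_and_covariance ::
    "'w measure \<Rightarrow> real set \<Rightarrow> ('w \<Rightarrow> real \<Rightarrow> real) \<Rightarrow> (real \<Rightarrow> real) \<Rightarrow> (real \<Rightarrow> real \<Rightarrow> real) \<Rightarrow> bool" where
  "has_mean_and_covariance P T X \<eta> \<gamma> \<longleftrightarrow>
     (\<forall>t\<in>T. integrable P (\<lambda>w. X w t) \<and> (\<integral>w. X w t \<partial>P) = \<eta> t) \<and>
     (\<forall>t\<in>T. \<forall>s\<in>T. integrable P (\<lambda>w. (X w t - \<eta> t) * (X w s - \<eta> s)) \<and>
        (\<integral>w. (X w t - \<eta> t) * (X w s - \<eta> s) \<partial>P) = \<gamma> t s)"

definition process_law :: "'w measure \<Rightarrow> real set \<Rightarrow> ('w \<Rightarrow> real \<Rightarrow> real) \<Rightarrow> (real \<Rightarrow> real) measure" where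
  "process_law P T X = distr P (PiM T (\<lambda>_. borel)) (\<lambda>w. restrict (X w) T)"

definition indep_processes :: "'w measure \<Rightarrow> real set \<Rightarrow> 'i set \<Rightarrow> ('i \<Rightarrow> 'w \<Rightarrow> real \<Rightarrow> real) \<Rightarrow> bool" where
  "indep_processes P T I X \<longleftrightarrow>
     prob_space.indep_vars P (\<lambda>_. PiM T (\<lambda>_. borel)) (\<lambda>i w. restrict (X i w) T) I"

definition outer_expectation :: "'w measure \<Rightarrow> ('w \<Rightarrow> ennreal) \<Rightarrow> ennreal" where
  "outer_expectation P f =
     (INF U\<in>{U \<in> borel_measurable P. \<forall>w\<in>space P. f w \<le> U w}. \<integral>\<^sup>+ w. U w \<partial>P)"

definition modulus_of_continuity :: "real set \<Rightarrow> (real \<Rightarrow> real) \<Rightarrow> real \<Rightarrow> ennreal" where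
  "modulus_of_continuity T f \<delta> =
     (SUP (t, s)\<in>{(t, s). t \<in> T \<and> s \<in> T \<and> \<bar>t - s\<bar> < \<delta>}. ennreal \<bar>f t - f s\<bar>)"

text \<open>Point masses count as normal laws, since covariance functions may be singular.\<close>

definition normal_law :: "real measure \<Rightarrow> bool" where
  "normal_law \<mu> \<longleftrightarrow> (\<exists>m. \<mu> = return borel m) \<or>
     (\<exists>m \<sigma>. \<sigma> > 0 \<and> \<mu> = density lborel (\<lambda>y. ennreal (normal_density m \<sigma> y)))"

definition centered_gaussian_family ::
    "'w measure \<Rightarrow> 's set \<Rightarrow> ('s \<Rightarrow> 'w \<Rightarrow> real) \<Rightarrow> ('s \<Rightarrow> 's \<Rightarrow> real) \<Rightarrow> bool" where
  "centered_gaussian_family P S X C \<longleftrightarrow>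
     prob_space P \<and>
     (\<forall>s\<in>S. X s \<in> borel_measurable P) \<and>
     (\<forall>F c. finite F \<and> F \<subseteq> S \<longrightarrow> normal_law (distr P borel (\<lambda>w. \<Sum>s\<in>F. c s * X s w))) \<and>
     (\<forall>s\<in>S. (\<integral>w. X s w \<partial>P) = 0) \<and>
     (\<forall>s\<in>S. \<forall>s'\<in>S. (\<integral>w. X s w * X s' w \<partial>P) = C s s')"

definition gaussian_process ::
    "'w measure \<Rightarrow> real set \<Rightarrow> (real \<Rightarrow> real \<Rightarrow> real) \<Rightarrow> ('w \<Rightarrow> real \<Rightarrow> real) \<Rightarrow> bool" where
  "gaussian_process P T \<gamma> X \<longleftrightarrow>
     L2_process P T X \<and> centered_gaussian_family P T (\<lambda>t w. X w t) \<gamma>"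

definition vec_gaussian_process ::
    "'w measure \<Rightarrow> real set \<Rightarrow> nat \<Rightarrow> (real \<Rightarrow> real \<Rightarrow> real mat) \<Rightarrow> ('w \<Rightarrow> real \<Rightarrow> real vec) \<Rightarrow> bool" where
  "vec_gaussian_process P T r \<Gamma> Z \<longleftrightarrow>
     (\<forall>w\<in>space P. \<forall>t\<in>T. Z w t \<in> carrier_vec r) \<and>
     (\<forall>p<r. L2_process P T (\<lambda>w t. Z w t $ p)) \<and>
     centered_gaussian_family P ({..<r} \<times> T) (\<lambda>(p, t) w. Z w t $ p)
       (\<lambda>(p, t) (q, s). \<Gamma> t s $$ (p, q))"

text \<open>Groups, observations within a group and blocks are numbered from \<open>0\<close>;
  \<open>N i\<close> is the size of the sample in group \<open>i\<close>.\<close>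

definition sample_mean :: "nat \<Rightarrow> (nat \<Rightarrow> real \<Rightarrow> real) \<Rightarrow> real \<Rightarrow> real" where
  "sample_mean m x t = 1 / real m * (\<Sum>j<m. x j t)"

definition sample_cov :: "nat \<Rightarrow> (nat \<Rightarrow> real \<Rightarrow> real) \<Rightarrow> real \<Rightarrow> real \<Rightarrow> real" where
  "sample_cov m x t s =
     1 / (real m - 1) * (\<Sum>j<m. (x j t - sample_mean m x t) * (x j s - sample_mean m x s))"

definition total_size :: "nat \<Rightarrow> (nat \<Rightarrow> nat) \<Rightarrow> nat" where
  "total_size k N = (\<Sum>i<k. N i)"

definition sample_mean_vec ::
    "nat \<Rightarrow> (nat \<Rightarrow> nat) \<Rightarrow> (nat \<Rightarrow> nat \<Rightarrow> real \<Rightarrow> real) \<Rightarrow> real \<Rightarrow> real vec" where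
  "sample_mean_vec k N x t = vec k (\<lambda>i. sample_mean (N i) (x i) t)"

definition sample_cov_mat ::
    "nat \<Rightarrow> (nat \<Rightarrow> nat) \<Rightarrow> (nat \<Rightarrow> nat \<Rightarrow> real \<Rightarrow> real) \<Rightarrow> real \<Rightarrow> real \<Rightarrow> real mat" where
  "sample_cov_mat k N x t s =
     mat_diag k (\<lambda>i. real (total_size k N) / real (N i) * sample_cov (N i) (x i) t s)"

definition test_statistic ::
    "real set \<Rightarrow> nat \<Rightarrow> (nat \<Rightarrow> nat) \<Rightarrow> (nat \<Rightarrow> nat \<Rightarrow> real \<Rightarrow> real) \<Rightarrow> real mat \<Rightarrow> real" where
  "test_statistic T k N x A =
     (\<integral>t. real (total_size k N) *
        ((A *\<^sub>v sample_mean_vec k N x t) \<bullet>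
         (moore_penrose (A * sample_cov_mat k N x t t * A\<^sup>T) *\<^sub>v (A *\<^sub>v sample_mean_vec k N x t)))
      \<partial>lborel_on T)"

definition limit_cov_mat ::
    "nat \<Rightarrow> (nat \<Rightarrow> real) \<Rightarrow> (nat \<Rightarrow> real \<Rightarrow> real \<Rightarrow> real) \<Rightarrow> real \<Rightarrow> real \<Rightarrow> real mat" where
  "limit_cov_mat k \<tau> \<gamma> t s = mat_diag k (\<lambda>i. 1 / \<tau> i * \<gamma> i t s)"

definition gaussian_quadratic_functional ::
    "real set \<Rightarrow> (real \<Rightarrow> real \<Rightarrow> real mat) \<Rightarrow> real mat \<Rightarrow> (real \<Rightarrow> real vec) \<Rightarrow> real" where
  "gaussian_quadratic_functional T S A u =
     (\<integral>t. u t \<bullet> (moore_penrose (A * S t t * A\<^sup>T) *\<^sub>v u t) \<partial>lborel_on T)"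

text \<open>Here \<open>y i j\<close> is the observed realization of the \<open>j\<close>-th path in group \<open>i\<close>, so that
  \<open>Q\<close> carries the bootstrap randomness only: the law under \<open>Q\<close> of a function of \<open>xP\<close> is its
  conditional law given the data \<open>y\<close>.\<close>

definition parametric_bootstrap ::
    "'b measure \<Rightarrow> real set \<Rightarrow> nat \<Rightarrow> (nat \<Rightarrow> nat) \<Rightarrow> (nat \<Rightarrow> nat \<Rightarrow> real \<Rightarrow> real) \<Rightarrow>
     (nat \<Rightarrow> nat \<Rightarrow> 'b \<Rightarrow> real \<Rightarrow> real) \<Rightarrow> bool" where
  "parametric_bootstrap Q T k N y xP \<longleftrightarrow>
     prob_space Q \<and>
     (\<forall>i<k. \<forall>j<N i. gaussian_process Q T (sample_cov (N i) (y i)) (xP i j)) \<and>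
     indep_processes Q T (SIGMA i:{..<k}. {..<N i}) (\<lambda>(i, j). xP i j)"

definition weakly_converges :: "'a topology \<Rightarrow> (nat \<Rightarrow> 'a measure) \<Rightarrow> 'a measure \<Rightarrow> bool" where
  "weakly_converges X \<mu>s \<mu> \<longleftrightarrow>
     (\<forall>f. continuous_map X euclideanreal f \<and> bounded (f ` topspace X) \<longrightarrow>
        (\<lambda>m. \<integral>y. f y \<partial>\<mu>s m) \<longlonglongrightarrow> (\<integral>y. f y \<partial>\<mu>))"

text \<open>\<open>K \<nu> w\<close> is the conditional law, at stage \<open>\<nu>\<close>, given the data in the realization \<open>w\<close>.\<close>

definition conditionally_converges ::
    "'w measure \<Rightarrow> 'a topology \<Rightarrow> (nat \<Rightarrow> 'w \<Rightarrow> 'a measure) \<Rightarrow> 'a measure \<Rightarrow> bool" where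
  "conditionally_converges M X K \<mu> \<longleftrightarrow>
     (\<forall>\<phi>::nat \<Rightarrow> nat. strict_mono \<phi> \<longrightarrow> (\<exists>\<psi>::nat \<Rightarrow> nat. strict_mono \<psi> \<and>
        (AE w in M. weakly_converges X (\<lambda>m. K (\<phi> (\<psi> m)) w) \<mu>)))"

text \<open>\<open>\<real>\<^sup>R\<close> is rendered as the functions on \<open>{..<R}\<close>, extensional outside.\<close>

abbreviation tuple_topology :: "nat \<Rightarrow> (nat \<Rightarrow> real) topology" where
  "tuple_topology R \<equiv> product_topology (\<lambda>_. euclideanreal) {..<R}"

definition tuple_law :: "'w measure \<Rightarrow> nat \<Rightarrow> (nat \<Rightarrow> 'w \<Rightarrow> real) \<Rightarrow> (nat \<Rightarrow> real) measure" where
  "tuple_law P R Y = distr P (PiM {..<R} (\<lambda>_. borel)) (\<lambda>w. \<lambda>l\<in>{..<R}. Y l w)"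

end

theory Submission
  imports Defs "Jordan_Normal_Form.Determinant"
begin

text \<open>Along a subsequence, the sample covariance functions converge, for almost every realization of
  the data, at almost every pair of points of \<open>T\<close>; this needs only a weak law in mean, Fubini's
  theorem and the passage from convergence in \<open>L\<^sup>1\<close> to convergence almost everywhere. For such a
  realization the bootstrap paths are Gaussian with convergent covariances, so the scaled group
  means at finitely many points converge in law, while the bootstrap variances converge in mean to
  constants. Since all variances are positive in the limit, the Moore--Penrose inverse
  \<open>(A D A\<^sup>T)\<^sup>+\<close> is continuous in the diagonal matrix \<open>D\<close> there, and the finite-dimensional laws of
  the integrands converge.

  No uniform control of the paths is needed to integrate over \<open>T\<close>. The integral of a process over \<open>T\<close>
  is close in mean to its average over \<open>m\<close> independent uniform sampling times, with an error governed
  by its second moment alone, and the latter is bounded uniformly: the quadratic form is at most the sum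
  over the groups of the squared Student statistics, whose moments do not depend on the covariance.
  Hence the characteristic functions of the tuples of integrals converge, which together with
  tightness yields weak convergence.\<close>

subsection \<open>Pseudoinverses of congruent diagonal matrices\<close>

text \<open>Random sampling times suit covariances that converge only almost everywhere: distinct
  coordinates of independent uniform times avoid a null set of pairs almost surely. The diagonal is
  itself a null set of pairs, so convergence of the variances is carried along as a statement of its
  own. The data variances converge pointwise with no bound uniform in time, so the integrands are
  bounded without reference to them: the Student statistic is invariant under scaling, and where a
  variance vanishes all observations vanish, so that the quotient is \<open>0 / 0 = 0\<close>. The
  second moment of its square reduces to an eighth normal moment and a negative fourth moment of an
  average of squares. The geometric mean turns the latter into a product of independent factors;
  from 32 observations on, each factor is dominated by an integrable inverse square root. The
  pseudoinverse jumps where a variance vanishes, while weak convergence asks for continuous test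
  functions. The variances are therefore cut off below, at a level that the limits exceed by a
  factor 2; the cut acts only where a variance is far from its limit.\<close>

lemma span_projector_exists:
  fixes a :: "nat \<Rightarrow> nat \<Rightarrow> real"
  shows "\<exists>P. (\<forall>p q. P p q = P q p) \<and> (\<forall>i<k. \<forall>p<r. (\<Sum>q<r. P p q * a i q) = a i p) \<and>
    (\<forall>v. (\<forall>i<k. (\<Sum>q<r. a i q * v q) = 0) \<longrightarrow> (\<forall>p<r. (\<Sum>q<r. P p q * v q) = 0))"
proof (induction k)
  case 0
  show ?case by (rule exI[of _ "\<lambda>p q. 0"]) simp
next
  case (Suc k)
  then obtain P where sym: "\<And>p q. P p q = P q p"
    and fix_a: "\<And>i p. i < k \<Longrightarrow> p < r \<Longrightarrow> (\<Sum>q<r. P p q * a i q) = a i p"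
    and ker: "\<And>v p. (\<forall>i<k. (\<Sum>q<r. a i q * v q) = 0) \<Longrightarrow> p < r \<Longrightarrow> (\<Sum>q<r. P p q * v q) = 0"
    by blast
  \<comment> \<open>Gram-Schmidt: \<open>c\<close> is the residual of the new vector under the
    projector built so far. If it vanishes the projector stays; otherwise the projector onto the
    line of \<open>c\<close> is added.\<close>
  define c where "c p = a k p - (\<Sum>q<r. P p q * a k q)" for p
  have swap: "(\<Sum>p<r. u p * (\<Sum>q<r. P p q * w q)) = (\<Sum>q<r. w q * (\<Sum>p<r. P q p * u p))" for u w
  proof -
    have "(\<Sum>p<r. u p * (\<Sum>q<r. P p q * w q)) = (\<Sum>p<r. \<Sum>q<r. u p * (P p q * w q))"
      by (simp add: sum_distrib_left)
    also have "\<dots> = (\<Sum>q<r. \<Sum>p<r. u p * (P p q * w q))" by (rule sum.swap)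
    also have "\<dots> = (\<Sum>q<r. w q * (\<Sum>p<r. P q p * u p))"
      unfolding sum_distrib_left
    proof (intro sum.cong refl)
      show "u p * (P p q * w q) = w q * (P q p * u p)" for p q
        using sym[of p q] by simp
    qed
    finally show ?thesis .
  qed
  have orth: "(\<Sum>q<r. a i q * c q) = 0" if "i < k" for i
    using that unfolding c_def right_diff_distrib sum_subtractf swap[of "a i" "a k"]
    by (simp add: fix_a mult.commute)
  have Pc: "(\<Sum>q<r. P p q * c q) = 0" if "p < r" for p
    using orth that by (intro ker) auto
  define s where "s = (\<Sum>q<r. c q * c q)"
  \<comment> \<open>Since the symmetric \<open>P\<close> annihilates \<open>c\<close>, the squared
    norm of the residual equals its product with the new vector; this is why the updated projector
    fixes that vector.\<close>
  have s: "s = (\<Sum>q<r. c q * a k q)"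
  proof -
    have "s = (\<Sum>q<r. c q * a k q) - (\<Sum>p<r. c p * (\<Sum>q<r. P p q * a k q))"
      by (subst s_def, subst (2) c_def) (simp add: right_diff_distrib sum_subtractf)
    also have "(\<Sum>p<r. c p * (\<Sum>q<r. P p q * a k q)) = 0"
      by (subst swap) (simp add: Pc)
    finally show ?thesis by simp
  qed
  show ?case
  proof (cases "s = 0")
    case True
    then have c0: "c p = 0" if "p < r" for p
      using that unfolding s_def by (subst (asm) sum_nonneg_eq_0_iff) auto
    have "(\<Sum>q<r. P p q * a i q) = a i p" if "i < Suc k" "p < r" for i p
      using fix_a[of i p] c0[of p] that by (cases "i = k") (auto simp: c_def)
    moreover have "(\<Sum>q<r. P p q * v q) = 0" if "\<forall>i<Suc k. (\<Sum>q<r. a i q * v q) = 0" "p < r" for v p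
      using ker[of v p] that by auto
    ultimately show ?thesis using sym by (intro exI[of _ P]) blast
  next
    case False
    define P' where "P' p q = P p q + c p * c q / s" for p q
    have P': "(\<Sum>q<r. P' p q * v q) = (\<Sum>q<r. P p q * v q) + c p * (\<Sum>q<r. c q * v q) / s" for p v
      by (simp add: P'_def distrib_right sum.distrib sum_distrib_left sum_divide_distrib mult.assoc)
    have "(\<Sum>q<r. P' p q * a i q) = a i p" if "i < Suc k" "p < r" for i p
    proof (cases "i = k")
      case True
      then show ?thesis using False s by (simp add: P' c_def)
    next
      case False
      then have "i < k" using that by simp
      then show ?thesis using orth[of i] fix_a that by (simp add: P' mult.commute)
    qed
    moreover have "(\<Sum>q<r. P' p q * v q) = 0" if v: "\<forall>i<Suc k. (\<Sum>q<r. a i q * v q) = 0" and p: "p < r" for v p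
    proof -
      have Pv: "(\<Sum>q<r. P p q * v q) = 0" if "p < r" for p
        using ker[of v p] that v by auto
      have "(\<Sum>q<r. c q * v q) = (\<Sum>q<r. a k q * v q) - (\<Sum>p<r. v p * (\<Sum>q<r. P p q * a k q))"
        by (simp add: c_def right_diff_distrib sum_subtractf mult.commute[of _ "v _"])
      also have "\<dots> = 0" using v by (subst swap) (simp add: Pv)
      finally show ?thesis using Pv[OF p] by (simp add: P')
    qed
    moreover have "P' p q = P' q p" for p q by (simp add: P'_def sym mult.commute)
    ultimately show ?thesis by (intro exI[of _ P']) blast
  qed
qed

text \<open>The orthogonal projector onto the column space of \<open>A\<close>, whose orthogonal
  complement is the kernel of the transpose.\<close>

lemma column_projector_exists:
  assumes A: "(A :: real mat) \<in> carrier_mat r k"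
  shows "\<exists>P \<in> carrier_mat r r. P\<^sup>T = P \<and> P * A = A \<and>
    (\<forall>v\<in>carrier_vec r. A\<^sup>T *\<^sub>v v = 0\<^sub>v k \<longrightarrow> P *\<^sub>v v = 0\<^sub>v r)"
proof -
  obtain P where sym: "\<And>p q. P p q = P q p"
    and fix_a: "\<And>i p. i < k \<Longrightarrow> p < r \<Longrightarrow> (\<Sum>q<r. P p q * A $$ (q, i)) = A $$ (p, i)"
    and ker: "\<And>v p. (\<forall>i<k. (\<Sum>q<r. A $$ (q, i) * v q) = 0) \<Longrightarrow> p < r \<Longrightarrow> (\<Sum>q<r. P p q * v q) = 0"
    using span_projector_exists[of k r "\<lambda>i q. A $$ (q, i)"] by blast
  define P' where "P' = mat r r (\<lambda>(p, q). P p q)"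
  have "P'\<^sup>T = P'" by (rule eq_matI) (auto simp: P'_def sym)
  moreover have "P' * A = A"
    using A fix_a by (intro eq_matI) (auto simp: P'_def scalar_prod_def atLeast0LessThan)
  moreover have "P' *\<^sub>v v = 0\<^sub>v r" if v: "v \<in> carrier_vec r" "A\<^sup>T *\<^sub>v v = 0\<^sub>v k" for v
  proof -
    have "(\<Sum>q<r. A $$ (q, i) * v $ q) = 0" if "i < k" for i
    proof -
      have "(A\<^sup>T *\<^sub>v v) $ i = 0" using v that by simp
      then show ?thesis using A v(1) that by (simp add: scalar_prod_def atLeast0LessThan)
    qed
    then show ?thesis using v ker[of "\<lambda>q. v $ q"]
      by (intro eq_vecI) (auto simp: P'_def scalar_prod_def atLeast0LessThan)
  qed
  moreover have "P' \<in> carrier_mat r r" by (simp add: P'_def)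
  ultimately show ?thesis by blast
qed

text \<open>Transposing \<open>P * A = A\<close> shows that the columns of \<open>1 - P\<close> lie
  in the kernel of \<open>A\<^sup>T\<close>, which \<open>P\<close> annihilates; hence
  \<open>P * (1 - P) = 0\<close>.\<close>

lemma projector_idempotent:
  assumes A: "(A :: real mat) \<in> carrier_mat r k" and P: "P \<in> carrier_mat r r"
    and sym: "P\<^sup>T = P" and PA: "P * A = A"
    and ker: "\<And>v. v \<in> carrier_vec r \<Longrightarrow> A\<^sup>T *\<^sub>v v = 0\<^sub>v k \<Longrightarrow> P *\<^sub>v v = 0\<^sub>v r"
  shows "P * P = P"
proof -
  have ATP: "A\<^sup>T * P = A\<^sup>T"
    using transpose_mult[OF P A] PA sym by simp
  have "P * (1\<^sub>m r - P) = 0\<^sub>m r r"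
  proof (rule mat_col_eqI)
    fix i assume i: "i < dim_col (0\<^sub>m r r :: real mat)"
    then have v: "col (1\<^sub>m r - P) i \<in> carrier_vec r"
      using P by (intro carrier_vecI) simp
    have "A\<^sup>T *\<^sub>v col (1\<^sub>m r - P) i = col (A\<^sup>T * (1\<^sub>m r - P)) i"
      using A P i by (subst col_mult2[of _ k r _ r]) auto
    also have "A\<^sup>T * (1\<^sub>m r - P) = A\<^sup>T - A\<^sup>T * P"
      using A P by (subst mult_minus_distrib_mat[of _ k r]) auto
    also have "\<dots> = 0\<^sub>m k r" using ATP A by simp
    also have "col (0\<^sub>m k r) i = 0\<^sub>v k" using i by auto
    finally have "P *\<^sub>v col (1\<^sub>m r - P) i = 0\<^sub>v r" by (intro ker v)
    then show "col (P * (1\<^sub>m r - P)) i = col (0\<^sub>m r r) i"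
      using P i by (subst col_mult2[of _ r r _ r]) auto
  qed (use P in auto)
  moreover have "P * (1\<^sub>m r - P) = P - P * P"
    using P by (subst mult_minus_distrib_mat[of _ r r]) auto
  ultimately have *: "P - P * P = 0\<^sub>m r r" by simp
  show ?thesis
  proof (rule eq_matI)
    fix i j assume "i < dim_row P" "j < dim_col P"
    then show "(P * P) $$ (i, j) = P $$ (i, j)"
      using arg_cong[OF *, of "\<lambda>X. X $$ (i, j)"] P by simp
  qed (use P in auto)
qed

lemma conjugate_diag_carrier [simp]:
  "A \<in> carrier_mat r k \<Longrightarrow> A * mat_diag k d * A\<^sup>T \<in> carrier_mat r r"
  by (auto intro!: mult_carrier_mat[of _ _ k])

lemma conjugate_diag_index:
  assumes "(A :: real mat) \<in> carrier_mat r k" "p < r" "q < r"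
  shows "(A * mat_diag k d * A\<^sup>T) $$ (p, q) = (\<Sum>i<k. A $$ (p, i) * d i * A $$ (q, i))"
  using assms by (subst mat_diag_mult_right) (auto simp: scalar_prod_def atLeast0LessThan)

lemma transpose_conjugate_diag:
  assumes "(A :: real mat) \<in> carrier_mat r k"
  shows "(A * mat_diag k d * A\<^sup>T)\<^sup>T = A * mat_diag k d * A\<^sup>T"
proof (rule eq_matI)
  fix i j assume ij: "i < dim_row (A * mat_diag k d * A\<^sup>T)" "j < dim_col (A * mat_diag k d * A\<^sup>T)"
  then have ij': "i < r" "j < r" using assms by auto
  have "(A * mat_diag k d * A\<^sup>T)\<^sup>T $$ (i, j) = (A * mat_diag k d * A\<^sup>T) $$ (j, i)"
    using ij' assms by (intro index_transpose_mat(1)) auto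
  then show "(A * mat_diag k d * A\<^sup>T)\<^sup>T $$ (i, j) = (A * mat_diag k d * A\<^sup>T) $$ (i, j)"
    unfolding conjugate_diag_index[OF assms ij'] conjugate_diag_index[OF assms ij'(2,1)]
    by (simp add: mult_ac)
qed (use assms in auto)

text \<open>Moving \<open>A\<close> to the other side as its transpose leaves a weighted sum of
  squares. With positive weights the form vanishes exactly on the kernel of the transpose.\<close>

lemma conjugate_diag_quadratic:
  assumes A: "(A :: real mat) \<in> carrier_mat r k" and v: "v \<in> carrier_vec r"
  shows "v \<bullet> ((A * mat_diag k d * A\<^sup>T) *\<^sub>v v) = (\<Sum>i<k. d i * ((A\<^sup>T *\<^sub>v v) $ i)\<^sup>2)"
proof -
  have e: "A\<^sup>T *\<^sub>v v \<in> carrier_vec k" using A v by auto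
  have "(A * mat_diag k d * A\<^sup>T) *\<^sub>v v = A *\<^sub>v (mat_diag k d *\<^sub>v (A\<^sup>T *\<^sub>v v))"
    using A v by (simp add: assoc_mult_mat_vec[of _ r k _ k] assoc_mult_mat_vec[of _ r k _ r])
  then have "v \<bullet> ((A * mat_diag k d * A\<^sup>T) *\<^sub>v v) = (A\<^sup>T *\<^sub>v v) \<bullet> (mat_diag k d *\<^sub>v (A\<^sup>T *\<^sub>v v))"
    using transpose_vec_mult_scalar[OF A mult_mat_vec_carrier[OF mat_diag_dim e] v] by simp
  also have "\<dots> = (\<Sum>i<k. (A\<^sup>T *\<^sub>v v) $ i * (\<Sum>j<k. (if i = j then d j else 0) * (A\<^sup>T *\<^sub>v v) $ j))"
    using A by (simp add: scalar_prod_def mat_diag_def atLeast0LessThan)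
  also have "\<dots> = (\<Sum>i<k. d i * ((A\<^sup>T *\<^sub>v v) $ i)\<^sup>2)"
    by (intro sum.cong refl) (simp add: if_distrib[of "\<lambda>x. x * _"] power2_eq_square cong: if_cong)
  finally show ?thesis .
qed

text \<open>Replacing the complement of the range of \<open>A D A\<^sup>T\<close> by the identity makes the matrix invertible;
  for positive diagonal \<open>D\<close> the projector \<open>P\<close> onto that range does not depend on \<open>D\<close>, so that the
  pseudoinverse is a rational function of \<open>D\<close>.\<close>

lemma moore_penrose_conjugate_diag:
  assumes A: "(A :: real mat) \<in> carrier_mat r k" and P: "P \<in> carrier_mat r r"
    and sym: "P\<^sup>T = P" and PA: "P * A = A"
    and ker: "\<And>v. v \<in> carrier_vec r \<Longrightarrow> A\<^sup>T *\<^sub>v v = 0\<^sub>v k \<Longrightarrow> P *\<^sub>v v = 0\<^sub>v r"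
    and d: "\<And>i. i < k \<Longrightarrow> 0 < d i"
  defines "M \<equiv> A * mat_diag k d * A\<^sup>T"
  defines "K \<equiv> M + (1\<^sub>m r - P)"
  shows "det K \<noteq> 0"
    and "is_moore_penrose M ((1 / det K) \<cdot>\<^sub>m adj_mat K * P)"
proof -
  have M: "M \<in> carrier_mat r r" and K: "K \<in> carrier_mat r r"
    using A P unfolding K_def M_def by auto
  have PP: "P * P = P" by (rule projector_idempotent[OF A P sym PA ker])
  have PM: "P * M = M"
    unfolding M_def using A P PA
    by (simp add: assoc_mult_mat[of P r r _ k _ r, symmetric] assoc_mult_mat[of P r r _ k _ k, symmetric])
  have MP: "M * P = M"
    using arg_cong[OF PM, of transpose_mat] transpose_mult[OF P M] sym transpose_conjugate_diag[OF A, of d]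
    by (simp add: M_def)
  show det: "det K \<noteq> 0"
  proof
    assume "det K = 0"
    then obtain v where v: "v \<in> carrier_vec r" "v \<noteq> 0\<^sub>v r" "K *\<^sub>v v = 0\<^sub>v r"
      using det_0_iff_vec_prod_zero_field[OF K] by blast
    \<comment> \<open>\<open>w\<close> is the part of \<open>v\<close> in the complement of the
      range. Pairing \<open>K v = 0\<close> with \<open>v\<close> gives a sum of two nonnegative
      terms, the form of \<open>M\<close> at \<open>v\<close> and the squared norm of
      \<open>w\<close>, so both vanish and then \<open>v\<close> does.\<close>
    define w where "w = v - P *\<^sub>v v"
    have w: "w \<in> carrier_vec r" using v P by (auto simp: w_def)
    have Pw: "P *\<^sub>v w = 0\<^sub>v r"
      using P v PP by (simp add: w_def mult_minus_distrib_mat_vec[OF P] assoc_mult_mat_vec[OF P P, symmetric])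
    have "K *\<^sub>v v = M *\<^sub>v v + w"
      using v(1) P M
      by (simp add: K_def w_def add_mult_distrib_mat_vec[OF M minus_carrier_mat[OF P] v(1)]
          minus_mult_distrib_mat_vec[OF one_carrier_mat P v(1)])
    then have "M *\<^sub>v v + w = 0\<^sub>v r" using v(3) by simp
    then have "v \<bullet> (M *\<^sub>v v + w) = 0" using v(1) by simp
    then have "0 = v \<bullet> (M *\<^sub>v v) + v \<bullet> w"
      using scalar_prod_add_distrib[OF v(1) mult_mat_vec_carrier[OF M v(1)] w] by simp
    also have "v \<bullet> w = w \<bullet> w"
    proof -
      have "(P *\<^sub>v v) \<bullet> w = v \<bullet> (P *\<^sub>v w)"
        using transpose_vec_mult_scalar[OF P w v(1)] sym by simp
      then have "(P *\<^sub>v v) \<bullet> w = 0" using Pw v by simp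
      then show ?thesis using v P w
        by (subst (2) w_def) (simp add: minus_scalar_prod_distrib[of _ r])
    qed
    finally have *: "(\<Sum>i<k. d i * ((A\<^sup>T *\<^sub>v v) $ i)\<^sup>2) + w \<bullet> w = 0"
      using conjugate_diag_quadratic[OF A v(1), of d] by (simp add: M_def)
    moreover have "0 \<le> w \<bullet> w" by (simp add: scalar_prod_def sum_nonneg)
    moreover have "0 \<le> (\<Sum>i<k. d i * ((A\<^sup>T *\<^sub>v v) $ i)\<^sup>2)"
      by (intro sum_nonneg mult_nonneg_nonneg) (use d less_imp_le in auto)
    ultimately have "w \<bullet> w = 0" and s: "(\<Sum>i<k. d i * ((A\<^sup>T *\<^sub>v v) $ i)\<^sup>2) = 0" by linarith+
    then have "w = 0\<^sub>v r"
      using w by (intro eq_vecI) (auto simp: scalar_prod_def sum_nonneg_eq_0_iff)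
    have "(A\<^sup>T *\<^sub>v v) $ i = 0" if "i < k" for i
    proof -
      have "\<forall>i\<in>{..<k}. d i * ((A\<^sup>T *\<^sub>v v) $ i)\<^sup>2 = 0"
        using s by (subst (asm) sum_nonneg_eq_0_iff) (auto intro!: mult_nonneg_nonneg less_imp_le[OF d])
      then show ?thesis using that d[OF that] by force
    qed
    then have "A\<^sup>T *\<^sub>v v = 0\<^sub>v k" using A by (intro eq_vecI) auto
    then have "P *\<^sub>v v = 0\<^sub>v r" using v ker by blast
    moreover have "v = w + P *\<^sub>v v" using v P by (auto simp: w_def)
    ultimately show False using \<open>w = 0\<^sub>v r\<close> v by simp
  qed
  \<comment> \<open>The inverse of \<open>K\<close> through the adjugate. \<open>K\<close> acts as
    \<open>M\<close> on the range of \<open>P\<close> and as the identity on its complement, so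
    \<open>L * M\<close> and \<open>M * L\<close> are both equal to \<open>P\<close>; the four
    Moore-Penrose identities for \<open>L * P\<close> follow from this.\<close>
  define L where "L = (1 / det K) \<cdot>\<^sub>m adj_mat K"
  have L: "L \<in> carrier_mat r r" using adj_mat(1)[OF K] by (simp add: L_def)
  have KL: "K * L = 1\<^sub>m r"
    using adj_mat[OF K] K det by (simp add: L_def mult_smult_distrib[of _ r r _ r]) (auto intro!: eq_matI)
  have LK: "L * K = 1\<^sub>m r"
    using adj_mat[OF K] K det by (simp add: L_def mult_smult_assoc_mat[of _ r r _ r]) (auto intro!: eq_matI)
  have KP: "K * P = M"
    unfolding K_def add_mult_distrib_mat[OF M minus_carrier_mat[OF P] P] minus_mult_distrib_mat[OF one_carrier_mat P P]
    using M P by (intro eq_matI) (auto simp: PP MP left_mult_one_mat[OF P] simp del: index_mult_mat)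
  have PK: "P * K = M"
    unfolding K_def mult_add_distrib_mat[OF P M minus_carrier_mat[OF P]] mult_minus_distrib_mat[OF P one_carrier_mat P]
    using M P by (intro eq_matI) (auto simp: PP PM right_mult_one_mat[OF P] simp del: index_mult_mat)
  have eLM: "L * M = P"
    using assoc_mult_mat[OF L K P] P by (simp add: LK KP)
  have eML: "M * L = P"
    using assoc_mult_mat[OF P K L] P by (simp add: KL PK)
  have LP: "L * P = P * L"
    using assoc_mult_mat[OF L M L] by (simp add: eLM eML)
  have MX: "M * (L * P) = P"
    using assoc_mult_mat[OF M L P] by (simp add: eML PP)
  have XM: "(L * P) * M = P"
    using assoc_mult_mat[OF L P M] by (simp add: PM eLM)
  have "M * (L * P) * M = M" using MX PM by simp
  moreover have "L * P * M * (L * P) = L * P"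
    using assoc_mult_mat[OF P L P] assoc_mult_mat[OF L P P] by (simp add: XM PP LP[symmetric])
  ultimately show "is_moore_penrose M ((1 / det K) \<cdot>\<^sub>m adj_mat K * P)"
    unfolding is_moore_penrose_def L_def[symmetric] using MX XM sym L P M by auto
qed

section \<open>Vanishing weights and bounds for the quadratic form\<close>

text \<open>Columns are zeroed and not removed, which keeps the dimensions. A column with weight 0
  can thus be traded for a zero column with weight 1, and all weights become positive.\<close>

definition restrict_cols :: "nat set \<Rightarrow> real mat \<Rightarrow> real mat" where
  "restrict_cols Z A = mat (dim_row A) (dim_col A) (\<lambda>(p, i). if i \<in> Z then 0 else A $$ (p, i))"

lemma restrict_cols_carrier [simp]: "A \<in> carrier_mat r k \<Longrightarrow> restrict_cols Z A \<in> carrier_mat r k"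
  by (auto simp: restrict_cols_def)

lemma restrict_cols_conjugate_diag:
  assumes A: "(A :: real mat) \<in> carrier_mat r k" and Z: "\<And>i. i < k \<Longrightarrow> i \<in> Z \<Longrightarrow> d i = 0"
  shows "A * mat_diag k d * A\<^sup>T =
    restrict_cols Z A * mat_diag k (\<lambda>i. if i \<in> Z then 1 else d i) * (restrict_cols Z A)\<^sup>T"
proof (rule eq_matI)
  fix p q assume pq: "p < dim_row (restrict_cols Z A * mat_diag k (\<lambda>i. if i \<in> Z then 1 else d i) * (restrict_cols Z A)\<^sup>T)"
    "q < dim_col (restrict_cols Z A * mat_diag k (\<lambda>i. if i \<in> Z then 1 else d i) * (restrict_cols Z A)\<^sup>T)"
  then have "p < r" "q < r" using A by (auto simp: restrict_cols_def)
  then show "(A * mat_diag k d * A\<^sup>T) $$ (p, q) =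
      (restrict_cols Z A * mat_diag k (\<lambda>i. if i \<in> Z then 1 else d i) * (restrict_cols Z A)\<^sup>T) $$ (p, q)"
    using A Z by (subst (1 2) conjugate_diag_index[of _ r k]) (auto simp: restrict_cols_def intro!: sum.cong)
qed (use A in \<open>auto simp: restrict_cols_def\<close>)

text \<open>Trading zero weights for zero columns reduces existence to positive weights. With
  existence and uniqueness the definite description in \<open>moore_penrose\<close> denotes the
  pseudoinverse.\<close>

lemma is_moore_penrose_conjugate_diag:
  assumes A: "(A :: real mat) \<in> carrier_mat r k" and d: "\<And>i. i < k \<Longrightarrow> 0 \<le> d i"
  shows "is_moore_penrose (A * mat_diag k d * A\<^sup>T) (moore_penrose (A * mat_diag k d * A\<^sup>T))"
proof -
  define Z where "Z = {i. d i = 0}"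
  define d' where "d' = (\<lambda>i. if i \<in> Z then 1 else d i)"
  have eq: "A * mat_diag k d * A\<^sup>T = restrict_cols Z A * mat_diag k d' * (restrict_cols Z A)\<^sup>T"
    unfolding d'_def by (rule restrict_cols_conjugate_diag[OF A]) (simp add: Z_def)
  have B: "restrict_cols Z A \<in> carrier_mat r k" using A by simp
  have "0 < d' i" if "i < k" for i using d[OF that] by (auto simp: d'_def Z_def)
  then obtain X where "is_moore_penrose (A * mat_diag k d * A\<^sup>T) X"
    using column_projector_exists[OF B] moore_penrose_conjugate_diag(2)[OF B] unfolding eq by metis
  then show ?thesis using moore_penrose_eqI by metis
qed

lemma moore_penrose_conjugate_diag_carrier:
  assumes A: "(A :: real mat) \<in> carrier_mat r k" and d: "\<And>i. i < k \<Longrightarrow> 0 \<le> d i"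
  shows "moore_penrose (A * mat_diag k d * A\<^sup>T) \<in> carrier_mat r r"
  using is_moore_penrose_conjugate_diag[OF A d] A by (auto simp: is_moore_penrose_def)

text \<open>Together with uniqueness this makes the pseudoinverse of a symmetric matrix
  symmetric.\<close>

lemma is_moore_penrose_transpose:
  assumes "is_moore_penrose A X"
  shows "is_moore_penrose (A\<^sup>T) (X\<^sup>T)"
proof -
  obtain m n where A: "A \<in> carrier_mat m n" by blast
  then have X: "X \<in> carrier_mat n m" using assms by (auto simp: is_moore_penrose_def)
  have [simp]: "A\<^sup>T * X\<^sup>T = (X * A)\<^sup>T" "X\<^sup>T * A\<^sup>T = (A * X)\<^sup>T"
    using transpose_mult[OF X A] transpose_mult[OF A X] by auto
  have "(X * A)\<^sup>T * A\<^sup>T = (A * (X * A))\<^sup>T" "(A * X)\<^sup>T * X\<^sup>T = (X * (A * X))\<^sup>T"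
    using transpose_mult[of A m n "X * A" n] transpose_mult[of X n m "A * X" m] A X by auto
  moreover have "A * (X * A) = A" "X * (A * X) = X"
    using assms A X by (auto simp: is_moore_penrose_def assoc_mult_mat[of A m n X m A n] assoc_mult_mat[of X n m A n X m])
  ultimately show ?thesis using assms A X by (auto simp: is_moore_penrose_def)
qed

text \<open>With \<open>w = X A y\<close> and \<open>e = A\<^sup>T w\<close>, the form is the
  product of \<open>e\<close> and \<open>y\<close>, and by \<open>X M X = X\<close> also the energy,
  the sum of \<open>d i * (e $ i)\<^sup>2\<close>. Young's inequality bounds the product by half the
  energy plus half the sum of \<open>(y $ i)\<^sup>2 / d i\<close>; the energy is the form itself
  and is absorbed. Neither the rank of \<open>A\<close> nor its size enters. The condition
  \<open>y0\<close> settles the indices of weight 0, where the quotient is 0.\<close>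

lemma quadratic_moore_penrose_bounds:
  assumes A: "(A :: real mat) \<in> carrier_mat r k" and d: "\<And>i. i < k \<Longrightarrow> 0 \<le> d i"
    and y: "y \<in> carrier_vec k" and y0: "\<And>i. i < k \<Longrightarrow> d i = 0 \<Longrightarrow> y $ i = 0"
  defines "q \<equiv> (A *\<^sub>v y) \<bullet> (moore_penrose (A * mat_diag k d * A\<^sup>T) *\<^sub>v (A *\<^sub>v y))"
  shows "0 \<le> q" and "q \<le> (\<Sum>i<k. (y $ i)\<^sup>2 / d i)"
proof -
  define M where "M = A * mat_diag k d * A\<^sup>T"
  define X where "X = moore_penrose M"
  have mp: "is_moore_penrose M X" unfolding X_def M_def by (rule is_moore_penrose_conjugate_diag[OF A d])
  have M: "M \<in> carrier_mat r r" using A by (simp add: M_def)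
  then have X: "X \<in> carrier_mat r r" using mp by (auto simp: is_moore_penrose_def)
  have "is_moore_penrose M (X\<^sup>T)"
    using is_moore_penrose_transpose[OF mp] transpose_conjugate_diag[OF A, of d] by (simp add: M_def)
  then have sym: "X\<^sup>T = X" using mp by (rule is_moore_penrose_unique)
  define u where "u = A *\<^sub>v y"
  define w where "w = X *\<^sub>v u"
  define e where "e = A\<^sup>T *\<^sub>v w"
  have u: "u \<in> carrier_vec r" and w: "w \<in> carrier_vec r" and e: "e \<in> carrier_vec k"
    using A X y by (auto simp: u_def w_def e_def)
  have q: "q = u \<bullet> w" by (simp add: q_def u_def w_def X_def M_def)
  have "u \<bullet> w = w \<bullet> (A *\<^sub>v y)"
    unfolding u_def[symmetric] by (rule comm_scalar_prod[OF u w])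
  also have "\<dots> = e \<bullet> y"
    using transpose_vec_mult_scalar[OF A y w] by (simp add: e_def)
  also have "\<dots> = (\<Sum>i<k. e $ i * y $ i)"
    using y e by (simp add: scalar_prod_def atLeast0LessThan)
  finally have q1: "q = (\<Sum>i<k. e $ i * y $ i)" using q by simp
  have "X *\<^sub>v (M *\<^sub>v w) = (X * M * X) *\<^sub>v u"
    using X M u by (simp add: w_def assoc_mult_mat_vec[of _ r r _ r] assoc_mult_mat[of _ r r _ r _ r])
  then have "X *\<^sub>v (M *\<^sub>v w) = w" using mp by (simp add: is_moore_penrose_def w_def)
  then have "q = (X\<^sup>T *\<^sub>v u) \<bullet> (M *\<^sub>v w)"
    using q transpose_vec_mult_scalar[OF X _ u, of "M *\<^sub>v w"] M w by auto
  then have "q = w \<bullet> (M *\<^sub>v w)" by (simp add: sym w_def)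
  then have q2: "q = (\<Sum>i<k. d i * (e $ i)\<^sup>2)"
    using conjugate_diag_quadratic[OF A w, of d] by (simp add: M_def e_def)
  then show "0 \<le> q" using d by (auto intro!: sum_nonneg mult_nonneg_nonneg)
  have "e $ i * y $ i \<le> (d i * (e $ i)\<^sup>2 + (y $ i)\<^sup>2 / d i) / 2" if "i < k" for i
  proof (cases "d i = 0")
    case False
    then have "d i > 0" using d[OF that] by simp
    then have "0 \<le> (d i * e $ i - y $ i)\<^sup>2 / d i" by simp
    also have "\<dots> = d i * (e $ i)\<^sup>2 + (y $ i)\<^sup>2 / d i - 2 * (e $ i * y $ i)"
      using \<open>d i > 0\<close> by (simp add: field_simps power2_eq_square)
    finally show ?thesis by simp
  qed (use y0[OF that] in simp)
  then have "q \<le> (\<Sum>i<k. (d i * (e $ i)\<^sup>2 + (y $ i)\<^sup>2 / d i) / 2)"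
    unfolding q1 by (intro sum_mono) auto
  also have "\<dots> = (q + (\<Sum>i<k. (y $ i)\<^sup>2 / d i)) / 2"
    by (simp add: q2 sum.distrib add_divide_distrib sum_divide_distrib)
  finally show "q \<le> (\<Sum>i<k. (y $ i)\<^sup>2 / d i)" by simp
qed

section \<open>Measurability and continuity of the pseudoinverse in the weights\<close>

lemma borel_measurable_det [measurable (raw)]:
  assumes "\<And>w. F w \<in> carrier_mat n n"
    and [measurable]: "\<And>p q. p < n \<Longrightarrow> q < n \<Longrightarrow> (\<lambda>w. F w $$ (p, q)) \<in> borel_measurable M"
  shows "(\<lambda>w. det (F w) :: real) \<in> borel_measurable M"
  unfolding det_def'[OF assms(1)]
  by (intro borel_measurable_sum borel_measurable_times borel_measurable_prod assms(2) borel_measurable_const)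
     (auto dest: permutes_in_image)

lemma continuous_on_det:
  fixes F :: "'a::topological_space \<Rightarrow> real mat"
  assumes "\<And>w. F w \<in> carrier_mat n n"
    and "\<And>p q. p < n \<Longrightarrow> q < n \<Longrightarrow> continuous_on S (\<lambda>w. F w $$ (p, q))"
  shows "continuous_on S (\<lambda>w. det (F w))"
  unfolding det_def'[OF assms(1)]
  by (intro continuous_on_sum continuous_on_mult continuous_on_prod assms(2) continuous_on_const)
     (auto dest: permutes_in_image)

lemma adj_mat_index:
  assumes "A \<in> carrier_mat n n" "p < n" "q < n"
  shows "adj_mat A $$ (p, q) = (-1) ^ (q + p) * det (mat_delete A q p)"
  using assms by (simp add: adj_mat_def cofactor_def)

lemma mat_delete_entry:
  assumes "A \<in> carrier_mat n n" "p < n - 1" "q < n - 1"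
  shows "mat_delete A i j $$ (p, q) = A $$ (if p < i then p else Suc p, if q < j then q else Suc q)"
  using assms by (simp add: mat_delete_def)

lemma borel_measurable_adj_mat:
  assumes F: "\<And>w. F w \<in> carrier_mat n n"
    and [measurable]: "\<And>p q. p < n \<Longrightarrow> q < n \<Longrightarrow> (\<lambda>w. F w $$ (p, q)) \<in> borel_measurable M"
    and pq: "p < n" "q < n"
  shows "(\<lambda>w. adj_mat (F w) $$ (p, q) :: real) \<in> borel_measurable M"
proof -
  have "(\<lambda>w. det (mat_delete (F w) q p)) \<in> borel_measurable M"
  proof (rule borel_measurable_det)
    show "mat_delete (F w) q p \<in> carrier_mat (n - 1) (n - 1)" for w
      by (rule mat_delete_carrier[OF F])
    show "(\<lambda>w. mat_delete (F w) q p $$ (i, j)) \<in> borel_measurable M" if "i < n - 1" "j < n - 1" for i j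
      unfolding mat_delete_entry[OF F that] using that by (intro assms(2)) auto
  qed
  then show ?thesis unfolding adj_mat_index[OF F pq] by measurable
qed

lemma continuous_on_adj_mat:
  fixes F :: "'a::topological_space \<Rightarrow> real mat"
  assumes F: "\<And>w. F w \<in> carrier_mat n n"
    and c: "\<And>p q. p < n \<Longrightarrow> q < n \<Longrightarrow> continuous_on S (\<lambda>w. F w $$ (p, q))"
    and pq: "p < n" "q < n"
  shows "continuous_on S (\<lambda>w. adj_mat (F w) $$ (p, q))"
proof -
  have "continuous_on S (\<lambda>w. det (mat_delete (F w) q p))"
  proof (rule continuous_on_det)
    show "mat_delete (F w) q p \<in> carrier_mat (n - 1) (n - 1)" for w
      by (rule mat_delete_carrier[OF F])
    show "continuous_on S (\<lambda>w. mat_delete (F w) q p $$ (i, j))" if "i < n - 1" "j < n - 1" for i j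
      unfolding mat_delete_entry[OF F that] using that by (intro c) auto
  qed
  then show ?thesis unfolding adj_mat_index[OF F pq] by (intro continuous_intros)
qed

text \<open>The order of quantifiers is the point: \<open>P\<close> is chosen before
  \<open>d\<close>, so one rational expression with a nowhere vanishing denominator serves the whole
  open orthant of weights.\<close>

lemma moore_penrose_entry_formula:
  assumes A: "(A :: real mat) \<in> carrier_mat r k"
  obtains P where "P \<in> carrier_mat r r"
    and "\<And>d. (\<And>i. i < k \<Longrightarrow> 0 < d i) \<Longrightarrow> det (A * mat_diag k d * A\<^sup>T + (1\<^sub>m r - P)) \<noteq> 0"
    and "\<And>d p q. (\<And>i. i < k \<Longrightarrow> 0 < d i) \<Longrightarrow> p < r \<Longrightarrow> q < r \<Longrightarrow>
      moore_penrose (A * mat_diag k d * A\<^sup>T) $$ (p, q) =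
      (\<Sum>j<r. adj_mat (A * mat_diag k d * A\<^sup>T + (1\<^sub>m r - P)) $$ (p, j) * P $$ (j, q)) /
        det (A * mat_diag k d * A\<^sup>T + (1\<^sub>m r - P))"
proof -
  obtain P where P: "P \<in> carrier_mat r r" "P\<^sup>T = P" "P * A = A"
    "\<And>v. v \<in> carrier_vec r \<Longrightarrow> A\<^sup>T *\<^sub>v v = 0\<^sub>v k \<Longrightarrow> P *\<^sub>v v = 0\<^sub>v r"
    using column_projector_exists[OF A] by blast
  have K: "A * mat_diag k d * A\<^sup>T + (1\<^sub>m r - P) \<in> carrier_mat r r" for d
    using A P by (intro add_carrier_mat minus_carrier_mat)
  show ?thesis
  proof (rule that[OF P(1)])
    fix d :: "nat \<Rightarrow> real" and p q assume d: "\<And>i. i < k \<Longrightarrow> 0 < d i" and pq: "p < r" "q < r"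
    show "moore_penrose (A * mat_diag k d * A\<^sup>T) $$ (p, q) =
      (\<Sum>j<r. adj_mat (A * mat_diag k d * A\<^sup>T + (1\<^sub>m r - P)) $$ (p, j) * P $$ (j, q)) /
        det (A * mat_diag k d * A\<^sup>T + (1\<^sub>m r - P))"
    proof -
      define B where "B = adj_mat (A * mat_diag k d * A\<^sup>T + (1\<^sub>m r - P))"
      have B: "B \<in> carrier_mat r r" using adj_mat(1)[OF K] by (simp add: B_def)
      have "is_moore_penrose (A * mat_diag k d * A\<^sup>T)
          ((1 / det (A * mat_diag k d * A\<^sup>T + (1\<^sub>m r - P))) \<cdot>\<^sub>m B * P)"
        unfolding B_def by (rule moore_penrose_conjugate_diag(2)[OF A P(1-3)]) (use P(4) d in auto)
      then show ?thesis
        using B P(1) pq unfolding B_def[symmetric]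
        by (simp add: moore_penrose_eqI scalar_prod_def atLeast0LessThan sum_divide_distrib)
    qed
  next
    fix d :: "nat \<Rightarrow> real" assume "\<And>i. i < k \<Longrightarrow> 0 < d i"
    then show "det (A * mat_diag k d * A\<^sup>T + (1\<^sub>m r - P)) \<noteq> 0"
      by (intro moore_penrose_conjugate_diag(1)[OF A P(1-3)]) (use P(4) in auto)
  qed
qed

lemma continuous_on_moore_penrose_entry:
  assumes A: "(A :: real mat) \<in> carrier_mat r k" and pq: "p < r" "q < r"
    and D: "\<And>i. i < k \<Longrightarrow> continuous_on S (\<lambda>w. D w i)" and pos: "\<And>w i. w \<in> S \<Longrightarrow> i < k \<Longrightarrow> 0 < D w i"
  shows "continuous_on S (\<lambda>w. moore_penrose (A * mat_diag k (D w) * A\<^sup>T) $$ (p, q))"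
proof -
  obtain P where P: "P \<in> carrier_mat r r"
    and det: "\<And>d. (\<And>i. i < k \<Longrightarrow> 0 < d i) \<Longrightarrow> det (A * mat_diag k d * A\<^sup>T + (1\<^sub>m r - P)) \<noteq> 0"
    and eq: "\<And>d p q. (\<And>i. i < k \<Longrightarrow> 0 < d i) \<Longrightarrow> p < r \<Longrightarrow> q < r \<Longrightarrow>
      moore_penrose (A * mat_diag k d * A\<^sup>T) $$ (p, q) =
      (\<Sum>j<r. adj_mat (A * mat_diag k d * A\<^sup>T + (1\<^sub>m r - P)) $$ (p, j) * P $$ (j, q)) /
        det (A * mat_diag k d * A\<^sup>T + (1\<^sub>m r - P))"
    by (rule moore_penrose_entry_formula[OF A]) blast
  define K where "K w = A * mat_diag k (D w) * A\<^sup>T + (1\<^sub>m r - P)" for w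
  have K: "K w \<in> carrier_mat r r" for w
    using A P unfolding K_def by (intro add_carrier_mat minus_carrier_mat)
  have cK: "continuous_on S (\<lambda>w. K w $$ (i, j))" if "i < r" "j < r" for i j
  proof -
    have "K w $$ (i, j) = (\<Sum>l<k. A $$ (i, l) * D w l * A $$ (j, l)) + (1\<^sub>m r - P) $$ (i, j)" for w
      using that P A conjugate_diag_index[OF A that, of "D w"] conjugate_diag_carrier[OF A, of "D w"]
      unfolding K_def by (subst index_add_mat(1)) auto
    then show ?thesis by (auto intro!: continuous_intros D)
  qed
  have "continuous_on S (\<lambda>w. (\<Sum>j<r. adj_mat (K w) $$ (p, j) * P $$ (j, q)) / det (K w))"
    by (intro continuous_intros continuous_on_adj_mat[where n = r] continuous_on_det[where n = r] K cK pq)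
       (auto simp: K_def intro!: det pos)
  then show ?thesis
    by (rule continuous_on_eq) (simp add: eq[OF pos pq] K_def)
qed

text \<open>The pseudoinverse jumps where a diagonal entry vanishes; measurability on the closed orthant
  comes from splitting it into the finitely many zero patterns.\<close>

lemma borel_measurable_moore_penrose_entry:
  assumes A: "(A :: real mat) \<in> carrier_mat r k" and pq: "p < r" "q < r"
    and D [measurable]: "\<And>i. i < k \<Longrightarrow> (\<lambda>w. D w i) \<in> borel_measurable M"
    and nonneg: "\<And>w i. w \<in> space M \<Longrightarrow> i < k \<Longrightarrow> 0 \<le> D w i"
  shows "(\<lambda>w. moore_penrose (A * mat_diag k (D w) * A\<^sup>T) $$ (p, q)) \<in> borel_measurable M"
proof -
  \<comment> \<open>\<open>E Z w\<close> is positive at every \<open>w\<close>, whether or not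
    \<open>Z\<close> is the zero pattern there, so the rational formula can be used on the whole
    space. The indicators in the final sum select the pattern for which \<open>E Z w\<close> gives
    the true weights.\<close>
  define E where "E Z w i = (if i \<in> Z then 1 else max 0 (D w i) + (if D w i > 0 then 0 else 1))" for Z w i
  define g where "g Z w = moore_penrose (restrict_cols Z A * mat_diag k (E Z w) * (restrict_cols Z A)\<^sup>T) $$ (p, q)" for Z w
  have Epos: "0 < E Z w i" for Z w i by (auto simp: E_def)
  have g: "g Z \<in> borel_measurable M" for Z
  proof -
    define B where "B = restrict_cols Z A"
    have B: "B \<in> carrier_mat r k" using A by (simp add: B_def)
    obtain P where P: "P \<in> carrier_mat r r"
      and eq: "\<And>d p q. (\<And>i. i < k \<Longrightarrow> 0 < d i) \<Longrightarrow> p < r \<Longrightarrow> q < r \<Longrightarrow>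
        moore_penrose (B * mat_diag k d * B\<^sup>T) $$ (p, q) =
        (\<Sum>j<r. adj_mat (B * mat_diag k d * B\<^sup>T + (1\<^sub>m r - P)) $$ (p, j) * P $$ (j, q)) /
          det (B * mat_diag k d * B\<^sup>T + (1\<^sub>m r - P))"
      by (rule moore_penrose_entry_formula[OF B]) blast
    define K where "K w = B * mat_diag k (E Z w) * B\<^sup>T + (1\<^sub>m r - P)" for w
    have K: "K w \<in> carrier_mat r r" for w
      using B P unfolding K_def by (intro add_carrier_mat minus_carrier_mat)
    have mK: "(\<lambda>w. K w $$ (i, j)) \<in> borel_measurable M" if "i < r" "j < r" for i j
    proof -
      have "K w $$ (i, j) = (\<Sum>l<k. B $$ (i, l) * E Z w l * B $$ (j, l)) + (1\<^sub>m r - P) $$ (i, j)" for w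
        using that P B conjugate_diag_index[OF B that, of "E Z w"] conjugate_diag_carrier[OF B, of "E Z w"]
        unfolding K_def by (subst index_add_mat(1)) auto
      moreover have "(\<lambda>w. E Z w l) \<in> borel_measurable M" if "l < k" for l
        unfolding E_def using D[OF that] by measurable
      ultimately show ?thesis by (auto intro!: borel_measurable_add borel_measurable_sum borel_measurable_times)
    qed
    have "(\<lambda>w. (\<Sum>j<r. adj_mat (K w) $$ (p, j) * P $$ (j, q)) / det (K w)) \<in> borel_measurable M"
      by (intro borel_measurable_divide borel_measurable_sum borel_measurable_times borel_measurable_const
          borel_measurable_adj_mat[where n = r] borel_measurable_det[where n = r] K mK pq) auto
    moreover have "g Z = (\<lambda>w. (\<Sum>j<r. adj_mat (K w) $$ (p, j) * P $$ (j, q)) / det (K w))"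
      by (rule ext) (simp add: g_def K_def B_def[symmetric] eq[OF Epos pq])
    ultimately show ?thesis by simp
  qed
  have "(\<lambda>w. \<Sum>Z\<in>Pow {..<k}. indicator {w \<in> space M. \<forall>i<k. (D w i = 0) = (i \<in> Z)} w * g Z w)
      \<in> borel_measurable M"
    by (intro borel_measurable_sum borel_measurable_times borel_measurable_indicator g) measurable
  moreover have "(\<Sum>Z\<in>Pow {..<k}. indicator {w \<in> space M. \<forall>i<k. (D w i = 0) = (i \<in> Z)} w * g Z w) =
      moore_penrose (A * mat_diag k (D w) * A\<^sup>T) $$ (p, q)" if w: "w \<in> space M" for w
  proof -
    define Z where "Z = {i. i < k \<and> D w i = 0}"
    have "(\<Sum>Z'\<in>Pow {..<k}. indicator {w \<in> space M. \<forall>i<k. (D w i = 0) = (i \<in> Z')} w * g Z' w) =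
      (\<Sum>Z'\<in>Pow {..<k}. if Z' = Z then g Z w else 0)"
      using w by (intro sum.cong) (auto simp: Z_def indicator_def)
    also have "\<dots> = g Z w" by (subst sum.delta) (auto simp: Z_def)
    also have "mat_diag k (E Z w) = mat_diag k (\<lambda>i. if i \<in> Z then 1 else D w i)"
      using nonneg[OF w] by (intro eq_matI) (auto simp: mat_diag_def E_def Z_def not_less intro: antisym)
    then have "g Z w = moore_penrose (A * mat_diag k (D w) * A\<^sup>T) $$ (p, q)"
      unfolding g_def by (subst restrict_cols_conjugate_diag[OF A, of Z "D w"]) (auto simp: Z_def)
    finally show ?thesis .
  qed
  ultimately show ?thesis by (rule measurable_cong[THEN iffD1, rotated])
qed

subsection \<open>Weak convergence from characteristic functions\<close>

text \<open>The functions on which convergence of characteristic functions can be read off directly.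
  The complex coefficient covers sines, cosines and constants at once.\<close>

inductive_set trig_sums :: "'i set \<Rightarrow> (('i \<Rightarrow> real) \<Rightarrow> real) set" for I where
  wave: "(\<lambda>x. Re (c * iexp (\<Sum>p\<in>I. u p * x p))) \<in> trig_sums I"
| add: "f \<in> trig_sums I \<Longrightarrow> g \<in> trig_sums I \<Longrightarrow> (\<lambda>x. f x + g x) \<in> trig_sums I"

lemma trig_sums_const: "(\<lambda>x. c) \<in> trig_sums I"
  using trig_sums.wave[of "of_real c" "\<lambda>_. 0" I] by simp

lemma Re_mult_Re: "Re z * Re w = Re (z * w / 2) + Re (z * cnj w / 2)"
  by (simp add: field_simps)

text \<open>Product-to-sum formula: two waves multiply to waves with the sum and the difference of
  the frequencies. The sums therefore form an algebra, as Stone-Weierstrass requires.\<close>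

lemma trig_sums_mult:
  assumes "f \<in> trig_sums I" "g \<in> trig_sums I"
  shows "(\<lambda>x. f x * g x) \<in> trig_sums I"
  using assms(1)
proof induction
  case (wave a u)
  from assms(2) show ?case
  proof induction
    case (wave b v)
    let ?s = "\<lambda>u x. \<Sum>p\<in>I. u p * x p"
    have "Re (a * iexp (?s u x)) * Re (b * iexp (?s v x)) =
        Re ((a * b / 2) * iexp (?s (\<lambda>p. u p + v p) x)) + Re ((a * cnj b / 2) * iexp (?s (\<lambda>p. u p - v p) x))"
      for x :: "'a \<Rightarrow> real"
    proof -
      have "iexp (?s (\<lambda>p. u p + v p) x) = iexp (?s u x) * iexp (?s v x)"
        by (simp add: distrib_right sum.distrib distrib_left exp_add)
      moreover have "iexp (?s (\<lambda>p. u p - v p) x) = iexp (?s u x) * cnj (iexp (?s v x))"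
        by (simp add: left_diff_distrib sum_subtractf right_diff_distrib exp_diff exp_cnj exp_minus divide_inverse)
      ultimately show ?thesis unfolding Re_mult_Re by (simp add: mult_ac)
    qed
    then show ?case
      using trig_sums.add[OF trig_sums.wave[of "a * b / 2" "\<lambda>p. u p + v p" I]
          trig_sums.wave[of "a * cnj b / 2" "\<lambda>p. u p - v p" I]] by simp
  next
    case (add f g)
    then show ?case by (auto simp: distrib_left intro: trig_sums.add)
  qed
next
  case (add f g)
  then show ?case by (auto simp: distrib_right intro: trig_sums.add)
qed

lemma trig_sums_sin:
  assumes "finite I" "p \<in> I"
  shows "(\<lambda>x. sin (\<alpha> * x p)) \<in> trig_sums I"
proof -
  have "(\<Sum>q\<in>I. (if q = p then \<alpha> else 0) * x q) = \<alpha> * x p" for x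
    using assms by (simp add: if_distrib[of "\<lambda>z. z * _"] cong: if_cong)
  then show ?thesis
    using trig_sums.wave[of "- \<i>" "\<lambda>q. if q = p then \<alpha> else 0" I] by (simp add: Im_exp)
qed

lemma arcsin_sin_scaled:
  assumes "L > 0" "\<bar>x\<bar> \<le> L"
  shows "2 * L / pi * arcsin (sin (pi / (2 * L) * x)) = x"
proof -
  have "arcsin (sin (pi / (2 * L) * x)) = pi / (2 * L) * x"
  proof (rule arcsin_sin)
    have "pi / (2 * L) * - L \<le> pi / (2 * L) * x" "pi / (2 * L) * x \<le> pi / (2 * L) * L"
      using assms by (intro mult_left_mono; simp)+
    then show "- (pi / 2) \<le> pi / (2 * L) * x" "pi / (2 * L) * x \<le> pi / 2" using assms by simp_all
  qed
  then show ?thesis using assms by simp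
qed

text \<open>Stone--Weierstrass is applied in the variables \<open>sin (\<pi> x\<^sub>p / 2L)\<close>, which turns a polynomial
  approximation on a cube into a trigonometric sum that is bounded everywhere.\<close>

lemma trig_sum_approximation:
  fixes \<phi> :: "('i::countable \<Rightarrow> real) \<Rightarrow> real"
  assumes I: "finite I" and cont: "continuous_on UNIV \<phi>" and bound: "\<And>x. \<bar>\<phi> x\<bar> \<le> B"
    and e: "e > 0" and L: "L > 0"
  shows "\<exists>t\<in>trig_sums I. \<forall>x. \<bar>\<phi> (restrict x I) - t x\<bar> \<le> e + 2 * B * (\<Sum>p\<in>I. \<bar>x p\<bar>) / L"
proof -
  define \<sigma> where "\<sigma> x = (\<lambda>p. if p \<in> I then sin (pi / (2 * L) * x p) else 0)" for x :: "'i \<Rightarrow> real"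
  \<comment> \<open>Coordinates outside \<open>I\<close> are pinned to 0, so \<open>K\<close> is
    compact in the full product and its points are separated by the coordinates in \<open>I\<close>.
    The function \<open>\<psi>\<close> inverts the sine substitution and puts
    \<open>undefined\<close> outside \<open>I\<close>, to match \<open>restrict\<close>.\<close>
  define K where "K = PiE UNIV (\<lambda>p. if p \<in> I then {-1..1::real} else {0})"
  define \<psi> where "\<psi> s = \<phi> (\<lambda>p. if p \<in> I then 2 * L / pi * arcsin (s p) else undefined)" for s
  have comp: "compact K"
  proof -
    have "compactin (product_topology (\<lambda>_. euclideanreal) UNIV) K"
      unfolding K_def by (subst compactin_PiE) (auto simp: compactin_euclidean_iff)
    then show ?thesis by (simp add: euclidean_product_topology compactin_euclidean_iff)
  qed
  have K: "s p \<in> (if p \<in> I then {-1..1} else {0})" if "s \<in> K" for s p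
    using that by (auto simp: K_def PiE_iff)
  have coord: "continuous_on S (\<lambda>s. s p)" for S :: "('i \<Rightarrow> real) set" and p
    by (rule continuous_on_subset[OF continuous_on_product_coordinates]) simp
  have \<psi>: "continuous_on K \<psi>"
    unfolding \<psi>_def
  proof (rule continuous_on_compose2[OF cont])
    show "continuous_on K (\<lambda>s p. if p \<in> I then 2 * L / pi * arcsin (s p) else undefined)"
    proof (rule continuous_on_coordinatewise_then_product)
      fix p
      show "continuous_on K (\<lambda>s. if p \<in> I then 2 * L / pi * arcsin (s p) else undefined)"
      proof (cases "p \<in> I")
        case True
        then show ?thesis
          using K[where p = p] by (auto intro!: continuous_intros coord)
      qed simp
    qed
  qed simp
  \<comment> \<open>Membership is decided by the pullback along \<open>\<sigma>\<close>, so whatever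
    approximant is found is a trigonometric sum in \<open>x\<close> by construction.\<close>
  define A where "A = {g. continuous_on K g \<and> (\<lambda>x. g (\<sigma> x)) \<in> trig_sums I}"
  interpret function_ring_on A K
  proof
    fix s s' assume s: "s \<in> K" "s' \<in> K" "s \<noteq> s'"
    then obtain p where p: "s p \<noteq> s' p" by blast
    then have "p \<in> I" using K[OF s(1), of p] K[OF s(2), of p] by (cases "p \<in> I") auto
    then have "(\<lambda>s. s p) \<in> A"
      using trig_sums_sin[OF I, of p "pi / (2 * L)"] by (simp add: A_def coord \<sigma>_def)
    then show "\<exists>f\<in>A. f s \<noteq> f s'" using p by (intro bexI[of _ "\<lambda>s. s p"])
  next
    fix f g assume "f \<in> A" "g \<in> A"
    then have fg: "continuous_on K f" "continuous_on K g"
      "(\<lambda>x. f (\<sigma> x)) \<in> trig_sums I" "(\<lambda>x. g (\<sigma> x)) \<in> trig_sums I"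
      by (simp_all add: A_def)
    show "(\<lambda>x. f x + g x) \<in> A"
      unfolding A_def mem_Collect_eq using continuous_on_add[OF fg(1,2)] trig_sums.add[OF fg(3,4)] by (rule conjI)
    show "(\<lambda>x. f x * g x) \<in> A"
      unfolding A_def mem_Collect_eq using continuous_on_mult[OF fg(1,2)] trig_sums_mult[OF fg(3,4)] by (rule conjI)
  qed (simp_all add: A_def comp trig_sums_const)
  obtain g where g: "g \<in> A" and approx: "\<And>s. s \<in> K \<Longrightarrow> \<bar>\<psi> s - g s\<bar> < e"
    using Stone_Weierstrass_basic[OF \<psi> e] by blast
  show ?thesis
  proof (intro bexI allI)
    show "(\<lambda>x. g (\<sigma> x)) \<in> trig_sums I" using g by (simp add: A_def)
    fix x :: "'i \<Rightarrow> real"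
    have "\<sigma> x \<in> K" by (auto simp: K_def \<sigma>_def)
    then have *: "\<bar>\<psi> (\<sigma> x) - g (\<sigma> x)\<bar> < e" by (rule approx)
    have B: "0 \<le> B" using bound[of undefined] by linarith
    show "\<bar>\<phi> (restrict x I) - g (\<sigma> x)\<bar> \<le> e + 2 * B * (\<Sum>p\<in>I. \<bar>x p\<bar>) / L"
    proof (cases "\<forall>p\<in>I. \<bar>x p\<bar> \<le> L")
      case True
      then have "\<psi> (\<sigma> x) = \<phi> (restrict x I)"
        unfolding \<psi>_def \<sigma>_def
        by (intro arg_cong[of _ _ \<phi>] ext) (use arcsin_sin_scaled[OF L, of "x _"] in auto)
      moreover have "0 \<le> 2 * B * (\<Sum>p\<in>I. \<bar>x p\<bar>) / L" using B L by (simp add: sum_nonneg)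
      ultimately show ?thesis using * by linarith
    next
      \<comment> \<open>Outside the cube the two functions differ by at most
        \<open>2 * B + e\<close>, while the sum of the moduli divided by \<open>L\<close> is at
        least 1 and pays for \<open>2 * B\<close>, as in Markov's inequality.\<close>
      case False
      then obtain p where p: "p \<in> I" "L < \<bar>x p\<bar>" by force
      have "\<bar>x p\<bar> \<le> (\<Sum>p\<in>I. \<bar>x p\<bar>)" using I p by (intro member_le_sum) auto
      then have "1 \<le> (\<Sum>p\<in>I. \<bar>x p\<bar>) / L" using p L by (simp add: field_simps)
      then have "2 * B * 1 \<le> 2 * B * ((\<Sum>p\<in>I. \<bar>x p\<bar>) / L)" using B by (intro mult_left_mono) auto
      moreover have "\<bar>\<phi> (restrict x I)\<bar> \<le> B" "\<bar>\<psi> (\<sigma> x)\<bar> \<le> B" using bound by (auto simp: \<psi>_def)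
      ultimately show ?thesis using * by (simp add: mult.assoc)
    qed
  qed
qed

lemma borel_measurable_continuous_restrict:
  fixes \<phi> :: "('i::countable \<Rightarrow> real) \<Rightarrow> real"
  assumes "continuous_on UNIV \<phi>" and X: "\<And>p. p \<in> I \<Longrightarrow> X p \<in> borel_measurable M"
  shows "(\<lambda>w. \<phi> (\<lambda>p\<in>I. X p w)) \<in> borel_measurable M"
proof -
  have "(\<lambda>w. \<lambda>p\<in>I. X p w) \<in> borel_measurable M"
  proof (rule measurable_coordinatewise_then_product)
    show "(\<lambda>w. (\<lambda>p\<in>I. X p w) p) \<in> borel_measurable M" for p
      using X by (cases "p \<in> I") auto
  qed
  then show ?thesis
    using borel_measurable_continuous_onI[OF assms(1)] by measurable
qed

lemma (in prob_space) integrable_iexp_real: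
  assumes "Y \<in> borel_measurable M"
  shows "integrable M (\<lambda>w. iexp (Y w))"
  using assms by (intro integrable_const_bound[of _ 1]) auto

lemma (in prob_space) trig_sums_integrable:
  assumes "t \<in> trig_sums I" and X: "\<And>p. p \<in> I \<Longrightarrow> X p \<in> borel_measurable M"
  shows "integrable M (\<lambda>w. t (\<lambda>p. X p w))"
  using assms(1)
proof induction
  case (wave c u)
  show ?case
    by (intro integrable_Re integrable_mult_right integrable_iexp_real borel_measurable_sum borel_measurable_times
        borel_measurable_const X)
qed auto

lemma trig_sums_convergence:
  assumes t: "t \<in> trig_sums I"
    and Q: "\<And>n. prob_space (Q n)" and P: "prob_space P"
    and X: "\<And>n p. p \<in> I \<Longrightarrow> X n p \<in> borel_measurable (Q n)"
    and Y: "\<And>p. p \<in> I \<Longrightarrow> Y p \<in> borel_measurable P"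
    and char: "\<And>u. (\<lambda>n. \<integral>w. iexp (\<Sum>p\<in>I. u p * X n p w) \<partial>Q n) \<longlonglongrightarrow> (\<integral>w. iexp (\<Sum>p\<in>I. u p * Y p w) \<partial>P)"
  shows "(\<lambda>n. \<integral>w. t (\<lambda>p. X n p w) \<partial>Q n) \<longlonglongrightarrow> (\<integral>w. t (\<lambda>p. Y p w) \<partial>P)"
  using t
proof induction
  case (wave c u)
  have *: "(\<integral>w. Re (c * iexp (\<Sum>p\<in>I. u p * Z p w)) \<partial>N) = Re (c * (\<integral>w. iexp (\<Sum>p\<in>I. u p * Z p w) \<partial>N))"
    if N: "prob_space N" and Z: "\<And>p. p \<in> I \<Longrightarrow> Z p \<in> borel_measurable N" for N :: "'z measure" and Z
  proof -
    have "integrable N (\<lambda>w. iexp (\<Sum>p\<in>I. u p * Z p w))"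
      by (intro prob_space.integrable_iexp_real[OF N] borel_measurable_sum borel_measurable_times borel_measurable_const Z)
    then have i: "integrable N (\<lambda>w. c * iexp (\<Sum>p\<in>I. u p * Z p w))" by (rule integrable_mult_right)
    show ?thesis unfolding integral_Re[OF i] integral_mult_right_zero ..
  qed
  have "(\<integral>w. Re (c * iexp (\<Sum>p\<in>I. u p * X n p w)) \<partial>Q n) = Re (c * (\<integral>w. iexp (\<Sum>p\<in>I. u p * X n p w) \<partial>Q n))" for n
    by (rule *[OF Q]) (rule X)
  moreover have "(\<integral>w. Re (c * iexp (\<Sum>p\<in>I. u p * Y p w)) \<partial>P) = Re (c * (\<integral>w. iexp (\<Sum>p\<in>I. u p * Y p w) \<partial>P))"
    by (rule *[OF P]) (rule Y)
  ultimately show ?case by (simp only:) (intro tendsto_intros char)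
next
  case (add f g)
  have "(\<integral>w. f (\<lambda>p. Z p w) + g (\<lambda>p. Z p w) \<partial>N) = (\<integral>w. f (\<lambda>p. Z p w) \<partial>N) + (\<integral>w. g (\<lambda>p. Z p w) \<partial>N)"
    if N: "prob_space N" and Z: "\<And>p. p \<in> I \<Longrightarrow> Z p \<in> borel_measurable N" for N :: "'z measure" and Z
  proof (rule Bochner_Integration.integral_add)
    show "integrable N (\<lambda>w. f (\<lambda>p. Z p w))" by (rule prob_space.trig_sums_integrable[OF N add.hyps(1)]) (rule Z)
    show "integrable N (\<lambda>w. g (\<lambda>p. Z p w))" by (rule prob_space.trig_sums_integrable[OF N add.hyps(2)]) (rule Z)
  qed
  note * = this
  have "(\<integral>w. f (\<lambda>p. X n p w) + g (\<lambda>p. X n p w) \<partial>Q n) = (\<integral>w. f (\<lambda>p. X n p w) \<partial>Q n) + (\<integral>w. g (\<lambda>p. X n p w) \<partial>Q n)" for n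
    by (rule *[OF Q]) (rule X)
  moreover have "(\<integral>w. f (\<lambda>p. Y p w) + g (\<lambda>p. Y p w) \<partial>P) = (\<integral>w. f (\<lambda>p. Y p w) \<partial>P) + (\<integral>w. g (\<lambda>p. Y p w) \<partial>P)"
    by (rule *[OF P]) (rule Y)
  ultimately show ?case
    using tendsto_add[OF add.IH] by (simp only:)
qed

text \<open>Bounded first moments serve as tightness. A trigonometric sum approximates
  \<open>\<phi>\<close> with an error linear in the coordinates and divided by \<open>L\<close>, so
  the error in mean is small uniformly in \<open>n\<close> once \<open>L\<close> is large. For the
  trigonometric sum itself, convergence is that of the characteristic functions.\<close>

theorem weak_convergence_from_char:
  fixes X :: "nat \<Rightarrow> 'i::countable \<Rightarrow> 'b \<Rightarrow> real" and Y :: "'i \<Rightarrow> 'v \<Rightarrow> real"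
    and \<phi> :: "('i \<Rightarrow> real) \<Rightarrow> real"
  assumes I: "finite I"
    and Q: "\<And>n. prob_space (Q n)" and P: "prob_space P"
    and X: "\<And>n p. p \<in> I \<Longrightarrow> integrable (Q n) (X n p)" "\<And>n p. p \<in> I \<Longrightarrow> (\<integral>w. \<bar>X n p w\<bar> \<partial>Q n) \<le> C p"
    and Y: "\<And>p. p \<in> I \<Longrightarrow> integrable P (Y p)" 
    and char: "\<And>u. (\<lambda>n. \<integral>w. iexp (\<Sum>p\<in>I. u p * X n p w) \<partial>Q n) \<longlonglongrightarrow> (\<integral>w. iexp (\<Sum>p\<in>I. u p * Y p w) \<partial>P)"
    and cont: "continuous_on UNIV \<phi>" and bound: "\<And>x. \<bar>\<phi> x\<bar> \<le> B"
  shows "(\<lambda>n. \<integral>w. \<phi> (\<lambda>p\<in>I. X n p w) \<partial>Q n) \<longlonglongrightarrow> (\<integral>w. \<phi> (\<lambda>p\<in>I. Y p w) \<partial>P)"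
proof (rule LIMSEQ_I)
  fix r :: real assume r: "r > 0"
  define C' where "C' = (\<Sum>p\<in>I. max 0 (C p)) + (\<Sum>p\<in>I. \<integral>w. \<bar>Y p w\<bar> \<partial>P)"
  have C': "0 \<le> C'" unfolding C'_def by (intro add_nonneg_nonneg sum_nonneg) auto
  have B: "0 \<le> B" using bound[of undefined] by linarith
  define D where "D = 2 * B * (real (card I) * C')"
  have D: "0 \<le> D" using B C' by (simp add: D_def)
  \<comment> \<open>\<open>D + 1\<close> keeps \<open>L\<close> positive when \<open>D = 0\<close>,
    and \<open>D / L\<close> stays below \<open>r / 8\<close>.\<close>
  define L where "L = (D + 1) / (r / 8)"
  have L: "L > 0" using D r by (simp add: L_def)
  have DL: "D / L \<le> r / 8"
    using D r by (simp add: L_def field_simps)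
  obtain t where t: "t \<in> trig_sums I"
    and approx: "\<And>x. \<bar>\<phi> (restrict x I) - t x\<bar> \<le> r / 8 + 2 * B * (\<Sum>p\<in>I. \<bar>x p\<bar>) / L"
    using trig_sum_approximation[OF I cont bound, of "r / 8" L] r L by auto
  have diff: "\<bar>(\<integral>w. \<phi> (\<lambda>p\<in>I. Z p w) \<partial>N) - (\<integral>w. t (\<lambda>p. Z p w) \<partial>N)\<bar> \<le> r / 4"
    if N: "prob_space N" and Z: "\<And>p. p \<in> I \<Longrightarrow> integrable N (Z p)" "\<And>p. p \<in> I \<Longrightarrow> (\<integral>w. \<bar>Z p w\<bar> \<partial>N) \<le> C'"
    for N :: "'z measure" and Z
  proof -
    interpret N: prob_space N by (rule N)
    have int_t: "integrable N (\<lambda>w. t (\<lambda>p. Z p w))"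
      using Z by (intro N.trig_sums_integrable[OF t]) auto
    have int_\<phi>: "integrable N (\<lambda>w. \<phi> (\<lambda>p\<in>I. Z p w))"
      using Z bound by (intro N.integrable_const_bound[of _ B] borel_measurable_continuous_restrict[OF cont]) auto
    have int_s: "integrable N (\<lambda>w. r / 8 + 2 * B * (\<Sum>p\<in>I. \<bar>Z p w\<bar>) / L)"
      using Z by (intro Bochner_Integration.integrable_add integrable_divide integrable_mult_right Bochner_Integration.integrable_sum) auto
    have "\<bar>(\<integral>w. \<phi> (\<lambda>p\<in>I. Z p w) \<partial>N) - (\<integral>w. t (\<lambda>p. Z p w) \<partial>N)\<bar> =
        \<bar>\<integral>w. \<phi> (\<lambda>p\<in>I. Z p w) - t (\<lambda>p. Z p w) \<partial>N\<bar>"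
      using int_t int_\<phi> by simp
    also have "\<dots> \<le> (\<integral>w. \<bar>\<phi> (\<lambda>p\<in>I. Z p w) - t (\<lambda>p. Z p w)\<bar> \<partial>N)"
      by (rule integral_abs_bound)
    also have "\<dots> \<le> (\<integral>w. r / 8 + 2 * B * (\<Sum>p\<in>I. \<bar>Z p w\<bar>) / L \<partial>N)"
      using int_t int_\<phi> int_s approx[of "\<lambda>p. Z p _"] by (intro integral_mono) auto
    also have "\<dots> = r / 8 + 2 * B * (\<Sum>p\<in>I. \<integral>w. \<bar>Z p w\<bar> \<partial>N) / L"
      using Z by (subst Bochner_Integration.integral_add) (auto simp: N.prob_space Bochner_Integration.integral_sum)
    also have "\<dots> \<le> r / 8 + D / L"
    proof -
      have "(\<Sum>p\<in>I. \<integral>w. \<bar>Z p w\<bar> \<partial>N) \<le> (\<Sum>p\<in>I. C')" using Z by (intro sum_mono)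
      then have "2 * B * (\<Sum>p\<in>I. \<integral>w. \<bar>Z p w\<bar> \<partial>N) \<le> D"
        unfolding D_def using B by (intro mult_left_mono) auto
      then show ?thesis using L by (simp add: divide_right_mono)
    qed
    finally show ?thesis using DL by linarith
  qed
  have dX: "\<bar>(\<integral>w. \<phi> (\<lambda>p\<in>I. X n p w) \<partial>Q n) - (\<integral>w. t (\<lambda>p. X n p w) \<partial>Q n)\<bar> \<le> r / 4" for n
  proof (rule diff[OF Q])
    show "integrable (Q n) (X n p)" if "p \<in> I" for p using that by (rule X(1))
    fix p assume "p \<in> I"
    have "(\<integral>w. \<bar>X n p w\<bar> \<partial>Q n) \<le> C p" by (rule X(2)) fact
    also have "C p \<le> max 0 (C p)" by simp
    also have "\<dots> \<le> (\<Sum>p\<in>I. max 0 (C p))" by (rule member_le_sum[OF \<open>p \<in> I\<close>]) (auto simp: I)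
    also have "\<dots> \<le> C'" unfolding C'_def by (simp add: sum_nonneg)
    finally show "(\<integral>w. \<bar>X n p w\<bar> \<partial>Q n) \<le> C'" .
  qed
  have dY: "\<bar>(\<integral>w. \<phi> (\<lambda>p\<in>I. Y p w) \<partial>P) - (\<integral>w. t (\<lambda>p. Y p w) \<partial>P)\<bar> \<le> r / 4"
  proof (rule diff[OF P])
    show "integrable P (Y p)" if "p \<in> I" for p using that by (rule Y)
    fix p assume p: "p \<in> I"
    have "(\<integral>w. \<bar>Y p w\<bar> \<partial>P) \<le> (\<Sum>p\<in>I. \<integral>w. \<bar>Y p w\<bar> \<partial>P)"
      by (rule member_le_sum[OF p]) (auto simp: I)
    also have "\<dots> \<le> C'" unfolding C'_def by (simp add: sum_nonneg)
    finally show "(\<integral>w. \<bar>Y p w\<bar> \<partial>P) \<le> C'" .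
  qed
  have "(\<lambda>n. \<integral>w. t (\<lambda>p. X n p w) \<partial>Q n) \<longlonglongrightarrow> (\<integral>w. t (\<lambda>p. Y p w) \<partial>P)"
    using X Y by (intro trig_sums_convergence[OF t Q P _ _ char]) auto
  from LIMSEQ_D[OF this, of "r / 4"] r
  obtain n0 where n0: "\<And>n. n \<ge> n0 \<Longrightarrow> \<bar>(\<integral>w. t (\<lambda>p. X n p w) \<partial>Q n) - (\<integral>w. t (\<lambda>p. Y p w) \<partial>P)\<bar> < r / 4"
    unfolding real_norm_def by auto
  show "\<exists>n0. \<forall>n\<ge>n0. norm ((\<integral>w. \<phi> (\<lambda>p\<in>I. X n p w) \<partial>Q n) - (\<integral>w. \<phi> (\<lambda>p\<in>I. Y p w) \<partial>P)) < r"
  proof (intro exI[of _ n0] allI impI)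
    fix n assume "n \<ge> n0"
    from n0[OF this] dX[of n] dY r
    show "norm ((\<integral>w. \<phi> (\<lambda>p\<in>I. X n p w) \<partial>Q n) - (\<integral>w. \<phi> (\<lambda>p\<in>I. Y p w) \<partial>P)) < r"
      unfolding real_norm_def by linarith
  qed
qed

subsection \<open>Path integrals and random sampling times\<close>

text \<open>Products of two different centred summands have mean zero, so of the
  \<open>m * m\<close> terms only \<open>m\<close> variances remain, each at most the second
  moment.\<close>

lemma (in prob_space) mean_square_average:
  fixes X :: "nat \<Rightarrow> 'a \<Rightarrow> real"
  assumes ind: "indep_vars (\<lambda>_. borel) X {..<m}" and m: "0 < m"
    and int: "\<And>j. j < m \<Longrightarrow> integrable M (\<lambda>w. (X j w)\<^sup>2)"
    and mean: "\<And>j. j < m \<Longrightarrow> expectation (X j) = \<mu>"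
    and C: "\<And>j. j < m \<Longrightarrow> expectation (\<lambda>w. (X j w)\<^sup>2) \<le> C"
  shows "integrable M (\<lambda>w. (1 / real m * (\<Sum>j<m. X j w) - \<mu>)\<^sup>2)"
    and "expectation (\<lambda>w. (1 / real m * (\<Sum>j<m. X j w) - \<mu>)\<^sup>2) \<le> C / real m"
proof -
  have meas: "X j \<in> borel_measurable M" if "j < m" for j
    using ind that by (auto simp: indep_vars_def)
  have int1: "integrable M (X j)" if "j < m" for j
    by (rule square_integrable_imp_integrable[OF meas int]) (use that in auto)
  have prod: "integrable M (\<lambda>w. (X i w - \<mu>) * (X j w - \<mu>))"
    "expectation (\<lambda>w. (X i w - \<mu>) * (X j w - \<mu>)) = (if i = j then expectation (\<lambda>w. (X i w)\<^sup>2) - \<mu>\<^sup>2 else 0)"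
    if ij: "i < m" "j < m" for i j
  proof -
    have "integrable M (\<lambda>w. X i w * X j w) \<and>
      expectation (\<lambda>w. X i w * X j w) = (if i = j then expectation (\<lambda>w. (X i w)\<^sup>2) else \<mu>\<^sup>2)"
    proof (cases "i = j")
      case True
      then show ?thesis using int ij by (simp add: power2_eq_square)
    next
      case False
      have *: "indep_vars (\<lambda>_. borel) X {i, j}" by (rule indep_vars_subset[OF ind]) (use ij in auto)
      have "integrable M (\<lambda>w. \<Prod>l\<in>{i, j}. X l w)"
        by (rule indep_vars_integrable[OF _ *]) (use int1 ij in auto)
      moreover have "expectation (\<lambda>w. \<Prod>l\<in>{i, j}. X l w) = (\<Prod>l\<in>{i, j}. expectation (X l))"
        by (rule indep_vars_lebesgue_integral[OF _ *]) (use int1 ij in auto)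
      ultimately show ?thesis using False mean ij by (simp add: power2_eq_square)
    qed
    note 1 = this
    have eq: "(X i w - \<mu>) * (X j w - \<mu>) = X i w * X j w - \<mu> * X i w - \<mu> * X j w + \<mu>\<^sup>2" for w
      by (simp add: algebra_simps power2_eq_square)
    show "integrable M (\<lambda>w. (X i w - \<mu>) * (X j w - \<mu>))"
      unfolding eq using 1 int1 ij by simp
    show "expectation (\<lambda>w. (X i w - \<mu>) * (X j w - \<mu>)) = (if i = j then expectation (\<lambda>w. (X i w)\<^sup>2) - \<mu>\<^sup>2 else 0)"
      unfolding eq using 1 int1 ij mean by (simp add: prob_space power2_eq_square)
  qed
  have eq: "(1 / real m * (\<Sum>j<m. X j w) - \<mu>)\<^sup>2 = (1 / real m)\<^sup>2 * (\<Sum>i<m. \<Sum>j<m. (X i w - \<mu>) * (X j w - \<mu>))" for w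
  proof -
    have "1 / real m * (\<Sum>j<m. X j w) - \<mu> = 1 / real m * (\<Sum>j<m. X j w - \<mu>)"
      using m by (simp add: sum_subtractf field_simps)
    then show ?thesis by (simp add: power_mult_distrib power2_eq_square sum_product)
  qed
  show "integrable M (\<lambda>w. (1 / real m * (\<Sum>j<m. X j w) - \<mu>)\<^sup>2)"
    unfolding eq by (intro integrable_mult_right Bochner_Integration.integrable_sum prod) auto
  have "expectation (\<lambda>w. (1 / real m * (\<Sum>j<m. X j w) - \<mu>)\<^sup>2) =
      (1 / real m)\<^sup>2 * (\<Sum>i<m. \<Sum>j<m. expectation (\<lambda>w. (X i w - \<mu>) * (X j w - \<mu>)))"
  proof -
    have "expectation (\<lambda>w. \<Sum>i<m. \<Sum>j<m. (X i w - \<mu>) * (X j w - \<mu>)) =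
        (\<Sum>i<m. expectation (\<lambda>w. \<Sum>j<m. (X i w - \<mu>) * (X j w - \<mu>)))"
      by (rule Bochner_Integration.integral_sum) (auto intro!: Bochner_Integration.integrable_sum prod)
    also have "\<dots> = (\<Sum>i<m. \<Sum>j<m. expectation (\<lambda>w. (X i w - \<mu>) * (X j w - \<mu>)))"
      by (intro sum.cong refl Bochner_Integration.integral_sum) (auto intro!: prod)
    finally show ?thesis unfolding eq integral_mult_right_zero by simp
  qed
  also have "(\<Sum>i<m. \<Sum>j<m. expectation (\<lambda>w. (X i w - \<mu>) * (X j w - \<mu>))) = (\<Sum>i<m. expectation (\<lambda>w. (X i w)\<^sup>2) - \<mu>\<^sup>2)"
    by (intro sum.cong refl) (simp add: prod(2))
  also have "\<dots> \<le> (\<Sum>i<m. C)"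
  proof (rule sum_mono)
    fix i assume "i \<in> {..<m}"
    then show "expectation (\<lambda>w. (X i w)\<^sup>2) - \<mu>\<^sup>2 \<le> C" using C[of i] zero_le_power2[of \<mu>] unfolding lessThan_iff by linarith
  qed
  also have "(1 / real m)\<^sup>2 * (\<Sum>i<m. C) = C / real m" using m by (simp add: power2_eq_square)
  finally show "expectation (\<lambda>w. (1 / real m * (\<Sum>j<m. X j w) - \<mu>)\<^sup>2) \<le> C / real m"
    by (simp add: mult_left_mono)
qed

text \<open>Passes from second moments to first absolute moments with a free parameter and without
  square roots; it takes the place of Jensen's inequality.\<close>

lemma abs_le_add_square_div:
  fixes x \<delta> :: real
  assumes "\<delta> > 0"
  shows "\<bar>x\<bar> \<le> \<delta> + x\<^sup>2 / \<delta>"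
proof (cases "\<bar>x\<bar> \<le> \<delta>")
  case False
  then have "\<bar>x\<bar> * \<delta> \<le> \<bar>x\<bar> * \<bar>x\<bar>" by (intro mult_left_mono) auto
  then have "\<bar>x\<bar> \<le> x\<^sup>2 / \<delta>" using assms by (simp add: field_simps power2_eq_square abs_mult_self_eq)
  then show ?thesis using assms by simp
qed (use assms in \<open>simp add: add_increasing2\<close>)

lemma (in prob_space) mean_abs_average:
  fixes X :: "nat \<Rightarrow> 'a \<Rightarrow> real"
  assumes ind: "indep_vars (\<lambda>_. borel) X {..<m}" and m: "0 < m"
    and int: "\<And>j. j < m \<Longrightarrow> integrable M (\<lambda>w. (X j w)\<^sup>2)"
    and mean: "\<And>j. j < m \<Longrightarrow> expectation (X j) = \<mu>"
    and C: "\<And>j. j < m \<Longrightarrow> expectation (\<lambda>w. (X j w)\<^sup>2) \<le> C"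
    and \<delta>: "\<delta> > 0"
  shows "integrable M (\<lambda>w. 1 / real m * (\<Sum>j<m. X j w) - \<mu>)"
    and "expectation (\<lambda>w. \<bar>1 / real m * (\<Sum>j<m. X j w) - \<mu>\<bar>) \<le> \<delta> + C / (\<delta> * real m)"
proof -
  note sq = mean_square_average[OF ind m int mean C]
  have meas: "X j \<in> borel_measurable M" if "j < m" for j
    using ind that by (auto simp: indep_vars_def)
  show int': "integrable M (\<lambda>w. 1 / real m * (\<Sum>j<m. X j w) - \<mu>)"
    by (rule square_integrable_imp_integrable[OF _ sq(1)]) (use meas in \<open>auto intro!: borel_measurable_diff borel_measurable_sum borel_measurable_divide borel_measurable_times\<close>)
  have "expectation (\<lambda>w. \<bar>1 / real m * (\<Sum>j<m. X j w) - \<mu>\<bar>) \<le>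
      expectation (\<lambda>w. \<delta> + (1 / real m * (\<Sum>j<m. X j w) - \<mu>)\<^sup>2 / \<delta>)"
    using int' sq(1) by (intro integral_mono abs_le_add_square_div \<delta> integrable_abs Bochner_Integration.integrable_add) auto
  also have "\<dots> = \<delta> + expectation (\<lambda>w. (1 / real m * (\<Sum>j<m. X j w) - \<mu>)\<^sup>2) / \<delta>"
    using sq(1) by (subst Bochner_Integration.integral_add) (auto simp: prob_space)
  also have "\<dots> \<le> \<delta> + C / real m / \<delta>"
    using sq(2) \<delta> by (intro add_left_mono divide_right_mono) auto
  finally show "expectation (\<lambda>w. \<bar>1 / real m * (\<Sum>j<m. X j w) - \<mu>\<bar>) \<le> \<delta> + C / (\<delta> * real m)"
    by (simp add: mult.commute)
qed

lemma indep_vars_PiM_components: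
  assumes "\<And>i. i \<in> I \<Longrightarrow> prob_space (N i)"
  shows "prob_space.indep_vars (PiM I N) N (\<lambda>i x. x i) I"
proof -
  interpret P: prob_space "PiM I N" by (rule prob_space_PiM) fact
  show ?thesis
  proof (cases "I = {}")
    case True
    then show ?thesis unfolding P.indep_vars_def P.indep_sets_def by auto
  next
    case False
    have "distr (PiM I N) (PiM I N) (\<lambda>x. \<lambda>i\<in>I. x i) = distr (PiM I N) (PiM I N) (\<lambda>x. x)"
      by (intro distr_cong) (auto simp: space_PiM PiE_iff extensional_restrict)
    also have "\<dots> = PiM I N" by (simp add: distr_id)
    also have "\<dots> = PiM I (\<lambda>i. distr (PiM I N) (N i) (\<lambda>x. x i))"
      using assms by (intro PiM_cong) (auto simp: distr_PiM_component)
    finally show ?thesis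
      using False by (subst P.indep_vars_iff_distr_eq_PiM') auto
  qed
qed

section \<open>Characteristic functions of path integrals\<close>

lemma norm_iexp_diff_le: "cmod (iexp x - iexp y) \<le> \<bar>x - y\<bar>"
proof -
  have "iexp x - iexp y = iexp y * (iexp (x - y) - 1)"
    by (simp add: algebra_simps flip: exp_add)
  then have "cmod (iexp x - iexp y) = cmod (iexp (x - y) - 1)"
    by (simp add: norm_mult)
  also have "\<dots> \<le> \<bar>x - y\<bar>"
    using iexp_approx1[of "x - y" 0] by simp
  finally show ?thesis .
qed

text \<open>A path integral is compared with the average over \<open>m\<close> independent uniform sampling times; the
  error bound depends on the process only through its second moment.\<close>

lemma monte_carlo_char:
  fixes f :: "'b \<Rightarrow> 't \<Rightarrow> real"
  assumes U: "prob_space U" and Q: "prob_space Q"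
    and f [measurable]: "case_prod f \<in> borel_measurable (Q \<Otimes>\<^sub>M U)"
    and C: "(\<integral>\<^sup>+u. \<integral>\<^sup>+t. ennreal ((f u t)\<^sup>2) \<partial>U \<partial>Q) \<le> ennreal C" and C0: "0 \<le> C"
    and m: "0 < m" and \<delta>: "0 < \<delta>"
  shows "cmod ((\<integral>u. iexp (\<integral>t. f u t \<partial>U) \<partial>Q) -
      (\<integral>\<theta>. \<integral>u. iexp (1 / real m * (\<Sum>p<m. f u (\<theta> p))) \<partial>Q \<partial>(PiM {..<m} (\<lambda>_. U)))) \<le> \<delta> + C / (\<delta> * real m)"
    and "(\<lambda>\<theta>. \<integral>u. iexp (1 / real m * (\<Sum>p<m. f u (\<theta> p))) \<partial>Q) \<in> borel_measurable (PiM {..<m} (\<lambda>_. U))"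
proof -
  define \<Omega> where "\<Omega> = PiM {..<m} (\<lambda>_. U)"
  interpret U: prob_space U by (rule U)
  interpret Q: prob_space Q by (rule Q)
  interpret P: prob_space \<Omega> unfolding \<Omega>_def by (rule prob_space_PiM) (rule U)
  interpret QP: pair_prob_space Q \<Omega> ..
  define S where "S u = (\<integral>t. f u t \<partial>U)" for u
  define A where "A u \<theta> = 1 / real m * (\<Sum>p<m. f u (\<theta> p))" for u \<theta>
  have S [measurable]: "S \<in> borel_measurable Q" unfolding S_def by measurable
  have A [measurable]: "case_prod A \<in> borel_measurable (Q \<Otimes>\<^sub>M \<Omega>)"
  proof -
    have "(\<lambda>x. f (fst x) (snd x p)) \<in> borel_measurable (Q \<Otimes>\<^sub>M \<Omega>)" if "p < m" for p
    proof -
      have "(\<lambda>x. (fst x, snd x p)) \<in> Q \<Otimes>\<^sub>M \<Omega> \<rightarrow>\<^sub>M Q \<Otimes>\<^sub>M U"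
        unfolding \<Omega>_def
        by (intro measurable_Pair measurable_fst measurable_compose[OF measurable_snd measurable_component_singleton])
           (use that in simp)
      from measurable_compose[OF this f] show ?thesis by simp
    qed
    then show ?thesis
      unfolding A_def case_prod_beta by (intro borel_measurable_times borel_measurable_const borel_measurable_sum) auto
  qed
  have g: "integrable (Q \<Otimes>\<^sub>M \<Omega>) (\<lambda>(u, \<theta>). iexp (A u \<theta>))"
    by (intro QP.P.integrable_const_bound[of _ 1]) (auto simp: case_prod_beta)
  have h: "integrable (Q \<Otimes>\<^sub>M \<Omega>) (\<lambda>(u, \<theta>). iexp (S u) - iexp (A u \<theta>))"
    by (intro QP.P.integrable_const_bound[of _ 2])
       (auto simp: case_prod_beta intro!: order.trans[OF norm_triangle_ineq4])
  have int: "integrable Q (\<lambda>u. iexp (S u))" by (rule Q.integrable_iexp_real) measurable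
  have inner: "integrable Q (\<lambda>u. \<integral>\<theta>. iexp (A u \<theta>) \<partial>\<Omega>)" by (rule QP.integrable_fst[OF g])
  show "(\<lambda>\<theta>. \<integral>u. iexp (1 / real m * (\<Sum>p<m. f u (\<theta> p))) \<partial>Q) \<in> borel_measurable (PiM {..<m} (\<lambda>_. U))"
    using QP.integrable_snd[OF g] unfolding \<Omega>_def A_def by (rule borel_measurable_integrable)
  \<comment> \<open>For a fixed path the sampled values are independent with mean
    \<open>S u\<close>, so the mean absolute error of averages applies. In \<open>ennreal\<close> a
    path of infinite second moment makes the right-hand side infinite and needs no argument.\<close>
  have fibre: "(\<integral>\<^sup>+\<theta>. ennreal \<bar>S u - A u \<theta>\<bar> \<partial>\<Omega>) \<le> ennreal \<delta> + ennreal (1 / (\<delta> * real m)) * (\<integral>\<^sup>+t. ennreal ((f u t)\<^sup>2) \<partial>U)"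
    if u: "u \<in> space Q" for u
  proof (cases "(\<integral>\<^sup>+t. ennreal ((f u t)\<^sup>2) \<partial>U) = \<infinity>")
    case True
    then show ?thesis using \<delta> m by (simp add: ennreal_mult_top)
  next
    case False
    have fu [measurable]: "f u \<in> borel_measurable U" using measurable_Pair2[OF f u] by simp
    have sq: "integrable U (\<lambda>t. (f u t)\<^sup>2)"
      using False by (intro integrableI_bounded) (auto simp: top.not_eq_extremum)
    have comp: "distr \<Omega> U (\<lambda>\<theta>. \<theta> p) = U" if "p < m" for p
      unfolding \<Omega>_def using that U by (intro distr_PiM_component) auto
    have ind: "P.indep_vars (\<lambda>_. borel) (\<lambda>p \<theta>. f u (\<theta> p)) {..<m}"
      unfolding \<Omega>_def
      by (rule prob_space.indep_vars_compose2[OF prob_space_PiM indep_vars_PiM_components]) (use U in auto)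
    have coord: "(\<lambda>\<theta>. \<theta> p) \<in> \<Omega> \<rightarrow>\<^sub>M U" if "p < m" for p
      unfolding \<Omega>_def by (rule measurable_component_singleton) (use that in simp)
    have i2: "integrable \<Omega> (\<lambda>\<theta>. (f u (\<theta> p))\<^sup>2)" if "p < m" for p
      using integrable_distr[OF coord[OF that], of "\<lambda>t. (f u t)\<^sup>2"] sq by (simp add: comp that)
    have e2: "P.expectation (\<lambda>\<theta>. (f u (\<theta> p))\<^sup>2) = (\<integral>t. (f u t)\<^sup>2 \<partial>U)" if "p < m" for p
      using integral_distr[OF coord[OF that], of "\<lambda>t. (f u t)\<^sup>2"] by (simp add: comp that)
    have e1: "P.expectation (\<lambda>\<theta>. f u (\<theta> p)) = S u" if "p < m" for p
      using integral_distr[OF coord[OF that], of "f u"] by (simp add: comp that S_def)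
    note avg = P.mean_abs_average[OF ind m i2 e1 eq_refl[OF e2] \<delta>]
    have "(\<integral>\<^sup>+\<theta>. ennreal \<bar>S u - A u \<theta>\<bar> \<partial>\<Omega>) = (\<integral>\<^sup>+\<theta>. ennreal \<bar>1 / real m * (\<Sum>p<m. f u (\<theta> p)) - S u\<bar> \<partial>\<Omega>)"
      by (simp add: A_def abs_minus_commute)
    also have "\<dots> = ennreal (P.expectation (\<lambda>\<theta>. \<bar>1 / real m * (\<Sum>p<m. f u (\<theta> p)) - S u\<bar>))"
      using avg(1) by (intro nn_integral_eq_integral) auto
    also have "\<dots> \<le> ennreal (\<delta> + (\<integral>t. (f u t)\<^sup>2 \<partial>U) / (\<delta> * real m))"
      using avg(2) by (intro ennreal_leI) auto
    also have "\<dots> = ennreal \<delta> + ennreal (1 / (\<delta> * real m)) * (\<integral>\<^sup>+t. ennreal ((f u t)\<^sup>2) \<partial>U)"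
      using \<delta> m sq by (simp add: nn_integral_eq_integral ennreal_plus ennreal_mult'[symmetric])
    finally show ?thesis .
  qed
  have "(\<integral>u. iexp (S u) \<partial>Q) - (\<integral>\<theta>. \<integral>u. iexp (A u \<theta>) \<partial>Q \<partial>\<Omega>) = (\<integral>u. iexp (S u) \<partial>Q) - (\<integral>u. \<integral>\<theta>. iexp (A u \<theta>) \<partial>\<Omega> \<partial>Q)"
    using QP.integral_fst[OF g] QP.integral_snd[OF g] by simp
  also have "\<dots> = (\<integral>u. iexp (S u) - (\<integral>\<theta>. iexp (A u \<theta>) \<partial>\<Omega>) \<partial>Q)"
    using int inner by simp
  also have "\<dots> = (\<integral>u. (\<integral>\<theta>. iexp (S u) - iexp (A u \<theta>) \<partial>\<Omega>) \<partial>Q)"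
  proof (intro Bochner_Integration.integral_cong refl)
    fix u assume u: "u \<in> space Q"
    have "A u \<in> borel_measurable \<Omega>" using measurable_Pair2[OF A u] by simp
    from P.integrable_iexp_real[OF this]
    show "iexp (S u) - (\<integral>\<theta>. iexp (A u \<theta>) \<partial>\<Omega>) = (\<integral>\<theta>. iexp (S u) - iexp (A u \<theta>) \<partial>\<Omega>)"
      by (simp add: P.prob_space)
  qed
  also have "\<dots> = (\<integral>(u, \<theta>). iexp (S u) - iexp (A u \<theta>) \<partial>(Q \<Otimes>\<^sub>M \<Omega>))"
    by (rule QP.integral_fst[OF h])
  finally have "ennreal (cmod ((\<integral>u. iexp (S u) \<partial>Q) - (\<integral>\<theta>. \<integral>u. iexp (A u \<theta>) \<partial>Q \<partial>\<Omega>))) =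
      ennreal (cmod (\<integral>(u, \<theta>). iexp (S u) - iexp (A u \<theta>) \<partial>(Q \<Otimes>\<^sub>M \<Omega>)))" by simp
  also have "\<dots> \<le> (\<integral>\<^sup>+(u, \<theta>). ennreal (cmod (iexp (S u) - iexp (A u \<theta>))) \<partial>(Q \<Otimes>\<^sub>M \<Omega>))"
    unfolding case_prod_beta by (rule integral_norm_bound_ennreal[OF h[unfolded case_prod_beta]])
  also have "\<dots> \<le> (\<integral>\<^sup>+(u, \<theta>). ennreal \<bar>S u - A u \<theta>\<bar> \<partial>(Q \<Otimes>\<^sub>M \<Omega>))"
    by (intro nn_integral_mono) (auto simp: case_prod_beta norm_iexp_diff_le)
  also have "\<dots> = (\<integral>\<^sup>+u. \<integral>\<^sup>+\<theta>. ennreal \<bar>S u - A u \<theta>\<bar> \<partial>\<Omega> \<partial>Q)"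
    by (subst P.nn_integral_fst[symmetric]) (auto simp: case_prod_beta)
  also have "\<dots> \<le> (\<integral>\<^sup>+u. ennreal \<delta> + ennreal (1 / (\<delta> * real m)) * (\<integral>\<^sup>+t. ennreal ((f u t)\<^sup>2) \<partial>U) \<partial>Q)"
    by (intro nn_integral_mono fibre)
  also have "\<dots> = ennreal \<delta> + ennreal (1 / (\<delta> * real m)) * (\<integral>\<^sup>+u. \<integral>\<^sup>+t. ennreal ((f u t)\<^sup>2) \<partial>U \<partial>Q)"
    by (subst nn_integral_add) (auto simp: nn_integral_cmult Q.emeasure_space_1)
  also have "\<dots> \<le> ennreal \<delta> + ennreal (1 / (\<delta> * real m)) * ennreal C"
    by (intro add_left_mono mult_left_mono C) auto
  also have "\<dots> = ennreal (\<delta> + C / (\<delta> * real m))"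
    using \<delta> m C0 by (simp add: ennreal_plus ennreal_mult'[symmetric])
  finally show "cmod ((\<integral>u. iexp (\<integral>t. f u t \<partial>U) \<partial>Q) -
      (\<integral>\<theta>. \<integral>u. iexp (1 / real m * (\<Sum>p<m. f u (\<theta> p))) \<partial>Q \<partial>(PiM {..<m} (\<lambda>_. U)))) \<le> \<delta> + C / (\<delta> * real m)"
    using \<delta> m C0 unfolding S_def A_def \<Omega>_def by (subst (asm) ennreal_le_iff) (auto intro!: add_nonneg_nonneg)
qed

text \<open>The number \<open>m\<close> of sampling times is fixed first, from \<open>C\<close> and
  the tolerance alone, so the sampling error is at most \<open>r / 4\<close> at every stage and in
  the limit. For this \<open>m\<close>, dominated convergence over the sampling times turns
  convergence at almost every tuple into convergence of the averaged characteristic functions; these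
  are bounded by 1.\<close>

theorem char_integral_convergence:
  fixes f :: "nat \<Rightarrow> 'b \<Rightarrow> 't \<Rightarrow> real" and g :: "'v \<Rightarrow> 't \<Rightarrow> real"
  assumes U: "prob_space U" and Q: "\<And>n. prob_space (Q n)" and P: "prob_space P"
    and f: "\<And>n. case_prod (f n) \<in> borel_measurable (Q n \<Otimes>\<^sub>M U)"
    and g: "case_prod g \<in> borel_measurable (P \<Otimes>\<^sub>M U)"
    and Cf: "\<And>n. (\<integral>\<^sup>+u. \<integral>\<^sup>+t. ennreal ((f n u t)\<^sup>2) \<partial>U \<partial>Q n) \<le> ennreal C"
    and Cg: "(\<integral>\<^sup>+u. \<integral>\<^sup>+t. ennreal ((g u t)\<^sup>2) \<partial>U \<partial>P) \<le> ennreal C" and C0: "0 \<le> C"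
    and fdd: "\<And>m. 0 < m \<Longrightarrow> AE \<theta> in PiM {..<m} (\<lambda>_. U).
      (\<lambda>n. \<integral>u. iexp (1 / real m * (\<Sum>p<m. f n u (\<theta> p))) \<partial>Q n) \<longlonglongrightarrow> (\<integral>u. iexp (1 / real m * (\<Sum>p<m. g u (\<theta> p))) \<partial>P)"
  shows "(\<lambda>n. \<integral>u. iexp (\<integral>t. f n u t \<partial>U) \<partial>Q n) \<longlonglongrightarrow> (\<integral>u. iexp (\<integral>t. g u t \<partial>U) \<partial>P)"
proof (rule LIMSEQ_I)
  fix r :: real assume r: "0 < r"
  define \<delta> where "\<delta> = r / 8"
  have \<delta>: "\<delta> > 0" using r by (simp add: \<delta>_def)
  obtain m0 :: nat where m0: "C / \<delta> / \<delta> < real m0" using reals_Archimedean2 by blast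
  define m where "m = Suc m0"
  have m: "0 < m" by (simp add: m_def)
  have Cm: "C / (\<delta> * real m) \<le> \<delta>"
  proof -
    have "C / \<delta> / \<delta> \<le> real m" using m0 by (simp add: m_def)
    then have "C \<le> \<delta> * (\<delta> * real m)" using \<delta> by (simp add: field_simps)
    then show ?thesis using \<delta> m by (simp add: pos_divide_le_eq)
  qed
  define F where "F n \<theta> = (\<integral>u. iexp (1 / real m * (\<Sum>p<m. f n u (\<theta> p))) \<partial>Q n)" for n \<theta>
  define G where "G \<theta> = (\<integral>u. iexp (1 / real m * (\<Sum>p<m. g u (\<theta> p))) \<partial>P)" for \<theta>
  define \<Omega> where "\<Omega> = PiM {..<m} (\<lambda>_. U)"
  interpret P: prob_space \<Omega> unfolding \<Omega>_def by (rule prob_space_PiM) (rule U)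
  note mcf = monte_carlo_char[OF U Q f Cf C0 m \<delta>, folded F_def \<Omega>_def]
  note mcg = monte_carlo_char[OF U P g Cg C0 m \<delta>, folded G_def \<Omega>_def]
  have "(\<lambda>n. \<integral>\<theta>. F n \<theta> \<partial>\<Omega>) \<longlonglongrightarrow> (\<integral>\<theta>. G \<theta> \<partial>\<Omega>)"
  proof (rule integral_dominated_convergence)
    show "G \<in> borel_measurable \<Omega>" by (rule mcg(2))
    show "F n \<in> borel_measurable \<Omega>" for n by (rule mcf(2))
    show "integrable \<Omega> (\<lambda>_. 1 :: real)" by simp
    show "AE \<theta> in \<Omega>. (\<lambda>n. F n \<theta>) \<longlonglongrightarrow> G \<theta>"
      using fdd[OF m] unfolding \<Omega>_def F_def G_def .
    have "cmod (F n \<theta>) \<le> 1" for n \<theta>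
    proof -
      interpret Qn: prob_space "Q n" by (rule Q)
      have "cmod (F n \<theta>) \<le> (\<integral>u. cmod (iexp (1 / real m * (\<Sum>p<m. f n u (\<theta> p)))) \<partial>Q n)"
        unfolding F_def by (rule integral_norm_bound)
      then show ?thesis by (simp add: Qn.prob_space)
    qed
    then show "AE \<theta> in \<Omega>. norm (F n \<theta>) \<le> 1" for n by simp
  qed
  from LIMSEQ_D[OF this, of "r / 4"] r
  obtain n0 where n0: "\<And>n. n \<ge> n0 \<Longrightarrow> cmod ((\<integral>\<theta>. F n \<theta> \<partial>\<Omega>) - (\<integral>\<theta>. G \<theta> \<partial>\<Omega>)) < r / 4" by auto
  show "\<exists>n0. \<forall>n\<ge>n0. norm ((\<integral>u. iexp (\<integral>t. f n u t \<partial>U) \<partial>Q n) - (\<integral>u. iexp (\<integral>t. g u t \<partial>U) \<partial>P)) < r"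
  proof (intro exI[of _ n0] allI impI)
    fix n assume n: "n \<ge> n0"
    let ?a = "\<integral>u. iexp (\<integral>t. f n u t \<partial>U) \<partial>Q n" and ?b = "\<integral>u. iexp (\<integral>t. g u t \<partial>U) \<partial>P"
    let ?F = "\<integral>\<theta>. F n \<theta> \<partial>\<Omega>" and ?G = "\<integral>\<theta>. G \<theta> \<partial>\<Omega>"
    have "cmod (?a - ?b) \<le> cmod (?a - ?F) + cmod (?F - ?G) + cmod (?b - ?G)"
      using norm_triangle_ineq[of "?a - ?F + (?F - ?G)" "?G - ?b"] norm_triangle_ineq[of "?a - ?F" "?F - ?G"]
      by (simp add: norm_minus_commute)
    moreover have "cmod (?a - ?F) \<le> r / 4" using mcf(1)[of n] Cm by (simp add: \<delta>_def)
    moreover have "cmod (?b - ?G) \<le> r / 4" using mcg(1) Cm by (simp add: \<delta>_def)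
    ultimately show "cmod (?a - ?b) < r" using n0[OF n] r by linarith
  qed
qed

subsection \<open>Gaussian moments and studentized means\<close>

text \<open>Indexed by the variance and defined as an image measure, so that variance 0 gives the
  point mass at 0 without a case distinction.\<close>

definition scaled_normal :: "real \<Rightarrow> real measure" where
  "scaled_normal s = distr std_normal_distribution borel (\<lambda>x. sqrt s * x)"

lemma prob_space_std_normal: "prob_space std_normal_distribution"
  using real_distribution.axioms(1)[OF real_dist_normal_dist] .

lemma density_normal_eq_scaled_normal:
  assumes "\<sigma> > 0"
  shows "density lborel (\<lambda>x. ennreal (normal_density 0 \<sigma> x)) = scaled_normal (\<sigma>\<^sup>2)"
proof -
  interpret N: prob_space std_normal_distribution by (rule prob_space_std_normal)
  have "distributed std_normal_distribution lborel (\<lambda>x. x) std_normal_density"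
    by (auto simp: distributed_def distr_id2)
  then have "distributed std_normal_distribution lborel (\<lambda>x. 0 + \<sigma> * x) (normal_density (0 + \<sigma> * 0) (\<bar>\<sigma>\<bar> * 1))"
    using assms by (intro N.normal_density_affine) auto
  then have "distr std_normal_distribution lborel (\<lambda>x. \<sigma> * x) = density lborel (\<lambda>x. ennreal (normal_density 0 \<sigma> x))"
    using assms by (simp add: distributed_def)
  moreover have "distr std_normal_distribution lborel (\<lambda>x. \<sigma> * x) = distr std_normal_distribution borel (\<lambda>x. \<sigma> * x)"
    by (rule distr_cong) auto
  ultimately show ?thesis using assms by (simp add: scaled_normal_def)
qed

text \<open>The two integrals single out one member of the family: mean zero fixes the centre, the
  second moment is the variance, and a point mass is the case of variance 0.\<close>

lemma centered_normal_law:
  assumes P: "prob_space P" and Z [measurable]: "Z \<in> borel_measurable P"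
    and normal: "normal_law (distr P borel Z)"
    and mean: "(\<integral>w. Z w \<partial>P) = 0" and var: "(\<integral>w. Z w * Z w \<partial>P) = s"
  shows "0 \<le> s" and "distr P borel Z = scaled_normal s"
proof -
  interpret N: prob_space std_normal_distribution by (rule prob_space_std_normal)
  have E: "(\<integral>w. h (Z w) \<partial>P) = (\<integral>x. h x \<partial>distr P borel Z)" if "h \<in> borel_measurable borel" for h :: "real \<Rightarrow> real"
    using that by (simp add: integral_distr)
  have "0 \<le> s \<and> distr P borel Z = scaled_normal s"
    using normal unfolding normal_law_def
  proof (elim disjE exE conjE)
    fix m assume *: "distr P borel Z = return borel m"
    have "m = 0" using mean E[of "\<lambda>x. x"] by (simp add: * integral_return)
    moreover have "s = m * m" using var E[of "\<lambda>x. x * x"] by (simp add: * integral_return)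
    moreover have "distr std_normal_distribution borel (\<lambda>x. 0) = return borel (0 :: real)"
    proof (rule measure_eqI)
      fix A :: "real set" assume "A \<in> sets (distr std_normal_distribution borel (\<lambda>x. 0))"
      then show "emeasure (distr std_normal_distribution borel (\<lambda>x. 0)) A = emeasure (return borel 0) A"
        using N.emeasure_space_1 by (simp add: emeasure_distr indicator_def)
    qed simp
    ultimately show ?thesis using * by (simp add: scaled_normal_def)
  next
    fix m \<sigma> :: real assume \<sigma>: "\<sigma> > 0" and *: "distr P borel Z = density lborel (\<lambda>y. ennreal (normal_density m \<sigma> y))"
    have "m = (\<integral>x. x \<partial>density lborel (\<lambda>y. ennreal (normal_density m \<sigma> y)))"
      using integral_normal_moment_nz_1[OF \<sigma>, of m] by (simp add: integral_density)
    then have m: "m = 0" using mean E[of "\<lambda>x. x"] by (simp add: *)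
    have "(\<integral>x. x * x \<partial>density lborel (\<lambda>y. ennreal (normal_density 0 \<sigma> y))) = \<sigma>\<^sup>2"
    proof -
      have "(\<integral>y. normal_density 0 \<sigma> y * y\<^sup>2 \<partial>lborel) = \<sigma>\<^sup>2"
        using integral_normal_moment_even[OF \<sigma>, of 0 1] \<sigma> by (simp add: fact_2)
      then show ?thesis by (simp add: integral_density power2_eq_square)
    qed
    then have "s = \<sigma>\<^sup>2" using var E[of "\<lambda>x. x * x"] by (simp add: * m)
    then show ?thesis using * m density_normal_eq_scaled_normal[OF \<sigma>] by simp
  qed
  then show "0 \<le> s" and "distr P borel Z = scaled_normal s" by auto
qed

text \<open>The factorial quotient is the double factorial \<open>(2 * k - 1)!!\<close>. It is used
  for \<open>k\<close> equal to 1, 2 and 4, with values 1, 3 and 105.\<close>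

lemma scaled_normal_moments:
  assumes Z [measurable]: "Z \<in> borel_measurable P" and law: "distr P borel Z = scaled_normal s" and s: "0 \<le> s"
  shows "integrable P (\<lambda>w. Z w ^ (2 * k))"
    and "(\<integral>w. Z w ^ (2 * k) \<partial>P) = s ^ k * (fact (2 * k) / (2 ^ k * fact k))"
proof -
  have eq: "(sqrt s * x) ^ (2 * k) = s ^ k * x ^ (2 * k)" for x
    using s by (simp add: power_mult_distrib power_mult)
  have "integrable (distr P borel Z) (\<lambda>x. x ^ (2 * k))"
    unfolding law scaled_normal_def
    by (subst integrable_distr_eq) (auto simp: eq std_normal_distribution_even_moments)
  then show "integrable P (\<lambda>w. Z w ^ (2 * k))" by (subst (asm) integrable_distr_eq) auto
  have "(\<integral>w. Z w ^ (2 * k) \<partial>P) = (\<integral>x. x ^ (2 * k) \<partial>distr P borel Z)" by (simp add: integral_distr)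
  also have "\<dots> = s ^ k * (fact (2 * k) / (2 ^ k * fact k))"
    unfolding law scaled_normal_def by (subst integral_distr) (auto simp: eq std_normal_distribution_even_moments)
  finally show "(\<integral>w. Z w ^ (2 * k) \<partial>P) = s ^ k * (fact (2 * k) / (2 ^ k * fact k))" .
qed

lemma scaled_normal_mean:
  assumes [measurable]: "Z \<in> borel_measurable P" and law: "distr P borel Z = scaled_normal s"
  shows "(\<integral>w. Z w \<partial>P) = 0"
proof -
  have "(\<integral>w. Z w \<partial>P) = (\<integral>x. x \<partial>distr P borel Z)" by (simp add: integral_distr)
  also have "\<dots> = 0" unfolding law scaled_normal_def by (subst integral_distr) (use integral_std_normal_distribution_moment_odd[of 1] in auto)
  finally show ?thesis .
qed

lemma scaled_normal_char:
  assumes [measurable]: "Z \<in> borel_measurable P" and law: "distr P borel Z = scaled_normal s" and s: "0 \<le> s"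
  shows "(\<integral>w. iexp (Z w) \<partial>P) = exp (- s / 2)"
proof -
  have "(\<integral>w. iexp (Z w) \<partial>P) = (\<integral>x. iexp x \<partial>distr P borel Z)" by (simp add: integral_distr)
  also have "\<dots> = (\<integral>x. iexp (sqrt s * x) \<partial>std_normal_distribution)"
    unfolding law scaled_normal_def by (subst integral_distr) auto
  also have "\<dots> = char std_normal_distribution (sqrt s)" by (simp add: char_def)
  also have "\<dots> = exp (- s / 2)" using s by (simp add: char_std_normal_distribution exp_of_real)
  finally show ?thesis .
qed

text \<open>\<open>centered_gaussian_family\<close> gives covariances only as values of integrals.
  Square integrability of each member is therefore recovered first, from the normality of one-term
  combinations; then integrals of the sums may be expanded, and mean and second moment fix the
  law.\<close>

lemma gaussian_family_linear:
  fixes c :: "'s \<Rightarrow> real"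
  assumes X: "centered_gaussian_family P S X C" and F: "finite F" "F \<subseteq> S"
  defines "Z \<equiv> \<lambda>w. \<Sum>s\<in>F. c s * X s w"
  defines "V \<equiv> \<Sum>s\<in>F. \<Sum>s'\<in>F. c s * c s' * C s s'"
  shows "Z \<in> borel_measurable P" and "0 \<le> V" and "distr P borel Z = scaled_normal V"
proof -
  have P: "prob_space P" and meas: "\<And>s. s \<in> S \<Longrightarrow> X s \<in> borel_measurable P"
    and normal: "\<And>F c. finite F \<Longrightarrow> F \<subseteq> S \<Longrightarrow> normal_law (distr P borel (\<lambda>w. \<Sum>s\<in>F. c s * X s w))"
    and mean: "\<And>s. s \<in> S \<Longrightarrow> (\<integral>w. X s w \<partial>P) = 0"
    and cov: "\<And>s s'. s \<in> S \<Longrightarrow> s' \<in> S \<Longrightarrow> (\<integral>w. X s w * X s' w \<partial>P) = C s s'"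
    using X by (auto simp: centered_gaussian_family_def)
  interpret P: prob_space P by (rule P)
  have sq: "integrable P (\<lambda>w. (X s w)\<^sup>2)" if s: "s \<in> S" for s
  proof -
    have "normal_law (distr P borel (X s))" using normal[of "{s}" "\<lambda>_. 1"] s by simp
    from centered_normal_law[OF P meas[OF s] this mean[OF s] cov[OF s s]]
    show ?thesis using scaled_normal_moments(1)[OF meas[OF s], of "C s s" 1] by simp
  qed
  have int1: "integrable P (X s)" if "s \<in> S" for s
    by (rule P.square_integrable_imp_integrable[OF meas sq]) (use that in auto)
  have int2: "integrable P (\<lambda>w. X s w * X s' w)" if "s \<in> S" "s' \<in> S" for s s'
  proof (rule Bochner_Integration.integrable_bound)
    show "integrable P (\<lambda>w. (X s w)\<^sup>2 + (X s' w)\<^sup>2)" using sq that by simp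
    show "(\<lambda>w. X s w * X s' w) \<in> borel_measurable P" using meas that by simp
    have "\<bar>x * y\<bar> \<le> x\<^sup>2 + y\<^sup>2" for x y :: real
    proof -
      have "2 * \<bar>x * y\<bar> \<le> x\<^sup>2 + y\<^sup>2"
        using sum_squares_bound[of "\<bar>x\<bar>" "\<bar>y\<bar>"] by (simp add: abs_mult mult.assoc)
      moreover have "0 \<le> \<bar>x * y\<bar>" by simp
      ultimately show ?thesis by linarith
    qed
    then show "AE w in P. norm (X s w * X s' w) \<le> norm ((X s w)\<^sup>2 + (X s' w)\<^sup>2)" by simp
  qed
  show Z: "Z \<in> borel_measurable P"
    unfolding Z_def using meas F by (intro borel_measurable_sum borel_measurable_times) auto
  have m: "(\<integral>w. Z w \<partial>P) = 0"
    unfolding Z_def using int1 mean F by (subst Bochner_Integration.integral_sum) (auto intro!: sum.neutral)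
  have "Z w * Z w = (\<Sum>s\<in>F. \<Sum>s'\<in>F. c s * c s' * (X s w * X s' w))" for w
    by (simp add: Z_def sum_product mult_ac)
  moreover have "(\<integral>w. (\<Sum>s\<in>F. \<Sum>s'\<in>F. c s * c s' * (X s w * X s' w)) \<partial>P) = V"
  proof -
    have "(\<integral>w. (\<Sum>s\<in>F. \<Sum>s'\<in>F. c s * c s' * (X s w * X s' w)) \<partial>P) = (\<Sum>s\<in>F. \<integral>w. (\<Sum>s'\<in>F. c s * c s' * (X s w * X s' w)) \<partial>P)"
      using F int2 by (intro Bochner_Integration.integral_sum Bochner_Integration.integrable_sum integrable_mult_right) auto
    also have "\<dots> = (\<Sum>s\<in>F. \<Sum>s'\<in>F. \<integral>w. c s * c s' * (X s w * X s' w) \<partial>P)"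
      using F int2 by (intro sum.cong refl Bochner_Integration.integral_sum integrable_mult_right) auto
    also have "\<dots> = V" unfolding V_def using F cov by (intro sum.cong refl) (auto simp: subset_iff)
    finally show ?thesis .
  qed
  ultimately have v: "(\<integral>w. Z w * Z w \<partial>P) = V" by simp
  have "normal_law (distr P borel Z)" unfolding Z_def by (rule normal[OF F])
  from centered_normal_law[OF P Z this m v]
  show "0 \<le> V" and "distr P borel Z = scaled_normal V" .
qed

section \<open>Moments of the squared Student statistic\<close>

text \<open>Convexity of \<open>exp\<close> between 0 and \<open>ln b\<close>. With \<open>s\<close>
  of order \<open>1 / m\<close>, a product of \<open>m\<close> such bounds stays bounded in
  mean.\<close>

lemma powr_le_one_plus:
  fixes b s :: real
  assumes "0 < b" "0 \<le> s" "s \<le> 1"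
  shows "b powr s \<le> 1 + s * b"
proof -
  have "exp ((1 - s) *\<^sub>R 0 + s *\<^sub>R ln b) \<le> (1 - s) * exp 0 + s * exp (ln b)"
    using assms by (intro convex_onD[OF exp_convex]) auto
  then show ?thesis using assms by (simp add: powr_def)
qed

text \<open>The arithmetic mean is at least the geometric mean, so its inverse power is bounded by a
  product, whose expectation factorizes under independence. Each factor is
  \<open>\<bar>y j\<bar>\<close> to the power \<open>- 8 / m\<close>, that is the power
  \<open>16 / m\<close> of the inverse square root of \<open>\<bar>y j\<bar>\<close>; the condition
  \<open>16 \<le> m\<close> makes this exponent at most 1, as the convexity bound requires.\<close>

lemma inverse_mean_power_bound:
  fixes y :: "nat \<Rightarrow> real"
  assumes m: "16 \<le> m" and y: "\<And>j. j < m \<Longrightarrow> y j \<noteq> 0"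
  shows "(real m / (\<Sum>j<m. (y j)\<^sup>2)) ^ 4 \<le> (\<Prod>j<m. 1 + 16 / real m * \<bar>y j\<bar> powr (- 1 / 2))"
proof -
  define A where "A = (\<Sum>j<m. (y j)\<^sup>2 / real m)"
  define G where "G = (\<Prod>j<m. (y j)\<^sup>2) powr (1 / real m)"
  have "0 < (\<Prod>j<m. (y j)\<^sup>2)" using y by (intro prod_pos) auto
  then have G: "0 < G" unfolding G_def powr_gt_zero by linarith
  have GA: "G \<le> A"
    using arith_geom_mean[of "{..<m}" "\<lambda>j. (y j)\<^sup>2"] m by (auto simp: G_def A_def lessThan_empty_iff)
  have "real m / (\<Sum>j<m. (y j)\<^sup>2) = 1 / A"
    by (simp add: A_def sum_divide_distrib[symmetric])
  also have "\<dots> \<le> 1 / G" using G GA by (simp add: frac_le)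
  finally have "(real m / (\<Sum>j<m. (y j)\<^sup>2)) ^ 4 \<le> (1 / G) ^ 4"
    using m by (intro power_mono) (auto intro!: divide_nonneg_nonneg sum_nonneg)
  also have "\<dots> = (\<Prod>j<m. (y j)\<^sup>2) powr (- 4 / real m)"
  proof -
    have "(1 / G) ^ 4 = G powr (- 4)"
      using G by (simp add: powr_minus powr_numeral inverse_eq_divide power_one_over)
    then show ?thesis by (simp add: G_def powr_powr)
  qed
  also have "\<dots> = (\<Prod>j<m. ((y j)\<^sup>2) powr (- 4 / real m))"
    by (rule prod_powr_distrib)
  also have "\<dots> \<le> (\<Prod>j<m. 1 + 16 / real m * \<bar>y j\<bar> powr (- 1 / 2))"
  proof (intro prod_mono conjI)
    fix j assume j: "j \<in> {..<m}"
    have "((y j)\<^sup>2) powr (- 4 / real m) = (\<bar>y j\<bar> powr 2) powr (- 4 / real m)"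
    proof -
      have "(y j)\<^sup>2 = \<bar>y j\<bar> powr 2" using y j by simp
      then show ?thesis by (simp only:)
    qed
    also have "\<dots> = (\<bar>y j\<bar> powr (- 1 / 2)) powr (16 / real m)"
      unfolding powr_powr by simp
    also have "\<dots> \<le> 1 + 16 / real m * \<bar>y j\<bar> powr (- 1 / 2)"
      using y j m by (intro powr_le_one_plus) auto
    finally show "((y j)\<^sup>2) powr (- 4 / real m) \<le> 1 + 16 / real m * \<bar>y j\<bar> powr (- 1 / 2)" .
  qed simp
  finally show ?thesis .
qed

text \<open>On each side of 0, where the density is at most 1, the inverse square root has integral
  2 over the unit interval; outside it is at most 1 and the density contributes at most 1. Hence
  \<open>5 = 2 + 2 + 1\<close>.\<close>

lemma nn_integral_inverse_sqrt_normal: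
  assumes dens: "\<And>x. 0 \<le> g x" "\<And>x. g x \<le> 1" and [measurable]: "g \<in> borel_measurable borel"
    and prob: "(\<integral>\<^sup>+x. ennreal (g x) \<partial>lborel) = 1"
  shows "(\<integral>\<^sup>+x. ennreal (g x) * ennreal (\<bar>x\<bar> powr (- 1 / 2)) \<partial>lborel) \<le> 5"
proof -
  define h where "h x = (if x \<in> {0..1} then x powr (- 1 / 2) else 0)" for x :: real
  have [measurable]: "h \<in> borel_measurable borel" unfolding h_def by measurable
  have "(h has_integral 2) UNIV"
    using has_integral_powr_from_0[of "- 1 / 2" 1] unfolding h_def
    by (subst has_integral_restrict_UNIV) simp
  then have h: "(\<integral>\<^sup>+x. ennreal (h x) \<partial>lborel) = 2"
    by (subst nn_integral_has_integral_lborel[where I = 2]) (auto simp: h_def)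
  have h': "(\<integral>\<^sup>+x. ennreal (h (- x)) \<partial>lborel) = 2"
    using nn_integral_real_affine[of "\<lambda>x. ennreal (h x)" "-1" 0] h by simp
  have "(\<integral>\<^sup>+x. ennreal (g x) * ennreal (\<bar>x\<bar> powr (- 1 / 2)) \<partial>lborel) \<le>
      (\<integral>\<^sup>+x. ennreal (h x) + ennreal (h (- x)) + ennreal (g x) \<partial>lborel)"
  proof (intro nn_integral_mono)
    fix x :: real
    have "g x * \<bar>x\<bar> powr (- 1 / 2) \<le> h x + h (- x) + g x"
    proof (cases "\<bar>x\<bar> \<le> 1")
      case True
      have "g x * \<bar>x\<bar> powr (- 1 / 2) \<le> 1 * \<bar>x\<bar> powr (- 1 / 2)"
        using dens by (intro mult_right_mono) auto
      also have "\<dots> \<le> h x + h (- x)" using True by (auto simp: h_def)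
      finally show ?thesis using dens(1)[of x] by linarith
    next
      case False
      then have "\<bar>x\<bar> powr (- 1 / 2) \<le> \<bar>x\<bar> powr 0" by (intro powr_mono) auto
      also have "\<bar>x\<bar> powr 0 = 1" using False by auto
      finally have "\<bar>x\<bar> powr (- 1 / 2) \<le> 1" .
      then have "g x * \<bar>x\<bar> powr (- 1 / 2) \<le> g x * 1" using dens False by (intro mult_left_mono) auto
      moreover have "0 \<le> h x" "0 \<le> h (- x)" by (auto simp: h_def)
      ultimately show ?thesis by linarith
    qed
    then have "ennreal (g x * \<bar>x\<bar> powr (- 1 / 2)) \<le> ennreal (h x + h (- x) + g x)" by (rule ennreal_leI)
    then show "ennreal (g x) * ennreal (\<bar>x\<bar> powr (- 1 / 2)) \<le> ennreal (h x) + ennreal (h (- x)) + ennreal (g x)"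
      using dens by (simp add: ennreal_mult' ennreal_plus h_def)
  qed
  also have "\<dots> = 5"
    by (simp add: nn_integral_add h h' prob)
  finally show ?thesis .
qed

text \<open>Two squared deviations from any centre add up to at least half the squared difference.
  The terms of a sample variance all depend on the sample mean; differences over disjoint pairs are
  independent.\<close>

lemma sum_square_deviation_ge_pairs:
  fixes z :: "nat \<Rightarrow> real"
  assumes "2 * m \<le> N"
  shows "(\<Sum>j<m. (z (2 * j) - z (2 * j + 1))\<^sup>2) / 2 \<le> (\<Sum>j<N. (z j - c)\<^sup>2)"
proof -
  have "(\<Sum>j<m. (z (2 * j) - z (2 * j + 1))\<^sup>2) / 2 \<le> (\<Sum>j<2 * m. (z j - c)\<^sup>2)"
  proof (induction m)
    case (Suc m)
    have "(x - y)\<^sup>2 / 2 \<le> (x - c)\<^sup>2 + (y - c)\<^sup>2" for x y :: real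
    proof -
      have "(x - c)\<^sup>2 + (y - c)\<^sup>2 - (x - y)\<^sup>2 / 2 = ((x - c) + (y - c))\<^sup>2 / 2"
        by (simp add: power2_eq_square field_simps)
      then show ?thesis using zero_le_power2[of "(x - c) + (y - c)"] by linarith
    qed
    from Suc add_mono[OF Suc this[of "z (2 * m)" "z (2 * m + 1)"]] show ?case
      by (simp add: add_divide_distrib)
  qed simp
  also have "\<dots> \<le> (\<Sum>j<N. (z j - c)\<^sup>2)"
    using assms by (intro sum_mono2) auto
  finally show ?thesis .
qed

text \<open>Bounding the product by a sum lets numerator and denominator be integrated separately,
  with no appeal to their independence.\<close>

lemma student_square_le:
  fixes a b :: real
  shows "(a\<^sup>2 / b)\<^sup>2 \<le> a ^ 8 + (1 / b) ^ 4"
proof -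
  have "(a\<^sup>2 / b)\<^sup>2 = a ^ 4 * (1 / b)\<^sup>2" by (simp add: power_divide power_mult[symmetric])
  also have "\<dots> \<le> (a ^ 4)\<^sup>2 + ((1 / b)\<^sup>2)\<^sup>2"
  proof -
    have "0 \<le> a ^ 4 * (1 / b)\<^sup>2" by simp
    moreover have "2 * (a ^ 4 * (1 / b)\<^sup>2) \<le> (a ^ 4)\<^sup>2 + ((1 / b)\<^sup>2)\<^sup>2"
      using sum_squares_bound[of "a ^ 4" "(1 / b)\<^sup>2"] by (simp only: mult.assoc)
    ultimately show ?thesis by linarith
  qed
  finally show ?thesis by (simp add: power_mult[symmetric])
qed

lemma (in prob_space) distributed_normal_difference:
  fixes Z :: "nat \<Rightarrow> 'a \<Rightarrow> real"
  assumes ind: "indep_vars (\<lambda>_. borel) Z {..<N}"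
    and law: "\<And>j. j < N \<Longrightarrow> distr M borel (Z j) = scaled_normal 1"
    and ij: "i < N" "j < N" "i \<noteq> j"
  shows "distributed M lborel (\<lambda>w. Z i w - Z j w) (normal_density 0 (sqrt 2))"
proof -
  have Zm [measurable]: "Z l \<in> borel_measurable M" if "l < N" for l
    using ind that by (auto simp: indep_vars_def)
  have dist: "distributed M lborel (Z l) std_normal_density" if "l < N" for l
  proof -
    have "distr M lborel (Z l) = distr M borel (Z l)" by (rule distr_cong) auto
    then show ?thesis
      using that density_normal_eq_scaled_normal[of 1] law[OF that] by (simp add: distributed_def)
  qed
  define W where "W l w = 0 + (if l = i then 1 else - 1) * Z l w" for l w
  have "distributed M lborel (W l) (normal_density 0 1)" if "l < N" for l
    using normal_density_affine[OF dist[OF that], of "if l = i then 1 else - 1" 0]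
    unfolding W_def by (cases "l = i") simp_all
  moreover have "indep_vars (\<lambda>_. borel) W {i, j}"
    unfolding W_def by (rule indep_vars_compose2[OF indep_vars_subset[OF ind]]) (use ij in auto)
  ultimately have "distributed M lborel (\<lambda>w. \<Sum>l\<in>{i, j}. W l w)
      (normal_density (\<Sum>l\<in>{i, j}. 0) (sqrt (\<Sum>l\<in>{i, j}. 1\<^sup>2)))"
    using ij by (intro sum_indep_normal) auto
  then show ?thesis using ij by (simp add: W_def)
qed

lemma (in prob_space) AE_normal_difference_nonzero:
  assumes "distributed M lborel D (normal_density 0 (sqrt 2))"
  shows "AE w in M. D w \<noteq> 0"
proof -
  have [measurable]: "D \<in> borel_measurable M" using distributed_measurable[OF assms] by simp
  have "AE x in lborel. x \<noteq> (0 :: real)" by (rule AE_lborel_singleton)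
  then have "AE x in density lborel (\<lambda>x. ennreal (normal_density 0 (sqrt 2) x)). x \<noteq> 0"
    by (subst AE_density) auto
  then have "AE x in distr M lborel D. x \<noteq> 0"
    unfolding distributed_distr_eq_density[OF assms] .
  then show ?thesis by (subst (asm) AE_distr_iff) auto
qed

text \<open>The constant collects the eighth moment 105 of a standard normal variable and
  \<open>256 = 4 ^ 4\<close> times a bound for the product of \<open>m\<close> independent factors.
  Each factor has mean at most \<open>1 + 16 / m * 5\<close>, hence at most
  \<open>exp (80 / m)\<close>, and the product has mean at most \<open>exp 80\<close> for every
  sample size.\<close>

lemma (in prob_space) student_second_moment_standard:
  fixes Z :: "nat \<Rightarrow> 'a \<Rightarrow> real"
  assumes N: "32 \<le> N" and ind: "indep_vars (\<lambda>_. borel) Z {..<N}"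
    and law: "\<And>j. j < N \<Longrightarrow> distr M borel (Z j) = scaled_normal 1"
  defines "zb \<equiv> \<lambda>w. 1 / real N * (\<Sum>j<N. Z j w)"
  shows "(\<integral>\<^sup>+w. ennreal ((real N * (zb w)\<^sup>2 / (1 / (real N - 1) * (\<Sum>j<N. (Z j w - zb w)\<^sup>2)))\<^sup>2) \<partial>M)
    \<le> ennreal (105 + 256 * exp 80)"
proof -
  \<comment> \<open>The number of disjoint pairs: 32 observations give 16 pairs, and for odd
    \<open>N\<close> the last observation stays unpaired.\<close>
  define m where "m = N div 2"
  have m: "16 \<le> m" "2 * m \<le> N" "N \<le> 2 * m + 1" using N by (auto simp: m_def)
  define D where "D j w = Z (2 * j) w - Z (2 * j + 1) w" for j w
  have Zm [measurable]: "Z j \<in> borel_measurable M" if "j < N" for j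
    using ind that by (auto simp: indep_vars_def)
  have dist: "distributed M lborel (Z j) std_normal_density" if "j < N" for j
  proof -
    have "distr M lborel (Z j) = distr M borel (Z j)" by (rule distr_cong) auto
    then show ?thesis
      using that density_normal_eq_scaled_normal[of 1] law[OF that] by (simp add: distributed_def)
  qed
  have Dm [measurable]: "D j \<in> borel_measurable M" if "j < m" for j
    unfolding D_def using that m by (intro borel_measurable_diff Zm) auto
  have distD: "distributed M lborel (D j) (normal_density 0 (sqrt 2))" if "j < m" for j
    using distributed_normal_difference[OF ind law, of "2 * j" "2 * j + 1"] that m by (simp add: D_def[abs_def])
  have indD: "indep_vars (\<lambda>_. borel) D {..<m}"
  proof -
    have "indep_vars (\<lambda>j. PiM {2 * j, 2 * j + 1} (\<lambda>_. borel)) (\<lambda>j w. restrict (\<lambda>i. Z i w) {2 * j, 2 * j + 1}) {..<m}"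
    proof (rule indep_vars_restrict[OF ind])
      show "disjoint_family_on (\<lambda>j. {2 * j, 2 * j + 1}) {..<m}"
        unfolding disjoint_family_on_def by (intro ballI impI) (auto; presburger)
    qed (use m in auto)
    then have "indep_vars (\<lambda>_. borel) (\<lambda>j w. (\<lambda>x. x (2 * j) - x (2 * j + 1)) (restrict (\<lambda>i. Z i w) {2 * j, 2 * j + 1})) {..<m}"
      by (rule indep_vars_compose2) (auto intro!: borel_measurable_diff measurable_component_singleton)
    then show ?thesis by (simp add: D_def[abs_def])
  qed
  have AE_D: "AE w in M. \<forall>j<m. D j w \<noteq> 0"
  proof -
    have "AE w in M. D j w \<noteq> 0" if "j < m" for j
      by (rule AE_normal_difference_nonzero[OF distD[OF that]])
    then show ?thesis by (auto simp: AE_all_countable)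
  qed
  define Wn where "Wn w = (\<Sum>j<N. Z j w) / sqrt (real N)" for w
  define f where "f j w = 1 + 16 / real m * \<bar>D j w\<bar> powr (- 1 / 2)" for j w
  have pointwise: "(real N * (zb w)\<^sup>2 / (1 / (real N - 1) * (\<Sum>j<N. (Z j w - zb w)\<^sup>2)))\<^sup>2 \<le>
      Wn w ^ 8 + 256 * (\<Prod>j<m. f j w)" if D: "\<forall>j<m. D j w \<noteq> 0" for w
  proof -
    define S where "S = 1 / (real N - 1) * (\<Sum>j<N. (Z j w - zb w)\<^sup>2)"
    define V where "V = (\<Sum>j<m. (D j w)\<^sup>2)"
    have "0 < (D 0 w)\<^sup>2" using D m by simp
    also have "(D 0 w)\<^sup>2 \<le> V" unfolding V_def using m by (intro member_le_sum) auto
    finally have V: "0 < V" .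
    have V2: "V / 2 \<le> (\<Sum>j<N. (Z j w - zb w)\<^sup>2)"
      unfolding V_def D_def by (rule sum_square_deviation_ge_pairs[OF m(2)])
    \<comment> \<open>\<open>N - 1 \<le> 2 * m\<close> also holds for odd \<open>N\<close>; together
      with the factor 1/2 of the pairing inequality this gives the constant 4.\<close>
    have "1 / S = (real N - 1) / (\<Sum>j<N. (Z j w - zb w)\<^sup>2)" by (simp add: S_def)
    also have "\<dots> \<le> (2 * real m) / (V / 2)" using V V2 m by (intro frac_le) auto
    also have "\<dots> = 4 * (real m / V)" by simp
    finally have "1 / S \<le> 4 * (real m / V)" .
    moreover have "0 \<le> S" unfolding S_def by (intro mult_nonneg_nonneg sum_nonneg) (use N in auto)
    ultimately have "(1 / S) ^ 4 \<le> (4 * (real m / V)) ^ 4" by (intro power_mono) auto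
    also have "\<dots> = 256 * (real m / V) ^ 4" unfolding power_mult_distrib by simp
    also have "(real m / V) ^ 4 \<le> (\<Prod>j<m. f j w)"
      unfolding V_def f_def by (rule inverse_mean_power_bound[OF m(1)]) (use D in auto)
    finally have S4: "(1 / S) ^ 4 \<le> 256 * (\<Prod>j<m. f j w)" by simp
    have "real N * (zb w)\<^sup>2 = (Wn w)\<^sup>2"
      using N by (simp add: zb_def Wn_def power_divide power2_eq_square)
    then have "(real N * (zb w)\<^sup>2 / S)\<^sup>2 \<le> Wn w ^ 8 + (1 / S) ^ 4"
      using student_square_le[of "Wn w" S] by simp
    then show ?thesis using S4 unfolding S_def by linarith
  qed
  have W8: "(\<integral>\<^sup>+w. ennreal (Wn w ^ 8) \<partial>M) = ennreal 105"
  proof -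
    have "distributed M lborel (\<lambda>w. \<Sum>j<N. Z j w) (normal_density (\<Sum>j<N. 0) (sqrt (\<Sum>j<N. 1\<^sup>2)))"
      using N dist by (intro sum_indep_normal ind) (auto simp: lessThan_empty_iff)
    then have "distr M lborel (\<lambda>w. \<Sum>j<N. Z j w) = scaled_normal (real N)"
      using density_normal_eq_scaled_normal[of "sqrt (real N)"] N by (simp add: distributed_def)
    moreover have "distr M lborel (\<lambda>w. \<Sum>j<N. Z j w) = distr M borel (\<lambda>w. \<Sum>j<N. Z j w)"
      by (rule distr_cong) auto
    ultimately have l: "distr M borel (\<lambda>w. \<Sum>j<N. Z j w) = scaled_normal (real N)" by simp
    have sm: "(\<lambda>w. \<Sum>j<N. Z j w) \<in> borel_measurable M" by measurable
    note mom = scaled_normal_moments[OF sm l, where k = 4]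
    have W: "Wn w ^ 8 = (\<Sum>j<N. Z j w) ^ 8 / real N ^ 4" for w
    proof -
      have "sqrt (real N) ^ 8 = (sqrt (real N) ^ 2) ^ 4" by (simp only: power_mult[symmetric]) simp
      then show ?thesis by (simp add: Wn_def power_divide)
    qed
    have "(\<integral>\<^sup>+w. ennreal (Wn w ^ 8) \<partial>M) = ennreal (expectation (\<lambda>w. Wn w ^ 8))"
      unfolding W using mom(1) by (intro nn_integral_eq_integral) (auto intro!: AE_I2)
    also have "expectation (\<lambda>w. Wn w ^ 8) = 105"
      unfolding W using mom(2) N by (simp add: fact_numeral)
    finally show ?thesis .
  qed
  have fm: "f j \<in> borel_measurable M" if "j < m" for j unfolding f_def using that by measurable
  have f0: "0 \<le> f j w" for j w by (simp add: f_def)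
  have Ef: "(\<integral>\<^sup>+w. ennreal (f j w) \<partial>M) \<le> ennreal (exp (80 / real m))" if j: "j < m" for j
  proof -
    have "(\<integral>\<^sup>+w. ennreal (\<bar>D j w\<bar> powr (- 1 / 2)) \<partial>M) =
        (\<integral>\<^sup>+x. ennreal (normal_density 0 (sqrt 2) x) * ennreal (\<bar>x\<bar> powr (- 1 / 2)) \<partial>lborel)"
      by (rule distributed_nn_integral[OF distD[OF j], symmetric]) simp
    also have "\<dots> \<le> 5"
    proof (rule nn_integral_inverse_sqrt_normal)
      show "normal_density 0 (sqrt 2) x \<le> 1" for x
      proof -
        have "1 \<le> sqrt (2 * pi * 2)" using pi_gt3 by simp
        then have "1 / sqrt (2 * pi * 2) * exp (- x\<^sup>2 / 4) \<le> 1 * 1"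
          by (intro mult_mono) auto
        then show ?thesis by (simp add: normal_density_def)
      qed
      show "(\<integral>\<^sup>+x. ennreal (normal_density 0 (sqrt 2) x) \<partial>lborel) = 1"
        using prob_space_normal_density[of "sqrt 2" 0] by (simp add: prob_space_def prob_space_axioms_def emeasure_density finite_measure_def)
    qed auto
    finally have b: "(\<integral>\<^sup>+w. ennreal (\<bar>D j w\<bar> powr (- 1 / 2)) \<partial>M) \<le> 5" .
    have "(\<integral>\<^sup>+w. ennreal (f j w) \<partial>M) = (\<integral>\<^sup>+w. 1 + ennreal (16 / real m) * ennreal (\<bar>D j w\<bar> powr (- 1 / 2)) \<partial>M)"
      unfolding f_def by (intro nn_integral_cong) (simp add: ennreal_mult[symmetric])
    also have "\<dots> = 1 + ennreal (16 / real m) * (\<integral>\<^sup>+w. ennreal (\<bar>D j w\<bar> powr (- 1 / 2)) \<partial>M)"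
      using j by (simp add: nn_integral_add nn_integral_cmult emeasure_space_1)
    also have "\<dots> \<le> 1 + ennreal (16 / real m) * ennreal 5"
      using b by (intro add_left_mono mult_left_mono) auto
    also have "\<dots> = ennreal 1 + ennreal (16 / real m * 5)"
      by (subst ennreal_mult) auto
    also have "\<dots> = ennreal (1 + 80 / real m)"
      by (subst ennreal_plus[symmetric]) auto
    also have "\<dots> \<le> ennreal (exp (80 / real m))" by (intro ennreal_leI exp_ge_add_one_self)
    finally show ?thesis .
  qed
  have prodf: "(\<integral>\<^sup>+w. ennreal (\<Prod>j<m. f j w) \<partial>M) \<le> ennreal (exp 80)"
  proof -
    have "indep_vars (\<lambda>_. borel) (\<lambda>j w. ennreal (1 + 16 / real m * \<bar>D j w\<bar> powr (- 1 / 2))) {..<m}"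
      by (rule indep_vars_compose2[OF indD]) auto
    then have "(\<integral>\<^sup>+w. (\<Prod>j<m. ennreal (f j w)) \<partial>M) = (\<Prod>j<m. \<integral>\<^sup>+w. ennreal (f j w) \<partial>M)"
      unfolding f_def by (intro indep_vars_nn_integral) auto
    also have "\<dots> \<le> (\<Prod>j<m. ennreal (exp (80 / real m)))" by (intro prod_mono_ennreal Ef) auto
    also have "\<dots> = ennreal (exp 80)"
      using m by (simp add: ennreal_power exp_of_nat_mult[symmetric])
    finally show ?thesis using f0 by (simp add: prod_ennreal)
  qed
  have "(\<integral>\<^sup>+w. ennreal ((real N * (zb w)\<^sup>2 / (1 / (real N - 1) * (\<Sum>j<N. (Z j w - zb w)\<^sup>2)))\<^sup>2) \<partial>M) \<le>
      (\<integral>\<^sup>+w. ennreal (Wn w ^ 8) + 256 * ennreal (\<Prod>j<m. f j w) \<partial>M)"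
  proof (intro nn_integral_mono_AE, use AE_D in eventually_elim)
    fix w assume "\<forall>j<m. D j w \<noteq> 0"
    from ennreal_leI[OF pointwise[OF this]]
    show "ennreal ((real N * (zb w)\<^sup>2 / (1 / (real N - 1) * (\<Sum>j<N. (Z j w - zb w)\<^sup>2)))\<^sup>2) \<le>
        ennreal (Wn w ^ 8) + 256 * ennreal (\<Prod>j<m. f j w)"
      using f0 by (simp add: ennreal_plus ennreal_mult' prod_nonneg ennreal_numeral)
  qed
  also have "\<dots> = (\<integral>\<^sup>+w. ennreal (Wn w ^ 8) \<partial>M) + 256 * (\<integral>\<^sup>+w. ennreal (\<Prod>j<m. f j w) \<partial>M)"
    using fm by (subst nn_integral_add) (auto simp: Wn_def nn_integral_cmult intro!: borel_measurable_prod)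
  also have "\<dots> \<le> ennreal 105 + 256 * ennreal (exp 80)"
    unfolding W8 by (intro add_left_mono mult_left_mono prodf) auto
  also have "\<dots> = ennreal (105 + 256 * exp 80)"
    by (simp add: ennreal_plus ennreal_mult' flip: ennreal_numeral)
  finally show ?thesis .
qed

section \<open>Algebra and concentration of sample covariances\<close>

text \<open>Steiner's formula: arbitrary centres may be inserted. At the true means the correction
  is a product of two centred averages and therefore of order \<open>1 / N\<close> in mean.\<close>

lemma sample_cov_shift:
  assumes N: "2 \<le> N"
  shows "sample_cov N x t s = real N / (real N - 1) *
    (1 / real N * (\<Sum>j<N. (x j t - a) * (x j s - b)) - (sample_mean N x t - a) * (sample_mean N x s - b))"
proof -
  define U V where "U j = x j t - a" and "V j = x j s - b" for j
  define ub vb where "ub = 1 / real N * (\<Sum>j<N. U j)" and "vb = 1 / real N * (\<Sum>j<N. V j)"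
  have sums: "(\<Sum>j<N. U j) = real N * ub" "(\<Sum>j<N. V j) = real N * vb"
    using N by (auto simp: ub_def vb_def)
  have m: "sample_mean N x t = ub + a" "sample_mean N x s = vb + b"
    using N by (auto simp: sample_mean_def ub_def vb_def U_def V_def sum_subtractf field_simps)
  have "(\<Sum>j<N. (x j t - sample_mean N x t) * (x j s - sample_mean N x s)) = (\<Sum>j<N. (U j - ub) * (V j - vb))"
    by (simp add: m U_def V_def algebra_simps)
  also have "\<dots> = (\<Sum>j<N. U j * V j) - vb * (\<Sum>j<N. U j) - ub * (\<Sum>j<N. V j) + real N * (ub * vb)"
    by (simp add: algebra_simps sum.distrib sum_subtractf sum_distrib_left)
  also have "\<dots> = (\<Sum>j<N. U j * V j) - real N * (ub * vb)" by (simp add: sums)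
  also have "\<dots> = real N * (1 / real N * (\<Sum>j<N. U j * V j) - ub * vb)" using N by (simp add: field_simps)
  finally show ?thesis by (simp add: sample_cov_def m U_def V_def)
qed

text \<open>Deviations from the sample mean have the least sum of squares, and
  \<open>1 / (N - 1) \<le> 2 / N\<close> is paid for by the factor 1/2 in bounding a product by
  squares. For \<open>N \<le> 1\<close> the sample covariance is 0, by an empty sum or by division
  by zero.\<close>

lemma abs_sample_cov_le:
  "\<bar>sample_cov N x t s\<bar> \<le> 1 / real N * (\<Sum>j<N. (x j t - a)\<^sup>2) + 1 / real N * (\<Sum>j<N. (x j s - b)\<^sup>2)"
proof (cases "2 \<le> N")
  case True
  define dev where "dev t = (\<Sum>j<N. (x j t - sample_mean N x t)\<^sup>2)" for t
  have dev: "dev t \<le> (\<Sum>j<N. (x j t - a)\<^sup>2)" for t a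
  proof -
    define S p where "S = (\<Sum>j<N. (x j t - a) * (x j t - a))" and "p = (sample_mean N x t - a) * (sample_mean N x t - a)"
    have cancel: "n * q = d" if "n / c * q = 1 / c * d" "c \<noteq> 0" for n c q d :: real
      using that by simp
    have "real N / (real N - 1) * (1 / real N * S - p) = 1 / (real N - 1) * dev t"
      unfolding S_def p_def
      unfolding sample_cov_shift[OF True, symmetric] by (simp add: sample_cov_def dev_def power2_eq_square)
    from cancel[OF this] True have "dev t = S - real N * p" by (simp add: right_diff_distrib)
    also have "\<dots> \<le> S" by (simp add: p_def)
    finally show ?thesis by (simp add: S_def power2_eq_square)
  qed
  have "\<bar>\<Sum>j<N. (x j t - sample_mean N x t) * (x j s - sample_mean N x s)\<bar> \<le>
      (\<Sum>j<N. \<bar>(x j t - sample_mean N x t) * (x j s - sample_mean N x s)\<bar>)" by (rule sum_abs)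
  also have "\<dots> \<le> (\<Sum>j<N. ((x j t - sample_mean N x t)\<^sup>2 + (x j s - sample_mean N x s)\<^sup>2) / 2)"
  proof (rule sum_mono)
    fix j
    show "\<bar>(x j t - sample_mean N x t) * (x j s - sample_mean N x s)\<bar> \<le> ((x j t - sample_mean N x t)\<^sup>2 + (x j s - sample_mean N x s)\<^sup>2) / 2"
      using sum_squares_bound[of "\<bar>x j t - sample_mean N x t\<bar>" "\<bar>x j s - sample_mean N x s\<bar>"]
      by (simp add: abs_mult)
  qed
  also have "\<dots> = (dev t + dev s) / 2" by (simp add: dev_def sum.distrib sum_divide_distrib add_divide_distrib)
  also have "\<dots> \<le> ((\<Sum>j<N. (x j t - a)\<^sup>2) + (\<Sum>j<N. (x j s - b)\<^sup>2)) / 2"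
    using dev[of t a] dev[of s b] by simp
  finally have le: "\<bar>\<Sum>j<N. (x j t - sample_mean N x t) * (x j s - sample_mean N x s)\<bar> \<le>
    ((\<Sum>j<N. (x j t - a)\<^sup>2) + (\<Sum>j<N. (x j s - b)\<^sup>2)) / 2" .
  have "\<bar>sample_cov N x t s\<bar> = 1 / (real N - 1) * \<bar>\<Sum>j<N. (x j t - sample_mean N x t) * (x j s - sample_mean N x s)\<bar>"
    using True by (simp add: sample_cov_def abs_mult)
  also have "\<dots> \<le> 1 / (real N - 1) * (((\<Sum>j<N. (x j t - a)\<^sup>2) + (\<Sum>j<N. (x j s - b)\<^sup>2)) / 2)"
    using True by (intro mult_left_mono le) auto
  also have "\<dots> \<le> 2 / real N * (((\<Sum>j<N. (x j t - a)\<^sup>2) + (\<Sum>j<N. (x j s - b)\<^sup>2)) / 2)"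
    using True by (intro mult_right_mono) (auto simp: field_simps intro!: add_nonneg_nonneg sum_nonneg)
  finally show ?thesis by (simp add: distrib_left add_divide_distrib)
next
  case False
  then have "N = 0 \<or> N = 1" by auto
  then have "sample_cov N x t s = 0" by (auto simp: sample_cov_def)
  then show ?thesis by (simp add: sum_nonneg)
qed

context prob_space
begin

lemma scaled_normal_zero:
  assumes "Y \<in> borel_measurable M" "distr M borel Y = scaled_normal 0"
  shows "AE w in M. Y w = 0"
proof -
  have "integrable M (\<lambda>w. (Y w)\<^sup>2)" "expectation (\<lambda>w. (Y w)\<^sup>2) = 0"
    using scaled_normal_moments[OF assms, of 1] by auto
  then show ?thesis by (subst (asm) integral_nonneg_eq_0_iff_AE) auto
qed

lemma standardize:
  fixes Y :: "nat \<Rightarrow> 'a \<Rightarrow> real"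
  assumes ind: "indep_vars (\<lambda>_. borel) Y {..<N}"
    and law: "\<And>j. j < N \<Longrightarrow> distr M borel (Y j) = scaled_normal s" and s: "0 < s"
  shows "indep_vars (\<lambda>_. borel) (\<lambda>j w. Y j w / sqrt s) {..<N}"
    and "\<And>j. j < N \<Longrightarrow> distr M borel (\<lambda>w. Y j w / sqrt s) = scaled_normal 1"
proof -
  show "indep_vars (\<lambda>_. borel) (\<lambda>j w. Y j w / sqrt s) {..<N}"
    by (rule indep_vars_compose2[OF ind]) auto
  fix j assume j: "j < N"
  then have [measurable]: "(Y j) \<in> borel_measurable M"
    using ind by (auto simp: indep_vars_def)
  have "distr M borel (\<lambda>w. Y j w / sqrt s) = distr (distr M borel (Y j)) borel (\<lambda>y. y / sqrt s)"
    by (simp add: distr_distr comp_def)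
  also have "\<dots> = scaled_normal 1"
    unfolding law[OF j] scaled_normal_def using s
    by (simp add: distr_distr comp_def) (intro distr_cong; simp)
  finally show "distr M borel (\<lambda>w. Y j w / sqrt s) = scaled_normal 1" .
qed

text \<open>If the variance is 0, all observations vanish; otherwise the first two differ almost
  surely and the sample variance is nonzero. This supplies the condition on zero weights under which
  the pseudoinverse form is bounded.\<close>

lemma AE_sample_cov_zero:
  fixes x :: "nat \<Rightarrow> 'a \<Rightarrow> real \<Rightarrow> real"
  assumes N: "2 \<le> N" and ind: "indep_vars (\<lambda>_. borel) (\<lambda>j w. x j w t) {..<N}"
    and law: "\<And>j. j < N \<Longrightarrow> distr M borel (\<lambda>w. x j w t) = scaled_normal s" and s: "0 \<le> s"
  shows "AE w in M. sample_cov N (\<lambda>j. x j w) t t = 0 \<longrightarrow> sample_mean N (\<lambda>j. x j w) t = 0"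
proof -
  have meas [measurable]: "(\<lambda>w. x j w t) \<in> borel_measurable M" if "j < N" for j
    using ind that by (auto simp: indep_vars_def)
  show ?thesis
  proof (cases "s = 0")
    case True
    have "AE w in M. x j w t = 0" if "j < N" for j
      by (rule scaled_normal_zero[OF meas[OF that]]) (use law[OF that] True in simp)
    then have "AE w in M. \<forall>j<N. x j w t = 0" by (simp add: AE_all_countable)
    then show ?thesis by eventually_elim (simp add: sample_mean_def)
  next
    case False
    then have s: "0 < s" using s by simp
    note std = standardize[OF ind law s]
    have "AE w in M. x 0 w t / sqrt s - x 1 w t / sqrt s \<noteq> 0"
      by (rule AE_normal_difference_nonzero[OF distributed_normal_difference[OF std, of 0 1]]) (use N in auto)
    then show ?thesis
    proof eventually_elim
      fix w assume ne: "x 0 w t / sqrt s - x 1 w t / sqrt s \<noteq> 0"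
      have "sample_cov N (\<lambda>j. x j w) t t \<noteq> 0"
      proof
        assume "sample_cov N (\<lambda>j. x j w) t t = 0"
        then have "(\<Sum>j<N. (x j w t - sample_mean N (\<lambda>j. x j w) t)\<^sup>2) = 0"
          using N by (simp add: sample_cov_def power2_eq_square)
        then have "\<forall>j\<in>{..<N}. (x j w t - sample_mean N (\<lambda>j. x j w) t)\<^sup>2 = 0"
          by (subst (asm) sum_nonneg_eq_0_iff) auto
        then have "x 0 w t = sample_mean N (\<lambda>j. x j w) t" "x 1 w t = sample_mean N (\<lambda>j. x j w) t" using N by auto
        then show False using ne by simp
      qed
      then show "sample_cov N (\<lambda>j. x j w) t t = 0 \<longrightarrow> sample_mean N (\<lambda>j. x j w) t = 0" by simp
    qed
  qed
qed

text \<open>The quotient is unchanged when the observations are scaled, which reduces the claim to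
  \<open>s = 1\<close>; for \<open>s = 0\<close> it is almost surely \<open>0 / 0\<close>, hence 0.
  The bound is free of \<open>s\<close>.\<close>

lemma student_second_moment:
  fixes x :: "nat \<Rightarrow> 'a \<Rightarrow> real \<Rightarrow> real"
  assumes N: "32 \<le> N" and ind: "indep_vars (\<lambda>_. borel) (\<lambda>j w. x j w t) {..<N}"
    and law: "\<And>j. j < N \<Longrightarrow> distr M borel (\<lambda>w. x j w t) = scaled_normal s" and s: "0 \<le> s"
  shows "(\<integral>\<^sup>+w. ennreal ((real N * (sample_mean N (\<lambda>j. x j w) t)\<^sup>2 / sample_cov N (\<lambda>j. x j w) t t)\<^sup>2) \<partial>M)
    \<le> ennreal (105 + 256 * exp 80)"
proof -
  have meas [measurable]: "(\<lambda>w. x j w t) \<in> borel_measurable M" if "j < N" for j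
    using ind that by (auto simp: indep_vars_def)
  show ?thesis
  proof (cases "s = 0")
    case True
    have "AE w in M. x j w t = 0" if "j < N" for j
      by (rule scaled_normal_zero[OF meas[OF that]]) (use law[OF that] True in simp)
    then have "AE w in M. \<forall>j<N. x j w t = 0" by (simp add: AE_all_countable)
    then have "AE w in M. ennreal ((real N * (sample_mean N (\<lambda>j. x j w) t)\<^sup>2 / sample_cov N (\<lambda>j. x j w) t t)\<^sup>2) = 0"
      by eventually_elim (simp add: sample_mean_def)
    then have "(\<integral>\<^sup>+w. ennreal ((real N * (sample_mean N (\<lambda>j. x j w) t)\<^sup>2 / sample_cov N (\<lambda>j. x j w) t t)\<^sup>2) \<partial>M) = (\<integral>\<^sup>+w. 0 \<partial>M)"
      by (rule nn_integral_cong_AE)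
    then show ?thesis by simp
  next
    case False
    then have s: "0 < s" using s by simp
    define Z where "Z j w = x j w t / sqrt s" for j w
    have *: "(\<integral>\<^sup>+w. ennreal ((real N * (1 / real N * (\<Sum>j<N. Z j w))\<^sup>2 /
        (1 / (real N - 1) * (\<Sum>j<N. (Z j w - 1 / real N * (\<Sum>j<N. Z j w))\<^sup>2)))\<^sup>2) \<partial>M) \<le> ennreal (105 + 256 * exp 80)"
      unfolding Z_def using standardize[OF ind law s] by (rule student_second_moment_standard[OF N])
    have "real N * (1 / real N * (\<Sum>j<N. Z j w))\<^sup>2 / (1 / (real N - 1) * (\<Sum>j<N. (Z j w - 1 / real N * (\<Sum>j<N. Z j w))\<^sup>2)) =
      real N * (sample_mean N (\<lambda>j. x j w) t)\<^sup>2 / sample_cov N (\<lambda>j. x j w) t t" for w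
    proof -
      have m: "1 / real N * (\<Sum>j<N. Z j w) = sample_mean N (\<lambda>j. x j w) t / sqrt s"
        by (simp add: Z_def sample_mean_def sum_divide_distrib mult.commute)
      have "(\<Sum>j<N. (Z j w - sample_mean N (\<lambda>j. x j w) t / sqrt s)\<^sup>2) = (\<Sum>j<N. (x j w t - sample_mean N (\<lambda>j. x j w) t)\<^sup>2) / s"
        using s by (simp add: Z_def diff_divide_distrib[symmetric] power_divide sum_divide_distrib)
      then have c: "1 / (real N - 1) * (\<Sum>j<N. (Z j w - sample_mean N (\<lambda>j. x j w) t / sqrt s)\<^sup>2) = sample_cov N (\<lambda>j. x j w) t t / s"
        by (simp add: sample_cov_def power2_eq_square)
      show ?thesis unfolding m c using s by (simp add: power_divide)
    qed
    then show ?thesis using * by simp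
  qed
qed

text \<open>Steiner's formula at 0: the average of the squares is controlled through the fourth
  moment \<open>3 * s\<^sup>2\<close>, and the squared mean has expectation at most
  \<open>s / N\<close>. The prefactor \<open>N / (N - 1)\<close> is at most 2 and exceeds 1 by at
  most \<open>2 / N\<close>.\<close>

lemma sample_variance_concentration:
  fixes x :: "nat \<Rightarrow> 'a \<Rightarrow> real \<Rightarrow> real"
  assumes N: "2 \<le> N" and ind: "indep_vars (\<lambda>_. borel) (\<lambda>j w. x j w t) {..<N}"
    and law: "\<And>j. j < N \<Longrightarrow> distr M borel (\<lambda>w. x j w t) = scaled_normal s" and s: "0 \<le> s" and \<delta>: "0 < \<delta>"
  shows "integrable M (\<lambda>w. sample_cov N (\<lambda>j. x j w) t t)"
    and "expectation (\<lambda>w. \<bar>sample_cov N (\<lambda>j. x j w) t t - s\<bar>) \<le> 2 * \<delta> + 6 * s\<^sup>2 / (\<delta> * real N) + 4 * s / real N"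
proof -
  have meas [measurable]: "(\<lambda>w. x j w t) \<in> borel_measurable M" if "j < N" for j
    using ind that by (auto simp: indep_vars_def)
  note mom = scaled_normal_moments[OF meas law s]
  have N0: "0 < N" using N by simp
  have m2: "integrable M (\<lambda>w. (x j w t)\<^sup>2)" "expectation (\<lambda>w. (x j w t)\<^sup>2) = s" if "j < N" for j
    using mom(1)[OF that that, of 1] mom(2)[OF that that, of 1] by auto
  have m4: "integrable M (\<lambda>w. ((x j w t)\<^sup>2)\<^sup>2)" "expectation (\<lambda>w. ((x j w t)\<^sup>2)\<^sup>2) = 3 * s\<^sup>2" if "j < N" for j
    using mom(1)[OF that that, of 2] mom(2)[OF that that, of 2]
    by (auto simp: power_mult[symmetric] fact_numeral)
  have mean: "expectation (\<lambda>w. x j w t) = 0" if "j < N" for j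
    by (rule scaled_normal_mean[OF meas law]) (use that in auto)
  define A where "A w = 1 / real N * (\<Sum>j<N. (x j w t)\<^sup>2) - s" for w
  define B where "B w = (1 / real N * (\<Sum>j<N. x j w t) - 0)\<^sup>2" for w
  have B: "integrable M B" "expectation B \<le> s / real N"
    unfolding B_def using mean_square_average[OF ind N0 m2(1) mean eq_refl[OF m2(2)]] by auto
  have ind2: "indep_vars (\<lambda>_. borel) (\<lambda>j w. (x j w t)\<^sup>2) {..<N}"
    by (rule indep_vars_compose2[OF ind]) auto
  have A: "integrable M A" "expectation (\<lambda>w. \<bar>A w\<bar>) \<le> \<delta> + 3 * s\<^sup>2 / (\<delta> * real N)"
    unfolding A_def using mean_abs_average[OF ind2 N0 m4(1) m2(2) eq_refl[OF m4(2)] \<delta>] by auto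
  have eq: "sample_cov N (\<lambda>j. x j w) t t = real N / (real N - 1) * (A w - B w + s)" for w
    unfolding sample_cov_shift[OF N, of _ _ _ 0 0] by (simp add: A_def B_def sample_mean_def power2_eq_square)
  show int: "integrable M (\<lambda>w. sample_cov N (\<lambda>j. x j w) t t)"
    unfolding eq using A(1) B(1) by simp
  have r: "real N / (real N - 1) \<le> 2" "1 / (real N - 1) \<le> 2 / real N" using N by (auto simp: field_simps)
  have "\<bar>sample_cov N (\<lambda>j. x j w) t t - s\<bar> \<le> 2 * (\<bar>A w\<bar> + B w) + 2 * s / real N" for w
  proof -
    have "sample_cov N (\<lambda>j. x j w) t t - s = real N / (real N - 1) * (A w - B w) + 1 / (real N - 1) * s"
    proof -
      have *: "(1 + e) * (a - b + c) - c = (1 + e) * (a - b) + e * c" for a b c e :: real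
        by (simp add: algebra_simps)
      have "real N / (real N - 1) = 1 + 1 / (real N - 1)" using N by (simp add: field_simps)
      then show ?thesis unfolding eq by (simp only: *)
    qed
    then have "\<bar>sample_cov N (\<lambda>j. x j w) t t - s\<bar> \<le> \<bar>real N / (real N - 1) * (A w - B w)\<bar> + \<bar>1 / (real N - 1) * s\<bar>"
      by (simp only: abs_triangle_ineq)
    also have "\<dots> = real N / (real N - 1) * \<bar>A w - B w\<bar> + 1 / (real N - 1) * s"
      using N s by (simp add: abs_mult)
    also have "\<dots> \<le> 2 * (\<bar>A w\<bar> + B w) + 2 / real N * s"
    proof (intro add_mono mult_mono r)
      have "0 \<le> B w" by (simp add: B_def)
      then show "\<bar>A w - B w\<bar> \<le> \<bar>A w\<bar> + B w" by linarith
    qed (use s N in auto)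
    finally show ?thesis by simp
  qed
  then have "expectation (\<lambda>w. \<bar>sample_cov N (\<lambda>j. x j w) t t - s\<bar>) \<le> expectation (\<lambda>w. 2 * (\<bar>A w\<bar> + B w) + 2 * s / real N)"
    using int A(1) B(1) by (intro integral_mono) auto
  also have "\<dots> = 2 * (expectation (\<lambda>w. \<bar>A w\<bar>) + expectation B) + 2 * s / real N"
    using A(1) B(1) by (simp add: prob_space)
  also have "\<dots> \<le> 2 * ((\<delta> + 3 * s\<^sup>2 / (\<delta> * real N)) + s / real N) + 2 * s / real N"
    using A(2) B(2) by simp
  finally show "expectation (\<lambda>w. \<bar>sample_cov N (\<lambda>j. x j w) t t - s\<bar>) \<le> 2 * \<delta> + 6 * s\<^sup>2 / (\<delta> * real N) + 4 * s / real N"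
    by (simp add: algebra_simps)
qed

end

subsection \<open>Sample covariance functions\<close>

context prob_space
begin

text \<open>Truncation reduces the weak law in mean to bounded summands, for which the variance bound applies.\<close>

lemma weak_law_in_mean:
  fixes X :: "nat \<Rightarrow> 'a \<Rightarrow> real"
  assumes ind: "indep_vars (\<lambda>_. borel) X UNIV"
    and id: "\<And>j. distr M borel (X j) = distr M borel (X 0)"
    and int: "integrable M (X 0)"
  shows "(\<lambda>m. expectation (\<lambda>w. \<bar>1 / real m * (\<Sum>j<m. X j w) - expectation (X 0)\<bar>)) \<longlonglongrightarrow> 0"
proof (rule LIMSEQ_I)
  fix r :: real assume r: "0 < r"
  have meas [measurable]: "X j \<in> borel_measurable M" for j
    using ind by (auto simp: indep_vars_def)
  have transfer: "expectation (\<lambda>w. h (X j w)) = expectation (\<lambda>w. h (X 0 w))"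
    "integrable M (\<lambda>w. h (X j w)) = integrable M (\<lambda>w. h (X 0 w))"
    if "h \<in> borel_measurable borel" for h :: "real \<Rightarrow> real" and j
    using integral_distr[OF meas that, of j] integral_distr[OF meas that, of 0]
      integrable_distr_eq[OF meas that, of j] integrable_distr_eq[OF meas that, of 0] id[of j] by auto
  define tail where "tail c = expectation (\<lambda>w. \<bar>if \<bar>X 0 w\<bar> \<le> real c then 0 else X 0 w\<bar>)" for c :: nat
  have "tail \<longlonglongrightarrow> expectation (\<lambda>w. 0)"
    unfolding tail_def
  proof (rule integral_dominated_convergence[where w = "\<lambda>w. \<bar>X 0 w\<bar>"])
    show "AE w in M. (\<lambda>c. \<bar>if \<bar>X 0 w\<bar> \<le> real c then 0 else X 0 w\<bar>) \<longlonglongrightarrow> 0"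
    proof (rule AE_I2)
      fix w
      obtain c0 :: nat where "\<bar>X 0 w\<bar> \<le> real c0" using real_arch_simple by blast
      then have "\<bar>if \<bar>X 0 w\<bar> \<le> real c then 0 else X 0 w\<bar> = 0" if "c \<ge> c0" for c using that by auto
      then show "(\<lambda>c. \<bar>if \<bar>X 0 w\<bar> \<le> real c then 0 else X 0 w\<bar>) \<longlonglongrightarrow> 0"
        by (intro tendsto_eventually eventually_sequentiallyI[of c0])
    qed
  qed (use int in auto)
  then have "tail \<longlonglongrightarrow> 0" by simp
  \<comment> \<open>The truncation level is fixed before the number of summands: the parts beyond it
    contribute at most \<open>2 * tail c\<close>, whatever \<open>m\<close> is.\<close>
  from LIMSEQ_D[OF this, of "r / 4"] r obtain c where "norm (tail c - 0) < r / 4" by auto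
  then have c: "tail c < r / 4" unfolding real_norm_def diff_zero by linarith
  define Y where "Y j w = (if \<bar>X j w\<bar> \<le> real c then X j w else 0)" for j w
  define Z where "Z j w = (if \<bar>X j w\<bar> \<le> real c then 0 else X j w)" for j w
  have [measurable]: "Y j \<in> borel_measurable M" "Z j \<in> borel_measurable M" for j
    unfolding Y_def Z_def by measurable
  have X_eq: "X j w = Y j w + Z j w" for j w by (simp add: Y_def Z_def)
  have Y_int: "integrable M (Y j)" and Y_sq: "integrable M (\<lambda>w. (Y j w)\<^sup>2)" for j
    by (rule integrable_const_bound[of _ "real c"]; simp add: Y_def)
       (rule integrable_const_bound[of _ "(real c)\<^sup>2"]; simp add: Y_def abs_le_square_iff[symmetric])
  have X_int: "integrable M (X j)" for j using transfer(2)[of "\<lambda>x. x" j] int by simp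
  have Z_int: "integrable M (Z j)" for j
    using Bochner_Integration.integrable_diff[OF X_int Y_int, of j j] by (simp add: X_eq)
  have Z_tail: "expectation (\<lambda>w. \<bar>Z j w\<bar>) = tail c" for j
    unfolding tail_def Z_def by (rule transfer(1)[of "\<lambda>x. \<bar>if \<bar>x\<bar> \<le> real c then 0 else x\<bar>"]) measurable
  define \<mu> where "\<mu> = expectation (Y 0)"
  have Y_mean: "expectation (Y j) = \<mu>" for j
    unfolding \<mu>_def Y_def by (rule transfer(1)[of "\<lambda>x. if \<bar>x\<bar> \<le> real c then x else 0"]) measurable
  have Y_bound: "expectation (\<lambda>w. (Y j w)\<^sup>2) \<le> (real c)\<^sup>2" for j
    using Y_sq by (intro integral_le_const AE_I2) (auto simp: Y_def abs_le_square_iff[symmetric])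
  have ind_Y: "indep_vars (\<lambda>_. borel) Y {..<m}" for m
    unfolding Y_def by (rule indep_vars_compose2[OF indep_vars_subset[OF ind]]) auto
  have \<mu>: "\<bar>\<mu> - expectation (X 0)\<bar> \<le> tail c"
  proof -
    have "expectation (X 0) = \<mu> + expectation (Z 0)"
      unfolding \<mu>_def X_eq[abs_def] using Y_int Z_int by simp
    moreover have "\<bar>expectation (Z 0)\<bar> \<le> tail c" unfolding Z_tail[of 0, symmetric] by (rule integral_abs_bound)
    ultimately show ?thesis by simp
  qed
  define \<delta> where "\<delta> = r / 8"
  have \<delta>: "0 < \<delta>" using r by (simp add: \<delta>_def)
  obtain m0 :: nat where m0: "(real c)\<^sup>2 / \<delta> / \<delta> < real m0" using reals_Archimedean2 by blast
  have "expectation (\<lambda>w. \<bar>1 / real m * (\<Sum>j<m. X j w) - expectation (X 0)\<bar>) < r" if m: "m \<ge> Suc m0" for m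
  proof -
    have m_pos: "0 < m" using m by simp
    note avg = mean_abs_average[OF ind_Y m_pos Y_sq Y_mean Y_bound \<delta>]
    have "(real c)\<^sup>2 / \<delta> / \<delta> \<le> real m" using m0 m by simp
    then have "(real c)\<^sup>2 / (\<delta> * real m) \<le> \<delta>" using \<delta> m_pos by (simp add: field_simps)
    then have avg': "expectation (\<lambda>w. \<bar>1 / real m * (\<Sum>j<m. Y j w) - \<mu>\<bar>) \<le> 2 * \<delta>" using avg(2) by simp
    have "\<bar>1 / real m * (\<Sum>j<m. X j w) - expectation (X 0)\<bar> \<le>
        \<bar>1 / real m * (\<Sum>j<m. Y j w) - \<mu>\<bar> + 1 / real m * (\<Sum>j<m. \<bar>Z j w\<bar>) + tail c" for w
    proof -
      have "\<bar>1 / real m * (\<Sum>j<m. Z j w)\<bar> \<le> 1 / real m * (\<Sum>j<m. \<bar>Z j w\<bar>)"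
        unfolding abs_mult by (intro mult_mono sum_abs) auto
      moreover have "1 / real m * (\<Sum>j<m. X j w) = 1 / real m * (\<Sum>j<m. Y j w) + 1 / real m * (\<Sum>j<m. Z j w)"
        by (simp add: X_eq sum.distrib distrib_left add_divide_distrib)
      ultimately show ?thesis using \<mu> by linarith
    qed
    then have "expectation (\<lambda>w. \<bar>1 / real m * (\<Sum>j<m. X j w) - expectation (X 0)\<bar>) \<le>
        expectation (\<lambda>w. \<bar>1 / real m * (\<Sum>j<m. Y j w) - \<mu>\<bar> + 1 / real m * (\<Sum>j<m. \<bar>Z j w\<bar>) + tail c)"
      using avg(1) X_int Z_int by (intro integral_mono) auto
    also have "\<dots> = expectation (\<lambda>w. \<bar>1 / real m * (\<Sum>j<m. Y j w) - \<mu>\<bar>) + 1 / real m * (\<Sum>j<m. tail c) + tail c"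
      using avg(1) Z_int by (simp add: prob_space Z_tail)
    also have "\<dots> \<le> 2 * \<delta> + tail c + tail c" using avg' m_pos by simp
    also have "\<dots> < r" using c r unfolding \<delta>_def by linarith
    finally show ?thesis .
  qed
  moreover have "0 \<le> expectation (\<lambda>w. \<bar>1 / real m * (\<Sum>j<m. X j w) - expectation (X 0)\<bar>)" for m by simp
  ultimately show "\<exists>n0. \<forall>m\<ge>n0. norm (expectation (\<lambda>w. \<bar>1 / real m * (\<Sum>j<m. X j w) - expectation (X 0)\<bar>) - 0) < r"
    by (intro exI[of _ "Suc m0"]) auto
qed

text \<open>By Steiner's formula at the true means, the average of the products obeys the weak law
  in mean, and the correction is at most the sum of two squared centred averages, each of order
  \<open>1 / m\<close> in mean. The bound uniform in \<open>m\<close> serves later as a dominating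
  function over pairs of times.\<close>

lemma sample_cov_mean_convergence:
  fixes x :: "nat \<Rightarrow> 'a \<Rightarrow> real \<Rightarrow> real"
  assumes ind: "indep_vars (\<lambda>_. borel \<Otimes>\<^sub>M borel) (\<lambda>j w. (x j w t, x j w s)) UNIV"
    and id: "\<And>j. distr M (borel \<Otimes>\<^sub>M borel) (\<lambda>w. (x j w t, x j w s)) = distr M (borel \<Otimes>\<^sub>M borel) (\<lambda>w. (x 0 w t, x 0 w s))"
    and sq: "integrable M (\<lambda>w. (x 0 w t - a)\<^sup>2)" "integrable M (\<lambda>w. (x 0 w s - b)\<^sup>2)"
    and mean: "expectation (\<lambda>w. x 0 w t - a) = 0" "expectation (\<lambda>w. x 0 w s - b) = 0"
  defines "c \<equiv> expectation (\<lambda>w. (x 0 w t - a) * (x 0 w s - b))"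
  shows "integrable M (\<lambda>w. sample_cov m (\<lambda>j. x j w) t s - c)"
    and "expectation (\<lambda>w. \<bar>sample_cov m (\<lambda>j. x j w) t s - c\<bar>) \<le>
      2 * (expectation (\<lambda>w. (x 0 w t - a)\<^sup>2) + expectation (\<lambda>w. (x 0 w s - b)\<^sup>2))"
    and "(\<lambda>m. expectation (\<lambda>w. \<bar>sample_cov m (\<lambda>j. x j w) t s - c\<bar>)) \<longlonglongrightarrow> 0"
proof -
  define U where "U j w = x j w t - a" for j w
  define V where "V j w = x j w s - b" for j w
  have pair: "(\<lambda>w. (x j w t, x j w s)) \<in> M \<rightarrow>\<^sub>M borel \<Otimes>\<^sub>M borel" for j
    using ind by (auto simp: indep_vars_def)
  have [measurable]: "(\<lambda>w. x j w t) \<in> borel_measurable M" "(\<lambda>w. x j w s) \<in> borel_measurable M" for j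
    using measurable_compose[OF pair measurable_fst] measurable_compose[OF pair measurable_snd] by simp_all
  have [measurable]: "U j \<in> borel_measurable M" "V j \<in> borel_measurable M" for j
    unfolding U_def V_def by measurable
  have transfer: "expectation (\<lambda>w. h (x j w t, x j w s)) = expectation (\<lambda>w. h (x 0 w t, x 0 w s))"
    "integrable M (\<lambda>w. h (x j w t, x j w s)) = integrable M (\<lambda>w. h (x 0 w t, x 0 w s))"
    if h: "h \<in> borel_measurable (borel \<Otimes>\<^sub>M borel)" for h :: "real \<times> real \<Rightarrow> real" and j
    using integral_distr[OF pair h, of j] integral_distr[OF pair h, of 0]
      integrable_distr_eq[OF pair h, of j] integrable_distr_eq[OF pair h, of 0] id[of j] by auto
  have U2: "integrable M (\<lambda>w. (U j w)\<^sup>2)" "expectation (\<lambda>w. (U j w)\<^sup>2) = expectation (\<lambda>w. (x 0 w t - a)\<^sup>2)" for j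
    using transfer[of "\<lambda>(p, q). (p - a)\<^sup>2" j] sq by (auto simp: U_def)
  have V2: "integrable M (\<lambda>w. (V j w)\<^sup>2)" "expectation (\<lambda>w. (V j w)\<^sup>2) = expectation (\<lambda>w. (x 0 w s - b)\<^sup>2)" for j
    using transfer[of "\<lambda>(p, q). (q - b)\<^sup>2" j] sq by (auto simp: V_def)
  have UV_le: "\<bar>p * q\<bar> \<le> p\<^sup>2 + q\<^sup>2" for p q :: real
    using sum_squares_bound[of "\<bar>p\<bar>" "\<bar>q\<bar>"] abs_ge_zero[of "p * q"] unfolding abs_mult mult.assoc power2_abs by linarith
  have UV: "integrable M (\<lambda>w. U j w * V j w)" for j
    by (rule Bochner_Integration.integrable_bound[OF Bochner_Integration.integrable_add[OF U2(1)[of j] V2(1)[of j]]])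
       (auto simp: UV_le)
  have mU: "expectation (U j) = 0" and mV: "expectation (V j) = 0" for j
    using transfer(1)[of "\<lambda>(p, q). p - a" j] transfer(1)[of "\<lambda>(p, q). q - b" j] mean by (auto simp: U_def[abs_def] V_def[abs_def])
  have bound: "\<bar>sample_cov m (\<lambda>j. x j w) t s\<bar> \<le> 1 / real m * (\<Sum>j<m. (U j w)\<^sup>2) + 1 / real m * (\<Sum>j<m. (V j w)\<^sup>2)" for m w
    unfolding U_def V_def by (rule abs_sample_cov_le)
  have bi: "integrable M (\<lambda>w. 1 / real m * (\<Sum>j<m. (U j w)\<^sup>2) + 1 / real m * (\<Sum>j<m. (V j w)\<^sup>2))" for m
    using U2 V2 by simp
  have sc: "(\<lambda>w. sample_cov m (\<lambda>j. x j w) t s) \<in> borel_measurable M" for m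
    unfolding sample_cov_def sample_mean_def by measurable
  have int: "integrable M (\<lambda>w. sample_cov m (\<lambda>j. x j w) t s)" for m
    by (rule Bochner_Integration.integrable_bound[OF bi[of m] sc], rule AE_I2, unfold real_norm_def)
       (rule order.trans[OF bound abs_ge_self])
  then show "integrable M (\<lambda>w. sample_cov m (\<lambda>j. x j w) t s - c)" by simp
  have c: "\<bar>c\<bar> \<le> expectation (\<lambda>w. (x 0 w t - a)\<^sup>2) + expectation (\<lambda>w. (x 0 w s - b)\<^sup>2)"
  proof -
    have "\<bar>c\<bar> \<le> expectation (\<lambda>w. \<bar>U 0 w * V 0 w\<bar>)" unfolding c_def U_def V_def by (rule integral_abs_bound)
    also have "\<dots> \<le> expectation (\<lambda>w. (U 0 w)\<^sup>2 + (V 0 w)\<^sup>2)"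
      using UV U2 V2 by (intro integral_mono UV_le) auto
    finally show ?thesis using U2 V2 by simp
  qed
  show "expectation (\<lambda>w. \<bar>sample_cov m (\<lambda>j. x j w) t s - c\<bar>) \<le>
      2 * (expectation (\<lambda>w. (x 0 w t - a)\<^sup>2) + expectation (\<lambda>w. (x 0 w s - b)\<^sup>2))"
  proof -
    have "expectation (\<lambda>w. \<bar>sample_cov m (\<lambda>j. x j w) t s - c\<bar>) \<le>
        expectation (\<lambda>w. 1 / real m * (\<Sum>j<m. (U j w)\<^sup>2) + 1 / real m * (\<Sum>j<m. (V j w)\<^sup>2) + \<bar>c\<bar>)"
      using int bi by (intro integral_mono order.trans[OF abs_triangle_ineq4 add_right_mono[OF bound]]) auto
    also have "\<dots> = 1 / real m * (\<Sum>j<m. expectation (\<lambda>w. (U j w)\<^sup>2)) + 1 / real m * (\<Sum>j<m. expectation (\<lambda>w. (V j w)\<^sup>2)) + \<bar>c\<bar>"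
      using U2(1) V2(1) by (simp add: prob_space)
    also have "\<dots> \<le> expectation (\<lambda>w. (x 0 w t - a)\<^sup>2) + expectation (\<lambda>w. (x 0 w s - b)\<^sup>2) + \<bar>c\<bar>"
      by (cases "m = 0") (auto simp: U2(2) V2(2))
    finally show ?thesis using c by simp
  qed
  have ind_UV: "indep_vars (\<lambda>_. borel) (\<lambda>j w. U j w * V j w) UNIV"
    using indep_vars_compose2[OF ind, of "\<lambda>_ (p, q). (p - a) * (q - b)" "\<lambda>_. borel"] by (simp add: U_def V_def)
  have ind_U: "indep_vars (\<lambda>_. borel) U {..<m}" for m
    using indep_vars_subset[OF indep_vars_compose2[OF ind, of "\<lambda>_ (p, q). p - a" "\<lambda>_. borel"], of "{..<m}"]
    by (simp add: U_def[abs_def])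
  have ind_V: "indep_vars (\<lambda>_. borel) V {..<m}" for m
    using indep_vars_subset[OF indep_vars_compose2[OF ind, of "\<lambda>_ (p, q). q - b" "\<lambda>_. borel"], of "{..<m}"]
    by (simp add: V_def[abs_def])
  have id_UV: "distr M borel (\<lambda>w. U j w * V j w) = distr M borel (\<lambda>w. U 0 w * V 0 w)" for j
  proof -
    have g: "(\<lambda>(p, q). (p - a) * (q - b)) \<in> borel_measurable (borel \<Otimes>\<^sub>M borel)" by measurable
    show ?thesis
      using distr_distr[OF g pair, of j] distr_distr[OF g pair, of 0] id[of j] by (simp add: U_def V_def comp_def)
  qed
  define e where "e m = expectation (\<lambda>w. \<bar>1 / real m * (\<Sum>j<m. U j w * V j w) - c\<bar>)" for m
  have e: "e \<longlonglongrightarrow> 0"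
    using weak_law_in_mean[OF ind_UV id_UV UV] unfolding e_def c_def U_def V_def .
  define K where "K = expectation (\<lambda>w. (x 0 w t - a)\<^sup>2) + expectation (\<lambda>w. (x 0 w s - b)\<^sup>2)"
  have upper: "expectation (\<lambda>w. \<bar>sample_cov m (\<lambda>j. x j w) t s - c\<bar>) \<le> 2 * e m + 2 * K / real m + 2 * \<bar>c\<bar> / real m"
    if m: "2 \<le> m" for m
  proof -
    define A where "A w = 1 / real m * (\<Sum>j<m. U j w * V j w) - c" for w
    define BU where "BU w = (1 / real m * (\<Sum>j<m. U j w) - 0)\<^sup>2" for w
    define BV where "BV w = (1 / real m * (\<Sum>j<m. V j w) - 0)\<^sup>2" for w
    have m0: "0 < m" using m by simp
    have BU: "integrable M BU" "expectation BU \<le> expectation (\<lambda>w. (x 0 w t - a)\<^sup>2) / real m"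
      unfolding BU_def using mean_square_average[OF ind_U m0 U2(1) mU eq_refl[OF U2(2)]] by auto
    have BV: "integrable M BV" "expectation BV \<le> expectation (\<lambda>w. (x 0 w s - b)\<^sup>2) / real m"
      unfolding BV_def using mean_square_average[OF ind_V m0 V2(1) mV eq_refl[OF V2(2)]] by auto
    have A: "integrable M A" unfolding A_def using UV by simp
    have r: "real m / (real m - 1) \<le> 2" "1 / (real m - 1) \<le> 2 / real m" using m by (auto simp: field_simps)
    have "\<bar>sample_cov m (\<lambda>j. x j w) t s - c\<bar> \<le> 2 * (\<bar>A w\<bar> + (BU w + BV w)) + 2 * \<bar>c\<bar> / real m" for w
    proof -
      define p where "p = (sample_mean m (\<lambda>j. x j w) t - a) * (sample_mean m (\<lambda>j. x j w) s - b)"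
      have sm: "sample_mean m (\<lambda>j. x j w) t - a = 1 / real m * (\<Sum>j<m. U j w)"
        "sample_mean m (\<lambda>j. x j w) s - b = 1 / real m * (\<Sum>j<m. V j w)"
        using m by (auto simp: sample_mean_def U_def V_def sum_subtractf field_simps)
      have p: "\<bar>p\<bar> \<le> BU w + BV w" unfolding p_def sm BU_def BV_def diff_zero by (rule UV_le)
      have *: "(1 + e) * (u + c - p) - c = (1 + e) * (u - p) + e * c" for e u :: real
        by (simp add: algebra_simps)
      have "sample_cov m (\<lambda>j. x j w) t s = real m / (real m - 1) * (A w + c - p)"
        unfolding sample_cov_shift[OF m, of _ _ _ a b] p_def A_def U_def V_def by simp
      moreover have "real m / (real m - 1) = 1 + 1 / (real m - 1)" using m by (simp add: field_simps)
      ultimately have "sample_cov m (\<lambda>j. x j w) t s - c = real m / (real m - 1) * (A w - p) + 1 / (real m - 1) * c"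
        by (simp only: *)
      then have "\<bar>sample_cov m (\<lambda>j. x j w) t s - c\<bar> \<le> \<bar>real m / (real m - 1) * (A w - p)\<bar> + \<bar>1 / (real m - 1) * c\<bar>"
        by (simp only: abs_triangle_ineq)
      also have "\<dots> = real m / (real m - 1) * \<bar>A w - p\<bar> + 1 / (real m - 1) * \<bar>c\<bar>"
        using m by (simp add: abs_mult)
      also have "\<dots> \<le> 2 * (\<bar>A w\<bar> + (BU w + BV w)) + 2 / real m * \<bar>c\<bar>"
      proof (intro add_mono mult_mono r)
        show "\<bar>A w - p\<bar> \<le> \<bar>A w\<bar> + (BU w + BV w)" using p by linarith
      qed (use m in auto)
      finally show ?thesis by simp
    qed
    then have "expectation (\<lambda>w. \<bar>sample_cov m (\<lambda>j. x j w) t s - c\<bar>) \<le>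
        expectation (\<lambda>w. 2 * (\<bar>A w\<bar> + (BU w + BV w)) + 2 * \<bar>c\<bar> / real m)"
      using int A BU(1) BV(1) by (intro integral_mono) auto
    also have "\<dots> = 2 * (e m + (expectation BU + expectation BV)) + 2 * \<bar>c\<bar> / real m"
      unfolding e_def A_def[symmetric] using A BU(1) BV(1) by (simp add: prob_space)
    also have "\<dots> \<le> 2 * (e m + K / real m) + 2 * \<bar>c\<bar> / real m"
      using BU(2) BV(2) by (simp add: K_def add_divide_distrib)
    finally show ?thesis by (simp add: algebra_simps)
  qed
  have "(\<lambda>m. 2 * e m + 2 * K / real m + 2 * \<bar>c\<bar> / real m) \<longlonglongrightarrow> 2 * 0 + 0 + 0"
    by (intro tendsto_intros e lim_const_over_n)
  then have "(\<lambda>m. 2 * e m + 2 * K / real m + 2 * \<bar>c\<bar> / real m) \<longlonglongrightarrow> 0" by simp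
  then show "(\<lambda>m. expectation (\<lambda>w. \<bar>sample_cov m (\<lambda>j. x j w) t s - c\<bar>)) \<longlonglongrightarrow> 0"
    by (rule tendsto_sandwich[OF _ _ tendsto_const, rotated 2])
       (auto intro!: eventually_sequentiallyI[of 2] upper)
qed

end

text \<open>Passes from a family indexed by pairs of group and observation to a single group, along
  the injection \<open>Pair i\<close>.\<close>

lemma (in prob_space) indep_vars_reindex:
  assumes f: "inj_on f I" and ind: "indep_vars M' X (f ` I)"
  shows "indep_vars (\<lambda>i. M' (f i)) (\<lambda>i. X (f i)) I"
  unfolding indep_vars_def2
proof (intro conjI ballI)
  show "random_variable (M' (f i)) (X (f i))" if "i \<in> I" for i
    using ind that by (auto simp: indep_vars_def2)
  let ?F = "\<lambda>i. {X i -` A \<inter> space M | A. A \<in> sets (M' i)}"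
  have sets: "indep_sets ?F (f ` I)" using ind by (simp add: indep_vars_def2)
  show "indep_sets (\<lambda>i. ?F (f i)) I"
  proof (rule indep_setsI)
    show "?F (f i) \<subseteq> events" if "i \<in> I" for i
      using sets that by (auto simp: indep_sets_def)
    fix A J assume J: "J \<noteq> {}" "J \<subseteq> I" "finite J" and A: "\<forall>j\<in>J. A j \<in> ?F (f j)"
    have inj: "inj_on f J" using f J by (blast intro: inj_on_subset)
    define B where "B = (\<lambda>i. A (the_inv_into J f i))"
    have B: "B (f j) = A j" if "j \<in> J" for j using inj that by (simp add: B_def the_inv_into_f_f)
    have "prob (\<Inter>i\<in>f ` J. B i) = (\<Prod>i\<in>f ` J. prob (B i))"
      by (rule indep_setsD[OF sets]) (use J A B in auto)
    then show "prob (\<Inter>j\<in>J. A j) = (\<Prod>j\<in>J. prob (A j))"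
      using B inj by (simp add: prod.reindex)
  qed
qed

text \<open>Deviations are integrated jointly over the data and the pairs of times. At a fixed pair
  their mean tends to 0, and it is dominated by the variance functions, which are bounded because
  they are continuous on a compact interval. The subsequence is extracted on the product space, so
  it does not depend on the realization of the data.\<close>

lemma data_covariance_subsequence:
  fixes x :: "nat \<Rightarrow> nat \<Rightarrow> 'w \<Rightarrow> real \<Rightarrow> real" and N :: "nat \<Rightarrow> nat \<Rightarrow> nat"
  assumes M: "prob_space M" and T: "T = {a..b}"
    and ind: "indep_processes M T ({..<k} \<times> UNIV) (\<lambda>(i, j). x i j)"
    and proc: "\<And>i j. i < k \<Longrightarrow> L2_process M T (x i j)"
    and law: "\<And>i j. i < k \<Longrightarrow> process_law M T (x i j) = process_law M T (x i 0)"
    and cov: "\<And>i j. i < k \<Longrightarrow> has_mean_and_covariance M T (x i j) (\<eta> i) (\<gamma> i)"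
    and \<eta>: "\<And>i. i < k \<Longrightarrow> L2_on T (\<eta> i)"
    and cont: "\<And>i. i < k \<Longrightarrow> continuous_on T (\<lambda>t. \<gamma> i t t)"
    and N: "\<And>i. i < k \<Longrightarrow> filterlim (\<lambda>\<nu>. N \<nu> i) at_top sequentially"
  shows "\<exists>\<psi>. strict_mono \<psi> \<and> (AE w in M. AE z in lborel_on T \<Otimes>\<^sub>M lborel_on T. \<forall>i<k.
      (\<lambda>\<nu>. sample_cov (N (\<psi> \<nu>) i) (\<lambda>j. x i j w) (fst z) (snd z)) \<longlonglongrightarrow> \<gamma> i (fst z) (snd z) \<and>
      (\<lambda>\<nu>. sample_cov (N (\<psi> \<nu>) i) (\<lambda>j. x i j w) (fst z) (fst z)) \<longlonglongrightarrow> \<gamma> i (fst z) (fst z))"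
proof -
  interpret M: prob_space M by (rule M)
  define \<mu> where "\<mu> = lborel_on T"
  have sp: "space \<mu> = T" by (simp add: \<mu>_def space_restrict_space)
  have "emeasure \<mu> (space \<mu>) < \<infinity>"
    using T by (simp add: \<mu>_def sp[unfolded \<mu>_def] emeasure_restrict_space emeasure_lborel_Icc_eq)
  then interpret \<mu>: finite_measure \<mu> by (intro finite_measureI) auto
  interpret \<mu>2: pair_sigma_finite \<mu> \<mu> ..
  interpret \<mu>2f: finite_measure "\<mu> \<Otimes>\<^sub>M \<mu>" by (rule finite_measure_pair_measure) unfold_locales
  interpret MP: pair_sigma_finite M "\<mu> \<Otimes>\<^sub>M \<mu>" ..
  have joint: "(\<lambda>(w, t). x i j w t) \<in> borel_measurable (M \<Otimes>\<^sub>M \<mu>)" if "i < k" for i j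
    using proc[OF that] by (simp add: L2_process_def \<mu>_def)
  have path: "(\<lambda>w. x i j w t) \<in> borel_measurable M" if "i < k" "t \<in> T" for i j t
    using cov[OF that(1), of j] that(2) by (auto simp: has_mean_and_covariance_def)
  have \<eta>_meas: "\<eta> i \<in> borel_measurable \<mu>" if "i < k" for i
    using \<eta>[OF that] by (simp add: L2_on_def \<mu>_def)
  define sc where "sc i m t s w = sample_cov m (\<lambda>j. x i j w) t s" for i m t s w
  have sc_conv: "integrable M (\<lambda>w. sc i m t s w - \<gamma> i t s)"
      "M.expectation (\<lambda>w. \<bar>sc i m t s w - \<gamma> i t s\<bar>) \<le> 2 * (\<gamma> i t t + \<gamma> i s s)"
      "(\<lambda>m. M.expectation (\<lambda>w. \<bar>sc i m t s w - \<gamma> i t s\<bar>)) \<longlonglongrightarrow> 0"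
    if i: "i < k" and ts: "t \<in> T" "s \<in> T" for i m t s
  proof -
    have ev: "(\<lambda>f. (f t, f s)) \<in> PiM T (\<lambda>_. borel) \<rightarrow>\<^sub>M (borel \<Otimes>\<^sub>M borel :: (real \<times> real) measure)"
      using ts by measurable
    have rs: "(\<lambda>w. restrict (x i j w) T) \<in> M \<rightarrow>\<^sub>M PiM T (\<lambda>_. borel)" for j
      using path[OF i] by (intro measurable_restrict) auto
    have "M.indep_vars (\<lambda>_. PiM T (\<lambda>_. borel)) (\<lambda>p w. restrict ((case p of (i, j) \<Rightarrow> x i j) w) T) (Pair i ` UNIV)"
      by (rule M.indep_vars_subset[OF ind[unfolded indep_processes_def]]) (use i in auto)
    from M.indep_vars_reindex[OF _ this]
    have "M.indep_vars (\<lambda>_. PiM T (\<lambda>_. borel)) (\<lambda>j w. restrict (x i j w) T) UNIV"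
      by (simp add: inj_on_def)
    then have "M.indep_vars (\<lambda>_. borel \<Otimes>\<^sub>M borel) (\<lambda>j w. (\<lambda>f. (f t, f s)) (restrict (x i j w) T)) UNIV"
      by (rule M.indep_vars_compose2) (rule ev)
    then have 1: "M.indep_vars (\<lambda>_. borel \<Otimes>\<^sub>M borel) (\<lambda>j w. (x i j w t, x i j w s)) UNIV"
      using ts by simp
    have "distr M (borel \<Otimes>\<^sub>M borel) (\<lambda>w. (x i j w t, x i j w s)) = distr (process_law M T (x i j)) (borel \<Otimes>\<^sub>M borel) (\<lambda>f. (f t, f s))" for j
      unfolding process_law_def using ts by (subst distr_distr[OF ev rs]) (simp add: comp_def)
    then have 2: "distr M (borel \<Otimes>\<^sub>M borel) (\<lambda>w. (x i j w t, x i j w s)) = distr M (borel \<Otimes>\<^sub>M borel) (\<lambda>w. (x i 0 w t, x i 0 w s))" for j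
      using law[OF i, of j] by simp
    have c0: "has_mean_and_covariance M T (x i 0) (\<eta> i) (\<gamma> i)" using cov[OF i] .
    have 3: "integrable M (\<lambda>w. (x i 0 w t - \<eta> i t)\<^sup>2)" "M.expectation (\<lambda>w. (x i 0 w t - \<eta> i t)\<^sup>2) = \<gamma> i t t"
      "M.expectation (\<lambda>w. x i 0 w t - \<eta> i t) = 0" if "t \<in> T" for t
      using c0 that by (auto simp: has_mean_and_covariance_def power2_eq_square M.prob_space)
    have 4: "M.expectation (\<lambda>w. (x i 0 w t - \<eta> i t) * (x i 0 w s - \<eta> i s)) = \<gamma> i t s"
      using c0 ts by (auto simp: has_mean_and_covariance_def)
    note conv = M.sample_cov_mean_convergence[OF 1 2 3(1)[OF ts(1)] 3(1)[OF ts(2)] 3(3)[OF ts(1)] 3(3)[OF ts(2)],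
        unfolded 4 3(2)[OF ts(1)] 3(2)[OF ts(2)]]
    show "integrable M (\<lambda>w. sc i m t s w - \<gamma> i t s)"
      "M.expectation (\<lambda>w. \<bar>sc i m t s w - \<gamma> i t s\<bar>) \<le> 2 * (\<gamma> i t t + \<gamma> i s s)"
      "(\<lambda>m. M.expectation (\<lambda>w. \<bar>sc i m t s w - \<gamma> i t s\<bar>)) \<longlonglongrightarrow> 0"
      unfolding sc_def by (rule conv)+
  qed
  have \<gamma>0: "0 \<le> \<gamma> i t t" if "i < k" "t \<in> T" for i t
  proof -
    have "\<gamma> i t t = M.expectation (\<lambda>w. (x i 0 w t - \<eta> i t) * (x i 0 w t - \<eta> i t))"
      using cov[OF that(1), of 0] that(2) by (auto simp: has_mean_and_covariance_def)
    then show ?thesis by simp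
  qed
  have "\<forall>i<k. \<exists>G. \<forall>t\<in>T. \<gamma> i t t \<le> G"
  proof (intro allI impI)
    fix i assume "i < k"
    have "bounded ((\<lambda>t. \<gamma> i t t) ` T)"
      using cont[OF \<open>i < k\<close>] by (intro compact_imp_bounded compact_continuous_image) (auto simp: T)
    then show "\<exists>G. \<forall>t\<in>T. \<gamma> i t t \<le> G" by (meson bounded_imp_bdd_above bdd_above.unfold imageI)
  qed
  then obtain G where G: "\<And>i t. i < k \<Longrightarrow> t \<in> T \<Longrightarrow> \<gamma> i t t \<le> G i" by metis
  \<comment> \<open>One nonnegative deviation collects all groups, at the pair of times and at its
    first time taken twice, so that a single subsequence serves all of them.\<close>
  define u where "u \<nu> wz = (\<Sum>i<k. \<bar>sc i (N \<nu> i) (fst (snd wz)) (snd (snd wz)) (fst wz) - \<gamma> i (fst (snd wz)) (snd (snd wz))\<bar> +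
      \<bar>sc i (N \<nu> i) (fst (snd wz)) (fst (snd wz)) (fst wz) - \<gamma> i (fst (snd wz)) (fst (snd wz))\<bar>)" for \<nu> wz
  have \<gamma>_meas: "(\<lambda>z. \<gamma> i (fst z) (snd z)) \<in> borel_measurable (\<mu> \<Otimes>\<^sub>M \<mu>)" if i: "i < k" for i
  proof -
    have [measurable]: "(\<lambda>p. x i 0 (snd p) (fst (fst p))) \<in> borel_measurable ((\<mu> \<Otimes>\<^sub>M \<mu>) \<Otimes>\<^sub>M M)"
      "(\<lambda>p. x i 0 (snd p) (snd (fst p))) \<in> borel_measurable ((\<mu> \<Otimes>\<^sub>M \<mu>) \<Otimes>\<^sub>M M)"
      using measurable_compose[of "\<lambda>p. (snd p, fst (fst p))" "(\<mu> \<Otimes>\<^sub>M \<mu>) \<Otimes>\<^sub>M M", OF _ joint[OF i, of 0]]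
        measurable_compose[of "\<lambda>p. (snd p, snd (fst p))" "(\<mu> \<Otimes>\<^sub>M \<mu>) \<Otimes>\<^sub>M M", OF _ joint[OF i, of 0]]
      by simp_all
    note [measurable] = \<eta>_meas[OF i]
    have "(\<lambda>z. \<integral>w. (x i 0 w (fst z) - \<eta> i (fst z)) * (x i 0 w (snd z) - \<eta> i (snd z)) \<partial>M) \<in> borel_measurable (\<mu> \<Otimes>\<^sub>M \<mu>)"
      by (rule M.borel_measurable_lebesgue_integral) (simp add: case_prod_beta)
    moreover have "(\<integral>w. (x i 0 w (fst z) - \<eta> i (fst z)) * (x i 0 w (snd z) - \<eta> i (snd z)) \<partial>M) = \<gamma> i (fst z) (snd z)"
      if "z \<in> space (\<mu> \<Otimes>\<^sub>M \<mu>)" for z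
      using cov[OF i, of 0] that by (auto simp: has_mean_and_covariance_def space_pair_measure sp)
    ultimately show ?thesis by (rule measurable_cong[THEN iffD1, rotated])
  qed
  have \<gamma>_diag: "(\<lambda>z. \<gamma> i (fst z) (fst z)) \<in> borel_measurable (\<mu> \<Otimes>\<^sub>M \<mu>)" if i: "i < k" for i
    using measurable_compose[of "\<lambda>z. (fst z, fst z)" "\<mu> \<Otimes>\<^sub>M \<mu>", OF _ \<gamma>_meas[OF i]] by simp
  have u_meas [measurable]: "u \<nu> \<in> borel_measurable (M \<Otimes>\<^sub>M (\<mu> \<Otimes>\<^sub>M \<mu>))" for \<nu>
    unfolding u_def
  proof (intro borel_measurable_sum)
    fix i assume "i \<in> {..<k}"
    then have i: "i < k" by simp
    have [measurable]: "(\<lambda>p. x i j (fst p) (fst (snd p))) \<in> borel_measurable (M \<Otimes>\<^sub>M (\<mu> \<Otimes>\<^sub>M \<mu>))"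
      "(\<lambda>p. x i j (fst p) (snd (snd p))) \<in> borel_measurable (M \<Otimes>\<^sub>M (\<mu> \<Otimes>\<^sub>M \<mu>))" for j
      using measurable_compose[of "\<lambda>p. (fst p, fst (snd p))" "M \<Otimes>\<^sub>M (\<mu> \<Otimes>\<^sub>M \<mu>)", OF _ joint[OF i, of j]]
        measurable_compose[of "\<lambda>p. (fst p, snd (snd p))" "M \<Otimes>\<^sub>M (\<mu> \<Otimes>\<^sub>M \<mu>)", OF _ joint[OF i, of j]]
      by simp_all
    have [measurable]: "(\<lambda>p. \<gamma> i (fst (snd p)) (snd (snd p))) \<in> borel_measurable (M \<Otimes>\<^sub>M (\<mu> \<Otimes>\<^sub>M \<mu>))"
      "(\<lambda>p. \<gamma> i (fst (snd p)) (fst (snd p))) \<in> borel_measurable (M \<Otimes>\<^sub>M (\<mu> \<Otimes>\<^sub>M \<mu>))"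
      by (rule measurable_compose[OF measurable_snd \<gamma>_meas[OF i]])
         (rule measurable_compose[OF measurable_snd \<gamma>_diag[OF i]])
    show "(\<lambda>wz. \<bar>sc i (N \<nu> i) (fst (snd wz)) (snd (snd wz)) (fst wz) - \<gamma> i (fst (snd wz)) (snd (snd wz))\<bar> +
        \<bar>sc i (N \<nu> i) (fst (snd wz)) (fst (snd wz)) (fst wz) - \<gamma> i (fst (snd wz)) (fst (snd wz))\<bar>)
        \<in> borel_measurable (M \<Otimes>\<^sub>M (\<mu> \<Otimes>\<^sub>M \<mu>))"
      unfolding sc_def sample_cov_def sample_mean_def by measurable
  qed
  have u0: "0 \<le> u \<nu> wz" for \<nu> wz by (auto simp: u_def intro!: sum_nonneg add_nonneg_nonneg)
  define E where "E \<nu> z = (\<Sum>i<k. M.expectation (\<lambda>w. \<bar>sc i (N \<nu> i) (fst z) (snd z) w - \<gamma> i (fst z) (snd z)\<bar>) +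
      M.expectation (\<lambda>w. \<bar>sc i (N \<nu> i) (fst z) (fst z) w - \<gamma> i (fst z) (fst z)\<bar>))" for \<nu> z
  have fibre: "(\<integral>\<^sup>+w. ennreal (u \<nu> (w, z)) \<partial>M) = ennreal (E \<nu> z)" if z: "z \<in> space (\<mu> \<Otimes>\<^sub>M \<mu>)" for \<nu> z
  proof -
    have z': "fst z \<in> T" "snd z \<in> T" using z by (auto simp: space_pair_measure sp)
    have "(\<integral>\<^sup>+w. ennreal (u \<nu> (w, z)) \<partial>M) = ennreal (M.expectation (\<lambda>w. u \<nu> (w, z)))"
      using sc_conv(1) z' u0 unfolding u_def
      by (intro nn_integral_eq_integral Bochner_Integration.integrable_sum Bochner_Integration.integrable_add integrable_abs) auto
    also have "M.expectation (\<lambda>w. u \<nu> (w, z)) = E \<nu> z"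
      unfolding u_def E_def using sc_conv(1) z' by (subst Bochner_Integration.integral_sum) auto
    finally show ?thesis .
  qed
  \<comment> \<open>Each of the two deviations of group \<open>i\<close> is at most
    \<open>2 * (G i + G i)\<close> in mean.\<close>
  define B where "B = (\<Sum>i<k. 8 * G i)"
  have E_bound: "E \<nu> z \<le> B" if z: "z \<in> space (\<mu> \<Otimes>\<^sub>M \<mu>)" for \<nu> z
    unfolding E_def B_def
  proof (rule sum_mono)
    fix i assume "i \<in> {..<k}"
    then have i: "i < k" by simp
    have z': "fst z \<in> T" "snd z \<in> T" using z by (auto simp: space_pair_measure sp)
    have lin: "2 * (p + q) + 2 * (p + p) \<le> 8 * g" if "p \<le> g" "q \<le> g" for p q g :: real
      using that by simp
    show "M.expectation (\<lambda>w. \<bar>sc i (N \<nu> i) (fst z) (snd z) w - \<gamma> i (fst z) (snd z)\<bar>) +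
        M.expectation (\<lambda>w. \<bar>sc i (N \<nu> i) (fst z) (fst z) w - \<gamma> i (fst z) (fst z)\<bar>) \<le> 8 * G i"
      by (rule order.trans[OF add_mono[OF sc_conv(2)[OF i z'] sc_conv(2)[OF i z'(1) z'(1)]]])
         (rule lin[OF G[OF i z'(1)] G[OF i z'(2)]])
  qed
  have E_lim: "(\<lambda>\<nu>. E \<nu> z) \<longlonglongrightarrow> 0" if z: "z \<in> space (\<mu> \<Otimes>\<^sub>M \<mu>)" for z
  proof -
    have z': "fst z \<in> T" "snd z \<in> T" using z by (auto simp: space_pair_measure sp)
    have "(\<lambda>\<nu>. E \<nu> z) \<longlonglongrightarrow> (\<Sum>i<k. 0 + 0)"
      unfolding E_def
      by (intro tendsto_sum tendsto_add filterlim_compose[OF sc_conv(3) N]) (use z' in auto)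
    then show ?thesis by simp
  qed
  have total: "(\<integral>\<^sup>+wz. ennreal (u \<nu> wz) \<partial>(M \<Otimes>\<^sub>M (\<mu> \<Otimes>\<^sub>M \<mu>))) = (\<integral>\<^sup>+z. ennreal (E \<nu> z) \<partial>(\<mu> \<Otimes>\<^sub>M \<mu>))" for \<nu>
    by (subst MP.nn_integral_snd[symmetric]) (auto intro!: nn_integral_cong simp: fibre)
  have E_meas: "(\<lambda>z. ennreal (E \<nu> z)) \<in> borel_measurable (\<mu> \<Otimes>\<^sub>M \<mu>)" for \<nu>
  proof -
    have "(\<lambda>z. \<integral>\<^sup>+w. ennreal (u \<nu> (w, z)) \<partial>M) \<in> borel_measurable (\<mu> \<Otimes>\<^sub>M \<mu>)" by measurable
    then show ?thesis by (rule measurable_cong[THEN iffD1, rotated]) (rule fibre)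
  qed
  have fin: "(\<integral>\<^sup>+z. ennreal B \<partial>(\<mu> \<Otimes>\<^sub>M \<mu>)) < \<infinity>"
    using \<mu>2f.emeasure_finite[of "space (\<mu> \<Otimes>\<^sub>M \<mu>)"] by (auto simp: less_top[symmetric] ennreal_mult_eq_top_iff)
  have lim: "(\<lambda>\<nu>. \<integral>\<^sup>+z. ennreal (E \<nu> z) \<partial>(\<mu> \<Otimes>\<^sub>M \<mu>)) \<longlonglongrightarrow> (\<integral>\<^sup>+z. 0 \<partial>(\<mu> \<Otimes>\<^sub>M \<mu>))"
  proof (rule nn_integral_dominated_convergence[OF E_meas _ _ _ fin])
    show "AE z in \<mu> \<Otimes>\<^sub>M \<mu>. ennreal (E \<nu> z) \<le> ennreal B" for \<nu>
      by (intro AE_I2 ennreal_leI E_bound)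
    show "AE z in \<mu> \<Otimes>\<^sub>M \<mu>. (\<lambda>\<nu>. ennreal (E \<nu> z)) \<longlonglongrightarrow> 0"
      using E_lim by (intro AE_I2) (auto simp: tendsto_ennreal_iff[symmetric] simp flip: ennreal_0 intro!: tendsto_ennrealI)
  qed auto
  have int: "integrable (M \<Otimes>\<^sub>M (\<mu> \<Otimes>\<^sub>M \<mu>)) (u \<nu>)" for \<nu>
  proof (rule integrableI_bounded)
    have "(\<integral>\<^sup>+wz. ennreal (norm (u \<nu> wz)) \<partial>(M \<Otimes>\<^sub>M (\<mu> \<Otimes>\<^sub>M \<mu>))) = (\<integral>\<^sup>+z. ennreal (E \<nu> z) \<partial>(\<mu> \<Otimes>\<^sub>M \<mu>))"
      using u0 by (simp add: total)
    also have "\<dots> \<le> (\<integral>\<^sup>+z. ennreal B \<partial>(\<mu> \<Otimes>\<^sub>M \<mu>))" by (intro nn_integral_mono ennreal_leI E_bound)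
    also note fin
    finally show "(\<integral>\<^sup>+wz. ennreal (norm (u \<nu> wz)) \<partial>(M \<Otimes>\<^sub>M (\<mu> \<Otimes>\<^sub>M \<mu>))) < \<infinity>" .
  qed measurable
  have "(\<lambda>\<nu>. \<integral>wz. norm (u \<nu> wz) \<partial>(M \<Otimes>\<^sub>M (\<mu> \<Otimes>\<^sub>M \<mu>))) \<longlonglongrightarrow> 0"
  proof -
    have "(\<integral>wz. norm (u \<nu> wz) \<partial>(M \<Otimes>\<^sub>M (\<mu> \<Otimes>\<^sub>M \<mu>))) = enn2real (\<integral>\<^sup>+z. ennreal (E \<nu> z) \<partial>(\<mu> \<Otimes>\<^sub>M \<mu>))" for \<nu>
      using u0 by (subst integral_eq_nn_integral) (auto simp: total)
    moreover have "(\<lambda>\<nu>. enn2real (\<integral>\<^sup>+z. ennreal (E \<nu> z) \<partial>(\<mu> \<Otimes>\<^sub>M \<mu>))) \<longlonglongrightarrow> 0"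
      using lim by (intro tendsto_enn2real) auto
    ultimately show ?thesis by simp
  qed
  from tendsto_L1_AE_subseq[OF int this] obtain \<psi> where \<psi>: "strict_mono \<psi>"
    and ae: "AE wz in M \<Otimes>\<^sub>M (\<mu> \<Otimes>\<^sub>M \<mu>). (\<lambda>\<nu>. u (\<psi> \<nu>) wz) \<longlonglongrightarrow> 0" by blast
  have imp: "\<forall>i<k. (\<lambda>\<nu>. sc i (N (\<psi> \<nu>) i) (fst z) (snd z) w) \<longlonglongrightarrow> \<gamma> i (fst z) (snd z) \<and>
      (\<lambda>\<nu>. sc i (N (\<psi> \<nu>) i) (fst z) (fst z) w) \<longlonglongrightarrow> \<gamma> i (fst z) (fst z)"
    if lim: "(\<lambda>\<nu>. u (\<psi> \<nu>) (w, z)) \<longlonglongrightarrow> 0" for w z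
    proof (intro allI impI)
      fix i assume i: "i < k"
      have le: "\<bar>sc i (N \<nu> i) (fst z) (snd z) w - \<gamma> i (fst z) (snd z)\<bar> +
        \<bar>sc i (N \<nu> i) (fst z) (fst z) w - \<gamma> i (fst z) (fst z)\<bar> \<le> u \<nu> (w, z)" for \<nu>
        unfolding u_def fst_conv snd_conv
        by (rule member_le_sum[where f = "\<lambda>i. \<bar>sc i (N \<nu> i) (fst z) (snd z) w - \<gamma> i (fst z) (snd z)\<bar> +
          \<bar>sc i (N \<nu> i) (fst z) (fst z) w - \<gamma> i (fst z) (fst z)\<bar>"]) (use i in auto)
      have "norm (sc i (N \<nu> i) (fst z) (snd z) w - \<gamma> i (fst z) (snd z)) \<le> u \<nu> (w, z)"
        "norm (sc i (N \<nu> i) (fst z) (fst z) w - \<gamma> i (fst z) (fst z)) \<le> u \<nu> (w, z)" for \<nu>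
        using le[of \<nu>] unfolding real_norm_def by linarith+
      then show "(\<lambda>\<nu>. sc i (N (\<psi> \<nu>) i) (fst z) (snd z) w) \<longlonglongrightarrow> \<gamma> i (fst z) (snd z) \<and>
          (\<lambda>\<nu>. sc i (N (\<psi> \<nu>) i) (fst z) (fst z) w) \<longlonglongrightarrow> \<gamma> i (fst z) (fst z)"
        by (intro conjI; intro LIM_zero_cancel[OF Lim_null_comparison[OF _ lim]] always_eventually allI)
    qed
  from MP.AE_pair[OF ae]
  have "AE w in M. AE z in \<mu> \<Otimes>\<^sub>M \<mu>. \<forall>i<k. (\<lambda>\<nu>. sc i (N (\<psi> \<nu>) i) (fst z) (snd z) w) \<longlonglongrightarrow> \<gamma> i (fst z) (snd z) \<and>
      (\<lambda>\<nu>. sc i (N (\<psi> \<nu>) i) (fst z) (fst z) w) \<longlonglongrightarrow> \<gamma> i (fst z) (fst z)"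
  proof eventually_elim
    case (elim w)
    then show ?case by eventually_elim (rule imp)
  qed
  then show ?thesis using \<psi> unfolding sc_def \<mu>_def by blast
qed

subsection \<open>Studentized quadratic forms\<close>

text \<open>Generalized over the starting index: the fold over \<open>[s..<s + d]\<close> splits off
  block \<open>s\<close>, and the induction hypothesis is needed for the offsets counted from
  \<open>Suc s\<close>.\<close>

lemma foldr_append_rows:
  assumes "\<And>l. s \<le> l \<Longrightarrow> l < s + d \<Longrightarrow> Hs l \<in> carrier_mat (rr l) k"
  shows "foldr (\<lambda>l A. Hs l @\<^sub>r A) [s..<s + d] (0\<^sub>m 0 k) \<in> carrier_mat (\<Sum>l\<in>{s..<s + d}. rr l) k \<and>
    (\<forall>l p i. s \<le> l \<longrightarrow> l < s + d \<longrightarrow> p < rr l \<longrightarrow> i < k \<longrightarrow>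
      foldr (\<lambda>l A. Hs l @\<^sub>r A) [s..<s + d] (0\<^sub>m 0 k) $$ ((\<Sum>m\<in>{s..<l}. rr m) + p, i) = (Hs l $$ (p, i) :: real))"
  using assms
proof (induction d arbitrary: s)
  case (Suc d)
  define B where "B = foldr (\<lambda>l A. Hs l @\<^sub>r A) [Suc s..<Suc s + d] (0\<^sub>m 0 k)"
  have B: "B \<in> carrier_mat (\<Sum>l\<in>{Suc s..<Suc s + d}. rr l) k"
    and ix: "\<And>l p i. Suc s \<le> l \<Longrightarrow> l < Suc s + d \<Longrightarrow> p < rr l \<Longrightarrow> i < k \<Longrightarrow>
      B $$ ((\<Sum>m\<in>{Suc s..<l}. rr m) + p, i) = Hs l $$ (p, i)"
    using Suc.IH[of "Suc s"] Suc.prems unfolding B_def by auto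
  have Hs: "Hs s \<in> carrier_mat (rr s) k" using Suc.prems[of s] by simp
  have eq: "foldr (\<lambda>l A. Hs l @\<^sub>r A) [s..<s + Suc d] (0\<^sub>m 0 k) = Hs s @\<^sub>r B"
    by (simp add: B_def upt_conv_Cons del: upt_Suc)
  have split: "(\<Sum>m\<in>{s..<l}. rr m) = rr s + (\<Sum>m\<in>{Suc s..<l}. rr m)" if "s < l" for l
    using that by (rule sum.atLeast_Suc_lessThan)
  have "(\<Sum>l\<in>{s..<s + Suc d}. rr l) = rr s + (\<Sum>l\<in>{Suc s..<Suc s + d}. rr l)"
    using split[of "s + Suc d"] by (simp del: sum.op_ivl_Suc)
  then have car: "Hs s @\<^sub>r B \<in> carrier_mat (\<Sum>l\<in>{s..<s + Suc d}. rr l) k"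
    using carrier_append_rows[OF Hs B] by (simp only:)
  have "(Hs s @\<^sub>r B) $$ ((\<Sum>m\<in>{s..<l}. rr m) + p, i) = Hs l $$ (p, i)"
    if l: "s \<le> l" "l < s + Suc d" and p: "p < rr l" and i: "i < k" for l p i
  proof (cases "l = s")
    case True
    then show ?thesis using Hs B p i by (simp add: append_rows_def)
  next
    case False
    then have l': "Suc s \<le> l" "l < Suc s + d" using l by auto
    have "(\<Sum>m\<in>{Suc s..<l}. rr m) + p < (\<Sum>m\<in>{Suc s..<Suc l}. rr m)" using l' p by simp
    also have "\<dots> \<le> (\<Sum>m\<in>{Suc s..<Suc s + d}. rr m)" using l' by (intro sum_mono2) auto
    finally show ?thesis
      using Hs B i ix[OF l' p i] l' by (simp add: append_rows_def split)
  qed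
  then show ?case unfolding eq using car by blast
qed simp

lemma stack_rows_carrier:
  assumes "\<forall>l<R. Hs l \<in> carrier_mat (rr l) k"
  shows "stack_rows R k Hs \<in> carrier_mat (\<Sum>l<R. rr l) k"
  using foldr_append_rows[of 0 R Hs rr k] assms by (simp add: stack_rows_def atLeast0LessThan)

lemma stack_rows_index:
  assumes "\<forall>l<R. Hs l \<in> carrier_mat (rr l) k" "l < R" "p < rr l" "i < k"
  shows "stack_rows R k Hs $$ ((\<Sum>m<l. rr m) + p, i) = Hs l $$ (p, i)"
  using foldr_append_rows[of 0 R Hs rr k] assms by (simp add: stack_rows_def atLeast0LessThan)

lemma block_offset_less:
  fixes rr :: "nat \<Rightarrow> nat"
  assumes "l < R" "p < rr l"
  shows "(\<Sum>m<l. rr m) + p < (\<Sum>m<R. rr m)"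
proof -
  have "(\<Sum>m<l. rr m) + p < (\<Sum>m<Suc l. rr m)" using assms by simp
  also have "\<dots> \<le> (\<Sum>m<R. rr m)" using assms by (intro sum_mono2) auto
  finally show ?thesis .
qed

text \<open>Vectors and weights enter as plain functions and the form as a sum over entries, so
  measurability and continuity of the entries pass to it termwise.\<close>

definition mp_form :: "nat \<Rightarrow> nat \<Rightarrow> real mat \<Rightarrow> (nat \<Rightarrow> real) \<Rightarrow> (nat \<Rightarrow> real) \<Rightarrow> real" where
  "mp_form r k A d y = (\<Sum>p<r. \<Sum>q<r. y p * moore_penrose (A * mat_diag k d * A\<^sup>T) $$ (p, q) * y q)"

lemma mp_form_eq_scalar_prod:
  assumes A: "A \<in> carrier_mat r k" and d: "\<And>i. i < k \<Longrightarrow> 0 \<le> d i" and u: "u \<in> carrier_vec r"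
  shows "u \<bullet> (moore_penrose (A * mat_diag k d * A\<^sup>T) *\<^sub>v u) = mp_form r k A d (\<lambda>p. u $ p)"
proof -
  define X where "X = moore_penrose (A * mat_diag k d * A\<^sup>T)"
  have "X \<in> carrier_mat r r" unfolding X_def by (rule moore_penrose_conjugate_diag_carrier[OF A d])
  then show ?thesis
    using u unfolding mp_form_def X_def[symmetric]
    by (simp add: scalar_prod_def atLeast0LessThan sum_distrib_left mult.assoc)
qed

lemma mp_form_cong:
  assumes "\<And>i. i < k \<Longrightarrow> d i = d' i" "\<And>p. p < r \<Longrightarrow> y p = y' p"
  shows "mp_form r k A d y = mp_form r k A d' y'"
proof -
  have "mat_diag k d = mat_diag k d'" using assms(1) by (intro eq_matI) (auto simp: mat_diag_def)
  then show ?thesis unfolding mp_form_def using assms(2) by (intro sum.cong refl) auto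
qed

lemma mp_form_scale: "mp_form r k A d (\<lambda>p. c * y p) = c\<^sup>2 * mp_form r k A d y"
  by (simp add: mp_form_def sum_distrib_left power2_eq_square mult_ac)

lemma borel_measurable_mp_form:
  assumes A: "A \<in> carrier_mat r k"
    and D: "\<And>i. i < k \<Longrightarrow> (\<lambda>w. D w i) \<in> borel_measurable M"
    and nonneg: "\<And>w i. w \<in> space M \<Longrightarrow> i < k \<Longrightarrow> 0 \<le> D w i"
    and y: "\<And>p. p < r \<Longrightarrow> (\<lambda>w. y w p) \<in> borel_measurable M"
  shows "(\<lambda>w. mp_form r k A (D w) (y w)) \<in> borel_measurable M"
  unfolding mp_form_def
  by (intro borel_measurable_sum borel_measurable_times y borel_measurable_moore_penrose_entry[OF A] D nonneg) auto

lemma continuous_on_mp_form: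
  assumes A: "A \<in> carrier_mat r k"
    and D: "\<And>i. i < k \<Longrightarrow> continuous_on S (\<lambda>w. D w i)"
    and pos: "\<And>w i. w \<in> S \<Longrightarrow> i < k \<Longrightarrow> 0 < D w i"
    and y: "\<And>p. p < r \<Longrightarrow> continuous_on S (\<lambda>w. y w p)"
  shows "continuous_on S (\<lambda>w. mp_form r k A (D w) (y w))"
  unfolding mp_form_def
  by (intro continuous_on_sum continuous_on_mult y continuous_on_moore_penrose_entry[OF A] D pos) auto

lemma sample_cov_nonneg: "0 \<le> sample_cov m x t t"
proof (cases "m = 0")
  case False
  then show ?thesis unfolding sample_cov_def power2_eq_square[symmetric]
    by (intro mult_nonneg_nonneg sum_nonneg) auto
qed (simp add: sample_cov_def)

text \<open>The integrand of the test statistic, with its factor \<open>n\<close> moved into both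
  arguments as \<open>sqrt n\<close>; the arguments are then linear in scaled means whose laws
  converge.\<close>

definition studentized_form ::
    "nat \<Rightarrow> (nat \<Rightarrow> nat) \<Rightarrow> (nat \<Rightarrow> nat \<Rightarrow> real \<Rightarrow> real) \<Rightarrow> nat \<Rightarrow> real mat \<Rightarrow> real \<Rightarrow> real" where
  "studentized_form k N x r A t = mp_form r k A
     (\<lambda>i. real (total_size k N) / real (N i) * sample_cov (N i) (x i) t t)
     (\<lambda>p. \<Sum>i<k. A $$ (p, i) * (sqrt (real (total_size k N)) * sample_mean (N i) (x i) t))"

lemma test_statistic_eq:
  assumes A: "A \<in> carrier_mat r k"
  shows "test_statistic T k N x A = (\<integral>t. studentized_form k N x r A t \<partial>lborel_on T)"
  unfolding test_statistic_def
proof (intro Bochner_Integration.integral_cong refl)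
  fix t
  define n where "n = real (total_size k N)"
  have n: "0 \<le> n" by (simp add: n_def)
  have u: "A *\<^sub>v sample_mean_vec k N x t \<in> carrier_vec r" using A by (auto simp: sample_mean_vec_def)
  have Au: "(A *\<^sub>v sample_mean_vec k N x t) $ p = (\<Sum>i<k. A $$ (p, i) * sample_mean (N i) (x i) t)" if "p < r" for p
    using A that by (simp add: sample_mean_vec_def scalar_prod_def atLeast0LessThan)
  have "(A *\<^sub>v sample_mean_vec k N x t) \<bullet>
      (moore_penrose (A * sample_cov_mat k N x t t * A\<^sup>T) *\<^sub>v (A *\<^sub>v sample_mean_vec k N x t)) =
      mp_form r k A (\<lambda>i. n / real (N i) * sample_cov (N i) (x i) t t) (\<lambda>p. (A *\<^sub>v sample_mean_vec k N x t) $ p)"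
    unfolding sample_cov_mat_def n_def[symmetric]
    by (rule mp_form_eq_scalar_prod[OF A _ u]) (simp add: n sample_cov_nonneg)
  also have "\<dots> = mp_form r k A (\<lambda>i. n / real (N i) * sample_cov (N i) (x i) t t) (\<lambda>p. \<Sum>i<k. A $$ (p, i) * sample_mean (N i) (x i) t)"
    by (rule mp_form_cong) (simp_all add: Au)
  finally have "n * ((A *\<^sub>v sample_mean_vec k N x t) \<bullet>
      (moore_penrose (A * sample_cov_mat k N x t t * A\<^sup>T) *\<^sub>v (A *\<^sub>v sample_mean_vec k N x t))) =
      (sqrt n)\<^sup>2 * mp_form r k A (\<lambda>i. n / real (N i) * sample_cov (N i) (x i) t t) (\<lambda>p. \<Sum>i<k. A $$ (p, i) * sample_mean (N i) (x i) t)"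
    using n by simp
  also have "\<dots> = studentized_form k N x r A t"
    unfolding mp_form_scale[symmetric] studentized_form_def n_def[symmetric]
    by (rule mp_form_cong) (simp_all add: sum_distrib_left mult_ac)
  finally show "real (total_size k N) * ((A *\<^sub>v sample_mean_vec k N x t) \<bullet>
      (moore_penrose (A * sample_cov_mat k N x t t * A\<^sup>T) *\<^sub>v (A *\<^sub>v sample_mean_vec k N x t))) = studentized_form k N x r A t"
    by (simp add: n_def)
qed

text \<open>In \<open>(y $ i)\<^sup>2 / d i\<close> the total size cancels, which leaves the squared
  Student statistic of group \<open>i\<close>. Neither \<open>A\<close> nor the proportions of the
  groups survive in the bound.\<close>

lemma studentized_form_bounds:
  assumes A: "A \<in> carrier_mat r k" and N: "\<And>i. i < k \<Longrightarrow> 0 < N i"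
    and zero: "\<And>i. i < k \<Longrightarrow> sample_cov (N i) (x i) t t = 0 \<Longrightarrow> sample_mean (N i) (x i) t = 0"
  shows "0 \<le> studentized_form k N x r A t"
    and "studentized_form k N x r A t \<le> (\<Sum>i<k. real (N i) * (sample_mean (N i) (x i) t)\<^sup>2 / sample_cov (N i) (x i) t t)"
proof -
  define n where "n = real (total_size k N)"
  define d where "d i = n / real (N i) * sample_cov (N i) (x i) t t" for i
  define y where "y = vec k (\<lambda>i. sqrt n * sample_mean (N i) (x i) t)"
  have n: "0 < n" if "i < k" for i
  proof -
    have "N i \<le> (\<Sum>i<k. N i)" using that by (intro member_le_sum) auto
    then show ?thesis using N[OF that] by (simp add: n_def total_size_def del: of_nat_sum)
  qed
  have n0: "0 \<le> n" by (simp add: n_def)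
  have d: "0 \<le> d i" for i by (simp add: d_def n0 sample_cov_nonneg)
  have y: "y \<in> carrier_vec k" by (simp add: y_def)
  have y0: "y $ i = 0" if i: "i < k" and "d i = 0" for i
  proof -
    have "sample_cov (N i) (x i) t t = 0" using that n[OF i] N[OF i] by (simp add: d_def)
    then show ?thesis using zero[OF i] i by (simp add: y_def)
  qed
  have Ay: "A *\<^sub>v y \<in> carrier_vec r" using A y by auto
  have "(A *\<^sub>v y) \<bullet> (moore_penrose (A * mat_diag k d * A\<^sup>T) *\<^sub>v (A *\<^sub>v y)) = mp_form r k A d (\<lambda>p. (A *\<^sub>v y) $ p)"
    by (rule mp_form_eq_scalar_prod[OF A _ Ay]) (rule d)
  also have "\<dots> = studentized_form k N x r A t"
    unfolding studentized_form_def n_def[symmetric] using A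
    by (intro mp_form_cong) (simp_all add: d_def y_def scalar_prod_def atLeast0LessThan)
  finally have eq: "(A *\<^sub>v y) \<bullet> (moore_penrose (A * mat_diag k d * A\<^sup>T) *\<^sub>v (A *\<^sub>v y)) = studentized_form k N x r A t" .
  note bounds = quadratic_moore_penrose_bounds[where d = d, OF A d y y0, unfolded eq]
  show "0 \<le> studentized_form k N x r A t" by (rule bounds(1))
  have "(y $ i)\<^sup>2 / d i = real (N i) * (sample_mean (N i) (x i) t)\<^sup>2 / sample_cov (N i) (x i) t t" if i: "i < k" for i
    using n[OF i] i by (simp add: y_def d_def power_mult_distrib)
  then show "studentized_form k N x r A t \<le> (\<Sum>i<k. real (N i) * (sample_mean (N i) (x i) t)\<^sup>2 / sample_cov (N i) (x i) t t)"
    using bounds(2) by simp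
qed

subsection \<open>Parametric bootstrap samples\<close>

text \<open>Sampling times may coincide, so the indices are mapped to members of the family by a
  function that need not be injective; the coefficients over each fibre are collected.\<close>

lemma gaussian_family_linear_indexed:
  fixes c :: "'j \<Rightarrow> real" and f :: "'j \<Rightarrow> 's"
  assumes X: "centered_gaussian_family P S X C" and J: "finite J" "f ` J \<subseteq> S"
  defines "Z \<equiv> \<lambda>w. \<Sum>p\<in>J. c p * X (f p) w"
  defines "V \<equiv> \<Sum>p\<in>J. \<Sum>q\<in>J. c p * c q * C (f p) (f q)"
  shows "Z \<in> borel_measurable P" and "0 \<le> V" and "distr P borel Z = scaled_normal V"
proof -
  define d where "d s = (\<Sum>p\<in>{p \<in> J. f p = s}. c p)" for s
  have collect: "(\<Sum>s\<in>f ` J. d s * h s) = (\<Sum>p\<in>J. c p * h (f p))" for h :: "'s \<Rightarrow> real"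
  proof -
    have "(\<Sum>p\<in>J. c p * h (f p)) = (\<Sum>s\<in>f ` J. \<Sum>p\<in>{p \<in> J. f p = s}. c p * h (f p))"
      by (rule sum.image_gen[OF J(1)])
    also have "\<dots> = (\<Sum>s\<in>f ` J. d s * h s)"
      unfolding d_def sum_distrib_right by (intro sum.cong refl) auto
    finally show ?thesis by simp
  qed
  have Z: "Z = (\<lambda>w. \<Sum>s\<in>f ` J. d s * X s w)"
    unfolding Z_def using collect[of "\<lambda>s. X s _"] by simp
  have "(\<Sum>s\<in>f ` J. \<Sum>s'\<in>f ` J. d s * d s' * C s s') = (\<Sum>s\<in>f ` J. d s * (\<Sum>s'\<in>f ` J. d s' * C s s'))"
    by (simp add: sum_distrib_left mult.assoc)
  also have "\<dots> = V"
    unfolding collect V_def by (simp add: sum_distrib_left mult.assoc)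
  finally have V: "V = (\<Sum>s\<in>f ` J. \<Sum>s'\<in>f ` J. d s * d s' * C s s')" by simp
  show "Z \<in> borel_measurable P" "0 \<le> V" "distr P borel Z = scaled_normal V"
    unfolding Z V using gaussian_family_linear[OF X, of "f ` J" d] J by auto
qed

text \<open>A single stage with the data frozen in \<open>y\<close>. The size 32 is what the moment
  bound for Student statistics asks for; as group sizes tend to infinity, it holds from some stage
  on.\<close>

locale bootstrap_stage = prob_space Q
  for Q :: "'b measure" +
  fixes T :: "real set" and k :: nat and N :: "nat \<Rightarrow> nat"
    and y :: "nat \<Rightarrow> nat \<Rightarrow> real \<Rightarrow> real" and xP :: "nat \<Rightarrow> nat \<Rightarrow> 'b \<Rightarrow> real \<Rightarrow> real"
  assumes boot: "parametric_bootstrap Q T k N y xP" and N: "\<And>i. i < k \<Longrightarrow> 32 \<le> N i"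
begin

abbreviation g :: "nat \<Rightarrow> real \<Rightarrow> real \<Rightarrow> real" where
  "g i \<equiv> sample_cov (N i) (y i)"

abbreviation n :: real where
  "n \<equiv> real (total_size k N)"

abbreviation xbar :: "nat \<Rightarrow> 'b \<Rightarrow> real \<Rightarrow> real" where
  "xbar i u \<equiv> sample_mean (N i) (\<lambda>j. xP i j u)"

abbreviation chat :: "nat \<Rightarrow> 'b \<Rightarrow> real \<Rightarrow> real" where
  "chat i u t \<equiv> sample_cov (N i) (\<lambda>j. xP i j u) t t"

lemma gauss: "i < k \<Longrightarrow> j < N i \<Longrightarrow> centered_gaussian_family Q T (\<lambda>t u. xP i j u t) (g i)"
  using boot by (auto simp: parametric_bootstrap_def gaussian_process_def)

lemma path_joint: "i < k \<Longrightarrow> j < N i \<Longrightarrow> (\<lambda>(u, t). xP i j u t) \<in> borel_measurable (Q \<Otimes>\<^sub>M lborel_on T)"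
  using boot by (auto simp: parametric_bootstrap_def gaussian_process_def L2_process_def)

lemma path_measurable: "i < k \<Longrightarrow> j < N i \<Longrightarrow> t \<in> T \<Longrightarrow> (\<lambda>u. xP i j u t) \<in> borel_measurable Q"
  using gauss by (auto simp: centered_gaussian_family_def)

lemma linear_law:
  fixes m :: nat
  assumes "i < k" "j < N i" "\<And>p. p < m \<Longrightarrow> \<theta> p \<in> T"
  shows "(\<lambda>u. \<Sum>p<m. c p * xP i j u (\<theta> p)) \<in> borel_measurable Q"
    and "0 \<le> (\<Sum>p<m. \<Sum>q<m. c p * c q * g i (\<theta> p) (\<theta> q))"
    and "distr Q borel (\<lambda>u. \<Sum>p<m. c p * xP i j u (\<theta> p)) =
      scaled_normal (\<Sum>p<m. \<Sum>q<m. c p * c q * g i (\<theta> p) (\<theta> q))"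
proof -
  have sub: "\<theta> ` {..<m} \<subseteq> T" using assms(3) by auto
  note L = gaussian_family_linear_indexed[where X = "\<lambda>t u. xP i j u t" and f = \<theta> and c = c,
      OF gauss[OF assms(1,2)] finite_lessThan sub]
  show "(\<lambda>u. \<Sum>p<m. c p * xP i j u (\<theta> p)) \<in> borel_measurable Q"
    "0 \<le> (\<Sum>p<m. \<Sum>q<m. c p * c q * g i (\<theta> p) (\<theta> q))"
    "distr Q borel (\<lambda>u. \<Sum>p<m. c p * xP i j u (\<theta> p)) =
      scaled_normal (\<Sum>p<m. \<Sum>q<m. c p * c q * g i (\<theta> p) (\<theta> q))"
    by (rule L)+
qed

lemma point_law:
  assumes "i < k" "t \<in> T"
  shows "0 \<le> g i t t" and "j < N i \<Longrightarrow> distr Q borel (\<lambda>u. xP i j u t) = scaled_normal (g i t t)"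
  using linear_law[OF assms(1), of j "Suc 0" "\<lambda>_. t" "\<lambda>_. 1"] assms by (auto simp: sample_cov_nonneg)

lemma indep_paths:
  "indep_vars (\<lambda>_. PiM T (\<lambda>_. borel)) (\<lambda>p u. restrict (xP (fst p) (snd p) u) T) (SIGMA i:{..<k}. {..<N i})"
  using boot by (simp add: parametric_bootstrap_def indep_processes_def case_prod_beta)

lemma indep_points:
  assumes i: "i < k" and t: "t \<in> T"
  shows "indep_vars (\<lambda>_. borel) (\<lambda>j u. xP i j u t) {..<N i}"
proof -
  have "indep_vars (\<lambda>_. PiM T (\<lambda>_. borel)) (\<lambda>p u. restrict (xP (fst p) (snd p) u) T) (Pair i ` {..<N i})"
    by (rule indep_vars_subset[OF indep_paths]) (use i in auto)
  from indep_vars_reindex[OF _ this]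
  have "indep_vars (\<lambda>_. PiM T (\<lambda>_. borel)) (\<lambda>j u. restrict (xP i j u) T) {..<N i}" by (simp add: inj_on_def)
  then have "indep_vars (\<lambda>_. borel) (\<lambda>j u. (\<lambda>f. f t) (restrict (xP i j u) T)) {..<N i}"
    by (rule indep_vars_compose2) (use t in measurable)
  then show ?thesis using t by simp
qed

text \<open>One factor \<open>k\<close> comes from Cauchy-Schwarz over the groups, the other from
  adding \<open>k\<close> equal moment bounds. The result depends neither on the time nor on the
  data nor on the stage.\<close>

lemma studentized_second_moment:
  assumes A: "A \<in> carrier_mat r k" and t: "t \<in> T"
  shows "(\<integral>\<^sup>+u. ennreal ((studentized_form k N (\<lambda>i j. xP i j u) r A t)\<^sup>2) \<partial>Q)
    \<le> ennreal ((real k)\<^sup>2 * (105 + 256 * exp 80))"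
proof -
  define s where "s i u = real (N i) * (xbar i u t)\<^sup>2 / chat i u t" for i u
  have "AE u in Q. chat i u t = 0 \<longrightarrow> xbar i u t = 0" if i: "i < k" for i
    using N[OF i]
    by (intro AE_sample_cov_zero[where x = "xP i" and t = t, OF _ indep_points[OF i t] point_law(2)[OF i t] point_law(1)[OF i t]]) auto
  then have "AE u in Q. \<forall>i<k. chat i u t = 0 \<longrightarrow> xbar i u t = 0" by (simp add: AE_all_countable)
  then have "AE u in Q. ennreal ((studentized_form k N (\<lambda>i j. xP i j u) r A t)\<^sup>2) \<le> ennreal (real k) * (\<Sum>i<k. ennreal ((s i u)\<^sup>2))"
  proof eventually_elim
    fix u assume zero: "\<forall>i<k. chat i u t = 0 \<longrightarrow> xbar i u t = 0"
    have N0: "0 < N i" if "i < k" for i using N[OF that] by simp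
    have b: "0 \<le> studentized_form k N (\<lambda>i j. xP i j u) r A t" "studentized_form k N (\<lambda>i j. xP i j u) r A t \<le> (\<Sum>i<k. s i u)"
      unfolding s_def using zero N0 by (intro studentized_form_bounds[OF A]; simp)+
    have "(studentized_form k N (\<lambda>i j. xP i j u) r A t)\<^sup>2 \<le> (\<Sum>i<k. s i u)\<^sup>2"
      using b by (intro power_mono)
    also have "\<dots> \<le> (\<Sum>i<k. (1::real)\<^sup>2) * (\<Sum>i<k. (s i u)\<^sup>2)"
      using Cauchy_Schwarz_ineq_sum[of "\<lambda>_. 1" "\<lambda>i. s i u" "{..<k}"] by simp
    finally have "(studentized_form k N (\<lambda>i j. xP i j u) r A t)\<^sup>2 \<le> real k * (\<Sum>i<k. (s i u)\<^sup>2)" by simp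
    then show "ennreal ((studentized_form k N (\<lambda>i j. xP i j u) r A t)\<^sup>2) \<le> ennreal (real k) * (\<Sum>i<k. ennreal ((s i u)\<^sup>2))"
    proof -
      assume "(studentized_form k N (\<lambda>i j. xP i j u) r A t)\<^sup>2 \<le> real k * (\<Sum>i<k. (s i u)\<^sup>2)"
      then have "ennreal ((studentized_form k N (\<lambda>i j. xP i j u) r A t)\<^sup>2) \<le> ennreal (real k * (\<Sum>i<k. (s i u)\<^sup>2))"
        by (rule ennreal_leI)
      also have "\<dots> = ennreal (real k) * (\<Sum>i<k. ennreal ((s i u)\<^sup>2))"
        by (simp only: ennreal_mult'[OF of_nat_0_le_iff] sum_ennreal[OF zero_le_power2])
      finally show ?thesis .
    qed
  qed
  then have "(\<integral>\<^sup>+u. ennreal ((studentized_form k N (\<lambda>i j. xP i j u) r A t)\<^sup>2) \<partial>Q) \<le>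
      (\<integral>\<^sup>+u. ennreal (real k) * (\<Sum>i<k. ennreal ((s i u)\<^sup>2)) \<partial>Q)"
    by (rule nn_integral_mono_AE)
  also have "\<dots> = ennreal (real k) * (\<Sum>i<k. \<integral>\<^sup>+u. ennreal ((s i u)\<^sup>2) \<partial>Q)"
  proof -
    have [measurable]: "s i \<in> borel_measurable Q" if i: "i < k" for i
      unfolding s_def sample_cov_def sample_mean_def using path_measurable[OF i _ t]
      by (intro borel_measurable_divide borel_measurable_times borel_measurable_const borel_measurable_sum
          borel_measurable_diff borel_measurable_power) auto
    have m2: "(\<lambda>u. ennreal ((s i u)\<^sup>2)) \<in> borel_measurable Q" if "i < k" for i using that by measurable
    have "(\<integral>\<^sup>+u. (\<Sum>i<k. ennreal ((s i u)\<^sup>2)) \<partial>Q) = (\<Sum>i<k. \<integral>\<^sup>+u. ennreal ((s i u)\<^sup>2) \<partial>Q)"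
      by (rule nn_integral_sum) (simp add: m2)
    then show ?thesis by (subst nn_integral_cmult) (auto intro!: borel_measurable_sum m2 simp del: sum_ennreal)
  qed
  also have "\<dots> \<le> ennreal (real k) * (\<Sum>i<k. ennreal (105 + 256 * exp 80))"
  proof (intro mult_left_mono sum_mono)
    fix i assume "i \<in> {..<k}"
    then have i: "i < k" by simp
    show "(\<integral>\<^sup>+u. ennreal ((s i u)\<^sup>2) \<partial>Q) \<le> ennreal (105 + 256 * exp 80)"
      unfolding s_def
      by (rule student_second_moment[where x = "xP i" and t = t, OF N[OF i] indep_points[OF i t] point_law(2)[OF i t] point_law(1)[OF i t]])
  qed simp
  also have "\<dots> = ennreal ((real k)\<^sup>2 * (105 + 256 * exp 80))"
  proof -
    have "(\<Sum>i<k. ennreal (105 + 256 * exp 80)) = ennreal (real k * (105 + 256 * exp 80))"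
      by (subst sum_ennreal) (auto intro: add_nonneg_nonneg)
    then show ?thesis by (simp add: ennreal_mult'[symmetric] power2_eq_square mult.assoc)
  qed
  finally show ?thesis .
qed

lemma studentized_joint_measurable:
  assumes A: "A \<in> carrier_mat r k"
  shows "(\<lambda>(u, t). studentized_form k N (\<lambda>i j. xP i j u) r A t) \<in> borel_measurable (Q \<Otimes>\<^sub>M lborel_on T)"
proof -
  have xm: "(\<lambda>p. xP i j (fst p) (snd p)) \<in> borel_measurable (Q \<Otimes>\<^sub>M lborel_on T)" if "i < k" "j < N i" for i j
    using path_joint[OF that] by (simp add: case_prod_beta)
  have mean: "(\<lambda>p. xbar i (fst p) (snd p)) \<in> borel_measurable (Q \<Otimes>\<^sub>M lborel_on T)" if i: "i < k" for i
    unfolding sample_mean_def using xm[OF i]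
    by (intro borel_measurable_times borel_measurable_const borel_measurable_sum) auto
  have cov: "(\<lambda>p. chat i (fst p) (snd p)) \<in> borel_measurable (Q \<Otimes>\<^sub>M lborel_on T)" if i: "i < k" for i
    unfolding sample_cov_def using xm[OF i] mean[OF i]
    by (intro borel_measurable_times borel_measurable_const borel_measurable_sum borel_measurable_diff) auto
  show ?thesis
    unfolding studentized_form_def case_prod_beta
    by (intro borel_measurable_mp_form[OF A] borel_measurable_times borel_measurable_const borel_measurable_sum mean cov)
       (auto simp: sample_cov_nonneg)
qed

text \<open>The bound involves the data only through a variance at one time. Where this variance and
  the ratio \<open>n / N i\<close> converge along the stages, the first moments are bounded, which
  is the tightness needed for the scaled means.\<close>

lemma mean_abs_bound:
  assumes i: "i < k" and t: "t \<in> T"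
  shows "integrable Q (\<lambda>u. sqrt n * xbar i u t)"
    and "expectation (\<lambda>u. \<bar>sqrt n * xbar i u t\<bar>) \<le> 1 + n / real (N i) * g i t t"
proof -
  have N0: "0 < N i" using N[OF i] by simp
  note mom = scaled_normal_moments[OF path_measurable[OF i _ t] point_law(2)[OF i t] point_law(1)[OF i t]]
  have m2: "integrable Q (\<lambda>u. (xP i j u t)\<^sup>2)" "expectation (\<lambda>u. (xP i j u t)\<^sup>2) = g i t t" if "j < N i" for j
    using mom(1)[OF that that, of 1] mom(2)[OF that that, of 1] by auto
  have mean: "expectation (\<lambda>u. xP i j u t) = 0" if "j < N i" for j
    by (rule scaled_normal_mean[OF path_measurable[OF i that t] point_law(2)[OF i t that]])
  define B where "B u = (1 / real (N i) * (\<Sum>j<N i. xP i j u t) - 0)\<^sup>2" for u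
  have B: "integrable Q B" "expectation B \<le> g i t t / real (N i)"
    unfolding B_def using mean_square_average[OF indep_points[OF i t] N0 m2(1) mean eq_refl[OF m2(2)]] by auto
  have meas: "(\<lambda>u. sqrt n * xbar i u t) \<in> borel_measurable Q"
    unfolding sample_mean_def using path_measurable[OF i _ t]
    by (intro borel_measurable_times borel_measurable_const borel_measurable_sum) auto
  have le: "\<bar>sqrt n * xbar i u t\<bar> \<le> 1 + n * B u" for u
  proof -
    have "(sqrt n * xbar i u t)\<^sup>2 = n * B u"
      unfolding power_mult_distrib B_def sample_mean_def by (simp add: power_divide)
    then show ?thesis using abs_le_add_square_div[of 1 "sqrt n * xbar i u t"] by simp
  qed
  show int: "integrable Q (\<lambda>u. sqrt n * xbar i u t)"
    by (rule Bochner_Integration.integrable_bound[of _ "\<lambda>u. 1 + n * B u", OF _ meas])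
       (use B(1) le in \<open>auto intro!: AE_I2 order.trans[OF _ abs_ge_self]\<close>)
  have "expectation (\<lambda>u. \<bar>sqrt n * xbar i u t\<bar>) \<le> expectation (\<lambda>u. 1 + n * B u)"
    using int B(1) by (intro integral_mono le) auto
  also have "\<dots> = 1 + n * expectation B" using B(1) by (simp add: prob_space)
  also have "\<dots> \<le> 1 + n * (g i t t / real (N i))" using B(2) by (intro add_left_mono mult_left_mono) auto
  finally show "expectation (\<lambda>u. \<bar>sqrt n * xbar i u t\<bar>) \<le> 1 + n / real (N i) * g i t t" by simp
qed

text \<open>The formula is exact, the paths being Gaussian: independence over all pairs of group and
  observation factorizes the expectation, and \<open>N i\<close> equal variances with factor
  \<open>n / (N i)\<^sup>2\<close> add up to the factor \<open>n / N i\<close>.\<close>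

lemma linear_mean_char:
  fixes m :: nat
  assumes \<theta>: "\<And>p. p < m \<Longrightarrow> \<theta> p \<in> T"
  shows "expectation (\<lambda>u. iexp (\<Sum>i<k. \<Sum>p<m. c i p * (sqrt n * xbar i u (\<theta> p)))) =
    exp (- (\<Sum>i<k. n / real (N i) * (\<Sum>p<m. \<Sum>q<m. c i p * c i q * g i (\<theta> p) (\<theta> q))) / 2)"
proof -
  define \<beta> where "\<beta> i p = sqrt n / real (N i) * c i p" for i p
  define W where "W ij u = (\<Sum>p<m. \<beta> (fst ij) p * xP (fst ij) (snd ij) u (\<theta> p))" for ij u
  define S where "S = (SIGMA i:{..<k}. {..<N i})"
  define V where "V i = (\<Sum>p<m. \<Sum>q<m. c i p * c i q * g i (\<theta> p) (\<theta> q))" for i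
  have V\<beta>: "(\<Sum>p<m. \<Sum>q<m. \<beta> i p * \<beta> i q * g i (\<theta> p) (\<theta> q)) = n / (real (N i))\<^sup>2 * V i" for i
  proof -
    have "sqrt n / real (N i) * a * (sqrt n / real (N i) * b) * e = n / (real (N i))\<^sup>2 * (a * b * e)" for a b e
      by (simp add: power2_eq_square field_simps)
    then show ?thesis by (simp add: \<beta>_def V_def sum_distrib_left)
  qed
  have eq: "(\<Sum>i<k. \<Sum>p<m. c i p * (sqrt n * xbar i u (\<theta> p))) = (\<Sum>ij\<in>S. W ij u)" for u
  proof -
    have "(\<Sum>ij\<in>S. W ij u) = (\<Sum>i<k. \<Sum>j<N i. W (i, j) u)"
      unfolding S_def by (subst sum.Sigma) (auto simp: case_prod_beta)
    also have "\<dots> = (\<Sum>i<k. \<Sum>p<m. \<Sum>j<N i. \<beta> i p * xP i j u (\<theta> p))"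
      unfolding W_def fst_conv snd_conv by (intro sum.cong refl sum.swap)
    also have "\<dots> = (\<Sum>i<k. \<Sum>p<m. c i p * (sqrt n * xbar i u (\<theta> p)))"
      unfolding \<beta>_def sample_mean_def sum_distrib_left[symmetric] by (intro sum.cong refl) simp
    finally show ?thesis by simp
  qed
  have W: "W ij \<in> borel_measurable Q" "distr Q borel (W ij) = scaled_normal (n / (real (N (fst ij)))\<^sup>2 * V (fst ij))"
    "0 \<le> n / (real (N (fst ij)))\<^sup>2 * V (fst ij)" if "ij \<in> S" for ij
    using linear_law[of "fst ij" "snd ij" m \<theta> "\<beta> (fst ij)"] \<theta> that unfolding V\<beta> W_def S_def by auto
  have "indep_vars (\<lambda>_. borel) (\<lambda>ij u. (\<lambda>f. iexp (\<Sum>p<m. \<beta> (fst ij) p * f (\<theta> p))) (restrict (xP (fst ij) (snd ij) u) T)) S"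
    unfolding S_def
  proof (rule indep_vars_compose2[OF indep_paths])
    fix ij
    have "(\<lambda>f. f (\<theta> p)) \<in> borel_measurable (PiM T (\<lambda>_. borel :: real measure))" if "p < m" for p
      by (rule measurable_component_singleton) (rule \<theta>[OF that])
    then have "(\<lambda>f. \<Sum>p<m. \<beta> (fst ij) p * f (\<theta> p)) \<in> borel_measurable (PiM T (\<lambda>_. borel :: real measure))"
      by (intro borel_measurable_sum borel_measurable_times borel_measurable_const) auto
    then show "(\<lambda>f. iexp (\<Sum>p<m. \<beta> (fst ij) p * f (\<theta> p))) \<in> borel_measurable (PiM T (\<lambda>_. borel :: real measure))"
      by measurable
  qed
  moreover have "(\<Sum>p<m. \<beta> (fst ij) p * restrict (xP (fst ij) (snd ij) u) T (\<theta> p)) = W ij u" for ij u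
    unfolding W_def using \<theta> by (intro sum.cong refl) auto
  ultimately have ind: "indep_vars (\<lambda>_. borel) (\<lambda>ij u. iexp (W ij u)) S" by (simp only:)
  have finS: "finite S" by (simp add: S_def)
  have "expectation (\<lambda>u. iexp (\<Sum>i<k. \<Sum>p<m. c i p * (sqrt n * xbar i u (\<theta> p)))) = expectation (\<lambda>u. \<Prod>ij\<in>S. iexp (W ij u))"
    unfolding eq by (simp add: exp_sum finS sum_distrib_left)
  also have "\<dots> = (\<Prod>ij\<in>S. expectation (\<lambda>u. iexp (W ij u)))"
    by (rule indep_vars_lebesgue_integral[OF finS ind]) (intro integrable_iexp_real W)
  also have "\<dots> = (\<Prod>ij\<in>S. exp (of_real (- (n / (real (N (fst ij)))\<^sup>2 * V (fst ij)) / 2)))"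
  proof (intro prod.cong refl)
    fix ij assume ij: "ij \<in> S"
    show "expectation (\<lambda>u. iexp (W ij u)) = exp (of_real (- (n / (real (N (fst ij)))\<^sup>2 * V (fst ij)) / 2))"
      using scaled_normal_char[OF W[OF ij]] unfolding exp_of_real .
  qed
  also have "\<dots> = exp (of_real (\<Sum>ij\<in>S. - (n / (real (N (fst ij)))\<^sup>2 * V (fst ij)) / 2))"
    unfolding of_real_sum by (rule exp_sum[OF finS, symmetric])
  also have "(\<Sum>ij\<in>S. - (n / (real (N (fst ij)))\<^sup>2 * V (fst ij)) / 2) = (\<Sum>i<k. \<Sum>j<N i. - (n / (real (N i))\<^sup>2 * V i) / 2)"
    unfolding S_def by (subst sum.Sigma) (auto simp: case_prod_beta)
  also have "\<dots> = (\<Sum>i<k. - (n / real (N i) * V i) / 2)"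
  proof (intro sum.cong refl)
    fix i assume "i \<in> {..<k}"
    then have "real (N i) \<noteq> 0" using N[of i] by auto
    then show "(\<Sum>j<N i. - (n / (real (N i))\<^sup>2 * V i) / 2) = - (n / real (N i) * V i) / 2"
      by (simp add: power2_eq_square)
  qed
  also have "\<dots> = - (\<Sum>i<k. n / real (N i) * V i) / 2"
    by (simp add: sum_negf sum_divide_distrib)
  finally show ?thesis unfolding V_def exp_of_real .
qed

lemma covariance_concentration:
  assumes i: "i < k" and t: "t \<in> T" and \<delta>: "0 < \<delta>"
  shows "integrable Q (\<lambda>u. chat i u t)"
    and "expectation (\<lambda>u. \<bar>chat i u t - g i t t\<bar>) \<le> 2 * \<delta> + 6 * (g i t t)\<^sup>2 / (\<delta> * real (N i)) + 4 * g i t t / real (N i)"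
proof -
  have N2: "2 \<le> N i" using N[OF i] by simp
  note c = sample_variance_concentration[where x = "xP i" and t = t, OF N2 indep_points[OF i t] point_law(2)[OF i t] point_law(1)[OF i t] \<delta>]
  show "integrable Q (\<lambda>u. chat i u t)" by (rule c(1))
  show "expectation (\<lambda>u. \<bar>chat i u t - g i t t\<bar>) \<le> 2 * \<delta> + 6 * (g i t t)\<^sup>2 / (\<delta> * real (N i)) + 4 * g i t t / real (N i)"
    by (rule c(2))
qed

end

section \<open>Convergence of finite-dimensional laws\<close>

lemma sum_lessThan_add: "(\<Sum>a<r + k. f a) = (\<Sum>a<r. f a) + (\<Sum>i<k. f (r + i))" for f :: "nat \<Rightarrow> real"
  by (induction k) (simp_all add: add.assoc)

lemma sum_times_snd:
  fixes f :: "'a \<times> 'b \<Rightarrow> real"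
  shows "(\<Sum>s\<in>A \<times> B. f s * h (snd s)) = (\<Sum>p\<in>B. (\<Sum>a\<in>A. f (a, p)) * h p)"
proof -
  have "(\<Sum>s\<in>A \<times> B. f s * h (snd s)) = (\<Sum>a\<in>A. \<Sum>p\<in>B. f (a, p) * h p)"
    by (subst sum.cartesian_product) (simp add: case_prod_beta)
  also have "\<dots> = (\<Sum>p\<in>B. \<Sum>a\<in>A. f (a, p) * h p)" by (rule sum.swap)
  finally show ?thesis by (simp add: sum_distrib_right)
qed

lemma sum_square_times_snd:
  fixes f :: "'a \<times> 'b \<Rightarrow> real"
  shows "(\<Sum>s\<in>A \<times> B. \<Sum>s'\<in>A \<times> B. f s * f s' * G (snd s) (snd s')) =
    (\<Sum>p\<in>B. \<Sum>q\<in>B. (\<Sum>a\<in>A. f (a, p)) * (\<Sum>a\<in>A. f (a, q)) * G p q)"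
proof -
  have "(\<Sum>s\<in>A \<times> B. \<Sum>s'\<in>A \<times> B. f s * f s' * G (snd s) (snd s')) =
      (\<Sum>s\<in>A \<times> B. f s * (\<Sum>s'\<in>A \<times> B. f s' * G (snd s) (snd s')))"
    by (simp add: sum_distrib_left mult.assoc)
  also have "\<dots> = (\<Sum>p\<in>B. (\<Sum>a\<in>A. f (a, p)) * (\<Sum>s'\<in>A \<times> B. f s' * G p (snd s')))"
    by (rule sum_times_snd)
  also have "\<dots> = (\<Sum>p\<in>B. (\<Sum>a\<in>A. f (a, p)) * (\<Sum>q\<in>B. (\<Sum>a\<in>A. f (a, q)) * G p q))"
    by (simp only: sum_times_snd)
  finally have *: "(\<Sum>s\<in>A \<times> B. \<Sum>s'\<in>A \<times> B. f s * f s' * G (snd s) (snd s')) =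
      (\<Sum>p\<in>B. (\<Sum>a\<in>A. f (a, p)) * (\<Sum>q\<in>B. (\<Sum>a\<in>A. f (a, q)) * G p q))" .
  define C where "C p = (\<Sum>a\<in>A. f (a, p))" for p
  show ?thesis unfolding * C_def[symmetric] by (simp add: sum_distrib_left mult.assoc)
qed

text \<open>The free parameter of the concentration bound is taken as \<open>1 / sqrt (N i)\<close>,
  so that the parameter and the term divided by it are both of order \<open>1 / sqrt (N i)\<close>.
  The number \<open>d\<close> will be the limit variance.\<close>

lemma (in bootstrap_stage) scaled_covariance_deviation:
  assumes i: "i < k" and t: "t \<in> T"
  shows "integrable Q (\<lambda>u. n / real (N i) * chat i u t - d)"
    and "expectation (\<lambda>u. \<bar>n / real (N i) * chat i u t - d\<bar>) \<le>
      n / real (N i) * (2 / sqrt (real (N i)) + 6 * (g i t t)\<^sup>2 / sqrt (real (N i)) + 4 * g i t t / real (N i)) +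
      \<bar>n / real (N i) * g i t t - d\<bar>"
proof -
  define \<rho> where "\<rho> = n / real (N i)"
  have \<rho>: "0 \<le> \<rho>" by (simp add: \<rho>_def)
  have N0: "0 < real (N i)" using N[OF i] by simp
  define \<delta> where "\<delta> = 1 / sqrt (real (N i))"
  have \<delta>: "0 < \<delta>" using N0 by (simp add: \<delta>_def)
  have \<delta>N: "\<delta> * real (N i) = sqrt (real (N i))" using N0 by (simp add: \<delta>_def real_div_sqrt)
  note c = covariance_concentration[OF i t \<delta>]
  show int: "integrable Q (\<lambda>u. n / real (N i) * chat i u t - d)" using c(1) by simp
  have "expectation (\<lambda>u. \<bar>\<rho> * chat i u t - d\<bar>) \<le> expectation (\<lambda>u. \<rho> * \<bar>chat i u t - g i t t\<bar> + \<bar>\<rho> * g i t t - d\<bar>)"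
  proof (rule integral_mono)
    fix u
    have "\<rho> * chat i u t - d = \<rho> * (chat i u t - g i t t) + (\<rho> * g i t t - d)" by (simp add: algebra_simps)
    then have "\<bar>\<rho> * chat i u t - d\<bar> \<le> \<bar>\<rho> * (chat i u t - g i t t)\<bar> + \<bar>\<rho> * g i t t - d\<bar>"
      by (simp only: abs_triangle_ineq)
    then show "\<bar>\<rho> * chat i u t - d\<bar> \<le> \<rho> * \<bar>chat i u t - g i t t\<bar> + \<bar>\<rho> * g i t t - d\<bar>"
      using \<rho> by (simp add: abs_mult)
  qed (use c(1) in simp_all)
  also have "\<dots> = \<rho> * expectation (\<lambda>u. \<bar>chat i u t - g i t t\<bar>) + \<bar>\<rho> * g i t t - d\<bar>"
    using c(1) by (simp add: prob_space)
  also have "\<dots> \<le> \<rho> * (2 * \<delta> + 6 * (g i t t)\<^sup>2 / (\<delta> * real (N i)) + 4 * g i t t / real (N i)) + \<bar>\<rho> * g i t t - d\<bar>"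
    by (intro add_right_mono mult_left_mono c(2) \<rho>)
  finally show "expectation (\<lambda>u. \<bar>n / real (N i) * chat i u t - d\<bar>) \<le>
      n / real (N i) * (2 / sqrt (real (N i)) + 6 * (g i t t)\<^sup>2 / sqrt (real (N i)) + 4 * g i t t / real (N i)) +
      \<bar>n / real (N i) * g i t t - d\<bar>"
    unfolding \<delta>N by (simp add: \<delta>_def \<rho>_def)
qed

lemma char_perturbation:
  assumes Q: "prob_space Q" and X: "X \<in> borel_measurable Q" and Y: "Y \<in> borel_measurable Q"
    and B: "integrable Q B" and le: "\<And>u. u \<in> space Q \<Longrightarrow> cmod (iexp (X u) - iexp (Y u)) \<le> B u"
  shows "cmod ((\<integral>u. iexp (X u) \<partial>Q) - (\<integral>u. iexp (Y u) \<partial>Q)) \<le> (\<integral>u. B u \<partial>Q)"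
proof -
  interpret Q: prob_space Q by (rule Q)
  have i: "integrable Q (\<lambda>u. iexp (X u))" "integrable Q (\<lambda>u. iexp (Y u))"
    by (intro Q.integrable_iexp_real X Y)+
  have "cmod ((\<integral>u. iexp (X u) \<partial>Q) - (\<integral>u. iexp (Y u) \<partial>Q)) = cmod (\<integral>u. iexp (X u) - iexp (Y u) \<partial>Q)"
    using i by simp
  also have "\<dots> \<le> (\<integral>u. cmod (iexp (X u) - iexp (Y u)) \<partial>Q)" by (rule integral_norm_bound)
  also have "\<dots> \<le> (\<integral>u. B u \<partial>Q)" using i B by (intro integral_mono le) auto
  finally show ?thesis .
qed

text \<open>Weak convergence is tested with real functions; real and imaginary part recover the
  complex exponential.\<close>

lemma cos_sin_convergence_imp_char:
  assumes Q: "\<And>\<nu>. prob_space (Q \<nu>)" and P: "prob_space P"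
    and X: "\<And>\<nu>. X \<nu> \<in> borel_measurable (Q \<nu>)" and Y: "Y \<in> borel_measurable P"
    and c: "(\<lambda>\<nu>. \<integral>u. cos (X \<nu> u) \<partial>Q \<nu>) \<longlonglongrightarrow> (\<integral>u. cos (Y u) \<partial>P)"
    and s: "(\<lambda>\<nu>. \<integral>u. sin (X \<nu> u) \<partial>Q \<nu>) \<longlonglongrightarrow> (\<integral>u. sin (Y u) \<partial>P)"
  shows "(\<lambda>\<nu>. \<integral>u. iexp (X \<nu> u) \<partial>Q \<nu>) \<longlonglongrightarrow> (\<integral>u. iexp (Y u) \<partial>P)"
proof -
  have eq: "(\<integral>u. iexp (W u) \<partial>N) = Complex (\<integral>u. cos (W u) \<partial>N) (\<integral>u. sin (W u) \<partial>N)"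
    if N: "prob_space N" and W: "W \<in> borel_measurable N" for N :: "'z measure" and W
  proof (rule complex_eqI)
    note i = prob_space.integrable_iexp_real[OF N W]
    show "Re (\<integral>u. iexp (W u) \<partial>N) = Re (Complex (\<integral>u. cos (W u) \<partial>N) (\<integral>u. sin (W u) \<partial>N))"
      unfolding integral_Re[OF i, symmetric] by (simp add: Re_exp)
    show "Im (\<integral>u. iexp (W u) \<partial>N) = Im (Complex (\<integral>u. cos (W u) \<partial>N) (\<integral>u. sin (W u) \<partial>N))"
      unfolding integral_Im[OF i, symmetric] by (simp add: Im_exp)
  qed
  show ?thesis unfolding eq[OF Q X] eq[OF P Y] by (intro tendsto_Complex c s)
qed

text \<open>The scaled means and the scaled sample variances are treated as one vector; since the latter
  converge to constants in mean, their contribution to the characteristic function is a phase factor.\<close>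

lemma studentized_fdd:
  fixes Q :: "nat \<Rightarrow> 'b measure" and P :: "'v measure" and N :: "nat \<Rightarrow> nat \<Rightarrow> nat"
    and xP :: "nat \<Rightarrow> nat \<Rightarrow> nat \<Rightarrow> 'b \<Rightarrow> real \<Rightarrow> real" and \<theta> :: "nat \<Rightarrow> real" and m :: nat
    and rr :: "nat \<Rightarrow> nat" and c :: "nat \<Rightarrow> real"
  assumes stage: "\<And>\<nu>. bootstrap_stage (Q \<nu>) T k (N \<nu>) y (xP \<nu>)"
    and z: "vec_gaussian_process P T r (\<lambda>t s. H * limit_cov_mat k \<tau> \<gamma> t s * H\<^sup>T) z"
    and r: "(\<Sum>l<R. rr l) = r"
    and Hs: "\<forall>l<R. Hs l \<in> carrier_mat (rr l) k" and H: "H = stack_rows R k Hs"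
    and ratio: "\<And>i. i < k \<Longrightarrow> (\<lambda>\<nu>. real (total_size k (N \<nu>)) / real (N \<nu> i)) \<longlonglongrightarrow> 1 / \<tau> i"
    and \<tau>: "\<And>i. i < k \<Longrightarrow> 0 < \<tau> i"
    and Ninf: "\<And>i. i < k \<Longrightarrow> filterlim (\<lambda>\<nu>. N \<nu> i) at_top sequentially"
    and \<theta>: "\<And>p. p < m \<Longrightarrow> \<theta> p \<in> T"
    and conv: "\<And>i p q. i < k \<Longrightarrow> p < m \<Longrightarrow> q < m \<Longrightarrow>
      (\<lambda>\<nu>. sample_cov (N \<nu> i) (y i) (\<theta> p) (\<theta> q)) \<longlonglongrightarrow> \<gamma> i (\<theta> p) (\<theta> q)"
    and pos: "\<And>i p. i < k \<Longrightarrow> p < m \<Longrightarrow> 0 < \<gamma> i (\<theta> p) (\<theta> p)"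
  shows "(\<lambda>\<nu>. \<integral>u. iexp (\<Sum>p<m. \<Sum>l<R. c l * studentized_form k (N \<nu>) (\<lambda>i j. xP \<nu> i j u) (rr l) (Hs l) (\<theta> p)) \<partial>Q \<nu>)
    \<longlonglongrightarrow> (\<integral>u. iexp (\<Sum>p<m. \<Sum>l<R. c l * mp_form (rr l) k (Hs l) (\<lambda>i. 1 / \<tau> i * \<gamma> i (\<theta> p) (\<theta> p))
        (\<lambda>a. z u (\<theta> p) $ ((\<Sum>l'<l. rr l') + a))) \<partial>P)"
proof -
  define off where "off l = (\<Sum>l'<l. rr l')" for l
  define n where "n \<nu> = real (total_size k (N \<nu>))" for \<nu>
  define xb where "xb \<nu> i p u = sqrt (n \<nu>) * sample_mean (N \<nu> i) (\<lambda>j. xP \<nu> i j u) (\<theta> p)" for \<nu> i p u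
  define D where "D \<nu> i p u = n \<nu> / real (N \<nu> i) * sample_cov (N \<nu> i) (\<lambda>j. xP \<nu> i j u) (\<theta> p) (\<theta> p)" for \<nu> i p u
  define d where "d i p = 1 / \<tau> i * \<gamma> i (\<theta> p) (\<theta> p)" for i p
  \<comment> \<open>Indices \<open>a < r\<close> carry the means transformed by \<open>H\<close>,
    the next \<open>k\<close> indices the scaled variances of the groups; the second component is
    the sampling time.\<close>
  define I where "I = {..<r + k} \<times> {..<m}"
  define X where "X \<nu> = (\<lambda>(a, p) u. if a < r then \<Sum>i<k. H $$ (a, i) * xb \<nu> i p u else D \<nu> (a - r) p u)" for \<nu>
  define Y where "Y = (\<lambda>(a, p) u. if a < r then z u (\<theta> p) $ a else d (a - r) p)"
  have Q: "prob_space (Q \<nu>)" for \<nu> using stage[of \<nu>] by (simp add: bootstrap_stage_def)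
  have zf: "centered_gaussian_family P ({..<r} \<times> T) (\<lambda>(p, t) w. z w t $ p)
      (\<lambda>(p, t) (q, s). (H * limit_cov_mat k \<tau> \<gamma> t s * H\<^sup>T) $$ (p, q))"
    using z by (simp add: vec_gaussian_process_def)
  have P: "prob_space P" using zf by (simp add: centered_gaussian_family_def)
  have Hc: "H \<in> carrier_mat r k" using stack_rows_carrier[OF Hs] by (simp add: H r)
  have xb_int: "integrable (Q \<nu>) (xb \<nu> i p)" and
    xb_le: "(\<integral>u. \<bar>xb \<nu> i p u\<bar> \<partial>Q \<nu>) \<le> 1 + n \<nu> / real (N \<nu> i) * sample_cov (N \<nu> i) (y i) (\<theta> p) (\<theta> p)"
    if "i < k" "p < m" for \<nu> i p
    using bootstrap_stage.mean_abs_bound[OF stage that(1) \<theta>[OF that(2)], of \<nu>]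
    unfolding xb_def[abs_def] n_def by auto
  have g0: "0 \<le> sample_cov (N \<nu> i) (y i) (\<theta> p) (\<theta> p)" for \<nu> i p by (rule sample_cov_nonneg)
  have D_int: "integrable (Q \<nu>) (D \<nu> i p)" if "i < k" "p < m" for \<nu> i p
    using bootstrap_stage.scaled_covariance_deviation(1)[OF stage that(1) \<theta>[OF that(2)], of \<nu> 0]
    unfolding D_def[abs_def] n_def by simp
  define e where "e \<nu> i p = (\<integral>u. \<bar>D \<nu> i p u - d i p\<bar> \<partial>Q \<nu>)" for \<nu> i p
  have e: "(\<lambda>\<nu>. e \<nu> i p) \<longlonglongrightarrow> 0" if i: "i < k" and p: "p < m" for i p
  proof -
    define G where "G \<nu> = sample_cov (N \<nu> i) (y i) (\<theta> p) (\<theta> p)" for \<nu>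
    define s where "s \<nu> = real (N \<nu> i)" for \<nu>
    have G: "G \<longlonglongrightarrow> \<gamma> i (\<theta> p) (\<theta> p)" unfolding G_def by (rule conv[OF i p p])
    have s: "filterlim s at_top sequentially"
      unfolding s_def by (rule filterlim_compose[OF filterlim_real_sequentially Ninf[OF i]])
    have s1: "(\<lambda>\<nu>. 1 / s \<nu>) \<longlonglongrightarrow> 0"
      using tendsto_divide_0[OF tendsto_const filterlim_at_top_imp_at_infinity[OF s]] .
    have s2: "(\<lambda>\<nu>. 1 / sqrt (s \<nu>)) \<longlonglongrightarrow> 0"
      using tendsto_divide_0[OF tendsto_const filterlim_at_top_imp_at_infinity[OF filterlim_compose[OF sqrt_at_top s]]] .
    have \<rho>: "(\<lambda>\<nu>. n \<nu> / s \<nu>) \<longlonglongrightarrow> 1 / \<tau> i" unfolding n_def s_def by (rule ratio[OF i])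
    have "(\<lambda>\<nu>. n \<nu> / s \<nu> * (2 * (1 / sqrt (s \<nu>)) + 6 * (G \<nu>)\<^sup>2 * (1 / sqrt (s \<nu>)) + 4 * G \<nu> * (1 / s \<nu>)) +
        \<bar>n \<nu> / s \<nu> * G \<nu> - d i p\<bar>) \<longlonglongrightarrow>
      1 / \<tau> i * (2 * 0 + 6 * (\<gamma> i (\<theta> p) (\<theta> p))\<^sup>2 * 0 + 4 * \<gamma> i (\<theta> p) (\<theta> p) * 0) + \<bar>1 / \<tau> i * \<gamma> i (\<theta> p) (\<theta> p) - d i p\<bar>"
      by (intro tendsto_intros G s1 s2 \<rho>)
    then have lim: "(\<lambda>\<nu>. n \<nu> / s \<nu> * (2 * (1 / sqrt (s \<nu>)) + 6 * (G \<nu>)\<^sup>2 * (1 / sqrt (s \<nu>)) + 4 * G \<nu> * (1 / s \<nu>)) +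
        \<bar>n \<nu> / s \<nu> * G \<nu> - d i p\<bar>) \<longlonglongrightarrow> 0" by (simp add: d_def)
    show ?thesis
    proof (rule tendsto_sandwich[OF _ _ tendsto_const lim])
      show "\<forall>\<^sub>F \<nu> in sequentially. 0 \<le> e \<nu> i p" by (simp add: e_def)
      show "\<forall>\<^sub>F \<nu> in sequentially. e \<nu> i p \<le> n \<nu> / s \<nu> * (2 * (1 / sqrt (s \<nu>)) + 6 * (G \<nu>)\<^sup>2 * (1 / sqrt (s \<nu>)) + 4 * G \<nu> * (1 / s \<nu>)) +
          \<bar>n \<nu> / s \<nu> * G \<nu> - d i p\<bar>"
        using bootstrap_stage.scaled_covariance_deviation(2)[OF stage i \<theta>[OF p], of _ "d i p"]
        by (simp add: e_def D_def n_def s_def G_def)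
    qed
  qed
  have X_int: "integrable (Q \<nu>) (X \<nu> s)" if "s \<in> I" for \<nu> s
  proof (cases s)
    case (Pair a p)
    then show ?thesis using that xb_int D_int[of "a - r" p]
      by (cases "a < r") (auto simp: I_def X_def)
  qed
  have bdd: "\<exists>C. \<forall>\<nu>. (\<integral>u. \<bar>X \<nu> s u\<bar> \<partial>Q \<nu>) \<le> C" if s: "s \<in> I" for s
  proof -
    obtain a p where ap: "s = (a, p)" by (cases s)
    then have p: "p < m" and a: "a < r + k" using s by (auto simp: I_def)
    show ?thesis
    proof (cases "a < r")
      case True
      define b where "b \<nu> = (\<Sum>i<k. \<bar>H $$ (a, i)\<bar> * (1 + n \<nu> / real (N \<nu> i) * sample_cov (N \<nu> i) (y i) (\<theta> p) (\<theta> p)))" for \<nu>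
      have "b \<longlonglongrightarrow> (\<Sum>i<k. \<bar>H $$ (a, i)\<bar> * (1 + 1 / \<tau> i * \<gamma> i (\<theta> p) (\<theta> p)))"
        unfolding b_def n_def by (intro tendsto_intros ratio conv p) auto
      then have "Bseq b" by (intro convergent_imp_Bseq convergentI)
      then obtain C where C: "\<And>\<nu>. norm (b \<nu>) \<le> C" by (auto simp: Bseq_def)
      have "(\<integral>u. \<bar>X \<nu> s u\<bar> \<partial>Q \<nu>) \<le> C" for \<nu>
      proof -
        have "(\<integral>u. \<bar>X \<nu> s u\<bar> \<partial>Q \<nu>) \<le> (\<integral>u. (\<Sum>i<k. \<bar>H $$ (a, i)\<bar> * \<bar>xb \<nu> i p u\<bar>) \<partial>Q \<nu>)"
        proof (rule integral_mono)
          show "integrable (Q \<nu>) (\<lambda>u. \<bar>X \<nu> s u\<bar>)" using X_int[OF s] by simp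
          show "integrable (Q \<nu>) (\<lambda>u. \<Sum>i<k. \<bar>H $$ (a, i)\<bar> * \<bar>xb \<nu> i p u\<bar>)" using xb_int p by auto
          show "\<bar>X \<nu> s u\<bar> \<le> (\<Sum>i<k. \<bar>H $$ (a, i)\<bar> * \<bar>xb \<nu> i p u\<bar>)" for u
            using True sum_abs[of "\<lambda>i. H $$ (a, i) * xb \<nu> i p u" "{..<k}"] by (simp add: X_def ap abs_mult)
        qed
        also have "\<dots> = (\<Sum>i<k. \<bar>H $$ (a, i)\<bar> * (\<integral>u. \<bar>xb \<nu> i p u\<bar> \<partial>Q \<nu>))"
          using xb_int p by (subst Bochner_Integration.integral_sum) auto
        also have "\<dots> \<le> b \<nu>" unfolding b_def using p by (intro sum_mono mult_left_mono xb_le) auto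
        also have "\<dots> \<le> C" using C[of \<nu>] by simp
        finally show ?thesis .
      qed
      then show ?thesis by blast
    next
      case False
      define i where "i = a - r"
      have i: "i < k" using False a by (simp add: i_def)
      have "Bseq (\<lambda>\<nu>. e \<nu> i p)" by (intro convergent_imp_Bseq convergentI[OF e[OF i p]])
      then obtain C where C: "\<And>\<nu>. norm (e \<nu> i p) \<le> C" by (auto simp: Bseq_def)
      have "(\<integral>u. \<bar>X \<nu> s u\<bar> \<partial>Q \<nu>) \<le> C + \<bar>d i p\<bar>" for \<nu>
      proof -
        interpret Qn: prob_space "Q \<nu>" by (rule Q)
        have "(\<integral>u. \<bar>X \<nu> s u\<bar> \<partial>Q \<nu>) \<le> (\<integral>u. \<bar>D \<nu> i p u - d i p\<bar> + \<bar>d i p\<bar> \<partial>Q \<nu>)"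
          using False D_int[OF i p] by (intro integral_mono) (auto simp: X_def ap i_def)
        also have "\<dots> = e \<nu> i p + \<bar>d i p\<bar>" using D_int[OF i p] by (simp add: e_def Qn.prob_space)
        finally show ?thesis using C[of \<nu>] by simp
      qed
      then show ?thesis by blast
    qed
  qed
  then obtain C where C: "\<And>\<nu> s. s \<in> I \<Longrightarrow> (\<integral>u. \<bar>X \<nu> s u\<bar> \<partial>Q \<nu>) \<le> C s" by metis
  have Y_int: "integrable P (Y s)" if s: "s \<in> I" for s
  proof -
    interpret P: prob_space P by (rule P)
    obtain a p where ap: "s = (a, p)" by (cases s)
    then have p: "p < m" using s by (auto simp: I_def)
    show ?thesis
    proof (cases "a < r")
      case True
      note L = gaussian_family_linear[OF zf, of "{(a, \<theta> p)}" "\<lambda>_. 1"]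
      have "(\<lambda>u. z u (\<theta> p) $ a) \<in> borel_measurable P" using L(1) True \<theta>[OF p] by simp
      moreover have "integrable P (\<lambda>u. (z u (\<theta> p) $ a)\<^sup>2)"
        using scaled_normal_moments(1)[OF L(1) L(3) L(2), of 1] True \<theta>[OF p] by simp
      ultimately have "integrable P (\<lambda>u. z u (\<theta> p) $ a)" by (rule P.square_integrable_imp_integrable)
      then show ?thesis using True by (simp add: Y_def ap)
    qed (simp add: Y_def ap)
  qed
  have char: "(\<lambda>\<nu>. \<integral>u. iexp (\<Sum>s\<in>I. w s * X \<nu> s u) \<partial>Q \<nu>) \<longlonglongrightarrow> (\<integral>u. iexp (\<Sum>s\<in>I. w s * Y s u) \<partial>P)" for w
  proof -
    \<comment> \<open>The coefficient of the mean of group \<open>i\<close> at time \<open>p\<close>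
      once \<open>H\<close> has been absorbed into the weights.\<close>
    define cc where "cc i p = (\<Sum>a<r. w (a, p) * H $$ (a, i))" for i p
    define L where "L \<nu> u = (\<Sum>i<k. \<Sum>p<m. cc i p * xb \<nu> i p u)" for \<nu> u
    define dl where "dl = (\<Sum>i<k. \<Sum>p<m. w (r + i, p) * d i p)"
    define V where "V = (\<Sum>i<k. 1 / \<tau> i * (\<Sum>p<m. \<Sum>q<m. cc i p * cc i q * \<gamma> i (\<theta> p) (\<theta> q)))"
    have split: "(\<Sum>s\<in>I. w s * F s) = (\<Sum>s\<in>{..<r} \<times> {..<m}. w s * F s) + (\<Sum>i<k. \<Sum>p<m. w (r + i, p) * F (r + i, p))" for F :: "nat \<times> nat \<Rightarrow> real"
      unfolding I_def sum.cartesian_product' sum_lessThan_add ..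
    have Xs: "(\<Sum>s\<in>I. w s * X \<nu> s u) = L \<nu> u + (\<Sum>i<k. \<Sum>p<m. w (r + i, p) * D \<nu> i p u)" for \<nu> u
    proof -
      have "(\<Sum>s\<in>{..<r} \<times> {..<m}. w s * X \<nu> s u) = (\<Sum>a<r. \<Sum>p<m. \<Sum>i<k. w (a, p) * (H $$ (a, i) * xb \<nu> i p u))"
        unfolding sum.cartesian_product' by (simp add: X_def sum_distrib_left)
      also have "\<dots> = (\<Sum>p<m. \<Sum>a<r. \<Sum>i<k. w (a, p) * (H $$ (a, i) * xb \<nu> i p u))" by (rule sum.swap)
      also have "\<dots> = (\<Sum>p<m. \<Sum>i<k. \<Sum>a<r. w (a, p) * (H $$ (a, i) * xb \<nu> i p u))"
        by (intro sum.cong refl sum.swap)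
      also have "\<dots> = (\<Sum>i<k. \<Sum>p<m. \<Sum>a<r. w (a, p) * (H $$ (a, i) * xb \<nu> i p u))" by (rule sum.swap)
      also have "\<dots> = L \<nu> u" by (simp add: L_def cc_def sum_distrib_right mult.assoc)
      finally show ?thesis unfolding split by (simp add: X_def)
    qed
    have L_meas: "L \<nu> \<in> borel_measurable (Q \<nu>)" for \<nu>
      unfolding L_def using xb_int by (intro borel_measurable_sum borel_measurable_times borel_measurable_const) auto
    have L_char: "(\<lambda>\<nu>. \<integral>u. iexp (L \<nu> u) \<partial>Q \<nu>) \<longlonglongrightarrow> exp (- V / 2)"
    proof -
      have "(\<integral>u. iexp (L \<nu> u) \<partial>Q \<nu>) = exp (- (\<Sum>i<k. n \<nu> / real (N \<nu> i) * (\<Sum>p<m. \<Sum>q<m. cc i p * cc i q * sample_cov (N \<nu> i) (y i) (\<theta> p) (\<theta> q))) / 2)" for \<nu>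
        unfolding L_def xb_def n_def by (rule bootstrap_stage.linear_mean_char[OF stage \<theta>])
      moreover have "(\<lambda>\<nu>. \<Sum>i<k. n \<nu> / real (N \<nu> i) * (\<Sum>p<m. \<Sum>q<m. cc i p * cc i q * sample_cov (N \<nu> i) (y i) (\<theta> p) (\<theta> q))) \<longlonglongrightarrow> V"
        unfolding V_def n_def by (intro tendsto_sum tendsto_mult tendsto_const ratio conv) auto
      ultimately show ?thesis by (simp only:) (intro tendsto_intros; simp)
    qed
    have L_shift: "(\<lambda>\<nu>. \<integral>u. iexp (L \<nu> u + dl) \<partial>Q \<nu>) \<longlonglongrightarrow> exp (- V / 2) * iexp dl"
      using tendsto_mult_right[OF L_char, of "iexp dl"] by (simp add: distrib_left exp_add)
    \<comment> \<open>The map \<open>iexp\<close> is 1-Lipschitz, so replacing the scaled variances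
      by their limits costs at most their weighted mean deviations \<open>e\<close>.\<close>
    have "(\<lambda>\<nu>. (\<integral>u. iexp (\<Sum>s\<in>I. w s * X \<nu> s u) \<partial>Q \<nu>) - (\<integral>u. iexp (L \<nu> u + dl) \<partial>Q \<nu>)) \<longlonglongrightarrow> 0"
    proof (rule Lim_null_comparison)
      have "(\<lambda>\<nu>. \<Sum>i<k. \<Sum>p<m. \<bar>w (r + i, p)\<bar> * e \<nu> i p) \<longlonglongrightarrow> (\<Sum>i<k. \<Sum>p<m. \<bar>w (r + i, p)\<bar> * 0)"
        by (intro tendsto_sum tendsto_mult tendsto_const e) auto
      then show "(\<lambda>\<nu>. \<Sum>i<k. \<Sum>p<m. \<bar>w (r + i, p)\<bar> * e \<nu> i p) \<longlonglongrightarrow> 0" by simp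
      show "\<forall>\<^sub>F \<nu> in sequentially. cmod ((\<integral>u. iexp (\<Sum>s\<in>I. w s * X \<nu> s u) \<partial>Q \<nu>) - (\<integral>u. iexp (L \<nu> u + dl) \<partial>Q \<nu>)) \<le>
          (\<Sum>i<k. \<Sum>p<m. \<bar>w (r + i, p)\<bar> * e \<nu> i p)"
      proof (intro always_eventually allI)
        fix \<nu>
        define B where "B u = (\<Sum>i<k. \<Sum>p<m. \<bar>w (r + i, p)\<bar> * \<bar>D \<nu> i p u - d i p\<bar>)" for u
        interpret Qn: prob_space "Q \<nu>" by (rule Q)
        have dev: "integrable (Q \<nu>) (\<lambda>u. \<bar>D \<nu> i p u - d i p\<bar>)" if "i < k" "p < m" for i p using D_int[OF that] by simp
        have B: "integrable (Q \<nu>) B" unfolding B_def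
          by (intro Bochner_Integration.integrable_sum integrable_mult_right dev) auto
        have "cmod ((\<integral>u. iexp (\<Sum>s\<in>I. w s * X \<nu> s u) \<partial>Q \<nu>) - (\<integral>u. iexp (L \<nu> u + dl) \<partial>Q \<nu>)) \<le> (\<integral>u. B u \<partial>Q \<nu>)"
        proof (rule char_perturbation[OF Q _ _ B])
          show "(\<lambda>u. \<Sum>s\<in>I. w s * X \<nu> s u) \<in> borel_measurable (Q \<nu>)"
            using X_int by (intro borel_measurable_sum borel_measurable_times borel_measurable_const) auto
          show "(\<lambda>u. L \<nu> u + dl) \<in> borel_measurable (Q \<nu>)" using L_meas by simp
          fix u
          have "cmod (iexp (\<Sum>s\<in>I. w s * X \<nu> s u) - iexp (L \<nu> u + dl)) \<le> \<bar>(\<Sum>s\<in>I. w s * X \<nu> s u) - (L \<nu> u + dl)\<bar>"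
            by (rule norm_iexp_diff_le)
          also have "(\<Sum>s\<in>I. w s * X \<nu> s u) - (L \<nu> u + dl) = (\<Sum>i<k. \<Sum>p<m. w (r + i, p) * (D \<nu> i p u - d i p))"
            unfolding Xs dl_def by (simp add: sum_subtractf right_diff_distrib)
          also have "\<bar>\<dots>\<bar> \<le> (\<Sum>i<k. \<bar>\<Sum>p<m. w (r + i, p) * (D \<nu> i p u - d i p)\<bar>)" by (rule sum_abs)
          also have "\<dots> \<le> B u" unfolding B_def abs_mult[symmetric] by (intro sum_mono sum_abs)
          finally show "cmod (iexp (\<Sum>s\<in>I. w s * X \<nu> s u) - iexp (L \<nu> u + dl)) \<le> B u" .
        qed
        also have "(\<integral>u. B u \<partial>Q \<nu>) = (\<Sum>i<k. \<integral>u. (\<Sum>p<m. \<bar>w (r + i, p)\<bar> * \<bar>D \<nu> i p u - d i p\<bar>) \<partial>Q \<nu>)"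
          unfolding B_def
          by (intro Bochner_Integration.integral_sum Bochner_Integration.integrable_sum integrable_mult_right dev) auto
        also have "\<dots> = (\<Sum>i<k. \<Sum>p<m. \<bar>w (r + i, p)\<bar> * e \<nu> i p)"
          unfolding e_def
          by (intro sum.cong refl trans[OF Bochner_Integration.integral_sum] integrable_mult_right dev) auto
        finally show "cmod ((\<integral>u. iexp (\<Sum>s\<in>I. w s * X \<nu> s u) \<partial>Q \<nu>) - (\<integral>u. iexp (L \<nu> u + dl) \<partial>Q \<nu>)) \<le>
          (\<Sum>i<k. \<Sum>p<m. \<bar>w (r + i, p)\<bar> * e \<nu> i p)" .
      qed
    qed
    from tendsto_add[OF this L_shift]
    have left: "(\<lambda>\<nu>. \<integral>u. iexp (\<Sum>s\<in>I. w s * X \<nu> s u) \<partial>Q \<nu>) \<longlonglongrightarrow> exp (- V / 2) * iexp dl" by simp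
    define J where "J = {..<r} \<times> {..<m}"
    define Zl where "Zl u = (\<Sum>s\<in>J. w s * z u (\<theta> (snd s)) $ fst s)" for u
    \<comment> \<open>The same \<open>V\<close> as on the bootstrap side: expanding the entries of
      \<open>H \<Sigma> H\<^sup>T\<close> and moving the sum over groups outermost lets the rows of
      \<open>H\<close> merge with the weights into the coefficients \<open>cc\<close>.\<close>
    have Zl_law: "Zl \<in> borel_measurable P" "0 \<le> V" "distr P borel Zl = scaled_normal V"
    proof -
      have sub: "(\<lambda>s. (fst s, \<theta> (snd s))) ` J \<subseteq> {..<r} \<times> T" using \<theta> by (auto simp: J_def)
      have fin: "finite J" by (simp add: J_def)
      note G = gaussian_family_linear_indexed[where f = "\<lambda>s. (fst s, \<theta> (snd s))" and c = w, OF zf fin sub]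
      define h where "h i s = w s * H $$ (fst s, i)" for i s
      have cov: "(H * limit_cov_mat k \<tau> \<gamma> t t' * H\<^sup>T) $$ (a, b) = (\<Sum>i<k. H $$ (a, i) * (1 / \<tau> i * \<gamma> i t t') * H $$ (b, i))"
        if "a < r" "b < r" for t t' a b
        unfolding limit_cov_mat_def by (rule conjugate_diag_index[OF Hc that])
      have "(\<Sum>s\<in>J. \<Sum>s'\<in>J. w s * w s' * (case (fst s, \<theta> (snd s)) of (p, t) \<Rightarrow> \<lambda>(q, s). (H * limit_cov_mat k \<tau> \<gamma> t s * H\<^sup>T) $$ (p, q)) (fst s', \<theta> (snd s')))
        = (\<Sum>s\<in>J. \<Sum>s'\<in>J. \<Sum>i<k. h i s * h i s' * (1 / \<tau> i * \<gamma> i (\<theta> (snd s)) (\<theta> (snd s'))))"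
        by (intro sum.cong refl) (auto simp: cov J_def h_def sum_distrib_left mult_ac simp del: index_mult_mat intro!: sum.cong)
      also have "\<dots> = (\<Sum>s\<in>J. \<Sum>i<k. \<Sum>s'\<in>J. h i s * h i s' * (1 / \<tau> i * \<gamma> i (\<theta> (snd s)) (\<theta> (snd s'))))"
        by (intro sum.cong refl sum.swap)
      also have "\<dots> = (\<Sum>i<k. \<Sum>s\<in>J. \<Sum>s'\<in>J. h i s * h i s' * (1 / \<tau> i * \<gamma> i (\<theta> (snd s)) (\<theta> (snd s'))))" by (rule sum.swap)
      also have "\<dots> = (\<Sum>i<k. \<Sum>p<m. \<Sum>q<m. (\<Sum>a<r. h i (a, p)) * (\<Sum>a<r. h i (a, q)) * (1 / \<tau> i * \<gamma> i (\<theta> p) (\<theta> q)))"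
        unfolding J_def
        by (intro sum.cong refl sum_square_times_snd[where G = "\<lambda>p q. 1 / \<tau> _ * \<gamma> _ (\<theta> p) (\<theta> q)"])
      also have "\<dots> = V" by (simp add: V_def cc_def h_def sum_distrib_left mult_ac)
      finally have v: "(\<Sum>s\<in>J. \<Sum>s'\<in>J. w s * w s' * (case (fst s, \<theta> (snd s)) of (p, t) \<Rightarrow> \<lambda>(q, s). (H * limit_cov_mat k \<tau> \<gamma> t s * H\<^sup>T) $$ (p, q)) (fst s', \<theta> (snd s'))) = V" .
      show "Zl \<in> borel_measurable P" "0 \<le> V" "distr P borel Zl = scaled_normal V"
        using G unfolding v by (simp_all add: Zl_def[abs_def])
    qed
    have "(\<Sum>s\<in>I. w s * Y s u) = Zl u + dl" for u
      unfolding split by (auto simp: Y_def Zl_def J_def dl_def intro!: sum.cong)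
    then have "(\<integral>u. iexp (\<Sum>s\<in>I. w s * Y s u) \<partial>P) = (\<integral>u. iexp (Zl u) * iexp dl \<partial>P)"
      by (simp add: distrib_left exp_add)
    also have "\<dots> = exp (- V / 2) * iexp dl"
      using scaled_normal_char[OF Zl_law(1) Zl_law(3) Zl_law(2)] by simp
    finally show ?thesis using left by simp
  qed
  \<comment> \<open>Half the smallest limit variance; inserting 1 keeps the set nonempty when there
    are no groups or no times.\<close>
  define \<delta> where "\<delta> = Min (insert 1 ((\<lambda>(i, p). d i p) ` ({..<k} \<times> {..<m}))) / 2"
  have d_pos: "0 < d i p" if "i < k" "p < m" for i p
    using pos[OF that] \<tau>[OF that(1)] by (simp add: d_def)
  have \<delta>: "0 < \<delta>" unfolding \<delta>_def using d_pos by (subst half_gt_zero_iff, subst Min_gr_iff) auto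
  have d\<delta>: "2 * \<delta> \<le> d i p" if "i < k" "p < m" for i p
    unfolding \<delta>_def using that by (auto intro!: Min_le)
  \<comment> \<open>With weights cut off below at \<open>\<delta>\<close>, the form is continuous on
    the whole space, so weak convergence applies to it. The limits are at least
    \<open>2 * \<delta>\<close> and do not feel the cut.\<close>
  define S where "S x = (\<Sum>p<m. \<Sum>l<R. c l * mp_form (rr l) k (Hs l) (\<lambda>i. max \<delta> (x (r + i, p))) (\<lambda>a. x (off l + a, p)))" for x :: "nat \<times> nat \<Rightarrow> real"
  have coord: "continuous_on UNIV (\<lambda>x :: nat \<times> nat \<Rightarrow> real. x s)" for s
    by (rule continuous_on_product_coordinates)
  have S_cont: "continuous_on UNIV S"
    unfolding S_def using Hs \<delta>
    by (intro continuous_on_sum continuous_on_mult continuous_on_const continuous_on_mp_form continuous_on_max coord)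
       (auto simp: less_max_iff_disj)
  have offr: "off l + a < r" if "l < R" "a < rr l" for l a
    using block_offset_less[where rr = rr, OF that] by (simp add: off_def r)
  define SX where "SX \<nu> u = S (\<lambda>s\<in>I. X \<nu> s u)" for \<nu> u
  define SY where "SY u = S (\<lambda>s\<in>I. Y s u)" for u
  have X_meas: "X \<nu> s \<in> borel_measurable (Q \<nu>)" if "s \<in> I" for \<nu> s using X_int[OF that] by simp
  have SX_meas: "SX \<nu> \<in> borel_measurable (Q \<nu>)" for \<nu>
    unfolding SX_def by (rule borel_measurable_continuous_restrict[OF S_cont X_meas])
  have SY_meas: "SY \<in> borel_measurable P"
    unfolding SY_def using Y_int by (intro borel_measurable_continuous_restrict[OF S_cont]) auto
  have finI: "finite I" by (simp add: I_def)
  have "(\<lambda>\<nu>. \<integral>u. cos (SX \<nu> u) \<partial>Q \<nu>) \<longlonglongrightarrow> (\<integral>u. cos (SY u) \<partial>P)"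
    unfolding SX_def SY_def
    by (rule weak_convergence_from_char[where \<phi> = "\<lambda>x. cos (S x)" and B = 1, OF finI Q P X_int C Y_int char])
       (auto intro!: continuous_intros S_cont)
  moreover have "(\<lambda>\<nu>. \<integral>u. sin (SX \<nu> u) \<partial>Q \<nu>) \<longlonglongrightarrow> (\<integral>u. sin (SY u) \<partial>P)"
    unfolding SX_def SY_def
    by (rule weak_convergence_from_char[where \<phi> = "\<lambda>x. sin (S x)" and B = 1, OF finI Q P X_int C Y_int char])
       (auto intro!: continuous_intros S_cont)
  ultimately have SX_lim: "(\<lambda>\<nu>. \<integral>u. iexp (SX \<nu> u) \<partial>Q \<nu>) \<longlonglongrightarrow> (\<integral>u. iexp (SY u) \<partial>P)"
    by (rule cos_sin_convergence_imp_char[OF Q P SX_meas SY_meas])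
  have SY_eq: "SY u = (\<Sum>p<m. \<Sum>l<R. c l * mp_form (rr l) k (Hs l) (\<lambda>i. 1 / \<tau> i * \<gamma> i (\<theta> p) (\<theta> p))
      (\<lambda>a. z u (\<theta> p) $ ((\<Sum>l'<l. rr l') + a)))" for u
    unfolding SY_def S_def
  proof (intro sum.cong refl arg_cong2[of _ _ _ _ "(*)"] mp_form_cong)
    fix p l i assume pl: "p \<in> {..<m}" "l \<in> {..<R}" and i: "i < k"
    then show "max \<delta> ((\<lambda>s\<in>I. Y s u) (r + i, p)) = 1 / \<tau> i * \<gamma> i (\<theta> p) (\<theta> p)"
      using d\<delta>[of i p] \<delta> by (simp add: I_def Y_def d_def)
  next
    fix p l a assume pl: "p \<in> {..<m}" "l \<in> {..<R}" and a: "a < rr l"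
    then show "(\<lambda>s\<in>I. Y s u) (off l + a, p) = z u (\<theta> p) $ ((\<Sum>l'<l. rr l') + a)"
      using offr[of l a] by (simp add: I_def Y_def) (simp add: off_def)
  qed
  define F where "F \<nu> u = (\<Sum>p<m. \<Sum>l<R. c l * studentized_form k (N \<nu>) (\<lambda>i j. xP \<nu> i j u) (rr l) (Hs l) (\<theta> p))" for \<nu> u
  have F_eq: "F \<nu> u = (\<Sum>p<m. \<Sum>l<R. c l * mp_form (rr l) k (Hs l) (\<lambda>i. D \<nu> i p u) (\<lambda>a. X \<nu> (off l + a, p) u))" for \<nu> u
    unfolding F_def studentized_form_def n_def[symmetric]
  proof (intro sum.cong refl arg_cong2[of _ _ _ _ "(*)"] mp_form_cong)
    fix p l a assume pl: "p \<in> {..<m}" "l \<in> {..<R}" and a: "a < rr l"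
    have "Hs l $$ (a, i) = H $$ (off l + a, i)" if "i < k" for i
      using stack_rows_index[OF Hs _ a that] pl by (simp add: H off_def)
    then show "(\<Sum>i<k. Hs l $$ (a, i) * (sqrt (n \<nu>) * sample_mean (N \<nu> i) (\<lambda>j. xP \<nu> i j u) (\<theta> p))) = X \<nu> (off l + a, p) u"
      using offr[of l a] pl a by (simp add: X_def xb_def)
  qed (simp add: D_def)
  have F_meas: "F \<nu> \<in> borel_measurable (Q \<nu>)" for \<nu>
    unfolding F_eq
  proof (intro borel_measurable_sum borel_measurable_times borel_measurable_const borel_measurable_mp_form)
    fix p l assume pl: "p \<in> {..<m}" "l \<in> {..<R}"
    show "Hs l \<in> carrier_mat (rr l) k" using Hs pl by simp
    show "D \<nu> i p \<in> borel_measurable (Q \<nu>)" if "i < k" for i using D_int[OF that] pl by simp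
    show "0 \<le> D \<nu> i p u" for i u by (simp add: D_def n_def sample_cov_nonneg)
    show "X \<nu> (off l + a, p) \<in> borel_measurable (Q \<nu>)" if "a < rr l" for a
      using offr[of l a] pl that by (intro X_meas) (simp add: I_def)
  qed
  \<comment> \<open>Where all scaled variances are at least \<open>\<delta>\<close>, the cut changes
    nothing. Elsewhere some variance misses its limit by at least \<open>\<delta>\<close>, and the
    trivial bound 2 for the distance of two points on the unit circle is paid for by
    \<open>2 / \<delta>\<close> times that deviation, which is small in mean.\<close>
  have "(\<lambda>\<nu>. (\<integral>u. iexp (F \<nu> u) \<partial>Q \<nu>) - (\<integral>u. iexp (SX \<nu> u) \<partial>Q \<nu>)) \<longlonglongrightarrow> 0"
  proof (rule Lim_null_comparison)
    have "(\<lambda>\<nu>. \<Sum>i<k. \<Sum>p<m. 2 / \<delta> * e \<nu> i p) \<longlonglongrightarrow> (\<Sum>i<k. \<Sum>p<m. 2 / \<delta> * 0)"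
      by (intro tendsto_sum tendsto_mult tendsto_const e) auto
    then show "(\<lambda>\<nu>. \<Sum>i<k. \<Sum>p<m. 2 / \<delta> * e \<nu> i p) \<longlonglongrightarrow> 0" by simp
    show "\<forall>\<^sub>F \<nu> in sequentially. cmod ((\<integral>u. iexp (F \<nu> u) \<partial>Q \<nu>) - (\<integral>u. iexp (SX \<nu> u) \<partial>Q \<nu>)) \<le> (\<Sum>i<k. \<Sum>p<m. 2 / \<delta> * e \<nu> i p)"
    proof (intro always_eventually allI)
      fix \<nu>
      define B where "B u = (\<Sum>i<k. \<Sum>p<m. 2 / \<delta> * \<bar>D \<nu> i p u - d i p\<bar>)" for u
      have dev: "integrable (Q \<nu>) (\<lambda>u. \<bar>D \<nu> i p u - d i p\<bar>)" if "i < k" "p < m" for i p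
      proof -
        interpret Qn: prob_space "Q \<nu>" by (rule Q)
        show ?thesis using D_int[OF that] by simp
      qed
      have B: "integrable (Q \<nu>) B" unfolding B_def
          by (intro Bochner_Integration.integrable_sum integrable_mult_right dev) auto
      have "cmod ((\<integral>u. iexp (F \<nu> u) \<partial>Q \<nu>) - (\<integral>u. iexp (SX \<nu> u) \<partial>Q \<nu>)) \<le> (\<integral>u. B u \<partial>Q \<nu>)"
      proof (rule char_perturbation[OF Q F_meas SX_meas B])
        fix u
        show "cmod (iexp (F \<nu> u) - iexp (SX \<nu> u)) \<le> B u"
        proof (cases "\<forall>i<k. \<forall>p<m. \<delta> \<le> D \<nu> i p u")
          case True
          have "F \<nu> u = SX \<nu> u"
            unfolding F_eq SX_def S_def
          proof (intro sum.cong refl arg_cong2[of _ _ _ _ "(*)"] mp_form_cong)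
            fix p l i assume "p \<in> {..<m}" "l \<in> {..<R}" "i < k"
            then show "D \<nu> i p u = max \<delta> ((\<lambda>s\<in>I. X \<nu> s u) (r + i, p))"
              using True by (simp add: I_def X_def max_absorb2)
          next
            fix p l a assume "p \<in> {..<m}" "l \<in> {..<R}" "a < rr l"
            then show "X \<nu> (off l + a, p) u = (\<lambda>s\<in>I. X \<nu> s u) (off l + a, p)"
              using offr[of l a] by (simp add: I_def)
          qed
          then show ?thesis unfolding B_def using \<delta> by (simp add: sum_nonneg)
        next
          case False
          then obtain i p where ip: "i < k" "p < m" "D \<nu> i p u < \<delta>" by (auto simp: not_le)
          then have "\<delta> \<le> \<bar>D \<nu> i p u - d i p\<bar>" using d\<delta>[OF ip(1,2)] by linarith
          then have "2 \<le> 2 / \<delta> * \<bar>D \<nu> i p u - d i p\<bar>" using \<delta> by (simp add: field_simps)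
          also have "\<dots> \<le> (\<Sum>p<m. 2 / \<delta> * \<bar>D \<nu> i p u - d i p\<bar>)"
            using ip \<delta> by (intro member_le_sum[where f = "\<lambda>p. 2 / \<delta> * \<bar>D \<nu> i p u - d i p\<bar>"]) auto
          also have "\<dots> \<le> B u"
            unfolding B_def using ip \<delta>
            by (intro member_le_sum[where f = "\<lambda>i. \<Sum>p<m. 2 / \<delta> * \<bar>D \<nu> i p u - d i p\<bar>"]) (auto intro!: sum_nonneg)
          finally have "2 \<le> B u" .
          moreover have "cmod (iexp (F \<nu> u) - iexp (SX \<nu> u)) \<le> 2"
            using norm_triangle_ineq4[of "iexp (F \<nu> u)" "iexp (SX \<nu> u)"] by simp
          ultimately show ?thesis by linarith
        qed
      qed
      also have "(\<integral>u. B u \<partial>Q \<nu>) = (\<Sum>i<k. \<integral>u. (\<Sum>p<m. 2 / \<delta> * \<bar>D \<nu> i p u - d i p\<bar>) \<partial>Q \<nu>)"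
        unfolding B_def
          by (intro Bochner_Integration.integral_sum Bochner_Integration.integrable_sum integrable_mult_right dev) auto
      also have "\<dots> = (\<Sum>i<k. \<Sum>p<m. 2 / \<delta> * e \<nu> i p)"
        unfolding e_def
          by (intro sum.cong refl trans[OF Bochner_Integration.integral_sum] integrable_mult_right dev) auto
      finally show "cmod ((\<integral>u. iexp (F \<nu> u) \<partial>Q \<nu>) - (\<integral>u. iexp (SX \<nu> u) \<partial>Q \<nu>)) \<le> (\<Sum>i<k. \<Sum>p<m. 2 / \<delta> * e \<nu> i p)" .
    qed
  qed
  from tendsto_add[OF this SX_lim]
  show ?thesis by (simp add: F_def SY_eq)
qed

subsection \<open>Weak convergence of path integrals\<close>

text \<open>The inequality \<open>\<bar>x\<bar> \<le> 1 + x\<^sup>2\<close> makes the process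
  integrable on the product space; Fubini then gives integrable paths almost surely and the first
  moment of their integrals.\<close>

lemma path_integral_moments:
  fixes f :: "'b \<Rightarrow> 't \<Rightarrow> real"
  assumes Q: "prob_space Q" and U: "prob_space U"
    and f [measurable]: "case_prod f \<in> borel_measurable (Q \<Otimes>\<^sub>M U)"
    and C: "(\<integral>\<^sup>+u. \<integral>\<^sup>+t. ennreal ((f u t)\<^sup>2) \<partial>U \<partial>Q) \<le> ennreal C" and C0: "0 \<le> C"
  shows "AE u in Q. integrable U (f u)"
    and "integrable Q (\<lambda>u. \<integral>t. f u t \<partial>U)"
    and "(\<integral>u. \<bar>\<integral>t. f u t \<partial>U\<bar> \<partial>Q) \<le> 1 + C"
proof -
  interpret Q: prob_space Q by (rule Q)
  interpret U: prob_space U by (rule U)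
  interpret QU: pair_prob_space Q U ..
  have total: "(\<integral>\<^sup>+p. ennreal \<bar>f (fst p) (snd p)\<bar> \<partial>(Q \<Otimes>\<^sub>M U)) \<le> ennreal (1 + C)"
  proof -
    have "(\<integral>\<^sup>+p. ennreal \<bar>f (fst p) (snd p)\<bar> \<partial>(Q \<Otimes>\<^sub>M U)) \<le> (\<integral>\<^sup>+p. 1 + ennreal ((f (fst p) (snd p))\<^sup>2) \<partial>(Q \<Otimes>\<^sub>M U))"
    proof (intro nn_integral_mono)
      fix p
      have "ennreal \<bar>f (fst p) (snd p)\<bar> \<le> ennreal (1 + (f (fst p) (snd p))\<^sup>2)"
        using abs_le_add_square_div[of 1 "f (fst p) (snd p)"] by (intro ennreal_leI) simp
      then show "ennreal \<bar>f (fst p) (snd p)\<bar> \<le> 1 + ennreal ((f (fst p) (snd p))\<^sup>2)" by simp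
    qed
    also have "\<dots> = 1 + (\<integral>\<^sup>+p. ennreal ((f (fst p) (snd p))\<^sup>2) \<partial>(Q \<Otimes>\<^sub>M U))"
      by (subst nn_integral_add) (auto simp: QU.emeasure_space_1)
    also have "(\<integral>\<^sup>+p. ennreal ((f (fst p) (snd p))\<^sup>2) \<partial>(Q \<Otimes>\<^sub>M U)) = (\<integral>\<^sup>+u. \<integral>\<^sup>+t. ennreal ((f u t)\<^sup>2) \<partial>U \<partial>Q)"
      by (subst U.nn_integral_fst[symmetric]) auto
    also have "1 + \<dots> \<le> 1 + ennreal C" by (intro add_left_mono C)
    finally show ?thesis using C0 by (simp add: ennreal_plus)
  qed
  have int: "integrable (Q \<Otimes>\<^sub>M U) (case_prod f)"
    using total by (intro integrableI_bounded) (auto simp: case_prod_beta intro: order.strict_trans1)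
  show "AE u in Q. integrable U (f u)" by (rule QU.AE_integrable_fst[OF int])
  show int': "integrable Q (\<lambda>u. \<integral>t. f u t \<partial>U)" by (rule QU.integrable_fst[OF int])
  have "ennreal (\<integral>u. \<bar>\<integral>t. f u t \<partial>U\<bar> \<partial>Q) = (\<integral>\<^sup>+u. ennreal \<bar>\<integral>t. f u t \<partial>U\<bar> \<partial>Q)"
    using int' by (intro nn_integral_eq_integral[symmetric]) auto
  also have "\<dots> \<le> (\<integral>\<^sup>+u. \<integral>\<^sup>+t. ennreal \<bar>f u t\<bar> \<partial>U \<partial>Q)"
    using QU.AE_integrable_fst[OF int]
    by (intro nn_integral_mono_AE) (auto elim!: eventually_mono dest: integral_norm_bound_ennreal)
  also have "\<dots> = (\<integral>\<^sup>+p. ennreal \<bar>f (fst p) (snd p)\<bar> \<partial>(Q \<Otimes>\<^sub>M U))"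
    by (subst U.nn_integral_fst[symmetric]) auto
  finally have "ennreal (\<integral>u. \<bar>\<integral>t. f u t \<partial>U\<bar> \<partial>Q) \<le> ennreal (1 + C)" using total by (rule order.trans)
  then show "(\<integral>u. \<bar>\<integral>t. f u t \<partial>U\<bar> \<partial>Q) \<le> 1 + C" using C0 by (subst (asm) ennreal_le_iff) auto
qed

text \<open>Tonelli: a bound at every fixed time suffices, because \<open>U\<close> has mass
  1.\<close>

lemma second_moment_from_fibres:
  fixes f :: "'b \<Rightarrow> 't \<Rightarrow> real"
  assumes Q: "prob_space Q" and U: "prob_space U"
    and f [measurable]: "case_prod f \<in> borel_measurable (Q \<Otimes>\<^sub>M U)"
    and C: "\<And>t. t \<in> space U \<Longrightarrow> (\<integral>\<^sup>+u. ennreal ((f u t)\<^sup>2) \<partial>Q) \<le> ennreal C"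
  shows "(\<integral>\<^sup>+u. \<integral>\<^sup>+t. ennreal ((f u t)\<^sup>2) \<partial>U \<partial>Q) \<le> ennreal C"
proof -
  interpret Q: prob_space Q by (rule Q)
  interpret U: prob_space U by (rule U)
  interpret QU: pair_prob_space Q U ..
  have "(\<integral>\<^sup>+u. \<integral>\<^sup>+t. ennreal ((f u t)\<^sup>2) \<partial>U \<partial>Q) = (\<integral>\<^sup>+t. \<integral>\<^sup>+u. ennreal ((f u t)\<^sup>2) \<partial>Q \<partial>U)"
    by (rule QU.Fubini'[symmetric]) (simp add: case_prod_beta)
  also have "\<dots> \<le> (\<integral>\<^sup>+t. ennreal C \<partial>U)" by (intro nn_integral_mono C)
  finally show ?thesis by (simp add: U.emeasure_space_1)
qed

text \<open>Two distinct coordinates have joint law \<open>U \<Otimes>\<^sub>M U\<close>, as is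
  checked on rectangles. With \<open>p = q\<close> the law would sit on the diagonal, where an
  almost-everywhere statement about pairs says nothing in general.\<close>

lemma AE_PiM_pair:
  assumes U: "prob_space U" and I: "finite I" "p \<in> I" "q \<in> I" "p \<noteq> q"
    and ae: "AE z in U \<Otimes>\<^sub>M U. pred (fst z) (snd z)"
  shows "AE \<theta> in PiM I (\<lambda>_. U). pred (\<theta> p) (\<theta> q)"
proof -
  interpret U: prob_space U by (rule U)
  interpret PP: product_prob_space "\<lambda>_. U" I ..
  have m: "(\<lambda>\<theta>. (\<theta> p, \<theta> q)) \<in> PiM I (\<lambda>_. U) \<rightarrow>\<^sub>M U \<Otimes>\<^sub>M U" using I by measurable
  have "U \<Otimes>\<^sub>M U = distr (PiM I (\<lambda>_. U)) (U \<Otimes>\<^sub>M U) (\<lambda>\<theta>. (\<theta> p, \<theta> q))"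
  proof (rule pair_measure_eqI)
    fix A B assume AB: "A \<in> sets U" "B \<in> sets U"
    have "(\<lambda>\<theta>. (\<theta> p, \<theta> q)) -` (A \<times> B) \<inter> space (PiM I (\<lambda>_. U)) =
        {\<theta> \<in> space (PiM I (\<lambda>_. U)). \<forall>i\<in>{p, q}. \<theta> i \<in> (if i = p then A else B)}"
      using I by auto
    also have "emeasure (PiM I (\<lambda>_. U)) \<dots> = (\<Prod>i\<in>{p, q}. emeasure U (if i = p then A else B))"
      using AB I by (intro PP.emeasure_PiM_Collect) auto
    also have "\<dots> = emeasure U A * emeasure U B" using I by simp
    finally show "emeasure U A * emeasure U B = emeasure (distr (PiM I (\<lambda>_. U)) (U \<Otimes>\<^sub>M U) (\<lambda>\<theta>. (\<theta> p, \<theta> q))) (A \<times> B)"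
      using AB m by (simp add: emeasure_distr)
  qed (use U.sigma_finite_measure_axioms in auto)
  from subst[where P = "\<lambda>N. AE z in N. pred (fst z) (snd z)", OF this ae]
  have "AE z in distr (PiM I (\<lambda>_. U)) (U \<Otimes>\<^sub>M U) (\<lambda>\<theta>. (\<theta> p, \<theta> q)). pred (fst z) (snd z)" .
  from AE_distrD[OF m this] show ?thesis by simp
qed

text \<open>Entrywise bound: the double sum gives \<open>2 * B * r\<close> times the sum of squares,
  and after squaring Cauchy-Schwarz adds one more factor \<open>r\<close>. Fourth powers are what
  Gaussian moments control.\<close>

lemma mp_form_square_le:
  assumes B: "\<And>a b. a < r \<Longrightarrow> b < r \<Longrightarrow> \<bar>moore_penrose (A * mat_diag k d * A\<^sup>T) $$ (a, b)\<bar> \<le> B" and B0: "0 \<le> B"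
  shows "(mp_form r k A d y)\<^sup>2 \<le> 4 * B\<^sup>2 * real r ^ 3 * (\<Sum>a<r. (y a) ^ 4)"
proof -
  have xy: "\<bar>p * q\<bar> \<le> p\<^sup>2 + q\<^sup>2" for p q :: real
    using sum_squares_bound[of "\<bar>p\<bar>" "\<bar>q\<bar>"] abs_ge_zero[of "p * q"] unfolding abs_mult mult.assoc power2_abs by linarith
  have "\<bar>mp_form r k A d y\<bar> \<le> (\<Sum>a<r. \<Sum>b<r. \<bar>y a * moore_penrose (A * mat_diag k d * A\<^sup>T) $$ (a, b) * y b\<bar>)"
    unfolding mp_form_def by (intro order.trans[OF sum_abs] sum_mono sum_abs)
  also have "\<dots> \<le> (\<Sum>a<r. \<Sum>b<r. B * ((y a)\<^sup>2 + (y b)\<^sup>2))"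
  proof (intro sum_mono)
    fix a b assume ab: "a \<in> {..<r}" "b \<in> {..<r}"
    have "\<bar>y a * moore_penrose (A * mat_diag k d * A\<^sup>T) $$ (a, b) * y b\<bar> =
        \<bar>moore_penrose (A * mat_diag k d * A\<^sup>T) $$ (a, b)\<bar> * \<bar>y a * y b\<bar>"
      by (simp add: abs_mult mult_ac)
    also have "\<dots> \<le> B * ((y a)\<^sup>2 + (y b)\<^sup>2)" using B[of a b] ab B0 by (intro mult_mono xy) auto
    finally show "\<bar>y a * moore_penrose (A * mat_diag k d * A\<^sup>T) $$ (a, b) * y b\<bar> \<le> B * ((y a)\<^sup>2 + (y b)\<^sup>2)" .
  qed
  also have "\<dots> = 2 * B * real r * (\<Sum>a<r. (y a)\<^sup>2)"
    by (simp add: sum.distrib sum_distrib_left[symmetric] distrib_left)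
  finally have "\<bar>mp_form r k A d y\<bar>\<^sup>2 \<le> (2 * B * real r * (\<Sum>a<r. (y a)\<^sup>2))\<^sup>2" by (intro power_mono) auto
  also have "\<dots> = 4 * B\<^sup>2 * (real r)\<^sup>2 * (\<Sum>a<r. (y a)\<^sup>2)\<^sup>2" by (simp add: power_mult_distrib)
  also have "\<dots> \<le> 4 * B\<^sup>2 * (real r)\<^sup>2 * (real r * (\<Sum>a<r. (y a) ^ 4))"
  proof (intro mult_left_mono)
    have "((y a)\<^sup>2)\<^sup>2 = (y a) ^ 4" for a by (simp flip: power_mult)
    then show "(\<Sum>a<r. (y a)\<^sup>2)\<^sup>2 \<le> real r * (\<Sum>a<r. (y a) ^ 4)"
      using Cauchy_Schwarz_ineq_sum[of "\<lambda>_. 1" "\<lambda>a. (y a)\<^sup>2" "{..<r}"] by simp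
  qed simp
  also have "\<dots> = 4 * B\<^sup>2 * real r ^ 3 * (\<Sum>a<r. (y a) ^ 4)"
    by (simp add: power2_eq_square power3_eq_cube)
  finally show ?thesis by simp
qed

lemma compact_bounded_finite_family:
  fixes f :: "'i \<Rightarrow> real \<Rightarrow> real"
  assumes "compact T" "finite I" "\<And>i. i \<in> I \<Longrightarrow> continuous_on T (f i)"
  shows "\<exists>B\<ge>0. \<forall>i\<in>I. \<forall>t\<in>T. \<bar>f i t\<bar> \<le> B"
proof -
  have "\<exists>b. \<forall>t\<in>T. \<bar>f i t\<bar> \<le> b" if "i \<in> I" for i
  proof -
    have "bounded (f i ` T)" using assms that by (intro compact_imp_bounded compact_continuous_image) auto
    then show ?thesis by (auto simp: bounded_iff)
  qed
  then obtain b where b: "\<And>i t. i \<in> I \<Longrightarrow> t \<in> T \<Longrightarrow> \<bar>f i t\<bar> \<le> b i" by metis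
  have "\<bar>f i t\<bar> \<le> (\<Sum>i\<in>I. \<bar>b i\<bar>)" if it: "i \<in> I" "t \<in> T" for i t
  proof -
    have "\<bar>f i t\<bar> \<le> \<bar>b i\<bar>" using b[OF it] by linarith
    also have "\<dots> \<le> (\<Sum>i\<in>I. \<bar>b i\<bar>)" using assms(2) it by (intro member_le_sum) auto
    finally show ?thesis .
  qed
  then show ?thesis by (intro exI[of _ "\<Sum>i\<in>I. \<bar>b i\<bar>"]) (auto intro: sum_nonneg)
qed

section \<open>Second moments of the limit integrand\<close>

text \<open>The argument \<open>s\<close> is the row offset of the block, so the full vector process
  can be passed without cutting it up.\<close>

definition limit_form ::
    "nat \<Rightarrow> (nat \<Rightarrow> real) \<Rightarrow> (nat \<Rightarrow> real \<Rightarrow> real \<Rightarrow> real) \<Rightarrow> nat \<Rightarrow> real mat \<Rightarrow> nat \<Rightarrow> (real \<Rightarrow> real vec) \<Rightarrow> real \<Rightarrow> real" where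
  "limit_form k \<tau> \<gamma> r A s u t = mp_form r k A (\<lambda>i. 1 / \<tau> i * \<gamma> i t t) (\<lambda>a. u t $ (s + a))"

lemma gaussian_quadratic_functional_eq:
  assumes A: "A \<in> carrier_mat (rr l) k" and \<gamma>: "\<And>i t. i < k \<Longrightarrow> t \<in> T \<Longrightarrow> 0 \<le> 1 / \<tau> i * \<gamma> i t t"
  shows "gaussian_quadratic_functional T (limit_cov_mat k \<tau> \<gamma>) A (\<lambda>t. vec_block rr l (u t)) =
    (\<integral>t. limit_form k \<tau> \<gamma> (rr l) A (\<Sum>m<l. rr m) u t \<partial>lborel_on T)"
  unfolding gaussian_quadratic_functional_def
proof (intro Bochner_Integration.integral_cong refl)
  fix t assume "t \<in> space (lborel_on T)"
  then have t: "t \<in> T" by (simp add: space_restrict_space)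
  have v: "vec_block rr l (u t) \<in> carrier_vec (rr l)" by (simp add: vec_block_def)
  have "vec_block rr l (u t) \<bullet> (moore_penrose (A * limit_cov_mat k \<tau> \<gamma> t t * A\<^sup>T) *\<^sub>v vec_block rr l (u t)) =
      mp_form (rr l) k A (\<lambda>i. 1 / \<tau> i * \<gamma> i t t) (\<lambda>p. vec_block rr l (u t) $ p)"
    unfolding limit_cov_mat_def by (rule mp_form_eq_scalar_prod[OF A _ v]) (rule \<gamma>[OF _ t])
  also have "\<dots> = limit_form k \<tau> \<gamma> (rr l) A (\<Sum>m<l. rr m) u t"
    unfolding limit_form_def by (rule mp_form_cong) (simp_all add: vec_block_def)
  finally show "vec_block rr l (u t) \<bullet> (moore_penrose (A * limit_cov_mat k \<tau> \<gamma> t t * A\<^sup>T) *\<^sub>v vec_block rr l (u t)) =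
      limit_form k \<tau> \<gamma> (rr l) A (\<Sum>m<l. rr m) u t" .
qed

lemma limit_form_measurable:
  assumes A: "A \<in> carrier_mat s k"
    and cont: "\<And>i. i < k \<Longrightarrow> continuous_on T (\<lambda>t. \<gamma> i t t)"
    and \<gamma>: "\<And>i t. i < k \<Longrightarrow> t \<in> T \<Longrightarrow> 0 \<le> 1 / \<tau> i * \<gamma> i t t"
    and z: "\<And>p. p < r \<Longrightarrow> L2_process P T (\<lambda>w t. z w t $ p)" and off: "q + s \<le> r"
  shows "(\<lambda>(u, t). limit_form k \<tau> \<gamma> s A q (z u) t) \<in> borel_measurable (P \<Otimes>\<^sub>M lborel_on T)"
  unfolding limit_form_def case_prod_beta
proof (rule borel_measurable_mp_form[OF A])
  fix i assume i: "i < k"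
  have "(\<lambda>t. \<gamma> i t t) \<in> borel_measurable (restrict_space borel T)"
    by (rule borel_measurable_continuous_on_restrict[OF cont[OF i]])
  then have "(\<lambda>t. \<gamma> i t t) \<in> borel_measurable (lborel_on T)"
    by (subst measurable_cong_sets[OF sets_restrict_space_cong[OF sets_lborel] refl])
  from measurable_compose[OF measurable_snd this]
  show "(\<lambda>x. 1 / \<tau> i * \<gamma> i (snd x) (snd x)) \<in> borel_measurable (P \<Otimes>\<^sub>M lborel_on T)"
    by (intro borel_measurable_times borel_measurable_const)
next
  fix x i assume "x \<in> space (P \<Otimes>\<^sub>M lborel_on T)" "i < k"
  then show "0 \<le> 1 / \<tau> i * \<gamma> i (snd x) (snd x)"
    using \<gamma> by (auto simp: space_pair_measure space_restrict_space)
next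
  fix a assume "a < s"
  then have "q + a < r" using off by simp
  then show "(\<lambda>x. z (fst x) (snd x) $ (q + a)) \<in> borel_measurable (P \<Otimes>\<^sub>M lborel_on T)"
    using z[of "q + a"] unfolding L2_process_def case_prod_beta' by simp
qed

text \<open>Compactness does the work: the limit variances are continuous and positive on
  \<open>T\<close>, hence the entries of the pseudoinverse are continuous and bounded, and the
  fourth moments of \<open>z\<close>, three times squared variances, are bounded as well.\<close>

lemma limit_form_second_moment:
  assumes A: "A \<in> carrier_mat s k" and T: "compact T"
    and H: "H \<in> carrier_mat r k" and \<tau>: "\<And>i. i < k \<Longrightarrow> 0 < \<tau> i"
    and cont: "\<And>i. i < k \<Longrightarrow> continuous_on T (\<lambda>t. \<gamma> i t t)"
    and pos: "\<And>i t. i < k \<Longrightarrow> t \<in> T \<Longrightarrow> 0 < \<gamma> i t t"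
    and z: "vec_gaussian_process P T r (\<lambda>t s. H * limit_cov_mat k \<tau> \<gamma> t s * H\<^sup>T) z" and off: "q + s \<le> r"
  shows "\<exists>C\<ge>0. \<forall>t\<in>T. (\<integral>\<^sup>+u. ennreal ((limit_form k \<tau> \<gamma> s A q (z u) t)\<^sup>2) \<partial>P) \<le> ennreal C"
proof -
  define d where "d t i = 1 / \<tau> i * \<gamma> i t t" for t i
  have d_pos: "0 < d t i" if "i < k" "t \<in> T" for t i
    using that pos \<tau> by (simp add: d_def)
  have d_cont: "continuous_on T (\<lambda>t. d t i)" if "i < k" for i
    unfolding d_def by (intro continuous_on_mult continuous_on_const cont that)
  have cM: "continuous_on T (\<lambda>t. moore_penrose (A * mat_diag k (d t) * A\<^sup>T) $$ (fst ab, snd ab))" if "ab \<in> {..<s} \<times> {..<s}" for ab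
    using that by (intro continuous_on_moore_penrose_entry[OF A] d_cont d_pos) auto
  have "\<exists>B\<ge>0. \<forall>ab\<in>{..<s} \<times> {..<s}. \<forall>t\<in>T. \<bar>moore_penrose (A * mat_diag k (d t) * A\<^sup>T) $$ (fst ab, snd ab)\<bar> \<le> B"
    by (rule compact_bounded_finite_family[OF T]) (use cM in auto)
  then obtain B where B0: "0 \<le> B" and B: "\<forall>ab\<in>{..<s} \<times> {..<s}. \<forall>t\<in>T. \<bar>moore_penrose (A * mat_diag k (d t) * A\<^sup>T) $$ (fst ab, snd ab)\<bar> \<le> B"
    by blast
  define V where "V a t = (\<Sum>i<k. H $$ (a, i) * d t i * H $$ (a, i))" for a t
  have cV: "continuous_on T (V a)" if "a \<in> {..<r}" for a
    unfolding V_def by (intro continuous_on_sum continuous_on_mult continuous_on_const d_cont) auto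
  have "\<exists>K\<ge>0. \<forall>a\<in>{..<r}. \<forall>t\<in>T. \<bar>V a t\<bar> \<le> K"
    by (rule compact_bounded_finite_family[OF T]) (use cV in auto)
  then obtain K where K0: "0 \<le> K" and K: "\<And>a t. a < r \<Longrightarrow> t \<in> T \<Longrightarrow> \<bar>V a t\<bar> \<le> K" by auto
  have zf: "centered_gaussian_family P ({..<r} \<times> T) (\<lambda>(p, t) w. z w t $ p)
      (\<lambda>(p, t) (q, s). (H * limit_cov_mat k \<tau> \<gamma> t s * H\<^sup>T) $$ (p, q))"
    using z by (simp add: vec_gaussian_process_def)
  have m4: "integrable P (\<lambda>u. (z u t $ a) ^ 4)" "(\<integral>u. (z u t $ a) ^ 4 \<partial>P) \<le> 3 * K\<^sup>2"
    if at: "a < r" "t \<in> T" for a t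
  proof -
    have cov: "(H * limit_cov_mat k \<tau> \<gamma> t t * H\<^sup>T) $$ (a, a) = V a t"
      unfolding limit_cov_mat_def V_def d_def by (rule conjugate_diag_index[OF H at(1) at(1)])
    have sub: "{(a, t)} \<subseteq> {..<r} \<times> T" using at by simp
    note L = gaussian_family_linear[OF zf _ sub, of "\<lambda>_. 1", simplified, unfolded cov]
    note M = scaled_normal_moments[OF L(1) L(3) L(2), of 2]
    show "integrable P (\<lambda>u. (z u t $ a) ^ 4)" using M(1) by simp
    have "(\<integral>u. (z u t $ a) ^ 4 \<partial>P) = 3 * (V a t)\<^sup>2" using M(2) by (simp add: fact_numeral)
    also have "(V a t)\<^sup>2 \<le> K\<^sup>2" using K[OF at] by (simp add: abs_le_square_iff[symmetric])
    finally show "(\<integral>u. (z u t $ a) ^ 4 \<partial>P) \<le> 3 * K\<^sup>2" by simp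
  qed
  define C where "C = 4 * B\<^sup>2 * real s ^ 3 * (real s * (3 * K\<^sup>2))"
  have "(\<integral>\<^sup>+u. ennreal ((limit_form k \<tau> \<gamma> s A q (z u) t)\<^sup>2) \<partial>P) \<le> ennreal C" if t: "t \<in> T" for t
  proof -
    have qa: "q + a < r" if "a < s" for a using that off by simp
    define S where "S u = 4 * B\<^sup>2 * real s ^ 3 * (\<Sum>a<s. (z u t $ (q + a)) ^ 4)" for u
    have S: "integrable P S" unfolding S_def
      by (intro integrable_mult_right Bochner_Integration.integrable_sum m4(1)) (use t qa in auto)
    have "(limit_form k \<tau> \<gamma> s A q (z u) t)\<^sup>2 \<le> S u" for u
      unfolding limit_form_def S_def d_def[symmetric] by (rule mp_form_square_le[OF _ B0]) (use B t in auto)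
    then have "(\<integral>\<^sup>+u. ennreal ((limit_form k \<tau> \<gamma> s A q (z u) t)\<^sup>2) \<partial>P) \<le> (\<integral>\<^sup>+u. ennreal (S u) \<partial>P)"
      by (intro nn_integral_mono ennreal_leI)
    also have "\<dots> = ennreal (\<integral>u. S u \<partial>P)"
      by (intro nn_integral_eq_integral S AE_I2) (auto simp: S_def intro!: mult_nonneg_nonneg sum_nonneg)
    also have "(\<integral>u. S u \<partial>P) = 4 * B\<^sup>2 * real s ^ 3 * (\<Sum>a<s. \<integral>u. (z u t $ (q + a)) ^ 4 \<partial>P)"
      unfolding S_def integral_mult_right_zero using m4(1) t qa by (subst Bochner_Integration.integral_sum) auto
    also have "ennreal \<dots> \<le> ennreal C"
    proof (rule ennreal_leI)
      have "(\<Sum>a<s. \<integral>u. (z u t $ (q + a)) ^ 4 \<partial>P) \<le> (\<Sum>a<s. 3 * K\<^sup>2)"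
        by (intro sum_mono m4(2)) (use t qa in auto)
      then show "4 * B\<^sup>2 * real s ^ 3 * (\<Sum>a<s. \<integral>u. (z u t $ (q + a)) ^ 4 \<partial>P) \<le> C"
        unfolding C_def by (intro mult_left_mono) auto
    qed
    finally show ?thesis .
  qed
  moreover have "0 \<le> C" by (simp add: C_def)
  ultimately show ?thesis by blast
qed

section \<open>Convergence of tuples of path integrals\<close>

text \<open>A test function on extensional tuples is pulled back along \<open>restrict\<close> to a
  continuous function on all of \<open>nat \<Rightarrow> real\<close>. The pullback also shows that
  the test function is measurable for the product sigma-algebra that \<open>tuple_law\<close>
  uses.\<close>

lemma weakly_converges_tuple_law:
  fixes X :: "nat \<Rightarrow> nat \<Rightarrow> 'b \<Rightarrow> real" and Y :: "nat \<Rightarrow> 'v \<Rightarrow> real"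
  assumes Q: "\<And>n. prob_space (Q n)" and P: "prob_space P"
    and X: "\<And>n l. l < R \<Longrightarrow> integrable (Q n) (X n l)" "\<And>n l. l < R \<Longrightarrow> (\<integral>w. \<bar>X n l w\<bar> \<partial>Q n) \<le> C"
    and Y: "\<And>l. l < R \<Longrightarrow> integrable P (Y l)"
    and char: "\<And>c. (\<lambda>n. \<integral>w. iexp (\<Sum>l<R. c l * X n l w) \<partial>Q n) \<longlonglongrightarrow> (\<integral>w. iexp (\<Sum>l<R. c l * Y l w) \<partial>P)"
  shows "weakly_converges (tuple_topology R) (\<lambda>n. tuple_law (Q n) R (X n)) (tuple_law P R Y)"
  unfolding weakly_converges_def
proof (intro allI impI, elim conjE)
  fix f :: "(nat \<Rightarrow> real) \<Rightarrow> real"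
  assume cont: "continuous_map (tuple_topology R) euclideanreal f" and bdd: "bounded (f ` topspace (tuple_topology R))"
  obtain B where B: "\<And>x. x \<in> topspace (tuple_topology R) \<Longrightarrow> \<bar>f x\<bar> \<le> B" using bdd by (auto simp: bounded_iff)
  define \<phi> where "\<phi> x = f (restrict x {..<R})" for x :: "nat \<Rightarrow> real"
  have "continuous_map (product_topology (\<lambda>_. euclideanreal) UNIV) (tuple_topology R) (\<lambda>x. restrict x {..<R})"
    unfolding continuous_map_componentwise by (auto intro: continuous_map_product_projection)
  from continuous_map_compose[OF this cont]
  have \<phi>_cont: "continuous_on UNIV \<phi>"
    by (simp add: \<phi>_def[abs_def] comp_def euclidean_product_topology)
  have \<phi>_bound: "\<bar>\<phi> x\<bar> \<le> B" for x unfolding \<phi>_def by (rule B) auto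
  have f_meas: "f \<in> borel_measurable (PiM {..<R} (\<lambda>_. borel))"
  proof -
    have "(\<lambda>x. \<phi> (\<lambda>l\<in>{..<R}. x l)) \<in> borel_measurable (PiM {..<R} (\<lambda>_. borel :: real measure))"
      by (rule borel_measurable_continuous_restrict[OF \<phi>_cont]) simp
    moreover have "\<phi> (\<lambda>l\<in>{..<R}. x l) = f x" if "x \<in> space (PiM {..<R} (\<lambda>_. borel :: real measure))" for x
      using that by (simp add: \<phi>_def space_PiM PiE_def extensional_restrict)
    ultimately show ?thesis by (rule measurable_cong[THEN iffD1, rotated])
  qed
  have law: "(\<integral>y. f y \<partial>tuple_law N R Z) = (\<integral>w. \<phi> (\<lambda>l\<in>{..<R}. Z l w) \<partial>N)"
    if "\<And>l. l < R \<Longrightarrow> Z l \<in> borel_measurable N" for N :: "'z measure" and Z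
  proof -
    have "(\<lambda>w. \<lambda>l\<in>{..<R}. Z l w) \<in> N \<rightarrow>\<^sub>M PiM {..<R} (\<lambda>_. borel)"
      using that by (intro measurable_restrict) auto
    then show ?thesis unfolding tuple_law_def by (subst integral_distr[OF _ f_meas]) (simp_all add: \<phi>_def)
  qed
  have "(\<lambda>n. \<integral>w. \<phi> (\<lambda>l\<in>{..<R}. X n l w) \<partial>Q n) \<longlonglongrightarrow> (\<integral>w. \<phi> (\<lambda>l\<in>{..<R}. Y l w) \<partial>P)"
    by (rule weak_convergence_from_char[where C = "\<lambda>_. C" and B = B, OF finite_lessThan Q P _ _ _ char \<phi>_cont \<phi>_bound])
       (use X Y in auto)
  moreover have "(\<integral>y. f y \<partial>tuple_law (Q n) R (X n)) = (\<integral>w. \<phi> (\<lambda>l\<in>{..<R}. X n l w) \<partial>Q n)" for n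
    by (rule law) (use X in auto)
  moreover have "(\<integral>y. f y \<partial>tuple_law P R Y) = (\<integral>w. \<phi> (\<lambda>l\<in>{..<R}. Y l w) \<partial>P)"
    by (rule law) (use Y in auto)
  ultimately show "(\<lambda>n. \<integral>y. f y \<partial>tuple_law (Q n) R (X n)) \<longlonglongrightarrow> (\<integral>y. f y \<partial>tuple_law P R Y)" by simp
qed

lemma linear_combination_second_moment:
  fixes f :: "nat \<Rightarrow> 'b \<Rightarrow> real"
  assumes f: "\<And>l. l < R \<Longrightarrow> f l \<in> borel_measurable Q"
    and C: "\<And>l. l < R \<Longrightarrow> (\<integral>\<^sup>+u. ennreal ((f l u)\<^sup>2) \<partial>Q) \<le> ennreal C" and C0: "0 \<le> C"
  shows "(\<integral>\<^sup>+u. ennreal ((\<Sum>l<R. c l * f l u)\<^sup>2) \<partial>Q) \<le> ennreal ((\<Sum>l<R. (c l)\<^sup>2) * (real R * C))"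
proof -
  have m: "(\<lambda>u. ennreal ((f l u)\<^sup>2)) \<in> borel_measurable Q" if "l < R" for l using f[OF that] by measurable
  have "(\<integral>\<^sup>+u. ennreal ((\<Sum>l<R. c l * f l u)\<^sup>2) \<partial>Q) \<le> (\<integral>\<^sup>+u. ennreal (\<Sum>l<R. (c l)\<^sup>2) * (\<Sum>l<R. ennreal ((f l u)\<^sup>2)) \<partial>Q)"
  proof (intro nn_integral_mono)
    fix u
    have "ennreal ((\<Sum>l<R. c l * f l u)\<^sup>2) \<le> ennreal ((\<Sum>l<R. (c l)\<^sup>2) * (\<Sum>l<R. (f l u)\<^sup>2))"
      by (intro ennreal_leI Cauchy_Schwarz_ineq_sum)
    then show "ennreal ((\<Sum>l<R. c l * f l u)\<^sup>2) \<le> ennreal (\<Sum>l<R. (c l)\<^sup>2) * (\<Sum>l<R. ennreal ((f l u)\<^sup>2))"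
      by (simp only: ennreal_mult'[OF sum_nonneg[OF zero_le_power2]] sum_ennreal[OF zero_le_power2])
  qed
  also have "\<dots> = ennreal (\<Sum>l<R. (c l)\<^sup>2) * (\<integral>\<^sup>+u. (\<Sum>l<R. ennreal ((f l u)\<^sup>2)) \<partial>Q)"
    by (rule nn_integral_cmult[OF borel_measurable_sum]) (rule m, simp)
  also have "(\<integral>\<^sup>+u. (\<Sum>l<R. ennreal ((f l u)\<^sup>2)) \<partial>Q) = (\<Sum>l<R. \<integral>\<^sup>+u. ennreal ((f l u)\<^sup>2) \<partial>Q)"
    by (rule nn_integral_sum) (rule m, simp)
  also have "ennreal (\<Sum>l<R. (c l)\<^sup>2) * \<dots> \<le> ennreal (\<Sum>l<R. (c l)\<^sup>2) * (\<Sum>l<R. ennreal C)"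
    by (intro mult_left_mono sum_mono C) auto
  also have "(\<Sum>l<R. ennreal C) = ennreal (real R * C)" using C0 by (subst sum_ennreal) auto
  finally show ?thesis using C0 by (simp add: ennreal_mult'' )
qed

text \<open>Almost surely only, since additivity of the integral is applied to integrable
  paths.\<close>

lemma integral_linear_combination_AE:
  fixes F :: "nat \<Rightarrow> 'b \<Rightarrow> 't \<Rightarrow> real"
  assumes int: "\<And>l. l < R \<Longrightarrow> AE u in Q. integrable U (F l u)"
    and c: "\<And>u l. l < R \<Longrightarrow> X l u = b * (\<integral>t. F l u t \<partial>U)"
  shows "AE u in Q. (\<integral>t. (\<Sum>l<R. (b * c l) * F l u t) \<partial>U) = (\<Sum>l<R. c l * X l u)"
proof -
  have "AE u in Q. \<forall>l<R. integrable U (F l u)" using int by (simp add: AE_all_countable)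
  then show ?thesis
  proof eventually_elim
    fix u assume i: "\<forall>l<R. integrable U (F l u)"
    have "(\<integral>t. (\<Sum>l<R. (b * c l) * F l u t) \<partial>U) = (\<Sum>l<R. \<integral>t. (b * c l) * F l u t \<partial>U)"
      using i by (intro Bochner_Integration.integral_sum integrable_mult_right) auto
    also have "\<dots> = (\<Sum>l<R. c l * X l u)"
      by (intro sum.cong refl) (simp add: c)
    finally show "(\<integral>t. (\<Sum>l<R. (b * c l) * F l u t) \<partial>U) = (\<Sum>l<R. c l * X l u)" .
  qed
qed

text \<open>In the spirit of Cramer and Wold: for fixed coefficients, a linear combination of path
  integrals is the integral of one scalar process, to which the sampling argument applies. The
  factor \<open>b\<close> leads from the probability measure \<open>U\<close> back to the original
  measure on time.\<close>

lemma weakly_converges_path_integrals: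
  fixes F :: "nat \<Rightarrow> nat \<Rightarrow> 'b \<Rightarrow> 't \<Rightarrow> real" and G :: "nat \<Rightarrow> 'v \<Rightarrow> 't \<Rightarrow> real"
  assumes Q: "\<And>\<nu>. prob_space (Q \<nu>)" and P: "prob_space P" and U: "prob_space U"
    and F: "\<And>\<nu> l. l < R \<Longrightarrow> case_prod (F \<nu> l) \<in> borel_measurable (Q \<nu> \<Otimes>\<^sub>M U)"
    and G: "\<And>l. l < R \<Longrightarrow> case_prod (G l) \<in> borel_measurable (P \<Otimes>\<^sub>M U)"
    and CF: "\<And>\<nu> l t. l < R \<Longrightarrow> t \<in> space U \<Longrightarrow> (\<integral>\<^sup>+u. ennreal ((F \<nu> l u t)\<^sup>2) \<partial>Q \<nu>) \<le> ennreal C"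
    and CG: "\<And>l t. l < R \<Longrightarrow> t \<in> space U \<Longrightarrow> (\<integral>\<^sup>+u. ennreal ((G l u t)\<^sup>2) \<partial>P) \<le> ennreal C" and C0: "0 \<le> C"
    and b: "0 \<le> b"
    and X: "\<And>\<nu> l u. l < R \<Longrightarrow> X \<nu> l u = b * (\<integral>t. F \<nu> l u t \<partial>U)"
    and Y: "\<And>l u. l < R \<Longrightarrow> Y l u = b * (\<integral>t. G l u t \<partial>U)"
    and fdd: "\<And>m c. 0 < m \<Longrightarrow> AE \<theta> in PiM {..<m :: nat} (\<lambda>_. U).
      (\<lambda>\<nu>. \<integral>u. iexp (\<Sum>p<m. \<Sum>l<R. c l * F \<nu> l u (\<theta> p)) \<partial>Q \<nu>) \<longlonglongrightarrow> (\<integral>u. iexp (\<Sum>p<m. \<Sum>l<R. c l * G l u (\<theta> p)) \<partial>P)"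
  shows "weakly_converges (tuple_topology R) (\<lambda>\<nu>. tuple_law (Q \<nu>) R (X \<nu>)) (tuple_law P R Y)"
proof (rule weakly_converges_tuple_law[OF Q P])
  have SF: "(\<integral>\<^sup>+u. \<integral>\<^sup>+t. ennreal ((F \<nu> l u t)\<^sup>2) \<partial>U \<partial>Q \<nu>) \<le> ennreal C" if "l < R" for \<nu> l
    by (rule second_moment_from_fibres[OF Q U F CF]) (use that in auto)
  have SG: "(\<integral>\<^sup>+u. \<integral>\<^sup>+t. ennreal ((G l u t)\<^sup>2) \<partial>U \<partial>P) \<le> ennreal C" if "l < R" for l
    by (rule second_moment_from_fibres[OF P U G CG]) (use that in auto)
  note pF = path_integral_moments[OF Q U F SF C0]
  note pG = path_integral_moments[OF P U G SG C0]
  show Xi: "integrable (Q \<nu>) (X \<nu> l)" if l: "l < R" for \<nu> l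
    unfolding X[OF l, abs_def] using pF(2)[OF l l] by simp
  show Yi: "integrable P (Y l)" if l: "l < R" for l
    unfolding Y[OF l, abs_def] using pG(2)[OF l l] by simp
  show "(\<integral>u. \<bar>X \<nu> l u\<bar> \<partial>Q \<nu>) \<le> b * (1 + C)" if l: "l < R" for \<nu> l
    unfolding X[OF l] abs_mult using pF(3)[OF l l, of \<nu>] b by (simp add: mult_left_mono)
  fix c :: "nat \<Rightarrow> real"
  define C' where "C' = (\<Sum>l<R. (b * c l)\<^sup>2) * (real R * C)"
  have C': "0 \<le> C'" using C0 by (auto simp: C'_def intro!: mult_nonneg_nonneg sum_nonneg)
  define f where "f \<nu> u t = (\<Sum>l<R. (b * c l) * F \<nu> l u t)" for \<nu> u t
  define g where "g u t = (\<Sum>l<R. (b * c l) * G l u t)" for u t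
  have f: "case_prod (f \<nu>) \<in> borel_measurable (Q \<nu> \<Otimes>\<^sub>M U)" for \<nu>
    using F unfolding f_def case_prod_beta' by (intro borel_measurable_sum borel_measurable_times borel_measurable_const) auto
  have g: "case_prod g \<in> borel_measurable (P \<Otimes>\<^sub>M U)"
    using G unfolding g_def case_prod_beta' by (intro borel_measurable_sum borel_measurable_times borel_measurable_const) auto
  have Ff: "(\<lambda>u. F \<nu> l u t) \<in> borel_measurable (Q \<nu>)" if "l < R" "t \<in> space U" for \<nu> l t
    using measurable_Pair1[OF F[OF that(1)] that(2)] by simp
  have Gf: "(\<lambda>u. G l u t) \<in> borel_measurable P" if "l < R" "t \<in> space U" for l t
    using measurable_Pair1[OF G[OF that(1)] that(2)] by simp
  have Cf: "(\<integral>\<^sup>+u. \<integral>\<^sup>+t. ennreal ((f \<nu> u t)\<^sup>2) \<partial>U \<partial>Q \<nu>) \<le> ennreal C'" for \<nu>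
    by (rule second_moment_from_fibres[OF Q U f]) (unfold f_def C'_def, rule linear_combination_second_moment[OF Ff CF C0])
  have Cg: "(\<integral>\<^sup>+u. \<integral>\<^sup>+t. ennreal ((g u t)\<^sup>2) \<partial>U \<partial>P) \<le> ennreal C'"
    by (rule second_moment_from_fibres[OF P U g]) (unfold g_def C'_def, rule linear_combination_second_moment[OF Gf CG C0])
  have "(\<lambda>\<nu>. \<integral>u. iexp (\<integral>t. f \<nu> u t \<partial>U) \<partial>Q \<nu>) \<longlonglongrightarrow> (\<integral>u. iexp (\<integral>t. g u t \<partial>U) \<partial>P)"
  proof (rule char_integral_convergence[OF U Q P f g Cf Cg C'])
    fix m :: nat assume m: "0 < m"
    \<comment> \<open>The factors \<open>b\<close> and \<open>1 / m\<close> are absorbed into the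
      coefficients, over which \<open>fdd\<close> is quantified.\<close>
    have "1 / real m * (\<Sum>p<m. \<Sum>l<R. (b * c l) * h l p) = (\<Sum>p<m. \<Sum>l<R. (b * c l / real m) * h l p)" for h :: "nat \<Rightarrow> nat \<Rightarrow> real"
      by (simp add: sum_distrib_left sum_divide_distrib)
    then show "AE \<theta> in PiM {..<m} (\<lambda>_. U). (\<lambda>n. \<integral>u. iexp (1 / real m * (\<Sum>p<m. f n u (\<theta> p))) \<partial>Q n)
        \<longlonglongrightarrow> (\<integral>u. iexp (1 / real m * (\<Sum>p<m. g u (\<theta> p))) \<partial>P)"
      unfolding f_def g_def using fdd[OF m, of "\<lambda>l. b * c l / real m"] by (simp only:)
  qed
  moreover have "(\<integral>u. iexp (\<integral>t. f \<nu> u t \<partial>U) \<partial>Q \<nu>) = (\<integral>u. iexp (\<Sum>l<R. c l * X \<nu> l u) \<partial>Q \<nu>)" for \<nu>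
  proof (rule integral_cong_AE)
    have "AE u in Q \<nu>. (\<integral>t. f \<nu> u t \<partial>U) = (\<Sum>l<R. c l * X \<nu> l u)"
      unfolding f_def by (rule integral_linear_combination_AE[OF pF(1) X]) auto
    then show "AE u in Q \<nu>. iexp (\<integral>t. f \<nu> u t \<partial>U) = iexp (\<Sum>l<R. c l * X \<nu> l u)" by eventually_elim simp
    have "(\<lambda>u. \<integral>t. f \<nu> u t \<partial>U) \<in> borel_measurable (Q \<nu>)"
      using path_integral_moments(2)[OF Q U f Cf C'] by (rule borel_measurable_integrable)
    then show "(\<lambda>u. iexp (\<integral>t. f \<nu> u t \<partial>U)) \<in> borel_measurable (Q \<nu>)" by measurable
    have "(\<lambda>u. \<Sum>l<R. c l * X \<nu> l u) \<in> borel_measurable (Q \<nu>)"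
      using Xi by (intro borel_measurable_sum borel_measurable_times borel_measurable_const) auto
    then show "(\<lambda>u. iexp (\<Sum>l<R. c l * X \<nu> l u)) \<in> borel_measurable (Q \<nu>)" by measurable
  qed
  moreover have "(\<integral>u. iexp (\<integral>t. g u t \<partial>U) \<partial>P) = (\<integral>u. iexp (\<Sum>l<R. c l * Y l u) \<partial>P)"
  proof (rule integral_cong_AE)
    have "AE u in P. (\<integral>t. g u t \<partial>U) = (\<Sum>l<R. c l * Y l u)"
      unfolding g_def by (rule integral_linear_combination_AE[OF pG(1) Y]) auto
    then show "AE u in P. iexp (\<integral>t. g u t \<partial>U) = iexp (\<Sum>l<R. c l * Y l u)" by eventually_elim simp
    have "(\<lambda>u. \<integral>t. g u t \<partial>U) \<in> borel_measurable P"
      using path_integral_moments(2)[OF P U g Cg C'] by (rule borel_measurable_integrable)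
    then show "(\<lambda>u. iexp (\<integral>t. g u t \<partial>U)) \<in> borel_measurable P" by measurable
    have "(\<lambda>u. \<Sum>l<R. c l * Y l u) \<in> borel_measurable P"
      using Yi by (intro borel_measurable_sum borel_measurable_times borel_measurable_const) auto
    then show "(\<lambda>u. iexp (\<Sum>l<R. c l * Y l u)) \<in> borel_measurable P" by measurable
  qed
  ultimately show "(\<lambda>\<nu>. \<integral>w. iexp (\<Sum>l<R. c l * X \<nu> l w) \<partial>Q \<nu>) \<longlonglongrightarrow> (\<integral>w. iexp (\<Sum>l<R. c l * Y l w) \<partial>P)"
    by (simp only:)
qed

text \<open>The data are frozen in \<open>y\<close>, and their asymptotics enter only through
  \<open>conv\<close>. Lebesgue measure on \<open>T\<close> is normalized by its length
  \<open>b - a\<close>, which is positive here; the length reappears as a factor of the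
  integrals.\<close>

lemma bootstrap_weak_convergence:
  fixes Q :: "nat \<Rightarrow> 'b measure" and P :: "'v measure" and N :: "nat \<Rightarrow> nat \<Rightarrow> nat"
    and xP :: "nat \<Rightarrow> nat \<Rightarrow> nat \<Rightarrow> 'b \<Rightarrow> real \<Rightarrow> real" and rr :: "nat \<Rightarrow> nat" and a b :: real
  assumes ab: "a < b" and T: "T = {a..b}"
    and stage: "\<And>\<nu>. bootstrap_stage (Q \<nu>) T k (N \<nu>) y (xP \<nu>)"
    and z: "vec_gaussian_process P T r (\<lambda>t s. H * limit_cov_mat k \<tau> \<gamma> t s * H\<^sup>T) z"
    and r: "(\<Sum>l<R. rr l) = r"
    and Hs: "\<forall>l<R. Hs l \<in> carrier_mat (rr l) k" and H: "H = stack_rows R k Hs"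
    and ratio: "\<And>i. i < k \<Longrightarrow> (\<lambda>\<nu>. real (total_size k (N \<nu>)) / real (N \<nu> i)) \<longlonglongrightarrow> 1 / \<tau> i"
    and \<tau>: "\<And>i. i < k \<Longrightarrow> 0 < \<tau> i"
    and Ninf: "\<And>i. i < k \<Longrightarrow> filterlim (\<lambda>\<nu>. N \<nu> i) at_top sequentially"
    and cont: "\<And>i. i < k \<Longrightarrow> continuous_on T (\<lambda>t. \<gamma> i t t)"
    and pos: "\<And>i t. i < k \<Longrightarrow> t \<in> T \<Longrightarrow> 0 < \<gamma> i t t"
    and conv: "AE p in lborel_on T \<Otimes>\<^sub>M lborel_on T. \<forall>i<k.
      (\<lambda>\<nu>. sample_cov (N \<nu> i) (y i) (fst p) (snd p)) \<longlonglongrightarrow> \<gamma> i (fst p) (snd p) \<and>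
      (\<lambda>\<nu>. sample_cov (N \<nu> i) (y i) (fst p) (fst p)) \<longlonglongrightarrow> \<gamma> i (fst p) (fst p)"
  shows "weakly_converges (tuple_topology R)
    (\<lambda>\<nu>. tuple_law (Q \<nu>) R (\<lambda>l u. test_statistic T k (N \<nu>) (\<lambda>i j. xP \<nu> i j u) (Hs l)))
    (tuple_law P R (\<lambda>l u. gaussian_quadratic_functional T (limit_cov_mat k \<tau> \<gamma>) (Hs l) (\<lambda>t. vec_block rr l (z u t))))"
proof -
  define \<mu> where "\<mu> = lborel_on T"
  define U where "U = density \<mu> (\<lambda>_. ennreal (1 / (b - a)))"
  have sp: "space \<mu> = T" by (simp add: \<mu>_def space_restrict_space)
  have em: "emeasure \<mu> (space \<mu>) = ennreal (b - a)"
    unfolding sp using ab by (simp add: \<mu>_def T emeasure_restrict_space)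
  have spU: "space U = T" and setsU: "sets U = sets \<mu>" by (simp_all add: U_def sp)
  have U: "prob_space U"
  proof (rule prob_spaceI)
    show "emeasure U (space U) = 1"
      using ab em by (simp add: U_def emeasure_density nn_integral_cmult ennreal_mult[symmetric])
  qed
  interpret U: prob_space U by (rule U)
  interpret \<mu>: finite_measure \<mu> using em by (intro finite_measureI) auto
  \<comment> \<open>Stated for arbitrary \<open>h\<close>: a nonmeasurable integrand has integral 0
    on both sides.\<close>
  have intU: "(\<integral>t. h t \<partial>\<mu>) = (b - a) * (\<integral>t. h t \<partial>U)" for h :: "real \<Rightarrow> real"
  proof (cases "h \<in> borel_measurable \<mu>")
    case True
    then show ?thesis unfolding U_def using ab by (subst integral_density) auto
  next
    case False
    then have "\<not> integrable \<mu> h" "\<not> integrable U h"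
      using measurable_cong_sets[OF setsU refl] by (auto dest: borel_measurable_integrable)
    then show ?thesis by (simp add: not_integrable_integral_eq)
  qed
  have measU: "borel_measurable (W \<Otimes>\<^sub>M U) = borel_measurable (W \<Otimes>\<^sub>M \<mu>)" for W :: "'z measure"
    by (intro measurable_cong_sets sets_pair_measure_cong refl setsU)
  have UU: "AE p in U \<Otimes>\<^sub>M U. pred p" if ae: "AE p in \<mu> \<Otimes>\<^sub>M \<mu>. pred p" for pred
  proof -
    interpret \<mu>2: pair_sigma_finite \<mu> \<mu> ..
    have "U \<Otimes>\<^sub>M U = density (\<mu> \<Otimes>\<^sub>M \<mu>) (\<lambda>(s, t). ennreal (1 / (b - a)) * ennreal (1 / (b - a)))"
      unfolding U_def using U.sigma_finite_measure_axioms
      by (intro pair_measure_density) (auto simp: U_def intro: \<mu>.sigma_finite_measure_axioms)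
    then show ?thesis using ae by (simp only:) (subst AE_density, auto simp: case_prod_beta' elim: eventually_mono)
  qed
  have P: "prob_space P" using z by (simp add: vec_gaussian_process_def centered_gaussian_family_def)
  have Q: "prob_space (Q \<nu>)" for \<nu> using stage[of \<nu>] by (simp add: bootstrap_stage_def)
  define off where "off l = (\<Sum>m<l. rr m)" for l
  have offr: "off l + rr l \<le> r" if "l < R" for l
  proof -
    have "off l + rr l = (\<Sum>m<Suc l. rr m)" by (simp add: off_def)
    also have "\<dots> \<le> (\<Sum>m<R. rr m)" using that by (intro sum_mono2) auto
    finally show ?thesis by (simp add: r)
  qed
  have Hc: "H \<in> carrier_mat r k" using stack_rows_carrier[OF Hs] by (simp add: H r)
  have d_nonneg: "0 \<le> 1 / \<tau> i * \<gamma> i t t" if "i < k" "t \<in> T" for i t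
    using pos[OF that] \<tau>[OF that(1)] by simp
  define F where "F \<nu> l u t = studentized_form k (N \<nu>) (\<lambda>i j. xP \<nu> i j u) (rr l) (Hs l) t" for \<nu> l u t
  define G where "G l u t = limit_form k \<tau> \<gamma> (rr l) (Hs l) (off l) (z u) t" for l u t
  have F_meas: "case_prod (F \<nu> l) \<in> borel_measurable (Q \<nu> \<Otimes>\<^sub>M \<mu>)" if "l < R" for \<nu> l
    using bootstrap_stage.studentized_joint_measurable[OF stage, of "Hs l" "rr l" \<nu>] Hs that
    by (simp add: F_def[abs_def] \<mu>_def)
  have G_meas: "case_prod (G l) \<in> borel_measurable (P \<Otimes>\<^sub>M \<mu>)" if "l < R" for l
    unfolding G_def[abs_def] \<mu>_def
  proof (rule limit_form_measurable[where r = r and A = "Hs l" and s = "rr l" and k = k and T = T and \<gamma> = \<gamma> and \<tau> = \<tau> and z = z and q = "off l" and P = P])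
    show "Hs l \<in> carrier_mat (rr l) k" using Hs that by simp
    show "continuous_on T (\<lambda>t. \<gamma> i t t)" if "i < k" for i by (rule cont[OF that])
    show "0 \<le> 1 / \<tau> i * \<gamma> i t t" if "i < k" "t \<in> T" for i t by (rule d_nonneg[OF that])
    show "L2_process P T (\<lambda>w t. z w t $ p)" if "p < r" for p using z that by (simp add: vec_gaussian_process_def)
    show "off l + rr l \<le> r" by (rule offr[OF that])
  qed
  define CF where "CF = (real k)\<^sup>2 * (105 + 256 * exp 80)"
  have CF0: "0 \<le> CF" by (auto simp: CF_def intro!: mult_nonneg_nonneg add_nonneg_nonneg)
  have CF: "(\<integral>\<^sup>+u. ennreal ((F \<nu> l u t)\<^sup>2) \<partial>Q \<nu>) \<le> ennreal CF" if "l < R" "t \<in> T" for \<nu> l t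
    unfolding F_def CF_def using Hs that by (intro bootstrap_stage.studentized_second_moment[OF stage]) auto
  have "\<exists>C\<ge>0. \<forall>t\<in>T. (\<integral>\<^sup>+u. ennreal ((G l u t)\<^sup>2) \<partial>P) \<le> ennreal C" if l: "l < R" for l
    unfolding G_def using Hs l
    by (intro limit_form_second_moment[OF _ _ Hc \<tau> cont pos z offr]) (auto simp: T)
  then obtain CG where CG0: "\<And>l. l < R \<Longrightarrow> 0 \<le> CG l"
    and CG: "\<And>l t. l < R \<Longrightarrow> t \<in> T \<Longrightarrow> (\<integral>\<^sup>+u. ennreal ((G l u t)\<^sup>2) \<partial>P) \<le> ennreal (CG l)" by metis
  define C where "C = CF + (\<Sum>l<R. CG l)"
  have CG_le: "CG l \<le> C" if "l < R" for l
    using member_le_sum[of l "{..<R}" CG] CG0 CF0 that by (auto simp: C_def)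
  have CF_le: "CF \<le> C" using CG0 by (auto simp: C_def intro: sum_nonneg)
  have C0: "0 \<le> C" using CF0 CF_le by simp
  show ?thesis
  proof (rule weakly_converges_path_integrals[where F = F and G = G and U = U and b = "b - a" and C = C, OF Q P U])
    show "case_prod (F \<nu> l) \<in> borel_measurable (Q \<nu> \<Otimes>\<^sub>M U)" if "l < R" for \<nu> l
      unfolding measU by (rule F_meas[OF that])
    show "case_prod (G l) \<in> borel_measurable (P \<Otimes>\<^sub>M U)" if "l < R" for l
      unfolding measU by (rule G_meas[OF that])
    show "(\<integral>\<^sup>+u. ennreal ((F \<nu> l u t)\<^sup>2) \<partial>Q \<nu>) \<le> ennreal C" if "l < R" "t \<in> space U" for \<nu> l t
      using CF[OF that(1)] that(2) ennreal_leI[OF CF_le] unfolding spU by (blast intro: order.trans)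
    show "(\<integral>\<^sup>+u. ennreal ((G l u t)\<^sup>2) \<partial>P) \<le> ennreal C" if "l < R" "t \<in> space U" for l t
      using CG[OF that(1)] that ennreal_leI[OF CG_le] unfolding spU by (blast intro: order.trans)
    show "0 \<le> C" by (rule C0)
    show "0 \<le> b - a" using ab by simp
    show "test_statistic T k (N \<nu>) (\<lambda>i j. xP \<nu> i j u) (Hs l) = (b - a) * (\<integral>t. F \<nu> l u t \<partial>U)" if l: "l < R" for \<nu> l u
      using test_statistic_eq[of "Hs l" "rr l" k T "N \<nu>" "\<lambda>i j. xP \<nu> i j u"] Hs l
      by (simp add: F_def intU flip: \<mu>_def)
    show "gaussian_quadratic_functional T (limit_cov_mat k \<tau> \<gamma>) (Hs l) (\<lambda>t. vec_block rr l (z u t)) = (b - a) * (\<integral>t. G l u t \<partial>U)" if l: "l < R" for l u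
      using gaussian_quadratic_functional_eq[of "Hs l" rr l k T \<tau> \<gamma> "z u"] d_nonneg Hs l
      by (simp add: G_def intU off_def flip: \<mu>_def)
    fix m :: nat and c :: "nat \<Rightarrow> real" assume m: "0 < m"
    have good: "AE p in U \<Otimes>\<^sub>M U. \<forall>i<k.
        (\<lambda>\<nu>. sample_cov (N \<nu> i) (y i) (fst p) (snd p)) \<longlonglongrightarrow> \<gamma> i (fst p) (snd p) \<and>
        (\<lambda>\<nu>. sample_cov (N \<nu> i) (y i) (fst p) (fst p)) \<longlonglongrightarrow> \<gamma> i (fst p) (fst p)"
      by (rule UU[OF conv[folded \<mu>_def]])
    interpret UU: pair_prob_space U U ..
    \<comment> \<open>The variance clause does not involve the second time, so Fubini leaves a
      statement about almost every single time.\<close>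
    have "AE t in U. AE s in U. \<forall>i<k. (\<lambda>\<nu>. sample_cov (N \<nu> i) (y i) t t) \<longlonglongrightarrow> \<gamma> i t t"
      using UU.AE_pair[OF good] by eventually_elim (elim eventually_mono, auto)
    then have diag: "AE t in U. \<forall>i<k. (\<lambda>\<nu>. sample_cov (N \<nu> i) (y i) t t) \<longlonglongrightarrow> \<gamma> i t t"
      by (simp add: U.AE_const)
    \<comment> \<open>Equal indices fall back on the variance clause, distinct ones on the clause
      for pairs.\<close>
    have pq: "AE \<theta> in PiM {..<m} (\<lambda>_. U). \<forall>i<k. (\<lambda>\<nu>. sample_cov (N \<nu> i) (y i) (\<theta> p) (\<theta> q)) \<longlonglongrightarrow> \<gamma> i (\<theta> p) (\<theta> q)"
      if "p < m" "q < m" for p q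
    proof (cases "p = q")
      case True
      show ?thesis unfolding True
        by (rule AE_PiM_component[where P = "\<lambda>t. \<forall>i<k. (\<lambda>\<nu>. sample_cov (N \<nu> i) (y i) t t) \<longlonglongrightarrow> \<gamma> i t t", OF U _ diag]) (use that in auto)
    next
      case False
      show ?thesis
        by (rule AE_PiM_pair[where pred = "\<lambda>s t. \<forall>i<k. (\<lambda>\<nu>. sample_cov (N \<nu> i) (y i) s t) \<longlonglongrightarrow> \<gamma> i s t", OF U])
           (use that False good in \<open>auto elim!: eventually_mono\<close>)
    qed
    then have "AE \<theta> in PiM {..<m} (\<lambda>_. U). \<forall>p<m. \<forall>q<m. \<forall>i<k. (\<lambda>\<nu>. sample_cov (N \<nu> i) (y i) (\<theta> p) (\<theta> q)) \<longlonglongrightarrow> \<gamma> i (\<theta> p) (\<theta> q)"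
      by (simp add: AE_all_countable)
    then show "AE \<theta> in PiM {..<m} (\<lambda>_. U). (\<lambda>\<nu>. \<integral>u. iexp (\<Sum>p<m. \<Sum>l<R. c l * F \<nu> l u (\<theta> p)) \<partial>Q \<nu>)
        \<longlonglongrightarrow> (\<integral>u. iexp (\<Sum>p<m. \<Sum>l<R. c l * G l u (\<theta> p)) \<partial>P)"
      using AE_space
    proof eventually_elim
      fix \<theta> assume cv: "\<forall>p<m. \<forall>q<m. \<forall>i<k. (\<lambda>\<nu>. sample_cov (N \<nu> i) (y i) (\<theta> p) (\<theta> q)) \<longlonglongrightarrow> \<gamma> i (\<theta> p) (\<theta> q)"
        and \<theta>: "\<theta> \<in> space (PiM {..<m} (\<lambda>_. U))"
      have \<theta>T: "\<theta> p \<in> T" if "p < m" for p using \<theta> that by (auto simp: space_PiM PiE_iff spU)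
      show "(\<lambda>\<nu>. \<integral>u. iexp (\<Sum>p<m. \<Sum>l<R. c l * F \<nu> l u (\<theta> p)) \<partial>Q \<nu>)
        \<longlonglongrightarrow> (\<integral>u. iexp (\<Sum>p<m. \<Sum>l<R. c l * G l u (\<theta> p)) \<partial>P)"
        unfolding F_def G_def limit_form_def off_def
        by (rule studentized_fdd[OF stage z r Hs H ratio \<tau> Ninf \<theta>T]) (use cv pos \<theta>T in auto)
    qed
  qed
qed

section \<open>Conditional convergence along subsequences\<close>

lemma weakly_converges_offset:
  assumes "weakly_converges X (\<lambda>m. \<mu>s (m + d)) \<mu>"
  shows "weakly_converges X \<mu>s \<mu>"
  unfolding weakly_converges_def
proof (intro allI impI)
  fix f assume "continuous_map X euclideanreal f \<and> bounded (f ` topspace X)"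
  then have "(\<lambda>m. \<integral>y. f y \<partial>\<mu>s (m + d)) \<longlonglongrightarrow> (\<integral>y. f y \<partial>\<mu>)"
    using assms unfolding weakly_converges_def by blast
  then show "(\<lambda>m. \<integral>y. f y \<partial>\<mu>s m) \<longlonglongrightarrow> (\<integral>y. f y \<partial>\<mu>)" by (rule LIMSEQ_offset)
qed

lemma integral_lborel_on_singleton:
  fixes f :: "real \<Rightarrow> real"
  shows "(\<integral>t. f t \<partial>lborel_on {a}) = 0"
proof -
  have "(\<integral>t. f t \<partial>lborel_on {a}) = (\<integral>t. indicator {a} t *\<^sub>R f t \<partial>lborel)"
    by (rule integral_restrict_space) simp
  also have "\<dots> = (\<integral>t. 0 \<partial>(lborel :: real measure))"
  proof (rule integral_cong_AE)
    have "(\<lambda>t. indicator {a} t *\<^sub>R f t) = (\<lambda>t. indicator {a} t *\<^sub>R f a)" by (auto simp: indicator_def)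
    then show "(\<lambda>t. indicator {a} t *\<^sub>R f t) \<in> borel_measurable lborel" by simp
    show "AE t in lborel. indicator {a} t *\<^sub>R f t = 0"
      using AE_lborel_singleton[of a] by eventually_elim (simp add: indicator_def)
  qed simp
  finally show ?thesis by simp
qed

text \<open>An interval reduced to a point has length zero, so all integrals vanish and every tuple
  law is the law of the zero tuple.\<close>

lemma weakly_converges_bootstrap_singleton:
  assumes Q: "\<And>\<nu>. prob_space (Q \<nu>)" and P: "prob_space P"
  shows "weakly_converges (tuple_topology R)
    (\<lambda>\<nu>. tuple_law (Q \<nu>) R (\<lambda>l u. test_statistic {a} k (N \<nu>) (\<lambda>i j. xP \<nu> i j u) (Hs l)))
    (tuple_law P R (\<lambda>l u. gaussian_quadratic_functional {a} S (Hs l) (Z l u)))"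
  unfolding test_statistic_def gaussian_quadratic_functional_def integral_lborel_on_singleton
proof (rule weakly_converges_tuple_law[where C = 0, OF Q P])
  show "(\<lambda>n. \<integral>w. iexp (\<Sum>l<R. c l * 0) \<partial>Q n) \<longlonglongrightarrow> (\<integral>w. iexp (\<Sum>l<R. c l * 0) \<partial>P)" for c :: "nat \<Rightarrow> real"
    by (simp only: prob_space.prob_space[OF Q] prob_space.prob_space[OF P] mult_zero_right sum.neutral_const of_real_0 exp_zero lebesgue_integral_const scaleR_one tendsto_const)
qed simp_all

theorem theorem4:
  fixes M :: "'w measure" and Q :: "nat \<Rightarrow> 'w \<Rightarrow> 'b measure" and P :: "'v measure"
    and a b :: real and T :: "real set"
    and k r R :: nat and rr :: "nat \<Rightarrow> nat"
    and Hs :: "nat \<Rightarrow> real mat" and H :: "real mat"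
    and N :: "nat \<Rightarrow> nat \<Rightarrow> nat" and n :: "nat \<Rightarrow> nat"
    and x v :: "nat \<Rightarrow> nat \<Rightarrow> 'w \<Rightarrow> real \<Rightarrow> real"
    and \<eta> :: "nat \<Rightarrow> real \<Rightarrow> real" and \<gamma> :: "nat \<Rightarrow> real \<Rightarrow> real \<Rightarrow> real"
    and \<tau> :: "nat \<Rightarrow> real"
    and xP :: "nat \<Rightarrow> 'w \<Rightarrow> nat \<Rightarrow> nat \<Rightarrow> 'b \<Rightarrow> real \<Rightarrow> real"
    and z :: "'v \<Rightarrow> real \<Rightarrow> real vec"
  assumes T: "a \<le> b" "T = {a..b}"
    and dims: "0 < k" "0 < R" "\<forall>l<R. 0 < rr l" "(\<Sum>l<R. rr l) = r"
    and H: "\<forall>l<R. Hs l \<in> carrier_mat (rr l) k" "H = stack_rows R k Hs"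
    and n: "n = (\<lambda>\<nu>. total_size k (N \<nu>))" "filterlim n at_top sequentially"
    and M: "prob_space M"
    and v: "v = (\<lambda>i j w t. x i j w t - \<eta> i t)"
    and samples_indep: "indep_processes M T ({..<k} \<times> UNIV) (\<lambda>(i, j). x i j)"
    and cond_i: "\<forall>i<k. \<forall>j. L2_process M T (x i j) \<and>
        process_law M T (x i j) = process_law M T (x i 0) \<and>
        has_mean_and_covariance M T (x i j) (\<eta> i) (\<gamma> i)"
    and cond_ii: "\<forall>i<k. L2_on T (\<eta> i)"
    and cond_iii: "\<forall>i<k. continuous_on T (\<lambda>t. \<gamma> i t t) \<and> (\<forall>t\<in>T. \<gamma> i t t > 0)"
    and cond_iv: "\<forall>i<k. \<tau> i > 0 \<and> (\<lambda>\<nu>. real (N \<nu> i) / real (n \<nu>)) \<longlonglongrightarrow> \<tau> i"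
    and cond_v: "\<forall>i<k. integrable M (\<lambda>w. (\<integral>t. (v i 0 w t)\<^sup>2 \<partial>lborel_on T)\<^sup>2)"
    and cond_vi: "\<forall>i<k. \<forall>j\<in>{0, 1}.
        ((\<lambda>\<delta>. outer_expectation M (\<lambda>w. modulus_of_continuity T (\<lambda>t. v i 0 w t * v i j w t) \<delta>))
          \<longlongrightarrow> 0) (at_right 0)"
    and bootstrap: "\<forall>\<nu>. AE w in M. parametric_bootstrap (Q \<nu> w) T k (N \<nu>) (\<lambda>i j. x i j w) (xP \<nu> w)"
    and z: "vec_gaussian_process P T r (\<lambda>t s. H * limit_cov_mat k \<tau> \<gamma> t s * H\<^sup>T) z"
  shows "conditionally_converges M (tuple_topology R)
      (\<lambda>\<nu> w. tuple_law (Q \<nu> w) R (\<lambda>l u. test_statistic T k (N \<nu>) (\<lambda>i j. xP \<nu> w i j u) (Hs l)))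
      (tuple_law P R (\<lambda>l u. gaussian_quadratic_functional T (limit_cov_mat k \<tau> \<gamma>) (Hs l)
         (\<lambda>t. vec_block rr l (z u t))))"
proof -
  have P: "prob_space P" using z by (simp add: vec_gaussian_process_def centered_gaussian_family_def)
  have \<tau>: "0 < \<tau> i" if "i < k" for i using cond_iv that by blast
  have tot: "N \<nu> i \<le> n \<nu>" if "i < k" for \<nu> i
    unfolding n(1) total_size_def using that by (intro member_le_sum) auto
  have Ninf: "filterlim (\<lambda>\<nu>. N \<nu> i) at_top sequentially" if i: "i < k" for i
  proof -
    have "filterlim (\<lambda>\<nu>. real (n \<nu>)) at_top sequentially"
      using n(2) by (rule filterlim_compose[OF filterlim_real_sequentially])
    from filterlim_tendsto_pos_mult_at_top[OF cond_iv[rule_format, OF i, THEN conjunct2] \<tau>[OF i] this]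
    have "filterlim (\<lambda>\<nu>. real (N \<nu> i) / real (n \<nu>) * real (n \<nu>)) at_top sequentially" .
    \<comment> \<open>A total size of 0 forces every group size to be 0, so division by zero does no
      harm.\<close>
    moreover have "real (N \<nu> i) / real (n \<nu>) * real (n \<nu>) = real (N \<nu> i)" for \<nu>
      using tot[OF i, of \<nu>] by (cases "n \<nu> = 0") auto
    ultimately show ?thesis by (simp add: filterlim_sequentially_iff_filterlim_real)
  qed
  have ratio: "(\<lambda>\<nu>. real (n \<nu>) / real (N \<nu> i)) \<longlonglongrightarrow> 1 / \<tau> i" if i: "i < k" for i
    using tendsto_inverse[OF cond_iv[rule_format, OF i, THEN conjunct2]] \<tau>[OF i] by (simp add: inverse_eq_divide)
  \<comment> \<open>There are countably many stages, so one null set of data serves all of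
    them.\<close>
  have boot: "AE w in M. \<forall>\<nu>. parametric_bootstrap (Q \<nu> w) T k (N \<nu>) (\<lambda>i j. x i j w) (xP \<nu> w)"
    using bootstrap by (simp add: AE_all_countable)
  show ?thesis
    unfolding conditionally_converges_def
  proof (intro allI impI)
    fix \<phi> :: "nat \<Rightarrow> nat" assume \<phi>: "strict_mono \<phi>"
    have N\<phi>: "filterlim (\<lambda>\<nu>. N (\<phi> \<nu>) i) at_top sequentially" if "i < k" for i
      using Ninf[OF that] filterlim_subseq[OF \<phi>] by (rule filterlim_compose)
    \<comment> \<open>The subsequence is fixed before the realization \<open>w\<close>, in the order
      that \<open>conditionally_converges\<close> prescribes.\<close>
    obtain \<psi> where \<psi>: "strict_mono \<psi>"
      and data: "AE w in M. AE p in lborel_on T \<Otimes>\<^sub>M lborel_on T. \<forall>i<k.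
        (\<lambda>\<nu>. sample_cov (N (\<phi> (\<psi> \<nu>)) i) (\<lambda>j. x i j w) (fst p) (snd p)) \<longlonglongrightarrow> \<gamma> i (fst p) (snd p) \<and>
        (\<lambda>\<nu>. sample_cov (N (\<phi> (\<psi> \<nu>)) i) (\<lambda>j. x i j w) (fst p) (fst p)) \<longlonglongrightarrow> \<gamma> i (fst p) (fst p)"
      using data_covariance_subsequence[OF M T(2) samples_indep, where \<eta> = \<eta> and \<gamma> = \<gamma> and N = "\<lambda>\<nu>. N (\<phi> \<nu>)"]
        cond_i cond_ii cond_iii N\<phi> by blast
    have "filterlim (\<lambda>\<nu>. \<phi> (\<psi> \<nu>)) sequentially sequentially"
      using filterlim_subseq[OF \<phi>] filterlim_subseq[OF \<psi>] by (rule filterlim_compose)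
    note sub = this
    have "\<forall>\<^sub>F \<nu> in sequentially. \<forall>i<k. 32 \<le> N (\<phi> (\<psi> \<nu>)) i"
    proof -
      have "\<forall>\<^sub>F \<nu> in sequentially. 32 \<le> N (\<phi> (\<psi> \<nu>)) i" if "i < k" for i
        using filterlim_compose[OF Ninf[OF that] sub] unfolding filterlim_at_top by blast
      then have "\<forall>\<^sub>F \<nu> in sequentially. \<forall>i\<in>{..<k}. 32 \<le> N (\<phi> (\<psi> \<nu>)) i"
        by (intro eventually_ball_finite) auto
      then show ?thesis by (simp only: Ball_def lessThan_iff)
    qed
    \<comment> \<open>Shifting by \<open>\<nu>0\<close> makes every stage an instance of
      \<open>bootstrap_stage\<close>; weak convergence ignores finitely many terms, so the shift is
      undone at the end.\<close>
    then obtain \<nu>0 where \<nu>0: "\<And>\<nu> i. \<nu>0 \<le> \<nu> \<Longrightarrow> i < k \<Longrightarrow> 32 \<le> N (\<phi> (\<psi> \<nu>)) i"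
      unfolding eventually_sequentially by blast
    define s where "s \<nu> = \<phi> (\<psi> (\<nu> + \<nu>0))" for \<nu>
    have "strict_mono (\<lambda>\<nu>. \<nu> + \<nu>0)" by (simp add: strict_mono_def)
    from filterlim_compose[OF sub filterlim_subseq[OF this]]
    have s: "filterlim s sequentially sequentially" by (simp add: s_def[abs_def])
    have "AE w in M. weakly_converges (tuple_topology R)
      (\<lambda>m. tuple_law (Q (\<phi> (\<psi> m)) w) R (\<lambda>l u. test_statistic T k (N (\<phi> (\<psi> m))) (\<lambda>i j. xP (\<phi> (\<psi> m)) w i j u) (Hs l)))
      (tuple_law P R (\<lambda>l u. gaussian_quadratic_functional T (limit_cov_mat k \<tau> \<gamma>) (Hs l) (\<lambda>t. vec_block rr l (z u t))))"
      using data boot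
    proof eventually_elim
      case (elim w)
      have stage: "bootstrap_stage (Q (s \<nu>) w) T k (N (s \<nu>)) (\<lambda>i j. x i j w) (xP (s \<nu>) w)" for \<nu>
        unfolding bootstrap_stage_def bootstrap_stage_axioms_def
        using elim(2) \<nu>0[of "\<nu> + \<nu>0"] by (auto simp: s_def parametric_bootstrap_def)
      have "weakly_converges (tuple_topology R)
        (\<lambda>m. tuple_law (Q (s m) w) R (\<lambda>l u. test_statistic T k (N (s m)) (\<lambda>i j. xP (s m) w i j u) (Hs l)))
        (tuple_law P R (\<lambda>l u. gaussian_quadratic_functional T (limit_cov_mat k \<tau> \<gamma>) (Hs l) (\<lambda>t. vec_block rr l (z u t))))"
      proof (cases "a = b")
        case True
        then have Ta: "T = {a}" using T by simp
        show ?thesis unfolding Ta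
          by (rule weakly_converges_bootstrap_singleton[OF _ P]) (use elim(2) in \<open>auto simp: parametric_bootstrap_def\<close>)
      next
        case False
        then have ab: "a < b" using T by simp
        show ?thesis
        proof (rule bootstrap_weak_convergence[OF ab T(2) stage z dims(4) H])
          show "(\<lambda>\<nu>. real (total_size k (N (s \<nu>))) / real (N (s \<nu>) i)) \<longlonglongrightarrow> 1 / \<tau> i" if "i < k" for i
            using filterlim_compose[OF ratio[OF that] s] by (simp add: n(1))
          show "0 < \<tau> i" if "i < k" for i by (rule \<tau>[OF that])
          show "filterlim (\<lambda>\<nu>. N (s \<nu>) i) at_top sequentially" if "i < k" for i
            by (rule filterlim_compose[OF Ninf[OF that] s])
          show "continuous_on T (\<lambda>t. \<gamma> i t t)" if "i < k" for i using cond_iii that by blast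
          show "0 < \<gamma> i t t" if "i < k" "t \<in> T" for i t using cond_iii that by blast
          show "AE p in lborel_on T \<Otimes>\<^sub>M lborel_on T. \<forall>i<k.
            (\<lambda>\<nu>. sample_cov (N (s \<nu>) i) (\<lambda>j. x i j w) (fst p) (snd p)) \<longlonglongrightarrow> \<gamma> i (fst p) (snd p) \<and>
            (\<lambda>\<nu>. sample_cov (N (s \<nu>) i) (\<lambda>j. x i j w) (fst p) (fst p)) \<longlonglongrightarrow> \<gamma> i (fst p) (fst p)"
            using elim(1) unfolding s_def
            by eventually_elim (intro allI impI conjI; rule LIMSEQ_ignore_initial_segment; blast)
        qed
      qed
      then show ?case unfolding s_def by (rule weakly_converges_offset)
    qed
    with \<psi> show "\<exists>\<psi>. strict_mono \<psi> \<and> (AE w in M. weakly_converges (tuple_topology R)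
      (\<lambda>m. tuple_law (Q (\<phi> (\<psi> m)) w) R (\<lambda>l u. test_statistic T k (N (\<phi> (\<psi> m))) (\<lambda>i j. xP (\<phi> (\<psi> m)) w i j u) (Hs l)))
      (tuple_law P R (\<lambda>l u. gaussian_quadratic_functional T (limit_cov_mat k \<tau> \<gamma>) (Hs l) (\<lambda>t. vec_block rr l (z u t)))))"
      by blast
  qed
qed

end
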